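(* Let $W=G\circ\Phi$ be a polyconvex stored energy with $G$ satisfying the hypotheses (H1)--(H5) listed in the context. For each time step $h>0$ let $\Theta^j=(v^j,\Xi^j)=(v^j,F^j,Z^j,w^j)\in L^2\times L^p\times L^2\times L^2$, $j\ge 0$, be spatial iterates satisfying (P1)--(P5) of the context, and let $\Theta^{(h)}=(V^{(h)},\Xi^{(h)})$ with $\Xi^{(h)}=(F^{(h)},Z^{(h)},w^{(h)})$, $\theta^{(h)}=(v^{(h)},\xi^{(h)})$ and $\tilde f^{(h)}$ be the interpolates induced by them, as defined in the context. Let $\bar\Theta=(\bar V,\bar\Xi)=(\bar V,\bar F,\bar Z,\bar w)$ be the smooth solution on $\mathbb{T}^3\times[0,T]$ of the extended system $$\partial_t v_i=\partial_\alpha\Big(\frac{\partial G}{\partial \Xi_A}(\Xi)\frac{\partial \Phi^A}{\partial F_{i\alpha}}(F)\Big),\qquad \partial_t\Xi_A=\partial_\alpha\Big(\frac{\partial \Phi^A}{\partial F_{i\alpha}}(F)\,v_i\Big)$$ emanating from the data $\bar\Theta^0=(\bar V^0,\bar F^0,\bar Z^0,\bar w^0)$. Assume that $F^0$ and $\bar F^0$ are gradients. Set $$\mathcal{E}(t)=\mathcal{E}^{(h)}(t):=\int_{\mathbb{T}^3}\Big((1+|F^{(h)}|^{p-2}+|\bar F|^{p-2})|F^{(h)}-\bar F|^2+|\Theta^{(h)}-\bar\Theta|^2\Big)\,dx .$$ Then: (a) The relative entropy $\eta^r=\eta^r(\Theta^{(h)},\bar\Theta):=\eta(\Theta^{(h)})-\eta(\bar\Theta)-\nabla\eta(\bar\Theta)(\Theta^{(h)}-\bar\Theta)$,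 where $\eta(v,\Xi)=\frac12|v|^2+G(\Xi)$, satisfies, for almost all $t\in[0,T]$, $$\partial_t\eta^r-\mathrm{div}\,q^r=Q-\frac1h\sum_{j=1}^\infty \mathcal{X}^j(t)D^j+S\quad\text{in }\mathcal{D}'(\mathbb{T}^3),$$ where $q^r,Q,D^j,S$ are the expressions given in the context and $\mathcal X^j$ is the characteristic function of $[(j-1)h,jh)$. Furthermore, there exist constants $\mu,\mu'>0$ such that $$\mu\,\mathcal{E}(t)\le\int_{\mathbb{T}^3}\eta^r(x,t)\,dx\le\mu'\,\mathcal{E}(t),\qquad t\in[0,T].$$ (b) There exist $\varepsilon>0$ and $C=C(T,\bar\Theta,E_0,\mu,\mu',\varepsilon)>0$ such that for all $h\in(0,\varepsilon)$ $$\mathcal{E}(\tau)\le C\big(\mathcal{E}(0)+h\big),\qquad \tau\in[0,T].$$ Moreover, if the data satisfy $\mathcal{E}^{(h)}(0)\to0$ as $h\downarrow0$, then $$\sup_{t\in[0,T]}\int_{\mathbb{T}^3}\Big(|\Theta^{(h)}-\bar\Theta|^2+|F^{(h)}-\bar F|^2(1+|F^{(h)}|^{p-2}+|\bar F|^{p-2})\Big)dx\to0\quad\text{as }h\downarrow0.$$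
   Context: **Setting.** $\mathbb{T}^3$ is the three-dimensional torus (periodic boundary conditions), $L^p=L^p(\mathbb{T}^3)$, $W^{1,p}=W^{1,p}(\mathbb{T}^3)$. $M^{3\times3}\cong\mathbb{R}^9$ denotes real $3\times 3$ matrices, $M^{3\times3}_+$ those with positive determinant. Indices $i,\alpha,\dots$ run over $1,2,3$; $A,B,\dots$ run over $1,\dots,19$; repeated indices are summed. $\Phi(F)=(F,\mathrm{cof}\,F,\det F)\in M^{3\times3}\times M^{3\times3}\times\mathbb{R}\cong\mathbb{R}^{19}$, with components $\Phi^A(F)$; elements of $\mathbb{R}^{19}$ are written $\Xi=(F,Z,w)$ and the components $A=1,\dots,9$, $10,\dots,18$, $19$ correspond to $F$, $Z$, $w$. The stored energy is $W:M_+^{3\times3}\to\mathbb{R}$, $W(F)=G(\Phi(F))$, $G:\mathbb{R}^{19}\to\mathbb{R}$ uniformly convex. Notation: $G_{,A}=\partial G/\partial\Xi_A$, $G_{,AB}=\partial^2G/\partial\Xi_A\partial\Xi_B$, $\Phi^A_{,i\alpha}=\partial\Phi^A/\partial F_{i\alpha}$. A matrix field $F$ is a gradient if $F_{i\alpha}=\partial_\alpha y_i$ for some map $y$. **Hypotheses on $G$** (with fixed positive constants $c_1,\dots,c_8$): (H1) $G\in C^3(\mathbb{R}^{19};[0,\infty))$ has the form $G(\Xi)=H(F)+R(\Xi)$ with $H\in C^3(M^{3\times3};[0,\infty))$ and $R\in C^3(\mathbb{R}^{19};[0,\infty))$ strictly convex, satisfying $\kappa|F|^{p-2}|z|^2\le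 z^T\nabla^2H(F)z\le\kappa'|F|^{p-2}|z|^2$ for all $z\in\mathbb{R}^9$, and $\gamma I\le\nabla^2R\le\gamma'I$, for some fixed $\gamma,\gamma',\kappa,\kappa'>0$ and $p\in[6,\infty)$. (H2) $G(\Xi)\ge c_1|F|^p+c_2|Z|^2+c_3|w|^2-c_4$. (H3) $G(\Xi)\le c_5(|F|^p+|Z|^2+|w|^2+1)$. (H4) $|G_F|^{\frac{p}{p-1}}+|G_Z|^{\frac{p}{p-2}}+|G_w|^{\frac{p}{p-3}}\le c_6(|F|^p+|Z|^2+|w|^2+1)$. (H5) $\big|\frac{\partial^3H}{\partial F_{i\alpha}\partial F_{ml}\partial F_{rs}}\big|\le c_7|F|^{p-3}$ and $\big|\frac{\partial^3R}{\partial\Xi_A\partial\Xi_B\partial\Xi_D}\big|\le c_8$. **Iterates.** For given $h>0$ and initial data $\Theta^0=(v^0,\Xi^0)=(v^0,F^0,Z^0,w^0)\in L^2\times L^p\times L^2\times L^2$, the iterates $\Theta^j=(v^j,\Xi^j)$, $j\ge1$, satisfy: (P1) $(v^j,\Xi^j)$ is the unique minimizer of $\mathcal{J}(v,\Xi)=\int_{\mathbb{T}^3}\big(\frac12|v-v^{j-1}|^2+G(\Xi)\big)dx$ over the weakly closed affine subspace $\mathcal{C}$ of those $(v,\Xi)\in L^2\times L^p\times L^2\times L^2$ such that for all $\varphi\in C^\infty(\mathbb{T}^3)$ (and all $A$): $\int_{\mathbb{T}^3}\frac{\Xi_A-\Xi_A^{j-1}}{h}\varphi\,dx=-\int_{\mathbb{T}^3}\Phi^A_{,i\alpha}(F^{j-1})v_i\,\partial_\alpha\varphi\,dx$.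 (P2) In $\mathcal{D}'(\mathbb{T}^3)$: $\frac{v^j_i-v^{j-1}_i}{h}=\partial_\alpha\big(G_{,A}(\Xi^j)\Phi^A_{,i\alpha}(F^{j-1})\big)$ and $\frac{\Xi^j_A-\Xi^{j-1}_A}{h}=\partial_\alpha\big(\Phi^A_{,i\alpha}(F^{j-1})v^j_i\big)$. (P3) If $F^0$ is a gradient, then so is $F^j$ for all $j\ge1$. (P4) $v^j\in W^{1,p}(\mathbb{T}^3)$ for all $j\ge1$. (P5) There is $E_0>0$ determined by the initial data with $\sup_{j\ge0}\big(\|v^j\|_{L^2}^2+\int_{\mathbb{T}^3}G(\Xi^j)dx\big)+\sum_{j=1}^\infty\|\Theta^j-\Theta^{j-1}\|_{L^2}^2\le E_0$. The data $\Theta^0$ may depend on $h$; $E_0$ is understood to be independent of $h$. $G$ and its constants are regarded as fixed. **Interpolates.** With $\mathcal{X}^j$ the characteristic function of $I_j=[(j-1)h,jh)$: $V^{(h)}(t)=\sum_{j\ge1}\mathcal{X}^j(t)\big(v^{j-1}+\frac{t-h(j-1)}{h}(v^j-v^{j-1})\big)$, $\Xi^{(h)}(t)=(F^{(h)},Z^{(h)},w^{(h)})(t)=\sum_{j\ge1}\mathcal{X}^j(t)\big(\Xi^{j-1}+\frac{t-h(j-1)}{h}(\Xi^j-\Xi^{j-1})\big)$, $v^{(h)}(t)=\sum_{j\ge1}\mathcal{X}^j(t)v^j$, $\xi^{(h)}(t)=\sum_{j\ge1}\mathcal{X}^j(t)\Xi^j$, $\tilde f^{(h)}(t)=\sum_{j\ge1}\mathcal{X}^j(t)F^{j-1}$.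 **Terms of the relative entropy identity** (writing $V,\Xi,F,\Theta,v,\xi,\theta,\tilde f$ for $V^{(h)},\Xi^{(h)},F^{(h)},\Theta^{(h)},v^{(h)},\xi^{(h)},\theta^{(h)},\tilde f^{(h)}$): $$q^r_\alpha=(v_i-\bar V_i)\big(G_{,A}(\xi)-G_{,A}(\bar\Xi)\big)\Phi^A_{,i\alpha}(\tilde f),\quad \alpha=1,2,3,$$ $$\begin{aligned}Q=\;&\partial_\alpha(G_{,A}(\bar\Xi))\big(\Phi^A_{,i\alpha}(F)-\Phi^A_{,i\alpha}(\bar F)\big)(V_i-\bar V_i)\\&+\partial_\alpha\bar V_i\big(G_{,A}(\Xi)-G_{,A}(\bar\Xi)\big)\big(\Phi^A_{,i\alpha}(F)-\Phi^A_{,i\alpha}(\bar F)\big)\\&+\partial_\alpha\bar V_i\big(G_{,A}(\Xi)-G_{,A}(\bar\Xi)-G_{,AB}(\bar\Xi)(\Xi-\bar\Xi)_B\big)\Phi^A_{,i\alpha}(\bar F),\end{aligned}$$ $$D^j=\big(\nabla\eta(\theta)-\nabla\eta(\Theta)\big)\delta\Theta^j,\qquad \delta\Theta^j=\Theta^j-\Theta^{j-1},$$ $$\begin{aligned}S=\;&\partial_\alpha(G_{,A}(\bar\Xi))\Big[\Phi^A_{,i\alpha}(\bar F)(v_i-V_i)+\big(\Phi^A_{,i\alpha}(F)-\Phi^A_{,i\alpha}(\bar F)\big)(v_i-V_i)\\&\quad+\big(\Phi^A_{,i\alpha}(\tilde f)-\Phi^A_{,i\alpha}(F)\big)(v_i-V_i)+\big(\Phi^A_{,i\alpha}(\tilde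 f)-\Phi^A_{,i\alpha}(F)\big)(V_i-\bar V_i)\Big]\\&+\partial_\alpha\bar V_i\Big[\big(G_{,A}(\xi)-G_{,A}(\Xi)\big)\Phi^A_{,i\alpha}(\bar F)+\big(G_{,A}(\xi)-G_{,A}(\Xi)\big)\big(\Phi^A_{,i\alpha}(\tilde f)-\Phi^A_{,i\alpha}(F)\big)\\&\quad+\big(G_{,A}(\xi)-G_{,A}(\Xi)\big)\big(\Phi^A_{,i\alpha}(F)-\Phi^A_{,i\alpha}(\bar F)\big)+\big(G_{,A}(\Xi)-G_{,A}(\bar\Xi)\big)\big(\Phi^A_{,i\alpha}(\tilde f)-\Phi^A_{,i\alpha}(F)\big)\Big].\end{aligned}$$ *)

theory Defs
  imports "HOL-Analysis.Analysis"
begin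

type_synonym vec3 = "real ^ 3"
type_synonym mat3 = "real ^ 3 ^ 3"

text \<open>
  The space of \<open>\<Xi> = (F, Z, w)\<close> is a 19-dimensional Euclidean space whose product norm is the
  norm of \<open>\<real>\<^sup>1\<^sup>9\<close>; its elements of \<^const>\<open>Basis\<close> play the role of the indices
  \<open>A = 1, \<dots>, 19\<close>, and \<open>\<Xi>\<^sub>A\<close> is the inner product of \<open>\<Xi>\<close> with \<open>A\<close>.
  A state is \<open>\<Theta> = (v, \<Xi>)\<close>.
\<close>

type_synonym ext = "mat3 \<times> mat3 \<times> real"
type_synonym state = "vec3 \<times> ext"

definition vel :: "state \<Rightarrow> vec3" where
  "vel \<theta> = fst \<theta>"

definition xi :: "state \<Rightarrow> ext" where
  "xi \<theta> = snd \<theta>"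

definition dgrad :: "state \<Rightarrow> mat3" where
  "dgrad \<theta> = fst (snd \<theta>)"


section \<open>Differential calculus\<close>

text \<open>Directional derivative; for \<open>b \<in> Basis\<close> the partial derivative.\<close>

definition pd :: "('a::euclidean_space \<Rightarrow> real) \<Rightarrow> 'a \<Rightarrow> 'a \<Rightarrow> real" where
  "pd f b x = frechet_derivative f (at x) b"

definition dx :: "3 \<Rightarrow> (vec3 \<Rightarrow> real) \<Rightarrow> vec3 \<Rightarrow> real" where
  "dx \<alpha> f x = pd f (axis \<alpha> 1) x"

definition grad :: "('a::euclidean_space \<Rightarrow> real) \<Rightarrow> 'a \<Rightarrow> 'a" where
  "grad f x = (\<Sum>b\<in>Basis. pd f b x *\<^sub>R b)"

definition hess_form :: "('a::euclidean_space \<Rightarrow> real) \<Rightarrow> 'a \<Rightarrow> 'a \<Rightarrow> real" where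
  "hess_form f x z = (\<Sum>a\<in>Basis. \<Sum>b\<in>Basis. (z \<bullet> a) * pd (pd f a) b x * (z \<bullet> b))"

text \<open>
  \<open>C\<^sup>k\<close> regularity up to the boundary. This is only used for sets \<open>S\<close> on which derivatives
  within \<open>S\<close> are unique: the whole space, and \<open>{0..T} \<times> UNIV\<close> with \<open>T > 0\<close>.
\<close>

primrec Ck_on :: "nat \<Rightarrow> 'a::euclidean_space set \<Rightarrow> ('a \<Rightarrow> 'b::real_normed_vector) \<Rightarrow> bool" where
  "Ck_on 0 S f \<longleftrightarrow> continuous_on S f"
| "Ck_on (Suc k) S f \<longleftrightarrow> f differentiable_on S \<and>
     (\<forall>b\<in>Basis. Ck_on k S (\<lambda>x. frechet_derivative f (at x within S) b))"

definition smooth_on :: "'a::euclidean_space set \<Rightarrow> ('a \<Rightarrow> 'b::real_normed_vector) \<Rightarrow> bool" where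
  "smooth_on S f \<longleftrightarrow> (\<forall>k. Ck_on k S f)"

definition strictly_convex :: "('a::real_vector \<Rightarrow> real) \<Rightarrow> bool" where
  "strictly_convex f \<longleftrightarrow> (\<forall>x y t. x \<noteq> y \<longrightarrow> 0 < t \<longrightarrow> t < 1 \<longrightarrow>
     f ((1 - t) *\<^sub>R x + t *\<^sub>R y) < (1 - t) * f x + t * f y)"

definition uniformly_convex :: "('a::euclidean_space \<Rightarrow> real) \<Rightarrow> bool" where
  "uniformly_convex f \<longleftrightarrow> (\<exists>m>0. \<forall>x z. m * (norm z)\<^sup>2 \<le> hess_form f x z)"


section \<open>Function spaces on the torus\<close>

text \<open>
  Functions on the torus are functions on \<open>\<real>\<^sup>3\<close> with period 1 in every coordinate, and the torus
  carries Lebesgue measure on the unit cube. Elements of Lebesgue spaces are given by representatives.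
\<close>

definition periodic :: "(vec3 \<Rightarrow> 'b) \<Rightarrow> bool" where
  "periodic u \<longleftrightarrow> (\<forall>x i. u (x + axis i 1) = u x)"

definition torus :: "vec3 measure" where
  "torus = lebesgue_on (cbox 0 One)"

definition Lp :: "real \<Rightarrow> (vec3 \<Rightarrow> 'b::euclidean_space) \<Rightarrow> bool" where
  "Lp p u \<longleftrightarrow> periodic u \<and> u \<in> borel_measurable torus \<and> integrable torus (\<lambda>x. norm (u x) powr p)"

definition testfun :: "(vec3 \<Rightarrow> real) \<Rightarrow> bool" where
  "testfun \<phi> \<longleftrightarrow> smooth_on UNIV \<phi> \<and> periodic \<phi>"

text \<open>\<open>g - div q = f\<close> in the sense of distributions on the torus, for integrable \<open>g\<close>, \<open>q\<close>, \<open>f\<close>.\<close>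

definition distr_balance :: "(vec3 \<Rightarrow> real) \<Rightarrow> (vec3 \<Rightarrow> vec3) \<Rightarrow> (vec3 \<Rightarrow> real) \<Rightarrow> bool" where
  "distr_balance g q f \<longleftrightarrow> integrable torus g \<and> integrable torus q \<and> integrable torus f \<and>
     (\<forall>\<phi>. testfun \<phi> \<longrightarrow>
        (\<integral>x. g x * \<phi> x \<partial>torus) + (\<integral>x. (\<Sum>\<alpha>\<in>UNIV. q x $ \<alpha> * dx \<alpha> \<phi> x) \<partial>torus)
        = (\<integral>x. f x * \<phi> x \<partial>torus))"

definition W1p :: "real \<Rightarrow> (vec3 \<Rightarrow> vec3) \<Rightarrow> bool" where
  "W1p p v \<longleftrightarrow> Lp p v \<and> (\<exists>g :: vec3 \<Rightarrow> mat3. Lp p g \<and>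
     (\<forall>\<phi> i \<alpha>. testfun \<phi> \<longrightarrow>
        (\<integral>x. v x $ i * dx \<alpha> \<phi> x \<partial>torus) = - (\<integral>x. g x $ i $ \<alpha> * \<phi> x \<partial>torus)))"

text \<open>
  The map \<open>y\<close> lives on \<open>\<real>\<^sup>3\<close> and need not be periodic (for instance \<open>y = id\<close>, \<open>F = I\<close>);
  its derivatives are weak derivatives.
\<close>

definition is_gradient :: "(vec3 \<Rightarrow> mat3) \<Rightarrow> bool" where
  "is_gradient F \<longleftrightarrow> (\<exists>y :: vec3 \<Rightarrow> vec3.
     (\<forall>a b. integrable (lebesgue_on (cbox a b)) y) \<and>
     (\<forall>\<psi> r i \<alpha>. smooth_on UNIV \<psi> \<longrightarrow> (\<forall>x. norm x > r \<longrightarrow> \<psi> x = 0) \<longrightarrow>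
        (\<integral>x. y x $ i * dx \<alpha> \<psi> x \<partial>lebesgue) = - (\<integral>x. F x $ i $ \<alpha> * \<psi> x \<partial>lebesgue)))"


section \<open>The stored energy\<close>

text \<open>Row and column indices are cyclic, that is, taken modulo 3, so the cofactors carry no sign.\<close>

definition cof :: "mat3 \<Rightarrow> mat3" where
  "cof F = (\<chi> i \<alpha>. F $ (i + 1) $ (\<alpha> + 1) * F $ (i + 2) $ (\<alpha> + 2)
                 - F $ (i + 1) $ (\<alpha> + 2) * F $ (i + 2) $ (\<alpha> + 1))"

definition Phi :: "mat3 \<Rightarrow> ext" where
  "Phi F = (F, cof F, det F)"

definition dPhi :: "ext \<Rightarrow> 3 \<Rightarrow> 3 \<Rightarrow> mat3 \<Rightarrow> real" where
  "dPhi A i \<alpha> F = pd (\<lambda>F. Phi F \<bullet> A) (axis i (axis \<alpha> 1)) F"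

definition polyconvex_energy :: "(mat3 \<Rightarrow> real) \<Rightarrow> (ext \<Rightarrow> real) \<Rightarrow> bool" where
  "polyconvex_energy W G \<longleftrightarrow> (\<forall>F. det F > 0 \<longrightarrow> W F = G (Phi F)) \<and> uniformly_convex G"

definition H1 :: "(ext \<Rightarrow> real) \<Rightarrow> (mat3 \<Rightarrow> real) \<Rightarrow> (ext \<Rightarrow> real) \<Rightarrow> real \<Rightarrow> bool" where
  "H1 G H R p \<longleftrightarrow> p \<ge> 6 \<and>
     Ck_on 3 UNIV G \<and> (\<forall>X. 0 \<le> G X) \<and>
     Ck_on 3 UNIV H \<and> (\<forall>F. 0 \<le> H F) \<and>
     Ck_on 3 UNIV R \<and> (\<forall>X. 0 \<le> R X) \<and> strictly_convex R \<and>
     (\<forall>F Z w. G (F, Z, w) = H F + R (F, Z, w)) \<and>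
     (\<exists>\<kappa>>0. \<exists>\<kappa>'>0. \<forall>F z.
        \<kappa> * norm F powr (p - 2) * (norm z)\<^sup>2 \<le> hess_form H F z \<and>
        hess_form H F z \<le> \<kappa>' * norm F powr (p - 2) * (norm z)\<^sup>2) \<and>
     (\<exists>\<gamma>>0. \<exists>\<gamma>'>0. \<forall>X z.
        \<gamma> * (norm z)\<^sup>2 \<le> hess_form R X z \<and> hess_form R X z \<le> \<gamma>' * (norm z)\<^sup>2)"

definition H2 :: "(ext \<Rightarrow> real) \<Rightarrow> real \<Rightarrow> bool" where
  "H2 G p \<longleftrightarrow> (\<exists>c\<^sub>1>0. \<exists>c\<^sub>2>0. \<exists>c\<^sub>3>0. \<exists>c\<^sub>4>0. \<forall>F Z w.
     G (F, Z, w) \<ge> c\<^sub>1 * norm F powr p + c\<^sub>2 * (norm Z)\<^sup>2 + c\<^sub>3 * \<bar>w\<bar>\<^sup>2 - c\<^sub>4)"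

definition H3 :: "(ext \<Rightarrow> real) \<Rightarrow> real \<Rightarrow> bool" where
  "H3 G p \<longleftrightarrow> (\<exists>c\<^sub>5>0. \<forall>F Z w.
     G (F, Z, w) \<le> c\<^sub>5 * (norm F powr p + (norm Z)\<^sup>2 + \<bar>w\<bar>\<^sup>2 + 1))"

definition H4 :: "(ext \<Rightarrow> real) \<Rightarrow> real \<Rightarrow> bool" where
  "H4 G p \<longleftrightarrow> (\<exists>c\<^sub>6>0. \<forall>F Z w.
     norm (fst (grad G (F, Z, w))) powr (p / (p - 1))
     + norm (fst (snd (grad G (F, Z, w)))) powr (p / (p - 2))
     + \<bar>snd (snd (grad G (F, Z, w)))\<bar> powr (p / (p - 3))
     \<le> c\<^sub>6 * (norm F powr p + (norm Z)\<^sup>2 + \<bar>w\<bar>\<^sup>2 + 1))"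

definition H5 :: "(mat3 \<Rightarrow> real) \<Rightarrow> (ext \<Rightarrow> real) \<Rightarrow> real \<Rightarrow> bool" where
  "H5 H R p \<longleftrightarrow>
     (\<exists>c\<^sub>7>0. \<forall>F. \<forall>a\<in>Basis. \<forall>b\<in>Basis. \<forall>c\<in>Basis.
        \<bar>pd (pd (pd H a) b) c F\<bar> \<le> c\<^sub>7 * norm F powr (p - 3)) \<and>
     (\<exists>c\<^sub>8>0. \<forall>X. \<forall>A\<in>Basis. \<forall>B\<in>Basis. \<forall>D\<in>Basis.
        \<bar>pd (pd (pd R A) B) D X\<bar> \<le> c\<^sub>8)"

definition energy_hyps :: "(ext \<Rightarrow> real) \<Rightarrow> (mat3 \<Rightarrow> real) \<Rightarrow> (ext \<Rightarrow> real) \<Rightarrow> real \<Rightarrow> bool" where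
  "energy_hyps G H R p \<longleftrightarrow> H1 G H R p \<and> H2 G p \<and> H3 G p \<and> H4 G p \<and> H5 H R p"


section \<open>The variational scheme\<close>

definition in_space :: "real \<Rightarrow> (vec3 \<Rightarrow> state) \<Rightarrow> bool" where
  "in_space p \<Theta> \<longleftrightarrow> Lp 2 (\<lambda>x. vel (\<Theta> x)) \<and> Lp p (\<lambda>x. dgrad (\<Theta> x)) \<and>
     Lp 2 (\<lambda>x. fst (snd (xi (\<Theta> x)))) \<and> Lp 2 (\<lambda>x. snd (snd (xi (\<Theta> x))))"

definition J_fun :: "(ext \<Rightarrow> real) \<Rightarrow> (vec3 \<Rightarrow> state) \<Rightarrow> (vec3 \<Rightarrow> state) \<Rightarrow> real" where
  "J_fun G \<Theta>\<^sub>0 \<Theta> =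
     (\<integral>x. 1/2 * (norm (vel (\<Theta> x) - vel (\<Theta>\<^sub>0 x)))\<^sup>2 + G (xi (\<Theta> x)) \<partial>torus)"

definition admissible :: "real \<Rightarrow> real \<Rightarrow> (vec3 \<Rightarrow> state) \<Rightarrow> (vec3 \<Rightarrow> state) set" where
  "admissible p h \<Theta>\<^sub>0 = {\<Theta>. in_space p \<Theta> \<and>
     (\<forall>\<phi>. testfun \<phi> \<longrightarrow> (\<forall>A\<in>Basis.
        (\<integral>x. (xi (\<Theta> x) - xi (\<Theta>\<^sub>0 x)) \<bullet> A / h * \<phi> x \<partial>torus)
        = - (\<integral>x. (\<Sum>i\<in>UNIV. \<Sum>\<alpha>\<in>UNIV.
                dPhi A i \<alpha> (dgrad (\<Theta>\<^sub>0 x)) * vel (\<Theta> x) $ i * dx \<alpha> \<phi> x) \<partial>torus)))}"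

definition P1 :: "(ext \<Rightarrow> real) \<Rightarrow> real \<Rightarrow> real \<Rightarrow> (nat \<Rightarrow> vec3 \<Rightarrow> state) \<Rightarrow> bool" where
  "P1 G p h \<Theta> \<longleftrightarrow> (\<forall>j\<ge>1. \<Theta> j \<in> admissible p h (\<Theta> (j - 1)) \<and>
     (\<forall>\<Psi> \<in> admissible p h (\<Theta> (j - 1)).
        J_fun G (\<Theta> (j - 1)) (\<Theta> j) \<le> J_fun G (\<Theta> (j - 1)) \<Psi> \<and>
        (J_fun G (\<Theta> (j - 1)) \<Psi> = J_fun G (\<Theta> (j - 1)) (\<Theta> j) \<longrightarrow> (AE x in torus. \<Psi> x = \<Theta> j x))))"

definition P2 :: "(ext \<Rightarrow> real) \<Rightarrow> real \<Rightarrow> (nat \<Rightarrow> vec3 \<Rightarrow> state) \<Rightarrow> bool" where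
  "P2 G h \<Theta> \<longleftrightarrow> (\<forall>j\<ge>1.
     (\<forall>i. distr_balance
        (\<lambda>x. (vel (\<Theta> j x) $ i - vel (\<Theta> (j - 1) x) $ i) / h)
        (\<lambda>x. \<chi> \<alpha>. \<Sum>A\<in>Basis. pd G A (xi (\<Theta> j x)) * dPhi A i \<alpha> (dgrad (\<Theta> (j - 1) x)))
        (\<lambda>x. 0)) \<and>
     (\<forall>A\<in>Basis. distr_balance
        (\<lambda>x. (xi (\<Theta> j x) \<bullet> A - xi (\<Theta> (j - 1) x) \<bullet> A) / h)
        (\<lambda>x. \<chi> \<alpha>. \<Sum>i\<in>UNIV. dPhi A i \<alpha> (dgrad (\<Theta> (j - 1) x)) * vel (\<Theta> j x) $ i)
        (\<lambda>x. 0)))"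

definition P3 :: "(nat \<Rightarrow> vec3 \<Rightarrow> state) \<Rightarrow> bool" where
  "P3 \<Theta> \<longleftrightarrow> (is_gradient (\<lambda>x. dgrad (\<Theta> 0 x)) \<longrightarrow> (\<forall>j\<ge>1. is_gradient (\<lambda>x. dgrad (\<Theta> j x))))"

definition P4 :: "real \<Rightarrow> (nat \<Rightarrow> vec3 \<Rightarrow> state) \<Rightarrow> bool" where
  "P4 p \<Theta> \<longleftrightarrow> (\<forall>j\<ge>1. W1p p (\<lambda>x. vel (\<Theta> j x)))"

definition P5 :: "(ext \<Rightarrow> real) \<Rightarrow> real \<Rightarrow> (nat \<Rightarrow> vec3 \<Rightarrow> state) \<Rightarrow> bool" where
  "P5 G E\<^sub>0 \<Theta> \<longleftrightarrow>
     (let e = (\<lambda>j. (\<integral>x. (norm (vel (\<Theta> j x)))\<^sup>2 \<partial>torus) + (\<integral>x. G (xi (\<Theta> j x)) \<partial>torus));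
          d = (\<lambda>j. \<integral>x. (norm (\<Theta> (Suc j) x - \<Theta> j x))\<^sup>2 \<partial>torus)
      in bdd_above (range e) \<and> summable d \<and> (SUP j. e j) + (\<Sum>j. d j) \<le> E\<^sub>0)"

definition iterates ::
  "(ext \<Rightarrow> real) \<Rightarrow> real \<Rightarrow> real \<Rightarrow> real \<Rightarrow> (nat \<Rightarrow> vec3 \<Rightarrow> state) \<Rightarrow> bool" where
  "iterates G p E\<^sub>0 h \<Theta> \<longleftrightarrow> (\<forall>j. in_space p (\<Theta> j)) \<and>
     P1 G p h \<Theta> \<and> P2 G h \<Theta> \<and> P3 \<Theta> \<and> P4 p \<Theta> \<and> P5 G E\<^sub>0 \<Theta>"


section \<open>Interpolates\<close>

definition chi :: "real \<Rightarrow> nat \<Rightarrow> real \<Rightarrow> real" where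
  "chi h j t = indicat_real {(real j - 1) * h..<real j * h} t"

definition lin_interp ::
  "real \<Rightarrow> (nat \<Rightarrow> vec3 \<Rightarrow> 'b::euclidean_space) \<Rightarrow> real \<Rightarrow> vec3 \<Rightarrow> 'b" where
  "lin_interp h u t x = (\<Sum>\<^sub>\<infinity>j\<in>{1..}. chi h j t *\<^sub>R
     (u (j - 1) x + ((t - h * (real j - 1)) / h) *\<^sub>R (u j x - u (j - 1) x)))"

definition const_interp ::
  "real \<Rightarrow> (nat \<Rightarrow> vec3 \<Rightarrow> 'b::euclidean_space) \<Rightarrow> real \<Rightarrow> vec3 \<Rightarrow> 'b" where
  "const_interp h u t x = (\<Sum>\<^sub>\<infinity>j\<in>{1..}. chi h j t *\<^sub>R u j x)"

definition lag_interp ::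
  "real \<Rightarrow> (nat \<Rightarrow> vec3 \<Rightarrow> 'b::euclidean_space) \<Rightarrow> real \<Rightarrow> vec3 \<Rightarrow> 'b" where
  "lag_interp h u t x = (\<Sum>\<^sub>\<infinity>j\<in>{1..}. chi h j t *\<^sub>R u (j - 1) x)"


section \<open>Smooth solutions of the extended system\<close>

definition smooth_solution ::
  "(ext \<Rightarrow> real) \<Rightarrow> real \<Rightarrow> (vec3 \<Rightarrow> state) \<Rightarrow> (real \<Rightarrow> vec3 \<Rightarrow> state) \<Rightarrow> bool" where
  "smooth_solution G T U\<^sub>0 U \<longleftrightarrow>
     smooth_on ({0..T} \<times> UNIV) (\<lambda>(t, x). U t x) \<and>
     (\<forall>t\<in>{0..T}. periodic (U t)) \<and> (\<forall>x. U 0 x = U\<^sub>0 x) \<and>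
     (\<forall>t\<in>{0..T}. \<forall>x.
        (\<forall>i. ((\<lambda>s. vel (U s x) $ i) has_real_derivative
           (\<Sum>\<alpha>\<in>UNIV. dx \<alpha> (\<lambda>y. \<Sum>A\<in>Basis. pd G A (xi (U t y)) * dPhi A i \<alpha> (dgrad (U t y))) x))
           (at t within {0..T})) \<and>
        (\<forall>A\<in>Basis. ((\<lambda>s. xi (U s x) \<bullet> A) has_real_derivative
           (\<Sum>\<alpha>\<in>UNIV. dx \<alpha> (\<lambda>y. \<Sum>i\<in>UNIV. dPhi A i \<alpha> (dgrad (U t y)) * vel (U t y) $ i) x))
           (at t within {0..T})))"


section \<open>Relative entropy\<close>

definition eta :: "(ext \<Rightarrow> real) \<Rightarrow> state \<Rightarrow> real" where
  "eta G \<theta> = 1/2 * (norm (vel \<theta>))\<^sup>2 + G (xi \<theta>)"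

definition eta_r :: "(ext \<Rightarrow> real) \<Rightarrow> state \<Rightarrow> state \<Rightarrow> real" where
  "eta_r G \<theta> \<theta>b = eta G \<theta> - eta G \<theta>b - grad (eta G) \<theta>b \<bullet> (\<theta> - \<theta>b)"

definition err :: "real \<Rightarrow> (vec3 \<Rightarrow> state) \<Rightarrow> (vec3 \<Rightarrow> state) \<Rightarrow> real" where
  "err p \<Theta> U = (\<integral>x. (1 + norm (dgrad (\<Theta> x)) powr (p - 2) + norm (dgrad (U x)) powr (p - 2))
       * (norm (dgrad (\<Theta> x) - dgrad (U x)))\<^sup>2 + (norm (\<Theta> x - U x))\<^sup>2 \<partial>torus)"

text \<open>
  In the following terms all fields are taken at one fixed time: \<open>\<theta>\<close> is the piecewise constant
  interpolate, \<open>\<Theta>\<close> the piecewise linear one, \<open>f\<close> the lagged deformation gradient, and \<open>U\<close> the smooth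
  solution.
\<close>

definition q_rel ::
  "(ext \<Rightarrow> real) \<Rightarrow> (vec3 \<Rightarrow> state) \<Rightarrow> (vec3 \<Rightarrow> mat3) \<Rightarrow> (vec3 \<Rightarrow> state) \<Rightarrow> vec3 \<Rightarrow> vec3" where
  "q_rel G \<theta> f U x = (\<chi> \<alpha>. \<Sum>i\<in>UNIV. \<Sum>A\<in>Basis.
     (vel (\<theta> x) $ i - vel (U x) $ i) * (pd G A (xi (\<theta> x)) - pd G A (xi (U x))) * dPhi A i \<alpha> (f x))"

definition Q_term ::
  "(ext \<Rightarrow> real) \<Rightarrow> (vec3 \<Rightarrow> state) \<Rightarrow> (vec3 \<Rightarrow> state) \<Rightarrow> vec3 \<Rightarrow> real" where
  "Q_term G \<Theta> U x = (\<Sum>i\<in>UNIV. \<Sum>\<alpha>\<in>UNIV. \<Sum>A\<in>Basis.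
     (let V = vel (\<Theta> x) $ i; Vb = vel (U x) $ i;
          g = pd G A (xi (\<Theta> x)); gb = pd G A (xi (U x));
          P = dPhi A i \<alpha> (dgrad (\<Theta> x)); Pb = dPhi A i \<alpha> (dgrad (U x));
          dgb = dx \<alpha> (\<lambda>y. pd G A (xi (U y))) x;
          dVb = dx \<alpha> (\<lambda>y. vel (U y) $ i) x
      in dgb * (P - Pb) * (V - Vb)
       + dVb * (g - gb) * (P - Pb)
       + dVb * (g - gb - (\<Sum>B\<in>Basis. pd (pd G A) B (xi (U x)) * ((xi (\<Theta> x) - xi (U x)) \<bullet> B))) * Pb))"

definition S_term ::
  "(ext \<Rightarrow> real) \<Rightarrow> (vec3 \<Rightarrow> state) \<Rightarrow> (vec3 \<Rightarrow> state) \<Rightarrow> (vec3 \<Rightarrow> mat3) \<Rightarrow> (vec3 \<Rightarrow> state)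
     \<Rightarrow> vec3 \<Rightarrow> real" where
  "S_term G \<theta> \<Theta> f U x = (\<Sum>i\<in>UNIV. \<Sum>\<alpha>\<in>UNIV. \<Sum>A\<in>Basis.
     (let v = vel (\<theta> x) $ i; V = vel (\<Theta> x) $ i; Vb = vel (U x) $ i;
          gc = pd G A (xi (\<theta> x)); g = pd G A (xi (\<Theta> x)); gb = pd G A (xi (U x));
          Pf = dPhi A i \<alpha> (f x); P = dPhi A i \<alpha> (dgrad (\<Theta> x)); Pb = dPhi A i \<alpha> (dgrad (U x));
          dgb = dx \<alpha> (\<lambda>y. pd G A (xi (U y))) x;
          dVb = dx \<alpha> (\<lambda>y. vel (U y) $ i) x
      in dgb * (Pb * (v - V) + (P - Pb) * (v - V) + (Pf - P) * (v - V) + (Pf - P) * (V - Vb))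
       + dVb * ((gc - g) * Pb + (gc - g) * (Pf - P) + (gc - g) * (P - Pb) + (g - gb) * (Pf - P))))"

text \<open>The integrand \<open>D\<^sup>j\<close> at the values of the two interpolates, with the increment as last argument.\<close>

definition D_term :: "(ext \<Rightarrow> real) \<Rightarrow> state \<Rightarrow> state \<Rightarrow> state \<Rightarrow> real" where
  "D_term G \<theta> \<Theta> \<delta> = (grad (eta G) \<theta> - grad (eta G) \<Theta>) \<bullet> \<delta>"

text \<open>
  The identity for \<open>\<partial>\<^sub>t \<eta>\<^sup>r\<close> at one time \<open>t\<close>, for the iterates \<open>\<Theta>\<close> with time step \<open>h\<close>.
  The time derivative is the pointwise one, which is asserted to exist.
\<close>

definition rel_entropy_identity ::
  "(ext \<Rightarrow> real) \<Rightarrow> real \<Rightarrow> (nat \<Rightarrow> vec3 \<Rightarrow> state) \<Rightarrow> (real \<Rightarrow> vec3 \<Rightarrow> state) \<Rightarrow> real \<Rightarrow> bool" where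
  "rel_entropy_identity G h \<Theta> U t \<longleftrightarrow>
     (let er = (\<lambda>s x. eta_r G (lin_interp h \<Theta> s x) (U s x));
          \<theta> = const_interp h \<Theta>;
          f = lag_interp h (\<lambda>j x. dgrad (\<Theta> j x))
      in (AE x in torus. (\<lambda>s. er s x) differentiable at t) \<and>
         distr_balance
           (\<lambda>x. deriv (\<lambda>s. er s x) t)
           (q_rel G (\<theta> t) (f t) (U t))
           (\<lambda>x. Q_term G (lin_interp h \<Theta> t) (U t) x
              - 1 / h * (\<Sum>\<^sub>\<infinity>j\<in>{1..}. chi h j t *
                  D_term G (\<theta> t x) (lin_interp h \<Theta> t x) (\<Theta> j x - \<Theta> (j - 1) x))
              + S_term G (\<theta> t) (lin_interp h \<Theta> t) (f t) (U t) x))"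

end

theory Submission
  imports Defs
begin

text \<open>
  The relative entropy is comparable with the integrand of the error because the Hessian of \<open>H\<close> is
  bounded below by \<open>|F|\<^sup>p\<^sup>-\<^sup>2\<close> and, on a quarter of the segment between two matrices, the norm is at
  least half of its maximum at the end points.

  The balance of \<open>F\<close> in one time step says that the new velocity has the weak gradient
  \<open>(F\<^sup>j - F\<^sup>j\<^sup>-\<^sup>1) / h\<close>, which lies in \<open>L\<^sup>p\<close>. By approximation with trigonometric polynomials, the
  momentum balance may therefore be tested with \<open>v\<^sup>j\<close> minus the smooth velocity. Together with the
  null Lagrangian identities for \<open>\<partial>\<Phi>/\<partial>F\<close> at the lagged deformation gradient this gives the relative
  entropy identity at every time that is not a multiple of the time step.

  For the error estimate, \<open>Q\<close> is bounded by the error density, and \<open>S\<close> by the error density, a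
  superquadratic expression in the increments, and a term linear in the increments. The dissipation
  \<open>D\<^sup>j / h\<close> absorbs the linear term at the cost of \<open>O(h)\<close>, but at relative position \<open>l\<close> in the step it
  controls the other one only with the factor \<open>(1 - l)\<^sup>3 / h\<close>. Adding to the relative entropy a
  correction that vanishes at both ends of each step makes this factor uniform, and Gronwall's
  inequality can be chained over the steps.
\<close>

section \<open>Calculus\<close>

text \<open>The splitting \<open>G = H + R\<close> decides which products can be estimated. In the
  \<open>F\<close> block \<open>\<partial>\<Phi>/\<partial>F\<close> is constant, so differences of
  it vanish there; in the other blocks the derivative of \<open>G\<close> comes from
  \<open>R\<close> alone and is globally Lipschitz. Hence the superquadratic growth of
  \<open>H\<close> never multiplies a difference of \<open>\<partial>\<Phi>/\<partial>F\<close>. The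
  same dichotomy puts the stress into the dual of L^p, and this is one place where p \<ge> 6 is
  used. The cubic degeneration has two sources. The dissipation compares the new state with the
  interpolate, and these merge as l tends to 1: one factor 1 - l. Its weight contains the
  deformation gradients at these two states only, and they control no more than (1 - l) times the
  increment: two further factors, from the square. The mean of (1 - l)^3 over a step is 1/4, so on
  average only a constant is lost; the correction is a primitive of the deviation from this mean,
  whence 48 = 4 * 12. The O(h) remainder carries powers of the deformation gradients, which (H2) and
  (P5) bound uniformly. All constants must be fixed before h and the iterates are known.\<close>

lemma pd_linear_comb:
  fixes f :: "'a::euclidean_space \<Rightarrow> real"
  assumes "f differentiable at x"
  shows "pd f v x = grad f x \<bullet> v"
proof -
  have lin: "linear (frechet_derivative f (at x))"
    using assms linear_frechet_derivative by blast
  have "pd f v x = frechet_derivative f (at x) (\<Sum>b\<in>Basis. (v \<bullet> b) *\<^sub>R b)"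
    by (simp add: pd_def euclidean_representation)
  also have "\<dots> = (\<Sum>b\<in>Basis. (v \<bullet> b) * pd f b x)"
    by (simp add: linear_sum[OF lin] linear_cmul[OF lin] pd_def)
  also have "\<dots> = grad f x \<bullet> v"
    by (simp add: grad_def inner_sum_left inner_sum_right mult.commute inner_commute)
  finally show ?thesis .
qed

lemma has_derivative_grad:
  fixes f :: "'a::euclidean_space \<Rightarrow> real"
  assumes "f differentiable at x"
  shows "(f has_derivative (\<lambda>v. grad f x \<bullet> v)) (at x)"
proof -
  have "frechet_derivative f (at x) = (\<lambda>v. grad f x \<bullet> v)"
    using pd_linear_comb[OF assms] by (auto simp: pd_def)
  then show ?thesis using assms frechet_derivative_works[of f "at x"] by simp
qed

lemma pd_eqI:
  assumes "(f has_derivative f') (at x)"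
  shows "pd f v x = f' v"
  using frechet_derivative_at[OF assms] by (simp add: pd_def)

lemma grad_eqI:
  fixes f :: "'a::euclidean_space \<Rightarrow> real"
  assumes "(f has_derivative (\<lambda>v. g \<bullet> v)) (at x)"
  shows "grad f x = g"
proof -
  have "pd f v x = g \<bullet> v" for v using pd_eqI[OF assms] by simp
  then show ?thesis by (simp add: grad_def euclidean_representation)
qed

lemma grad_inner_Basis: "b \<in> Basis \<Longrightarrow> grad f x \<bullet> b = pd f b x"
  by (simp add: grad_def inner_sum_left inner_Basis if_distrib sum.delta cong: if_cong)

definition C1 :: "('a::euclidean_space \<Rightarrow> real) \<Rightarrow> bool" where
  "C1 f \<longleftrightarrow> (\<forall>x. f differentiable at x) \<and> (\<forall>b\<in>Basis. continuous_on UNIV (pd f b))"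

lemma C1D: "C1 f \<Longrightarrow> f differentiable at x" "C1 f \<Longrightarrow> b \<in> Basis \<Longrightarrow> continuous_on UNIV (pd f b)"
  by (auto simp: C1_def)

lemma C1_cont: "C1 f \<Longrightarrow> continuous_on S f"
  by (meson C1D(1) continuous_at_imp_continuous_on differentiable_imp_continuous_within)

lemma Ck_Suc_UNIV:
  "Ck_on (Suc k) UNIV f \<longleftrightarrow> (\<forall>x. f differentiable at x) \<and> (\<forall>b\<in>Basis. Ck_on k UNIV (pd f b))"
  by (simp add: differentiable_on_def pd_def[abs_def])

lemma Ck_on_Suc_D: "Ck_on (Suc k) S f \<Longrightarrow> Ck_on k S f"
proof (induction k arbitrary: f)
  case 0
  then show ?case by (auto intro: differentiable_imp_continuous_on)
next
  case (Suc k)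
  have "Ck_on k S (\<lambda>x. frechet_derivative f (at x within S) b)" if "b \<in> Basis" for b
    by (rule Suc.IH) (use Suc.prems that in auto)
  then show ?case using Suc.prems by simp
qed

lemma Ck_on_le: "Ck_on n S f \<Longrightarrow> k \<le> n \<Longrightarrow> Ck_on k S f"
  by (induction n) (auto simp: le_Suc_eq dest: Ck_on_Suc_D simp del: Ck_on.simps(2))

lemma Ck_C1: "Ck_on (Suc k) UNIV f \<Longrightarrow> C1 f"
proof -
  assume a: "Ck_on (Suc k) UNIV f"
  then have "Ck_on k UNIV (pd f b)" if "b \<in> Basis" for b using that by (simp add: Ck_Suc_UNIV del: Ck_on.simps)
  then have "continuous_on UNIV (pd f b)" if "b \<in> Basis" for b
    using that Ck_on_le[of k UNIV _ 0] by auto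
  then show ?thesis using a by (auto simp: C1_def Ck_Suc_UNIV simp del: Ck_on.simps)
qed

lemma C1_if_Ck1: "C1 f \<Longrightarrow> Ck_on (Suc 0) UNIV f"
  unfolding Ck_Suc_UNIV C1_def by auto

lemma smooth_C1: "smooth_on UNIV f \<Longrightarrow> C1 f"
  unfolding smooth_on_def by (rule Ck_C1[of 0]) blast

lemma pd_add: "f differentiable at x \<Longrightarrow> g differentiable at x \<Longrightarrow>
    pd (\<lambda>x. f x + g x) b x = pd f b x + pd g b x"
  unfolding pd_def by (subst frechet_derivative_at[OF has_derivative_add[OF
    frechet_derivative_works[THEN iffD1] frechet_derivative_works[THEN iffD1]], symmetric]) auto

lemma pd_mult: "f differentiable at x \<Longrightarrow> g differentiable at x \<Longrightarrow>
    pd (\<lambda>x. f x * g x) b x = f x * pd g b x + pd f b x * g x"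
proof -
  assume a: "f differentiable at x" "g differentiable at x"
  have "((\<lambda>x. f x * g x) has_derivative (\<lambda>h. f x * frechet_derivative g (at x) h + frechet_derivative f (at x) h * g x)) (at x)"
    using a frechet_derivative_works by (intro has_derivative_mult) auto
  from pd_eqI[OF this] show ?thesis by (simp add: pd_def)
qed

lemma Ck_const: "Ck_on k UNIV (\<lambda>x::'a::euclidean_space. c::real)"
proof (induction k arbitrary: c)
  case (Suc k)
  have "pd (\<lambda>x::'a. c) b = (\<lambda>x. 0)" for b
    using pd_eqI[OF has_derivative_const] by auto
  then show ?case using Suc by (simp add: Ck_Suc_UNIV del: Ck_on.simps)
qed simp

lemma Ck_add: "Ck_on k UNIV f \<Longrightarrow> Ck_on k UNIV g \<Longrightarrow> Ck_on k UNIV (\<lambda>x::'a::euclidean_space. f x + g x :: real)"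
proof (induction k arbitrary: f g)
  case 0 then show ?case by (auto intro: continuous_intros)
next
  case (Suc k)
  have "pd (\<lambda>x. f x + g x) b = (\<lambda>x. pd f b x + pd g b x)" for b
    using Suc.prems by (intro ext pd_add) (auto simp: Ck_Suc_UNIV simp del: Ck_on.simps)
  then show ?case using Suc by (simp add: Ck_Suc_UNIV del: Ck_on.simps)
qed

lemma Ck_mult: "Ck_on k UNIV f \<Longrightarrow> Ck_on k UNIV g \<Longrightarrow> Ck_on k UNIV (\<lambda>x::'a::euclidean_space. f x * g x :: real)"
proof (induction k arbitrary: f g)
  case 0 then show ?case by (simp add: continuous_on_mult)
next
  case (Suc k)
  have d: "f differentiable at x" "g differentiable at x" for x
    using Suc.prems unfolding Ck_Suc_UNIV by blast+
  have p: "Ck_on k UNIV (pd f b)" "Ck_on k UNIV (pd g b)" if "b \<in> Basis" for b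
    using Suc.prems that unfolding Ck_Suc_UNIV by blast+
  have e: "pd (\<lambda>x. f x * g x) b = (\<lambda>x. f x * pd g b x + pd f b x * g x)" for b
    using d by (intro ext pd_mult)
  have "Ck_on k UNIV (\<lambda>x. f x * pd g b x + pd f b x * g x)" if "b \<in> Basis" for b
    by (intro Ck_add Suc.IH p that Suc.prems[THEN Ck_on_Suc_D])
  then show ?case unfolding Ck_Suc_UNIV e using d by (simp add: differentiable_mult)
qed

text \<open>Carries smoothness from the line to R^3: coordinates, shifts and reflections all have
  the form \<open>x \<bullet> c + d\<close>.\<close>

lemma Ck_comp_affine:
  fixes f :: "real \<Rightarrow> real" and c :: "'a::euclidean_space"
  shows "Ck_on k UNIV f \<Longrightarrow> Ck_on k UNIV (\<lambda>x. f (x \<bullet> c + d))"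
proof (induction k arbitrary: f)
  case 0
  have "continuous_on UNIV (\<lambda>x. x \<bullet> c + d)" by (intro continuous_intros)
  then show ?case
    using continuous_on_compose2[of UNIV f UNIV "\<lambda>x. x \<bullet> c + d"] 0 by simp
next
  case (Suc k)
  have df: "f differentiable at x" for x using Suc.prems unfolding Ck_Suc_UNIV by blast
  have d: "((\<lambda>x. f (x \<bullet> c + d)) has_derivative (\<lambda>v. pd f (v \<bullet> c) (x \<bullet> c + d))) (at x)" for x
  proof -
    have "((\<lambda>x. x \<bullet> c + d) has_derivative (\<lambda>v. v \<bullet> c)) (at x)"
      by (auto intro!: derivative_eq_intros)
    from has_derivative_compose[OF this df[unfolded frechet_derivative_works]] show ?thesis
      by (simp add: pd_def)
  qed
  have e: "pd (\<lambda>x. f (x \<bullet> c + d)) v = (\<lambda>x. (v \<bullet> c) * pd f 1 (x \<bullet> c + d))" for v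
    by (rule ext) (simp add: pd_eqI[OF d] pd_linear_comb[OF df])
  have "Ck_on k UNIV (\<lambda>x. (v \<bullet> c) * pd f 1 (x \<bullet> c + d))" for v
    using Suc.prems unfolding Ck_Suc_UNIV by (intro Ck_mult Ck_const Suc.IH) auto
  then show ?case unfolding Ck_Suc_UNIV e using d differentiable_def by blast
qed

lemma Ck_inverse: "Ck_on k UNIV f \<Longrightarrow> (\<And>x. f x \<noteq> 0) \<Longrightarrow> Ck_on k UNIV (\<lambda>x::'a::euclidean_space. inverse (f x) :: real)"
proof (induction k arbitrary: f)
  case 0 then show ?case by (simp add: continuous_on_inverse)
next
  case (Suc k)
  have df: "f differentiable at x" for x using Suc.prems unfolding Ck_Suc_UNIV by blast
  have d: "((\<lambda>x. inverse (f x)) has_derivative (\<lambda>v. - (inverse (f x) * pd f v x * inverse (f x)))) (at x)" for x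
    using Deriv.has_derivative_inverse[OF Suc.prems(2) df[unfolded frechet_derivative_works]] by (simp add: pd_def)
  have e: "pd (\<lambda>x. inverse (f x)) v = (\<lambda>x. (-1) * (inverse (f x) * pd f v x * inverse (f x)))" for v
    by (rule ext) (simp add: pd_eqI[OF d])
  have p: "Ck_on k UNIV (pd f b)" if "b \<in> Basis" for b
    using Suc.prems that unfolding Ck_Suc_UNIV by blast
  have "Ck_on k UNIV (\<lambda>x. (-1) * (inverse (f x) * pd f b x * inverse (f x)))" if "b \<in> Basis" for b
    by (intro Ck_mult Ck_const p that Suc.IH Suc.prems(2) Suc.prems(1)[THEN Ck_on_Suc_D])
  then show ?case unfolding Ck_Suc_UNIV e using d differentiable_def by blast
qed

text \<open>Meant for the cosine, whose successive derivatives are its shifts by quarter periods, so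
  that one derivative rule settles all orders.\<close>

lemma Ck_derivative_seq:
  fixes F :: "nat \<Rightarrow> real \<Rightarrow> real"
  assumes "\<And>n x. (F n has_real_derivative F (Suc n) x) (at x)"
  shows "Ck_on k UNIV (F n)"
proof (induction k arbitrary: n)
  case 0
  then show ?case using assms by (auto intro!: DERIV_isCont continuous_at_imp_continuous_on)
next
  case (Suc k)
  have "pd (F n) 1 = F (Suc n)"
    using pd_eqI[OF assms[THEN has_field_derivative_imp_has_derivative]] by auto
  then show ?case using Suc assms
    by (auto simp: Ck_Suc_UNIV real_differentiable_def simp del: Ck_on.simps)
qed

lemma C1_add: "C1 f \<Longrightarrow> C1 g \<Longrightarrow> C1 (\<lambda>x. f x + g x)"
  by (rule Ck_C1[of 0]) (intro Ck_add C1_if_Ck1)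
lemma C1_mult: "C1 f \<Longrightarrow> C1 g \<Longrightarrow> C1 (\<lambda>x. f x * g x)"
  by (rule Ck_C1[of 0]) (intro Ck_mult C1_if_Ck1)
lemma C1_const: "C1 (\<lambda>x. c)"
  by (rule Ck_C1[of 0]) (rule Ck_const)
lemma C1_sum: "(\<And>i. i \<in> I \<Longrightarrow> C1 (f i)) \<Longrightarrow> C1 (\<lambda>x. \<Sum>i\<in>I. f i x)"
  by (induction I rule: infinite_finite_induct) (auto simp: C1_const C1_add)

lemma has_real_derivative_line:
  fixes f :: "'a::euclidean_space \<Rightarrow> real"
  assumes "f differentiable at (x + s *\<^sub>R z)"
  shows "((\<lambda>s. f (x + s *\<^sub>R z)) has_real_derivative pd f z (x + s *\<^sub>R z)) (at s)"
proof -
  have "((\<lambda>s. x + s *\<^sub>R z) has_derivative (\<lambda>h. h *\<^sub>R z)) (at s)"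
    by (auto intro!: derivative_eq_intros)
  from has_derivative_compose[OF this has_derivative_grad[OF assms]]
  show ?thesis by (simp add: has_field_derivative_def pd_linear_comb[OF assms] mult_commute_abs)
qed

lemma mvt_line:
  fixes f :: "'a::euclidean_space \<Rightarrow> real"
  assumes "\<And>x. f differentiable at x"
  obtains s where "0 < s" "s < 1" "f y - f x = pd f (y - x) (x + s *\<^sub>R (y - x))"
proof -
  have "\<exists>z. 0 < z \<and> z < 1 \<and> f (x + 1 *\<^sub>R (y-x)) - f (x + 0 *\<^sub>R (y-x)) = (1 - 0) * pd f (y-x) (x + z *\<^sub>R (y-x))"
    by (rule MVT2) (auto intro!: has_real_derivative_line assms)
  then show ?thesis using that by auto
qed

text \<open>The mixed difference quotient is a value of either mixed derivative, by the mean value theorem.\<close>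

lemma mixed_derivatives_commute:
  fixes f :: "'a::euclidean_space \<Rightarrow> real"
  assumes S: "open S" "x \<in> S"
    and fa: "\<And>y. y \<in> S \<Longrightarrow> ((\<lambda>s. f (y + s *\<^sub>R a)) has_real_derivative fa y) (at 0)"
    and fb: "\<And>y. y \<in> S \<Longrightarrow> ((\<lambda>s. f (y + s *\<^sub>R b)) has_real_derivative fb y) (at 0)"
    and fab: "\<And>y. y \<in> S \<Longrightarrow> ((\<lambda>s. fa (y + s *\<^sub>R b)) has_real_derivative fab y) (at 0)"
    and fba: "\<And>y. y \<in> S \<Longrightarrow> ((\<lambda>s. fb (y + s *\<^sub>R a)) has_real_derivative fba y) (at 0)"
    and cont: "isCont fab x" "isCont fba x"
  shows "fab x = fba x"
proof -
  \<comment> \<open>The hypotheses give directional derivatives at the base point of a line; moving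
    the base point gives them at every parameter whose point lies in \<open>S\<close>.\<close>
  have shift: "((\<lambda>s. g (y + s *\<^sub>R c)) has_real_derivative g' (y + s *\<^sub>R c)) (at s)"
    if "\<And>y. y \<in> S \<Longrightarrow> ((\<lambda>s. g (y + s *\<^sub>R c)) has_real_derivative g' y) (at 0)" "y + s *\<^sub>R c \<in> S" for g g' y c s
  proof -
    have "((\<lambda>r. g ((y + s *\<^sub>R c) + r *\<^sub>R c)) has_real_derivative g' (y + s *\<^sub>R c)) (at (s - s))"
      using that by simp
    then have "((\<lambda>r. g ((y + s *\<^sub>R c) + (r - s) *\<^sub>R c)) has_real_derivative g' (y + s *\<^sub>R c)) (at s)"
      using DERIV_chain2[OF _ DERIV_diff[OF DERIV_ident DERIV_const], of "\<lambda>r. g ((y + s *\<^sub>R c) + r *\<^sub>R c)" _ s s UNIV]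
      by simp
    then show ?thesis by (simp add: algebra_simps)
  qed
  \<comment> \<open>The second difference over a parallelogram: one mean value theorem along
    \<open>c\<close> for the increment in direction \<open>d\<close>, then another along
    \<open>d\<close>.\<close>
  have key: "\<exists>\<sigma> \<tau>. 0 < \<sigma> \<and> \<sigma> < e \<and> 0 < \<tau> \<and> \<tau> < e \<and>
      g (x + e *\<^sub>R c + e *\<^sub>R d) - g (x + e *\<^sub>R c) - g (x + e *\<^sub>R d) + g x = e * e * gcd (x + \<sigma> *\<^sub>R c + \<tau> *\<^sub>R d)"
    if e: "0 < e" and sub: "\<And>s t. 0 \<le> s \<Longrightarrow> s \<le> e \<Longrightarrow> 0 \<le> t \<Longrightarrow> t \<le> e \<Longrightarrow> x + s *\<^sub>R c + t *\<^sub>R d \<in> S"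
     and gc: "\<And>y. y \<in> S \<Longrightarrow> ((\<lambda>s. g (y + s *\<^sub>R c)) has_real_derivative gc y) (at 0)"
     and gcd: "\<And>y. y \<in> S \<Longrightarrow> ((\<lambda>s. gc (y + s *\<^sub>R d)) has_real_derivative gcd y) (at 0)"
    for e c d and g gc gcd :: "'a \<Rightarrow> real"
  proof -
    define k where "k s = g ((x + e *\<^sub>R d) + s *\<^sub>R c) - g (x + s *\<^sub>R c)" for s
    have "\<exists>z. 0 < z \<and> z < e \<and> k e - k 0 = (e - 0) * (gc ((x + e *\<^sub>R d) + z *\<^sub>R c) - gc (x + z *\<^sub>R c))"
      unfolding k_def
    proof (rule MVT2)
      fix s assume "0 \<le> s" "s \<le> e"
      then have "x + e *\<^sub>R d + s *\<^sub>R c \<in> S" "x + s *\<^sub>R c \<in> S"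
        using sub[of s e] sub[of s 0] e by (auto simp: algebra_simps)
      then show "((\<lambda>s. g (x + e *\<^sub>R d + s *\<^sub>R c) - g (x + s *\<^sub>R c)) has_real_derivative
          gc (x + e *\<^sub>R d + s *\<^sub>R c) - gc (x + s *\<^sub>R c)) (at s)"
        by (intro DERIV_diff shift[where g=g and g'=gc]) (auto intro: gc)
    qed (use e in auto)
    then obtain \<sigma> where \<sigma>: "0 < \<sigma>" "\<sigma> < e" "k e - k 0 = e * (gc ((x + e *\<^sub>R d) + \<sigma> *\<^sub>R c) - gc (x + \<sigma> *\<^sub>R c))"
      by auto
    have "\<exists>z. 0 < z \<and> z < e \<and> gc ((x + \<sigma> *\<^sub>R c) + e *\<^sub>R d) - gc ((x + \<sigma> *\<^sub>R c) + 0 *\<^sub>R d) = (e - 0) * gcd ((x + \<sigma> *\<^sub>R c) + z *\<^sub>R d)"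
    proof (rule MVT2)
      fix s assume "0 \<le> s" "s \<le> e"
      then have "x + \<sigma> *\<^sub>R c + s *\<^sub>R d \<in> S"
        using sub[of \<sigma> s] \<sigma> by (auto simp: algebra_simps)
      then show "((\<lambda>s. gc (x + \<sigma> *\<^sub>R c + s *\<^sub>R d)) has_real_derivative gcd (x + \<sigma> *\<^sub>R c + s *\<^sub>R d)) (at s)"
        by (intro shift[where g=gc and g'=gcd]) (auto intro: gcd)
    qed (use e in auto)
    then obtain \<tau> where \<tau>: "0 < \<tau>" "\<tau> < e" "gc ((x + \<sigma> *\<^sub>R c) + e *\<^sub>R d) - gc (x + \<sigma> *\<^sub>R c) = e * gcd ((x + \<sigma> *\<^sub>R c) + \<tau> *\<^sub>R d)"
      by auto
    have "k e - k 0 = e * (e * gcd ((x + \<sigma> *\<^sub>R c) + \<tau> *\<^sub>R d))"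
      using \<sigma>(3) \<tau>(3) by (simp add: algebra_simps)
    moreover have "k e - k 0 = g (x + e *\<^sub>R c + e *\<^sub>R d) - g (x + e *\<^sub>R c) - g (x + e *\<^sub>R d) + g x"
      by (simp add: k_def algebra_simps)
    ultimately show ?thesis using \<sigma> \<tau> by (intro exI[of _ \<sigma>] exI[of _ \<tau>]) (simp add: mult.assoc)
  qed
  have "\<bar>fab x - fba x\<bar> < 2 * \<epsilon>" if eps: "\<epsilon> > 0" for \<epsilon>
  proof -
    obtain r1 where r1: "r1 > 0" "\<And>y. dist y x < r1 \<Longrightarrow> y \<in> S" using S by (metis open_dist)
    obtain r2 where r2: "r2 > 0" "\<And>y. dist y x < r2 \<Longrightarrow> \<bar>fab y - fab x\<bar> < \<epsilon>"
      using cont(1)[unfolded continuous_at_eps_delta, rule_format, OF eps] by (auto simp: dist_real_def)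
    obtain r3 where r3: "r3 > 0" "\<And>y. dist y x < r3 \<Longrightarrow> \<bar>fba y - fba x\<bar> < \<epsilon>"
      using cont(2)[unfolded continuous_at_eps_delta, rule_format, OF eps] by (auto simp: dist_real_def)
    define r where "r = min r1 (min r2 r3)"
    \<comment> \<open>With this side the whole parallelogram stays within \<open>r / 2\<close> of
      \<open>x\<close>; adding 1 covers the case that both directions vanish.\<close>
    define e where "e = r / (2 * (norm a + norm b + 1))"
    have r: "r > 0" using r1 r2 r3 by (simp add: r_def)
    have np: "norm a + norm b + 1 > 0" by (simp add: add_nonneg_pos)
    have e: "e > 0" using r np by (simp add: e_def)
    have near: "dist (x + s *\<^sub>R a + t *\<^sub>R b) x < r" if "0 \<le> s" "s \<le> e" "0 \<le> t" "t \<le> e" for s t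
    proof -
      have "dist (x + s *\<^sub>R a + t *\<^sub>R b) x = norm (s *\<^sub>R a + t *\<^sub>R b)" by (simp add: dist_norm)
      also have "\<dots> \<le> s * norm a + t * norm b" using that norm_triangle_ineq[of "s *\<^sub>R a" "t *\<^sub>R b"] by simp
      also have "\<dots> \<le> e * norm a + e * norm b" using that by (intro add_mono mult_right_mono) auto
      also have "\<dots> \<le> e * (norm a + norm b + 1)" using e by (simp add: algebra_simps)
      also have "\<dots> = r / 2" unfolding e_def using np
        by (metis less_irrefl mult.commute nonzero_mult_divide_mult_cancel_left times_divide_eq_left)
      also have "\<dots> < r" using r by simp
      finally show ?thesis .
    qed
    have near2: "dist (x + s *\<^sub>R b + t *\<^sub>R a) x < r" if "0 \<le> s" "s \<le> e" "0 \<le> t" "t \<le> e" for s t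
      using near[of t s] that by (simp add: algebra_simps)
    have rr: "r \<le> r1" by (simp add: r_def)
    have in1: "x + s *\<^sub>R a + t *\<^sub>R b \<in> S" if "0 \<le> s" "s \<le> e" "0 \<le> t" "t \<le> e" for s t
      using near[OF that] rr by (intro r1(2)) linarith
    have in2: "x + s *\<^sub>R b + t *\<^sub>R a \<in> S" if "0 \<le> s" "s \<le> e" "0 \<le> t" "t \<le> e" for s t
      using near2[OF that] rr by (intro r1(2)) linarith
    obtain s t where st: "0 < s" "s < e" "0 < t" "t < e"
       "f (x + e *\<^sub>R a + e *\<^sub>R b) - f (x + e *\<^sub>R a) - f (x + e *\<^sub>R b) + f x = e * e * fab (x + s *\<^sub>R a + t *\<^sub>R b)"
      using key[OF e in1 fa fab] by blast
    obtain s' t' where st': "0 < s'" "s' < e" "0 < t'" "t' < e"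
       "f (x + e *\<^sub>R b + e *\<^sub>R a) - f (x + e *\<^sub>R b) - f (x + e *\<^sub>R a) + f x = e * e * fba (x + s' *\<^sub>R b + t' *\<^sub>R a)"
      using key[OF e in2 fb fba] by blast
    have "e * e * fab (x + s *\<^sub>R a + t *\<^sub>R b) = e * e * fba (x + s' *\<^sub>R b + t' *\<^sub>R a)"
      using st(5) st'(5) by (simp add: algebra_simps)
    then have "fab (x + s *\<^sub>R a + t *\<^sub>R b) = fba (x + s' *\<^sub>R b + t' *\<^sub>R a)" using e by simp
    moreover have "\<bar>fab (x + s *\<^sub>R a + t *\<^sub>R b) - fab x\<bar> < \<epsilon>"
      using near[of s t] st by (intro r2) (auto simp: r_def)
    moreover have "\<bar>fba (x + s' *\<^sub>R b + t' *\<^sub>R a) - fba x\<bar> < \<epsilon>"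
      using near2[of s' t'] st' by (intro r3) (auto simp: r_def)
    ultimately show ?thesis by linarith
  qed
  \<comment> \<open>With half the difference as tolerance the bound reads
    \<open>\<bar>fab x - fba x\<bar> < \<bar>fab x - fba x\<bar>\<close>, unless the difference is
    zero.\<close>
  from this[of "\<bar>fab x - fba x\<bar> / 2"] show ?thesis by (cases "fab x = fba x") auto
qed

lemma pd_pd_commute:
  fixes f :: "'a::euclidean_space \<Rightarrow> real"
  assumes f: "Ck_on 2 UNIV f" and ab: "a \<in> Basis" "b \<in> Basis"
  shows "pd (pd f a) b x = pd (pd f b) a x"
proof -
  have c: "C1 f" "C1 (pd f a)" "C1 (pd f b)"
    using f ab Ck_C1[of 1 f] Ck_C1[of 0 "pd f a"] Ck_C1[of 0 "pd f b"] Ck_Suc_UNIV[of 1 f]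
    by (auto simp: numeral_2_eq_2 simp del: Ck_on.simps)
  have l: "((\<lambda>s. g (y + s *\<^sub>R c)) has_real_derivative pd g c y) (at 0)" if "C1 g" for g y and c :: 'a
    using has_real_derivative_line[of g y 0 c] C1D(1)[OF that] by simp
  have cont: "isCont (pd g c) y" if "C1 g" "c \<in> Basis" for g y and c :: 'a
    using C1D(2)[OF that] by (simp add: continuous_on_eq_continuous_at)
  show ?thesis
    by (rule mixed_derivatives_commute[where S=UNIV and f=f and a=a and b=b and fa="pd f a" and fb="pd f b"])
       (use l c cont ab in auto)
qed

declare Ck_on.simps(2) [simp del]

section \<open>The torus\<close>

lemma axis_Basis [simp]: "axis (i::3) (1::real) \<in> Basis" by (simp add: axis_in_Basis_iff)

lemma One_nth [simp]: "(One::vec3) $ i = 1"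
  unfolding cart_eq_inner_axis by (simp add: inner_sum_left inner_Basis)

lemma sum_Basis_nth [simp]: "(\<Sum>b\<in>(Basis::vec3 set). b $ i) = 1"
  using One_nth[of i] unfolding sum_component .

lemma smooth_onD: "smooth_on UNIV f \<Longrightarrow> Ck_on k UNIV f" by (simp add: smooth_on_def)

lemma smooth_pd: "smooth_on UNIV f \<Longrightarrow> b \<in> Basis \<Longrightarrow> smooth_on UNIV (pd f b)"
  unfolding smooth_on_def using Ck_Suc_UNIV by blast

lemma smooth_const: "smooth_on UNIV (\<lambda>x::'a::euclidean_space. c::real)"
  by (simp add: smooth_on_def Ck_const)
lemma smooth_add: "smooth_on UNIV f \<Longrightarrow> smooth_on UNIV g \<Longrightarrow> smooth_on UNIV (\<lambda>x::'a::euclidean_space. f x + g x::real)"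
  by (simp add: smooth_on_def Ck_add)
lemma smooth_mult: "smooth_on UNIV f \<Longrightarrow> smooth_on UNIV g \<Longrightarrow> smooth_on UNIV (\<lambda>x::'a::euclidean_space. f x * g x::real)"
  by (simp add: smooth_on_def Ck_mult)

lemma pd_periodic:
  fixes f :: "vec3 \<Rightarrow> real"
  assumes p: "periodic f" and d: "\<And>x. f differentiable at x"
  shows "periodic (pd f b)"
  unfolding periodic_def
proof (intro allI)
  fix x :: vec3 and i
  have "((\<lambda>x. x + axis i (1::real)) has_derivative (\<lambda>v. v)) (at x)"
    by (auto intro!: derivative_eq_intros)
  from has_derivative_compose[OF this d[unfolded frechet_derivative_works, of "x + axis i 1"]]
  have "(f has_derivative frechet_derivative f (at (x + axis i 1))) (at x)"
    using p by (simp add: periodic_def)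
  from pd_eqI[OF this] show "pd f b (x + axis i 1) = pd f b x" by (simp add: pd_def)
qed

lemma testfun_const: "testfun (\<lambda>x. c)" by (simp add: testfun_def smooth_const periodic_def)
lemma testfun_add: "testfun f \<Longrightarrow> testfun g \<Longrightarrow> testfun (\<lambda>x. f x + g x)"
  by (simp add: testfun_def smooth_add periodic_def)
lemma testfun_mult: "testfun f \<Longrightarrow> testfun g \<Longrightarrow> testfun (\<lambda>x. f x * g x)"
  by (simp add: testfun_def smooth_mult periodic_def)
lemma testfun_C1: "testfun f \<Longrightarrow> C1 f" by (simp add: testfun_def smooth_C1)
text \<open>Smooth test functions are too small a class: \<open>G\<close> is only three times
  differentiable, so the coefficients formed from it and the smooth solution, which multiply test
  functions in the weak forms, are treated as periodic C^1 functions.\<close>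

definition C1per :: "(vec3 \<Rightarrow> real) \<Rightarrow> bool" where
  "C1per f \<longleftrightarrow> C1 f \<and> periodic f"

lemma testfun_C1per: "testfun f \<Longrightarrow> C1per f"
  by (simp add: C1per_def testfun_C1) (simp add: testfun_def)
lemma C1per_mult: "C1per f \<Longrightarrow> C1per g \<Longrightarrow> C1per (\<lambda>x. f x * g x)"
  by (simp add: C1per_def C1_mult periodic_def)
lemma C1per_add: "C1per f \<Longrightarrow> C1per g \<Longrightarrow> C1per (\<lambda>x. f x + g x)"
  by (simp add: C1per_def C1_add periodic_def)
lemma C1per_sum: "(\<And>i. i \<in> I \<Longrightarrow> C1per (f i)) \<Longrightarrow> C1per (\<lambda>x. \<Sum>i\<in>I. f i x)"
  unfolding C1per_def periodic_def by (simp add: C1_sum)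
lemma C1per_const: "C1per (\<lambda>x. c)"
  by (simp add: C1per_def C1_const periodic_def)
lemma C1per_dx_cont: "C1per f \<Longrightarrow> continuous_on UNIV (dx \<alpha> f)"
  by (simp add: C1per_def C1D dx_def[abs_def])
lemma C1per_cont: "C1per f \<Longrightarrow> continuous_on UNIV f"
  by (simp add: C1per_def C1_cont)

lemma dx_mult: "C1per f \<Longrightarrow> C1per g \<Longrightarrow> dx \<alpha> (\<lambda>x. f x * g x) x = f x * dx \<alpha> g x + dx \<alpha> f x * g x"
  by (simp add: C1per_def C1D dx_def pd_mult)
lemma dx_add: "C1per f \<Longrightarrow> C1per g \<Longrightarrow> dx \<alpha> (\<lambda>x. f x + g x) x = dx \<alpha> f x + dx \<alpha> g x"
  by (simp add: C1per_def C1D dx_def pd_add)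
lemma dx_const: "dx \<alpha> (\<lambda>x. c) x = 0"
  using pd_eqI[OF has_derivative_const] by (simp add: dx_def)
lemma dx_sum: "finite I \<Longrightarrow> (\<And>i. i \<in> I \<Longrightarrow> C1per (f i)) \<Longrightarrow> dx \<alpha> (\<lambda>x. \<Sum>i\<in>I. f i x) x = (\<Sum>i\<in>I. dx \<alpha> (f i) x)"
  by (induction I rule: finite_induct) (simp_all add: dx_const dx_add C1per_sum)
lemma dx_cmult: "C1per g \<Longrightarrow> dx \<alpha> (\<lambda>x. c * g x) x = c * dx \<alpha> g x"
  using dx_mult[OF C1per_const, of g \<alpha> c x] by (simp add: dx_const)

lemma space_torus [simp]: "space torus = cbox 0 One" by (simp add: torus_def)
lemma emeasure_torus [simp]: "emeasure torus (cbox 0 One) = 1"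
proof -
  have "emeasure lborel (cbox 0 (One::vec3)) = ennreal (\<Prod>b\<in>Basis. (One - 0) \<bullet> (b::vec3))"
    by (rule emeasure_lborel_cbox) simp
  then show ?thesis
    unfolding torus_def by (subst emeasure_restrict_space) simp_all
qed

interpretation torus: finite_measure torus
  by standard simp

lemma measure_torus [simp]: "measure torus (cbox 0 One) = 1"
  by (simp add: measure_def)

lemma meas_torus_cont: "continuous_on UNIV f \<Longrightarrow> f \<in> borel_measurable torus"
  for f :: "vec3 \<Rightarrow> 'b::{euclidean_space}"
  unfolding torus_def
  by (rule continuous_imp_measurable_on_sets_lebesgue) (auto intro: continuous_on_subset)

lemma integrable_torus_const [simp]: "integrable torus (\<lambda>x. c::'b::{banach,second_countable_topology})"
  by simp

lemma integral_torus_const [simp]: "(\<integral>x. c \<partial>torus) = (c::'b::{banach,second_countable_topology})"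
  by simp

lemma integrable_torus_bdd:
  fixes f :: "vec3 \<Rightarrow> 'b::{banach,second_countable_topology}"
  shows "f \<in> borel_measurable torus \<Longrightarrow> (\<And>x. x \<in> cbox 0 One \<Longrightarrow> norm (f x) \<le> C) \<Longrightarrow> integrable torus f"
  by (rule Bochner_Integration.integrable_bound[OF integrable_torus_const[of C]])
     (auto intro!: AE_I2 intro: order_trans[OF _ abs_ge_self])

lemma cont_bdd_cube:
  fixes f :: "vec3 \<Rightarrow> 'b::euclidean_space"
  assumes "continuous_on UNIV f"
  obtains C where "C \<ge> 0" "\<And>x. x \<in> cbox 0 One \<Longrightarrow> norm (f x) \<le> C"
proof -
  have "compact (f ` cbox 0 One)"
    using assms by (intro compact_continuous_image compact_cbox) (auto intro: continuous_on_subset)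
  then obtain C where "\<forall>y\<in>f ` cbox 0 One. norm y \<le> C"
    using compact_imp_bounded bounded_iff by blast
  then show ?thesis using that[of "max C 0"] by (auto intro: max.coboundedI1)
qed

lemma integrable_torus_cont:
  fixes f :: "vec3 \<Rightarrow> 'b::euclidean_space"
  assumes "continuous_on UNIV f" shows "integrable torus f"
proof -
  obtain C where "\<And>x. x \<in> cbox 0 One \<Longrightarrow> norm (f x) \<le> C" using cont_bdd_cube[OF assms] by blast
  then show ?thesis by (intro integrable_torus_bdd meas_torus_cont assms)
qed

lemma integrable_torus_mult_cont:
  fixes f g :: "vec3 \<Rightarrow> real"
  assumes "integrable torus g" "continuous_on UNIV f" shows "integrable torus (\<lambda>x. g x * f x)"
proof -
  obtain C where C: "\<And>x. x \<in> cbox 0 One \<Longrightarrow> norm (f x) \<le> C" using cont_bdd_cube[OF assms(2)] by blast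
  have "integrable torus (\<lambda>x. C * g x)" using assms by simp
  then show ?thesis
  proof (rule Bochner_Integration.integrable_bound)
    show "AE x in torus. norm (g x * f x) \<le> norm (C * g x)"
      using C by (intro AE_I2) (auto simp: abs_mult mult.commute intro!: mult_right_mono dest: order_trans[OF _ abs_ge_self])
  qed (use assms meas_torus_cont in \<open>auto intro!: borel_measurable_times\<close>)
qed

lemma integral_torus_HK: 
  fixes f :: "vec3 \<Rightarrow> real"
  shows "integrable torus f \<Longrightarrow> (f has_integral (\<integral>x. f x \<partial>torus)) (cbox 0 One)"
  unfolding torus_def by (rule has_integral_integral_lebesgue_on) auto

lemma cbox_le_split:
  fixes a b :: vec3
  assumes "a $ k \<le> c" "c \<le> b $ k"
  shows "cbox a b \<inter> {x. x \<bullet> axis k 1 \<le> c} = cbox a (b + axis k (c - b $ k))"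
    and "cbox a b \<inter> {x. x \<bullet> axis k 1 \<ge> c} = cbox (a + axis k (c - a $ k)) b"
proof -
  have e: "(b + axis k (c - b $ k)) $ i = (if i = k then c else b $ i)"
    "(a + axis k (c - a $ k)) $ i = (if i = k then c else a $ i)" for i by (simp_all add: axis_def)
  show "cbox a b \<inter> {x. x \<bullet> axis k 1 \<le> c} = cbox a (b + axis k (c - b $ k))"
    unfolding set_eq_iff Int_iff mem_Collect_eq mem_box_cart e using assms(2) by (simp add: inner_axis) force
  show "cbox a b \<inter> {x. x \<bullet> axis k 1 \<ge> c} = cbox (a + axis k (c - a $ k)) b"
    unfolding set_eq_iff Int_iff mem_Collect_eq mem_box_cart e using assms(1) by (simp add: inner_axis) force
qed

text \<open>The slab of length \<open>s\<close> cut off at one end is glued on at the other.\<close>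

lemma torus_translate_axis:
  fixes u :: "vec3 \<Rightarrow> real"
  assumes u: "continuous_on UNIV u" "periodic u" and s: "0 \<le> s" "s \<le> 1"
  shows "(\<integral>x. u (x + axis k s) \<partial>torus) = (\<integral>x. u x \<partial>torus)"
proof -
  have io: "u integrable_on cbox a b" for a b
    by (intro integrable_continuous continuous_on_subset[OF u(1)]) auto
  have c2: "continuous_on UNIV (\<lambda>x. u (x + axis k s))"
    by (intro continuous_on_compose2[OF u(1)] continuous_intros) auto
  have e1: "(\<integral>x. u (x + axis k s) \<partial>torus) = integral (cbox 0 One) (\<lambda>x. u (x + axis k s))"
    using integral_torus_HK[OF integrable_torus_cont[OF c2]] by (simp add: integral_unique)
  have e0: "(\<integral>x. u x \<partial>torus) = integral (cbox 0 One) u"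
    using integral_torus_HK[OF integrable_torus_cont[OF u(1)]] by (simp add: integral_unique)
  have e2: "integral (cbox 0 One) (\<lambda>x. u (x + axis k s)) = integral (cbox (axis k s) (One + axis k s)) u"
    using integral_shift_cbox[of "axis k s" "axis k s" "One + axis k s" u] by simp
  have ax3: "One + axis k s + axis k (1 - (One + axis k s) $ k) = One"
      "axis k s + axis k (1 - axis k s $ k) = axis k 1"
    unfolding vec_eq_iff by (auto simp: axis_def)
  have s1: "integral (cbox (axis k s) (One + axis k s)) u =
      integral (cbox (axis k s) One) u + integral (cbox (axis k 1) (One + axis k s)) u"
    using integral_split[OF io, of "axis k 1" "axis k s" "One + axis k s" 1]
      cbox_le_split[of "axis k s" k 1 "One + axis k s", unfolded ax3] s
    by simp
  have s0: "integral (cbox 0 One) u = integral (cbox 0 (One + axis k (s - 1))) u + integral (cbox (axis k s) One) u"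
    using integral_split[OF io, of "axis k 1" "0" "One" s] cbox_le_split[of 0 k s "One"] s by simp
  have ax2: "One + axis k s - axis k 1 = One + axis k (s - 1)" 
    unfolding vec_eq_iff by (auto simp: axis_def)
  have "integral (cbox (axis k 1) (One + axis k s)) u = integral (cbox 0 (One + axis k (s - 1))) (\<lambda>x. u (x + axis k 1))"
    using integral_shift_cbox[of "axis k 1" "axis k 1" "One + axis k s" u] by (simp add: ax2)
  also have "\<dots> = integral (cbox 0 (One + axis k (s - 1))) u" using u(2) by (simp add: periodic_def)
  finally show ?thesis using e1 e0 e2 s1 s0 by simp
qed

text \<open>By translation invariance the integrals of the difference quotients vanish.\<close>

lemma torus_ibp:
  assumes u: "C1per u"
  shows "(\<integral>x. dx \<alpha> u x \<partial>torus) = 0"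
proof -
  have d: "u differentiable at x" for x using u by (simp add: C1per_def C1D)
  have cd: "continuous_on UNIV (dx \<alpha> u)" by (rule C1per_dx_cont[OF u])
  have cu: "continuous_on UNIV u" by (rule C1per_cont[OF u])
  define q where "q n x = real (Suc n) * (u (x + axis \<alpha> (1 / real (Suc n))) - u x)" for n x
  have ax: "axis \<alpha> r = r *\<^sub>R axis \<alpha> (1::real)" for r by (simp add: vec_eq_iff axis_def)
  have cq: "continuous_on UNIV (q n)" for n
    unfolding q_def by (intro continuous_intros continuous_on_compose2[OF cu]) auto
  \<comment> \<open>A shift by at most one that starts in the unit cube ends in the doubled cube, so
    a bound of the derivative there dominates all difference quotients.\<close>
  have "compact (dx \<alpha> u ` cbox 0 (2 *\<^sub>R One))"
    using cd by (intro compact_continuous_image compact_cbox) (auto intro: continuous_on_subset)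
  then obtain C where C: "\<forall>y\<in>dx \<alpha> u ` cbox 0 (2 *\<^sub>R One). norm y \<le> C"
    using compact_imp_bounded bounded_iff by blast
  have b: "norm (q n x) \<le> C" if "x \<in> cbox 0 One" for n x
  proof -
    define r where "r = 1 / real (Suc n)"
    have r: "0 < r" "r \<le> 1" by (auto simp: r_def)
    obtain s where s: "0 < s" "s < 1" "u (x + axis \<alpha> r) - u x = pd u ((x + axis \<alpha> r) - x) (x + s *\<^sub>R ((x + axis \<alpha> r) - x))"
      using mvt_line[OF d, where y="x + axis \<alpha> r" and x=x] by metis
    have sr: "0 \<le> s * r" "s * r \<le> 1" using s r mult_le_one[of s r] by auto
    have e: "x + s *\<^sub>R axis \<alpha> r \<in> cbox 0 (2 *\<^sub>R One)"
      unfolding mem_box_cart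
    proof
      fix i
      have "0 \<le> x $ i" "x $ i \<le> 1" using that by (auto simp: mem_box_cart)
      then show "0 $ i \<le> (x + s *\<^sub>R axis \<alpha> r) $ i \<and> (x + s *\<^sub>R axis \<alpha> r) $ i \<le> (2 *\<^sub>R One) $ i"
        using sr by (cases "i = \<alpha>") (auto simp: axis_def)
    qed
    have "pd u (axis \<alpha> r) z = r * dx \<alpha> u z" for z
      by (subst ax) (simp add: pd_linear_comb[OF d] dx_def)
    then have "u (x + axis \<alpha> r) - u x = r * dx \<alpha> u (x + s *\<^sub>R axis \<alpha> r)"
      using s(3) by simp
    moreover have "q n x = (u (x + axis \<alpha> r) - u x) / r" by (simp add: q_def r_def)
    ultimately have "q n x = dx \<alpha> u (x + s *\<^sub>R axis \<alpha> r)" using r by simp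
    then show ?thesis using C e by auto
  qed
  have "(\<lambda>n. \<integral>x. q n x \<partial>torus) \<longlonglongrightarrow> (\<integral>x. dx \<alpha> u x \<partial>torus)"
  proof (rule integral_dominated_convergence[where w="\<lambda>x. C"])
    show "AE x in torus. (\<lambda>n. q n x) \<longlonglongrightarrow> dx \<alpha> u x"
    proof (intro AE_I2)
      fix x
      have "((\<lambda>s. u (x + s *\<^sub>R axis \<alpha> 1)) has_real_derivative dx \<alpha> u x) (at 0)"
        using has_real_derivative_line[of u x 0 "axis \<alpha> 1"] d by (simp add: dx_def)
      then have "((\<lambda>s. (u (x + s *\<^sub>R axis \<alpha> 1) - u x) / s) \<longlongrightarrow> dx \<alpha> u x) (at 0)"
        by (simp add: has_field_derivative_iff)
      moreover have "filterlim (\<lambda>n. 1 / real (Suc n)) (at 0) sequentially"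
        using LIMSEQ_inverse_real_of_nat by (auto simp: filterlim_at inverse_eq_divide simp del: of_nat_Suc)
      ultimately have "(\<lambda>n. (u (x + (1 / real (Suc n)) *\<^sub>R axis \<alpha> 1) - u x) / (1 / real (Suc n))) \<longlonglongrightarrow> dx \<alpha> u x"
        by (rule filterlim_compose)
      then show "(\<lambda>n. q n x) \<longlonglongrightarrow> dx \<alpha> u x"
        unfolding q_def by (subst ax) (simp add: mult.commute)
    qed
    show "AE x in torus. norm (q n x) \<le> C" for n using b by (intro AE_I2) simp
  qed (use cd cq meas_torus_cont in auto)
  moreover have "(\<integral>x. q n x \<partial>torus) = 0" for n
  proof -
    have "continuous_on UNIV (\<lambda>x. u (x + axis \<alpha> (1 / real (Suc n))))"
      by (intro continuous_on_compose2[OF cu] continuous_intros) auto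
    then show ?thesis unfolding q_def
      using torus_translate_axis[OF cu, of "1 / real (Suc n)" \<alpha>] u cu
      by (simp add: integrable_torus_cont C1per_def)
  qed
  ultimately show ?thesis using LIMSEQ_unique[OF _ tendsto_const] by simp
qed

section \<open>From gradients to weakly curl-free periodic fields\<close>

definition flat :: "nat \<Rightarrow> real \<Rightarrow> real" where
  "flat n x = (if x > 0 then exp (- inverse x) * inverse x ^ n else 0)"

text \<open>The factors \<open>inverse x ^ n\<close> make the flat functions closed under
  differentiation. At the origin the difference quotient from the right is
  \<open>z ^ Suc n / exp z\<close> with \<open>z = inverse x\<close>, and from the left it is
  zero.\<close>

lemma flat_deriv: "(flat n has_real_derivative (flat (n + 2) x - real n * flat (n + 1) x)) (at x)"
proof -
  consider "x > 0" | "x < 0" | "x = 0" by linarith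
  then show ?thesis
  proof cases
    case 1
    have d: "(inverse has_real_derivative - (inverse x ^ 2)) (at x)"
      using DERIV_inverse[of x UNIV] 1 by (simp add: numeral_2_eq_2)
    have d1: "((\<lambda>x. exp (- inverse x)) has_real_derivative exp (- inverse x) * inverse x ^ 2) (at x)"
      using DERIV_fun_exp[OF DERIV_minus[OF d]] by simp
    have d2: "((\<lambda>x. inverse x ^ n) has_real_derivative - real n * inverse x ^ (n + 1)) (at x)"
      using DERIV_power[OF d, of n] by (cases n) (simp_all add: power2_eq_square algebra_simps)
    have "((\<lambda>x. exp (- inverse x) * inverse x ^ n) has_real_derivative (flat (n + 2) x - real n * flat (n + 1) x)) (at x)"
      using DERIV_mult[OF d1 d2] 1 by (simp add: flat_def power_add power2_eq_square algebra_simps)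
    moreover have "\<forall>\<^sub>F y in nhds x. 0 < y"
      using eventually_nhds_in_open[of "{0<..}" x] 1 by simp
    then have "\<forall>\<^sub>F y in nhds x. flat n y = exp (- inverse y) * inverse y ^ n"
      by (rule eventually_mono) (simp add: flat_def)
    ultimately show ?thesis by (simp only: DERIV_cong_ev[OF refl _ refl])
  next
    case 2
    have "\<forall>\<^sub>F y in nhds x. flat n y = 0"
      using eventually_nhds_in_open[of "{..<0}" x] 2 by (auto elim!: eventually_mono simp: flat_def)
    then have "(flat n has_real_derivative 0) (at x)" using DERIV_cong_ev[of x x "flat n" "\<lambda>_. 0" 0 0] by simp
    then show ?thesis using 2 by (simp add: flat_def)
  next
    case 3
    have r: "((\<lambda>y. flat n y / y) \<longlongrightarrow> 0) (at_right 0)"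
    proof -
      have "((\<lambda>z. z ^ Suc n / exp z) \<longlongrightarrow> (0::real)) at_top" by (rule tendsto_power_div_exp_0)
      from filterlim_compose[OF this filterlim_inverse_at_top_right]
      have "((\<lambda>y::real. inverse y ^ Suc n / exp (inverse y)) \<longlongrightarrow> 0) (at_right 0)" .
      then show ?thesis
        by (rule Lim_transform_eventually)
           (auto simp: eventually_at_right_less flat_def exp_minus field_simps intro!: eventually_at_rightI[of 0 1])
    qed
    have l: "((\<lambda>y. flat n y / y) \<longlongrightarrow> 0) (at_left 0)"
      by (rule Lim_transform_eventually[OF tendsto_const])
         (auto simp: flat_def intro!: eventually_at_leftI[of "-1" 0])
    have "((\<lambda>y. flat n y / y) \<longlongrightarrow> 0) (at 0)" using l r by (simp add: filterlim_split_at)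
    then show ?thesis using 3 by (simp add: has_field_derivative_iff flat_def)
  qed
qed

lemma Ck_flat: "Ck_on k UNIV (flat n)"
proof (induction k arbitrary: n)
  case 0
  then show ?case using flat_deriv by (auto intro!: DERIV_isCont continuous_at_imp_continuous_on)
next
  case (Suc k)
  have e: "pd (flat n) 1 = (\<lambda>x. flat (n + 2) x + (- real n) * flat (n + 1) x)"
    using pd_eqI[OF flat_deriv[THEN has_field_derivative_imp_has_derivative]] by auto
  have "Ck_on k UNIV (\<lambda>x. flat (n + 2) x + (- real n) * flat (n + 1) x)"
    by (intro Ck_add Ck_mult Ck_const Suc.IH)
  then show ?case unfolding Ck_Suc_UNIV Basis_real_def
    using flat_deriv real_differentiable_def e by auto
qed

text \<open>A smooth step, constant outside \<open>[1/4, 3/4]\<close>. These margins let the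
  partition identity for \<open>hat\<close> hold on an open neighbourhood of the unit interval,
  where it can be differentiated.\<close>

definition ramp :: "real \<Rightarrow> real" where
  "ramp x = flat 0 (x - 1/4) * inverse (flat 0 (x - 1/4) + flat 0 (3/4 - x))"

lemma ramp_0: "x \<le> 1/4 \<Longrightarrow> ramp x = 0" by (simp add: ramp_def flat_def)
lemma ramp_1: "x \<ge> 3/4 \<Longrightarrow> ramp x = 1" by (simp add: ramp_def flat_def)

lemma Ck_ramp: "Ck_on k UNIV ramp"
proof -
  have "(\<lambda>x. flat 0 (x \<bullet> 1 + (-1/4))) = (\<lambda>x. flat 0 (x - 1/4))" "(\<lambda>x. flat 0 (x \<bullet> (-1) + 3/4)) = (\<lambda>x. flat 0 (3/4 - x))"
    by (simp_all add: fun_eq_iff)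
  then have a: "Ck_on k UNIV (\<lambda>x. flat 0 (x - 1/4))" "Ck_on k UNIV (\<lambda>x. flat 0 (3/4 - x))"
    using Ck_comp_affine[OF Ck_flat, of k 0 "1::real" "-1/4"] Ck_comp_affine[OF Ck_flat, of k 0 "-1::real" "3/4"] by metis+
  have p: "flat 0 y \<ge> 0" for y by (simp add: flat_def)
  have "flat 0 (x - 1/4) + flat 0 (3/4 - x) > 0" for x
  proof (cases "x > 1/4")
    case True then have "flat 0 (x - 1/4) > 0" by (simp add: flat_def)
    then show ?thesis using p[of "3/4 - x"] by linarith
  next
    case False then have "flat 0 (3/4 - x) > 0" by (simp add: flat_def)
    then show ?thesis using p[of "x - 1/4"] by linarith
  qed
  then have nz: "flat 0 (x - 1/4) + flat 0 (3/4 - x) \<noteq> 0" for x by (metis less_irrefl)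
  show ?thesis unfolding ramp_def[abs_def] by (intro Ck_mult Ck_inverse Ck_add a nz)
qed

text \<open>As a difference of two unit shifts its translates telescope:
  \<open>hat x + hat (x - 1)\<close> is \<open>ramp (x + 1) - ramp (x - 1)\<close>.\<close>

definition hat :: "real \<Rightarrow> real" where "hat x = ramp (x + 1) - ramp x"

lemma Ck_hat: "Ck_on k UNIV hat"
proof -
  have "Ck_on k UNIV (\<lambda>x. ramp (x + 1) + (-1) * ramp x)"
    using Ck_comp_affine[OF Ck_ramp, of k "1::real" 1] by (intro Ck_add Ck_mult Ck_const Ck_ramp) simp
  then show ?thesis by (simp add: hat_def[abs_def])
qed

lemma hat_support: "\<bar>x\<bar> > 1 \<Longrightarrow> hat x = 0"
  by (cases "x > 0") (auto simp: hat_def ramp_0 ramp_1)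

lemma hat_partition: "-1/4 < x \<Longrightarrow> x < 5/4 \<Longrightarrow> hat x + hat (x - 1) = 1"
  by (simp add: hat_def ramp_0 ramp_1)

lemma hat_deriv: "(hat has_real_derivative pd hat 1 x) (at x)"
  using has_real_derivative_line[of hat 0 x 1] C1D(1)[OF Ck_C1[OF Ck_hat]] by simp

lemma hat_deriv_partition: "0 \<le> x \<Longrightarrow> x \<le> 1 \<Longrightarrow> pd hat 1 x + pd hat 1 (x - 1) = 0"
proof -
  assume x: "0 \<le> x" "x \<le> 1"
  have 1: "((\<lambda>x. hat x + hat (x - 1)) has_real_derivative pd hat 1 x + pd hat 1 (x - 1)) (at x)"
    using DERIV_add[OF hat_deriv DERIV_chain2[OF hat_deriv DERIV_diff[OF DERIV_ident DERIV_const], of 1 x UNIV]] by simp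
  have "\<forall>\<^sub>F y in nhds x. hat y + hat (y - 1) = 1"
    using eventually_nhds_in_open[of "{-1/4<..<5/4}" x] x by (auto elim!: eventually_mono simp: hat_partition)
  then have "((\<lambda>x. hat x + hat (x - 1)) has_real_derivative 0) (at x)"
    using DERIV_cong_ev[of x x _ "\<lambda>_. 1" 0 0] by simp
  from DERIV_unique[OF 1 this] show ?thesis .
qed

section \<open>Folding integrals over an enlarged cube onto the torus\<close>

lemma fold_axis:
  fixes P r :: "vec3 \<Rightarrow> real"
  assumes P: "periodic P" and r: "\<And>x. r (x + axis k 1) = r x"
    and 0: "((\<lambda>x. P x * \<omega> (x $ k) * r x) has_integral I0) (cbox a b)"
    and 1: "((\<lambda>x. P x * \<omega> (x $ k - 1) * r x) has_integral I1) (cbox a b)"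
    and ab: "b $ k = a $ k + 1"
  shows "((\<lambda>x. P x * \<omega> (x $ k) * r x) has_integral (I1 + I0)) (cbox (a - axis k 1) b)"
proof -
  \<comment> \<open>Below \<open>a $ k\<close> the box is a unit translate of its upper half. Both
    \<open>P\<close> and \<open>r\<close> are invariant under this translation, so only the cut-off
    \<open>\<omega>\<close> is shifted.\<close>
  have sh: "P (x - axis k 1) = P x" "r (x - axis k 1) = r x" for x
    using P r[of "x - axis k 1"] unfolding periodic_def by (metis diff_add_cancel)+
  have "((\<lambda>x. P (x - axis k 1) * \<omega> ((x - axis k 1) $ k) * r (x - axis k 1)) has_integral I1) (cbox a b)"
    using 1 by (simp add: sh)
  then have 2: "((\<lambda>x. P x * \<omega> (x $ k) * r x) has_integral I1) (cbox (a - axis k 1) (b - axis k 1))"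
    using has_integral_shift_cbox_iff[of "\<lambda>x. P x * \<omega> (x $ k) * r x" "- axis k 1" I1 a b]
    by (simp add: o_def)
  have e: "cbox (a - axis k 1) b \<inter> {x. x \<bullet> axis k 1 \<le> a $ k} = cbox (a - axis k 1) (b - axis k 1)"
     "cbox (a - axis k 1) b \<inter> {x. x \<bullet> axis k 1 \<ge> a $ k} = cbox a b"
    using cbox_le_split[of "a - axis k 1" k "a $ k" b] ab
    by (auto simp: axis_def vec_eq_iff algebra_simps intro!: arg_cong2[where f=cbox])
  show ?thesis
    by (rule has_integral_split[where c="a $ k" and k="axis k 1"]) (use 0 2 e in auto)
qed

text \<open>Unfolds one direction after the other. After three steps the box is the cube of side
  two, and each of the eight integrals over the unit cube carries one choice of shifts.\<close>

lemma fold_cube: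
  fixes P :: "vec3 \<Rightarrow> real"
  assumes P: "periodic P" "integrable torus P"
    and c: "continuous_on UNIV \<omega>1" "continuous_on UNIV \<omega>2" "continuous_on UNIV \<omega>3"
  shows "((\<lambda>x. P x * \<omega>1 (x $ 1) * \<omega>2 (x $ 2) * \<omega>3 (x $ 3)) has_integral
     (\<integral>x. P x * (\<omega>1 (x $ 1) + \<omega>1 (x $ 1 - 1)) * (\<omega>2 (x $ 2) + \<omega>2 (x $ 2 - 1)) * (\<omega>3 (x $ 3) + \<omega>3 (x $ 3 - 1)) \<partial>torus))
     (cbox (- One) One)"
proof -
  define g where "g a b c x = P x * \<omega>1 (x $ 1 - a) * \<omega>2 (x $ 2 - b) * \<omega>3 (x $ 3 - c)" for a b c x
  have cc: "continuous_on UNIV (\<lambda>x. \<omega>1 (x $ 1 - a) * \<omega>2 (x $ 2 - b) * \<omega>3 (x $ 3 - c))" for a b c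
    by (intro continuous_intros continuous_on_compose2[OF c(1)] continuous_on_compose2[OF c(2)] continuous_on_compose2[OF c(3)]) auto
  have i: "integrable torus (g a b c)" for a b c
    unfolding g_def using integrable_torus_mult_cont[OF P(2) cc[of a b c]] by (simp add: mult.assoc)
  define J where "J a b c = (\<integral>x. g a b c x \<partial>torus)" for a b c
  have 0: "(g a b c has_integral J a b c) (cbox 0 One)" for a b c
    unfolding J_def by (rule integral_torus_HK[OF i])
  have n: "axis (1::3) (1::real) $ 2 = 0" "axis (1::3) (1::real) $ 3 = 0" "axis (2::3) (1::real) $ 1 = 0" "axis (2::3) (1::real) $ 3 = 0"
     "axis (3::3) (1::real) $ 1 = 0" "axis (3::3) (1::real) $ 2 = 0" by (simp_all add: axis_def)
  have 1: "(g 0 b c has_integral (J 1 b c + J 0 b c)) (cbox (0 - axis 1 1) One)" for b c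
    using fold_axis[OF P(1), of "\<lambda>x. \<omega>2 (x $ 2 - b) * \<omega>3 (x $ 3 - c)" 1 \<omega>1 "J 0 b c" 0 One "J 1 b c"] 0[of 0 b c] 0[of 1 b c]
    by (simp add: n g_def[abs_def] mult.assoc del: sum_component)
  have 2: "(g 0 0 c has_integral ((J 1 1 c + J 0 1 c) + (J 1 0 c + J 0 0 c))) (cbox (0 - axis 1 1 - axis 2 1) One)" for c
    using fold_axis[OF P(1), of "\<lambda>x. \<omega>1 (x $ 1) * \<omega>3 (x $ 3 - c)" 2 \<omega>2 "J 1 0 c + J 0 0 c" "0 - axis 1 1" One "J 1 1 c + J 0 1 c"] 1[of 0 c] 1[of 1 c]
    by (simp add: n g_def[abs_def] mult.assoc mult.left_commute del: sum_component)
  have 3: "(g 0 0 0 has_integral (((J 1 1 1 + J 0 1 1) + (J 1 0 1 + J 0 0 1)) + ((J 1 1 0 + J 0 1 0) + (J 1 0 0 + J 0 0 0)))) (cbox (0 - axis 1 1 - axis 2 1 - axis 3 1) One)"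
    using fold_axis[OF P(1), of "\<lambda>x. \<omega>1 (x $ 1) * \<omega>2 (x $ 2)" 3 \<omega>3 "(J 1 1 0 + J 0 1 0) + (J 1 0 0 + J 0 0 0)" "0 - axis 1 1 - axis 2 1" One "(J 1 1 1 + J 0 1 1) + (J 1 0 1 + J 0 0 1)"] 2[of 0] 2[of 1]
    by (simp add: n g_def[abs_def] mult.assoc mult.left_commute mult.commute del: sum_component)
  have e: "0 - axis 1 1 - axis 2 1 - axis 3 1 = - (One::vec3)"
    unfolding vec_eq_iff forall_3 by (simp add: n)
  have "(\<integral>x. P x * (\<omega>1 (x $ 1) + \<omega>1 (x $ 1 - 1)) * (\<omega>2 (x $ 2) + \<omega>2 (x $ 2 - 1)) * (\<omega>3 (x $ 3) + \<omega>3 (x $ 3 - 1)) \<partial>torus)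
     = (\<integral>x. g 0 0 0 x + g 1 0 0 x + g 0 1 0 x + g 1 1 0 x + g 0 0 1 x + g 1 0 1 x + g 0 1 1 x + g 1 1 1 x \<partial>torus)"
    by (rule Bochner_Integration.integral_cong) (simp_all add: g_def algebra_simps)
  also have "\<dots> = J 0 0 0 + J 1 0 0 + J 0 1 0 + J 1 1 0 + J 0 0 1 + J 1 0 1 + J 0 1 1 + J 1 1 1"
    by (simp add: i J_def)
  finally show ?thesis using 3 unfolding e by (simp add: g_def[abs_def] algebra_simps)
qed

definition weak_curl_free :: "(vec3 \<Rightarrow> mat3) \<Rightarrow> bool" where
  "weak_curl_free F \<longleftrightarrow> (\<forall>\<phi> i \<alpha> \<beta>. testfun \<phi> \<longrightarrow>
     (\<integral>x. F x $ i $ \<alpha> * dx \<beta> \<phi> x \<partial>torus) = (\<integral>x. F x $ i $ \<beta> * dx \<alpha> \<phi> x \<partial>torus))"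

text \<open>
  The products of \<^const>\<open>hat\<close> form a smooth partition of unity under integer translations, so a
  periodic test function times such a product is an admissible compactly supported test function
  with the same integrals.
\<close>

lemma hat_cutoff_integral:
  fixes f :: "vec3 \<Rightarrow> real"
  assumes f: "periodic f" "integrable torus f" and \<phi>: "testfun \<phi>"
    and \<psi>: "\<psi> = (\<lambda>x. \<phi> x * (hat (x $ 1) * (hat (x $ 2) * hat (x $ 3))))"
  shows "((\<lambda>x. f x * dx \<beta> \<psi> x) has_integral (\<integral>x. f x * dx \<beta> \<phi> x \<partial>torus)) (cbox (- One) One)"
proof -
  have C1h: "C1 hat" "C1 (\<lambda>x::vec3. hat (x $ i))" for i
    using Ck_C1[OF Ck_hat] Ck_C1[OF Ck_comp_affine[OF Ck_hat], of "axis i (1::real)" 0] by (simp_all add: inner_axis)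
  have ch: "continuous_on UNIV hat" "continuous_on UNIV (pd hat 1)"
    using C1_cont[OF C1h(1)] C1D(2)[OF C1h(1), of 1] by auto
  have dh: "pd (\<lambda>x::vec3. hat (x $ i)) (axis \<beta> 1) x = (if i = \<beta> then pd hat 1 (x $ i) else 0)" for i x
  proof -
    have "((\<lambda>x::vec3. x $ i) has_derivative (\<lambda>v. v $ i)) (at x)"
      by (rule bounded_linear.has_derivative[OF bounded_linear_vec_nth has_derivative_ident])
    from has_derivative_compose[OF this hat_deriv[THEN has_field_derivative_imp_has_derivative]]
    have "((\<lambda>x::vec3. hat (x $ i)) has_derivative (\<lambda>v. pd hat 1 (x $ i) * v $ i)) (at x)" .
    from pd_eqI[OF this] show ?thesis by (simp add: axis_def)
  qed
  have C1\<phi>: "C1 \<phi>" "C1per \<phi>" "periodic \<phi>" using \<phi> by (auto simp: testfun_C1 testfun_C1per testfun_def)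
  have dif: "\<phi> differentiable at x" "(\<lambda>x::vec3. hat (x $ i)) differentiable at x"
     "(\<lambda>x::vec3. hat (x $ i) * hat (x $ j)) differentiable at x"
     "(\<lambda>x::vec3. hat (x $ i) * (hat (x $ j) * hat (x $ k))) differentiable at x" for x i j k
    by (intro C1D C1_mult C1h C1\<phi>)+
  \<comment> \<open>By the product rule the derivative of the cut-off hits exactly the factor in
    direction \<open>\<beta>\<close>.\<close>
  define K where "K k = (if k = \<beta> then pd hat 1 else hat)" for k :: 3
  have dpsi: "dx \<beta> \<psi> x = dx \<beta> \<phi> x * hat (x $ 1) * hat (x $ 2) * hat (x $ 3)
      + \<phi> x * K 1 (x $ 1) * K 2 (x $ 2) * K 3 (x $ 3)" for x
    unfolding \<psi> dx_def pd_mult[OF dif(1) dif(4)] pd_mult[OF dif(2) dif(3)] pd_mult[OF dif(2) dif(2)] dh K_def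
    using exhaust_3[of \<beta>] by auto
  have pf: "periodic (\<lambda>x. f x * dx \<beta> \<phi> x)" "periodic (\<lambda>x. f x * \<phi> x)"
    using f C1\<phi>(3) pd_periodic[OF C1\<phi>(3) dif(1), of "axis \<beta> 1"] by (auto simp: periodic_def dx_def)
  have i: "integrable torus (\<lambda>x. f x * dx \<beta> \<phi> x)" "integrable torus (\<lambda>x. f x * \<phi> x)"
    by (intro integrable_torus_mult_cont f C1per_dx_cont C1per_cont C1\<phi>)+
  have cK: "continuous_on UNIV (K k)" for k using ch by (simp add: K_def)
  have A: "((\<lambda>x. (f x * dx \<beta> \<phi> x) * hat (x $ 1) * hat (x $ 2) * hat (x $ 3)) has_integral
     (\<integral>x. f x * dx \<beta> \<phi> x \<partial>torus)) (cbox (- One) One)"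
  proof -
    have "(\<integral>x. (f x * dx \<beta> \<phi> x) * (hat (x $ 1) + hat (x $ 1 - 1)) * (hat (x $ 2) + hat (x $ 2 - 1)) * (hat (x $ 3) + hat (x $ 3 - 1)) \<partial>torus)
       = (\<integral>x. f x * dx \<beta> \<phi> x \<partial>torus)"
    proof (rule Bochner_Integration.integral_cong[OF refl])
      fix x :: vec3 assume "x \<in> space torus"
      then have x: "0 \<le> x $ i" "x $ i \<le> 1" for i by (auto simp: mem_box_cart)
      have "hat (x $ i) + hat (x $ i - 1) = 1" for i
        using x[of i] by (intro hat_partition) simp_all
      then show "(f x * dx \<beta> \<phi> x) * (hat (x $ 1) + hat (x $ 1 - 1)) * (hat (x $ 2) + hat (x $ 2 - 1)) * (hat (x $ 3) + hat (x $ 3 - 1)) = f x * dx \<beta> \<phi> x" by simp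
    qed
    then show ?thesis using fold_cube[OF pf(1) i(1) ch(1) ch(1) ch(1)] by simp
  qed
  \<comment> \<open>The term with the differentiated cut-off contributes nothing: folded onto the
    torus it contains the derivative of the constant \<open>hat x + hat (x - 1)\<close>.\<close>
  have B: "((\<lambda>x. (f x * \<phi> x) * K 1 (x $ 1) * K 2 (x $ 2) * K 3 (x $ 3)) has_integral 0) (cbox (- One) One)"
  proof -
    have "(\<integral>x. (f x * \<phi> x) * (K 1 (x $ 1) + K 1 (x $ 1 - 1)) * (K 2 (x $ 2) + K 2 (x $ 2 - 1)) * (K 3 (x $ 3) + K 3 (x $ 3 - 1)) \<partial>torus)
       = (\<integral>x. 0 \<partial>torus)"
    proof (rule Bochner_Integration.integral_cong[OF refl])
      fix x :: vec3 assume "x \<in> space torus"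
      then have "0 \<le> x $ \<beta>" "x $ \<beta> \<le> 1" by (auto simp: mem_box_cart)
      then have "K \<beta> (x $ \<beta>) + K \<beta> (x $ \<beta> - 1) = 0" unfolding K_def by (simp add: hat_deriv_partition)
      then show "(f x * \<phi> x) * (K 1 (x $ 1) + K 1 (x $ 1 - 1)) * (K 2 (x $ 2) + K 2 (x $ 2 - 1)) * (K 3 (x $ 3) + K 3 (x $ 3 - 1)) = 0"
        using exhaust_3[of \<beta>] by auto
    qed
    then show ?thesis using fold_cube[OF pf(2) i(2) cK[of 1] cK[of 2] cK[of 3]] by simp
  qed
  show ?thesis using has_integral_add[OF A B] by (simp add: dpsi algebra_simps)
qed

text \<open>Curl-freeness expresses the symmetry of second derivatives of the test function. Since
  the potential may fail to be periodic, the test function is first cut off to compact support;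
  folding then brings both integrals back to the torus.\<close>

lemma gradient_weak_curl_free:
  fixes F :: "vec3 \<Rightarrow> mat3"
  assumes g: "is_gradient F" and p: "periodic F" and int: "\<And>i \<alpha>. integrable torus (\<lambda>x. F x $ i $ \<alpha>)"
  shows "weak_curl_free F"
  unfolding weak_curl_free_def
proof (intro allI impI)
  fix \<phi> i \<alpha> \<beta> assume \<phi>: "testfun \<phi>"
  obtain y where y: "\<And>\<psi> r \<alpha>. smooth_on UNIV \<psi> \<Longrightarrow> (\<And>x. norm x > r \<Longrightarrow> \<psi> x = 0) \<Longrightarrow>
        (\<integral>x. y x $ i * dx \<alpha> \<psi> x \<partial>lebesgue) = - (\<integral>x. F x $ i $ \<alpha> * \<psi> x \<partial>lebesgue)"
    using g unfolding is_gradient_def by blast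
  define \<psi> where "\<psi> = (\<lambda>x. \<phi> x * (hat (x $ 1) * (hat (x $ 2) * hat (x $ 3))))"
  have sh: "smooth_on UNIV (\<lambda>x::vec3. hat (x $ i))" for i
    unfolding smooth_on_def using Ck_comp_affine[OF Ck_hat, of _ "axis i (1::real)" 0] by (simp add: inner_axis)
  have s: "smooth_on UNIV \<psi>"
    unfolding \<psi>_def using \<phi> by (intro smooth_mult sh) (simp add: testfun_def)
  have z: "\<psi> x = 0" if x: "x \<notin> cbox (- One) One" for x
  proof -
    obtain k where "\<not> (- 1 \<le> x $ k \<and> x $ k \<le> 1)"
      using x unfolding mem_box_cart by auto
    then have "\<bar>x $ k\<bar> > 1" by linarith
    then have "hat (x $ k) = 0" by (rule hat_support)
    then show ?thesis unfolding \<psi>_def using exhaust_3[of k] by auto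
  qed
  \<comment> \<open>In the cube of half side one the norm is at most the sum of the moduli of three
    coordinates, so radius 3 encloses the support.\<close>
  have far: "x \<notin> cbox (- One) One" if "norm x > 3" for x :: vec3
  proof
    assume "x \<in> cbox (- One) One"
    then have "- 1 \<le> x $ k \<and> x $ k \<le> 1" for k unfolding mem_box_cart by auto
    then have "\<bar>x $ k\<bar> \<le> 1" for k by (simp add: abs_le_iff minus_le_iff)
    then have "(\<Sum>k\<in>UNIV. \<bar>x $ k\<bar>) \<le> 3" using sum_bounded_above[of UNIV "\<lambda>k. \<bar>x $ k\<bar>" 1] by simp
    then show False using norm_le_l1_cart[of x] that by simp
  qed
  have dz: "dx \<gamma> \<psi> x = 0" if x: "x \<notin> cbox (- One) One" for x \<gamma>
  proof -
    have "open (- cbox (- One) (One::vec3))" by (intro open_Compl closed_cbox)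
    then have "(\<psi> has_derivative (\<lambda>_. 0)) (at x)"
      using x z by (intro has_derivative_transform_within_open[OF has_derivative_const[of 0]]) auto
    from pd_eqI[OF this] show ?thesis by (simp add: dx_def)
  qed
  have comm: "dx \<alpha> (dx \<beta> \<psi>) = dx \<beta> (dx \<alpha> \<psi>)"
    unfolding dx_def[abs_def] by (rule ext, rule pd_pd_commute) (use s in \<open>auto simp: smooth_onD\<close>)
  have "(\<integral>x. F x $ i $ \<alpha> * dx \<beta> \<psi> x \<partial>lebesgue) = (\<integral>x. F x $ i $ \<beta> * dx \<alpha> \<psi> x \<partial>lebesgue)"
    using y[of "dx \<beta> \<psi>" 3 \<alpha>] y[of "dx \<alpha> \<psi>" 3 \<beta>] smooth_pd[OF s] dz far comm by (simp add: dx_def[abs_def])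
  moreover have "(\<integral>x. F x $ i $ \<gamma> * dx \<delta> \<psi> x \<partial>lebesgue) = (\<integral>x. F x $ i $ \<gamma> * dx \<delta> \<phi> x \<partial>torus)" for \<gamma> \<delta>
  proof -
    have h: "((\<lambda>x. F x $ i $ \<gamma> * dx \<delta> \<psi> x) has_integral (\<integral>x. F x $ i $ \<gamma> * dx \<delta> \<phi> x \<partial>torus)) (cbox (- One) One)"
      using p by (intro hat_cutoff_integral int \<phi> \<psi>_def) (simp add: periodic_def)
    have pF: "periodic (\<lambda>x. F x $ i $ \<gamma>)" "periodic (\<lambda>x. \<bar>F x $ i $ \<gamma>\<bar>)" using p by (simp_all add: periodic_def)
    have cd: "continuous_on S (dx \<delta> \<psi>)" for S
      using C1D(2)[OF smooth_C1[OF s], of "axis \<delta> 1"] by (auto simp: dx_def[abs_def] intro: continuous_on_subset)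
    have o: "continuous_on UNIV (\<lambda>x::real. 1::real)" by simp
    \<comment> \<open>Folding with all cut-offs equal to one gives integrability of the entry and of
      its modulus on the large cube, so that gauge and Lebesgue integrals agree there.\<close>
    have ai: "(\<lambda>x. F x $ i $ \<gamma>) absolutely_integrable_on cbox (- One) One"
    proof (rule absolutely_integrable_onI)
      show "(\<lambda>x. F x $ i $ \<gamma>) integrable_on cbox (- One) One"
        using has_integral_integrable[OF fold_cube[OF pF(1) int o o o]] by simp
      show "(\<lambda>x. norm (F x $ i $ \<gamma>)) integrable_on cbox (- One) One"
        using has_integral_integrable[OF fold_cube[OF pF(2) integrable_abs[OF int] o o o]] by simp
    qed
    have "(\<lambda>x. dx \<delta> \<psi> x * F x $ i $ \<gamma>) absolutely_integrable_on cbox (- One) One"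
      by (rule absolutely_integrable_bounded_measurable_product[OF bilinear_times _ _ _ ai])
         (auto intro!: continuous_imp_measurable_on_sets_lebesgue cd compact_imp_bounded compact_continuous_image)
    then have "set_integrable lebesgue (cbox (- One) One) (\<lambda>x. F x $ i $ \<gamma> * dx \<delta> \<psi> x)"
      by (simp add: mult.commute)
    from set_lebesgue_integral_eq_integral(2)[OF this] h
    have "(LINT x:cbox (- One) One|lebesgue. F x $ i $ \<gamma> * dx \<delta> \<psi> x) = (\<integral>x. F x $ i $ \<gamma> * dx \<delta> \<phi> x \<partial>torus)"
      by (simp add: integral_unique)
    moreover have "indicator (cbox (- One) One) x *\<^sub>R (F x $ i $ \<gamma> * dx \<delta> \<psi> x) = F x $ i $ \<gamma> * dx \<delta> \<psi> x" for x
      by (cases "x \<in> cbox (- One) One") (simp_all add: dz)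
    ultimately show ?thesis unfolding set_lebesgue_integral_def by (simp only:)
  qed
  ultimately show "(\<integral>x. F x $ i $ \<alpha> * dx \<beta> \<phi> x \<partial>torus) = (\<integral>x. F x $ i $ \<beta> * dx \<alpha> \<phi> x \<partial>torus)" by simp
qed

section \<open>Lebesgue classes on the torus\<close>

text \<open>Scalar counterpart of \<open>Lp\<close> on the unit cube alone, because the continuous
  approximations used below are not periodic.\<close>

definition Lr :: "real \<Rightarrow> (vec3 \<Rightarrow> real) \<Rightarrow> bool" where
  "Lr r u \<longleftrightarrow> u \<in> borel_measurable torus \<and> integrable torus (\<lambda>x. \<bar>u x\<bar> powr r)"

lemma Lr_meas: "Lr r u \<Longrightarrow> u \<in> borel_measurable torus" by (simp add: Lr_def)

lemma Lr_dom:
  assumes "u \<in> borel_measurable torus" "integrable torus g" "\<And>x. x \<in> cbox 0 One \<Longrightarrow> \<bar>u x\<bar> powr r \<le> g x"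
  shows "Lr r u"
  unfolding Lr_def
proof
  show "integrable torus (\<lambda>x. \<bar>u x\<bar> powr r)"
    by (rule Bochner_Integration.integrable_bound[OF assms(2)])
       (use assms in \<open>auto intro!: AE_I2 intro: order_trans[OF _ abs_ge_self]\<close>)
qed (rule assms)

lemma integrable_dom:
  fixes f :: "vec3 \<Rightarrow> 'b::{banach,second_countable_topology}"
  assumes "f \<in> borel_measurable torus" "integrable torus g" "\<And>x. x \<in> cbox 0 One \<Longrightarrow> norm (f x) \<le> g x"
  shows "integrable torus f"
  by (rule Bochner_Integration.integrable_bound[OF assms(2)])
     (use assms in \<open>auto intro!: AE_I2 intro: order_trans[OF _ abs_ge_self]\<close>)

lemma powr_le_1_plus: "0 \<le> (x::real) \<Longrightarrow> 0 \<le> s \<Longrightarrow> s \<le> r \<Longrightarrow> x powr s \<le> 1 + x powr r"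
proof (cases "x \<le> 1")
  case True
  assume "0 \<le> x" "0 \<le> s"
  then have "x powr s \<le> 1" using True by (simp add: powr_le1)
  then show ?thesis by (simp add: add_increasing2)
next
  case False
  assume "s \<le> r"
  then have "x powr s \<le> x powr r" using False by (intro powr_mono) auto
  then show ?thesis by simp
qed

lemma Lr_mono: "Lr r u \<Longrightarrow> 0 \<le> s \<Longrightarrow> s \<le> r \<Longrightarrow> Lr s u"
  by (rule Lr_dom[where g="\<lambda>x. 1 + \<bar>u x\<bar> powr r"]) (auto simp: Lr_def powr_le_1_plus)

lemma Lr_integrable: "Lr r u \<Longrightarrow> 1 \<le> r \<Longrightarrow> integrable torus u"
  by (rule integrable_dom[where g="\<lambda>x. 1 + \<bar>u x\<bar> powr r"])
     (use powr_le_1_plus[of "\<bar>_\<bar>" 1] in \<open>auto simp: Lr_def\<close>)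

lemma powr_add_le: "0 \<le> (x::real) \<Longrightarrow> 0 \<le> y \<Longrightarrow> 0 \<le> r \<Longrightarrow> (x + y) powr r \<le> 2 powr r * (x powr r + y powr r)"
proof -
  assume a: "0 \<le> x" "0 \<le> y" "0 \<le> r"
  have "(x + y) powr r \<le> (2 * max x y) powr r" using a by (intro powr_mono2) auto
  also have "\<dots> = 2 powr r * max x y powr r" using a by (simp add: powr_mult)
  also have "\<dots> \<le> 2 powr r * (x powr r + y powr r)" by (intro mult_left_mono) (auto simp: max_def)
  finally show ?thesis .
qed

lemma Lr_add: "Lr r u \<Longrightarrow> Lr r v \<Longrightarrow> 0 \<le> r \<Longrightarrow> Lr r (\<lambda>x. u x + v x)"
proof (rule Lr_dom[where g="\<lambda>x. 2 powr r * (\<bar>u x\<bar> powr r + \<bar>v x\<bar> powr r)"])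
  fix x assume "0 \<le> r"
  have "\<bar>u x + v x\<bar> powr r \<le> (\<bar>u x\<bar> + \<bar>v x\<bar>) powr r" using \<open>0 \<le> r\<close> by (intro powr_mono2) auto
  also have "\<dots> \<le> 2 powr r * (\<bar>u x\<bar> powr r + \<bar>v x\<bar> powr r)" using \<open>0 \<le> r\<close> by (intro powr_add_le) auto
  finally show "\<bar>u x + v x\<bar> powr r \<le> 2 powr r * (\<bar>u x\<bar> powr r + \<bar>v x\<bar> powr r)" .
qed (auto simp: Lr_def)

lemma Lr_mult_cont:
  assumes u: "Lr r u" and f: "continuous_on UNIV f" and r: "0 \<le> r"
  shows "Lr r (\<lambda>x. u x * f x)"
proof -
  obtain C where C: "C \<ge> 0" "\<And>x. x \<in> cbox 0 One \<Longrightarrow> norm (f x) \<le> C" using cont_bdd_cube[OF f] by blast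
  show ?thesis
  proof (rule Lr_dom[where g="\<lambda>x. C powr r * \<bar>u x\<bar> powr r"])
    fix x :: vec3 assume "x \<in> cbox 0 One"
    then have "\<bar>f x\<bar> powr r \<le> C powr r" using C r by (intro powr_mono2) auto
    then show "\<bar>u x * f x\<bar> powr r \<le> C powr r * \<bar>u x\<bar> powr r"
      by (simp add: abs_mult powr_mult mult.commute[of "\<bar>u x\<bar> powr r"] mult_right_mono)
  qed (use u meas_torus_cont[OF f] in \<open>auto simp: Lr_def\<close>)
qed

lemma Lr_const: "Lr r (\<lambda>x. c)" by (simp add: Lr_def)

lemma Lr_cont: "continuous_on UNIV f \<Longrightarrow> 0 \<le> r \<Longrightarrow> Lr r f"
  using Lr_mult_cont[OF Lr_const[of r 1]] by simp

lemma Lr_cmult: "Lr r u \<Longrightarrow> 0 \<le> r \<Longrightarrow> Lr r (\<lambda>x. c * u x)"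
  using Lr_mult_cont[of r u "\<lambda>_. c"] by (simp add: mult.commute)

lemma Lr_diff: "Lr r u \<Longrightarrow> Lr r v \<Longrightarrow> 0 \<le> r \<Longrightarrow> Lr r (\<lambda>x. u x - v x)"
  using Lr_add[of r u "\<lambda>x. (-1) * v x"] Lr_cmult[of r v "-1"] by simp

text \<open>Writing \<open>a * u\<close> as \<open>(e * a) * (inverse e * u)\<close>, with the dual
  power of \<open>e\<close> equal to \<open>\<delta>\<close>, leaves a small weight on
  \<open>a\<close> and a large one on \<open>u\<close>.\<close>

lemma Young_scaled:
  assumes "1 < (p::real)" "\<delta> > 0"
  obtains C where "C \<ge> 0" "\<And>a u. 0 \<le> a \<Longrightarrow> 0 \<le> u \<Longrightarrow> a * u \<le> \<delta> * a powr (p / (p - 1)) + C * u powr p"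
proof -
  define q where "q = p / (p - 1)"
  have q: "1 < q" "1 / q + 1 / p = 1" using assms(1) by (auto simp: q_def field_simps)
  define e where "e = \<delta> powr (1 / q)"
  have e: "e > 0" "e powr q = \<delta>" using assms q by (auto simp: e_def powr_powr)
  show ?thesis
  proof (rule that[of "inverse e powr p"])
    fix a u :: real assume au: "0 \<le> a" "0 \<le> u"
    have "(e * a) * (inverse e * u) \<le> (e * a) powr q / q + (inverse e * u) powr p / p"
      using au e q assms by (intro Youngs_inequality) auto
    also have "\<dots> \<le> (e * a) powr q + (inverse e * u) powr p"
      using q(1) assms(1) divide_left_mono[of 1 q "(e * a) powr q"] divide_left_mono[of 1 p "(inverse e * u) powr p"]
      by (intro add_mono) simp_all
    also have "\<dots> = \<delta> * a powr q + inverse e powr p * u powr p" using e au by (simp add: powr_mult)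
    finally have "(e * a) * (inverse e * u) \<le> \<delta> * a powr q + inverse e powr p * u powr p" .
    moreover have "(e * a) * (inverse e * u) = a * u" using e by (simp add: field_simps)
    ultimately show "a * u \<le> \<delta> * a powr (p / (p - 1)) + inverse e powr p * u powr p"
      by (simp add: q_def)
  qed simp
qed

lemma Lr_dual_integrable:
  assumes p: "1 < p" and a: "Lr (p / (p - 1)) a" and u: "Lr p u"
  shows "integrable torus (\<lambda>x. a x * u x)"
proof -
  obtain C where C: "C \<ge> 0" "\<And>a u. 0 \<le> a \<Longrightarrow> 0 \<le> u \<Longrightarrow> a * u \<le> 1 * a powr (p / (p - 1)) + C * u powr p"
    using Young_scaled[OF p, of 1] by auto
  show ?thesis
    by (rule integrable_dom[where g="\<lambda>x. \<bar>a x\<bar> powr (p / (p - 1)) + C * \<bar>u x\<bar> powr p"])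
       (use a u C(2)[of "\<bar>_\<bar>" "\<bar>_\<bar>"] in \<open>auto simp: Lr_def abs_mult\<close>)
qed

section \<open>Approximation by trigonometric polynomials\<close>

text \<open>The phase \<open>d\<close> covers sines and translated cosines, so one rule for the
  derivative and one for the integral serve them all.\<close>

definition trig :: "int \<Rightarrow> real \<Rightarrow> 3 \<Rightarrow> vec3 \<Rightarrow> real" where
  "trig m d i x = cos (2 * pi * of_int m * x $ i + d)"

lemma testfun_trig: "testfun (trig m d i)"
  unfolding testfun_def
proof
  define F where "F n s = cos (s + real n * (pi / 2))" for n s
  have "(F n has_real_derivative F (Suc n) s) (at s)" for n s
  proof -
    have e: "s + real (Suc n) * (pi / 2) = (s + real n * (pi / 2)) + pi / 2" by (simp add: distrib_right)
    have "cos (s + real (Suc n) * (pi / 2)) = - sin (s + real n * (pi / 2))"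
      unfolding e by (simp add: cos_add)
    then show ?thesis unfolding F_def by (auto intro!: derivative_eq_intros)
  qed
  from Ck_derivative_seq[of F, OF this, where n = 0] have c: "Ck_on k UNIV (F 0)" for k .
  have "trig m d i = (\<lambda>x. F 0 (x \<bullet> ((2 * pi * of_int m) *\<^sub>R axis i 1) + d))"
    by (auto simp: trig_def F_def inner_axis mult.commute)
  then show "smooth_on UNIV (trig m d i)" unfolding smooth_on_def by (simp only:) (intro allI Ck_comp_affine c)
  show "periodic (trig m d i)" unfolding periodic_def
  proof (intro allI)
    fix x :: vec3 and j
    show "trig m d i (x + axis j 1) = trig m d i x"
    proof (cases "i = j")
      case True
      have "2 * pi * of_int m * (x $ i + 1) + d = (2 * pi * of_int m * x $ i + d) + 2 * pi * of_int m" by (simp add: algebra_simps)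
      moreover have "cos ((2 * pi * of_int m * x $ i + d) + 2 * pi * of_int m) = cos (2 * pi * of_int m * x $ i + d)"
        by (subst cos_add) simp
      moreover have "(x + axis j 1) $ i = x $ i + 1" using True by (simp add: axis_def)
      ultimately show ?thesis unfolding trig_def by (simp only:)
    qed (simp add: trig_def axis_def)
  qed
qed

lemma dx_trig: "dx j (trig m d i) x = (if i = j then - (2 * pi * of_int m) * sin (2 * pi * of_int m * x $ i + d) else 0)"
proof -
  have "((\<lambda>x::vec3. 2 * pi * of_int m * x $ i + d) has_derivative (\<lambda>v. 2 * pi * of_int m * v $ i)) (at x)"
    by (auto intro!: derivative_eq_intros bounded_linear.has_derivative[OF bounded_linear_vec_nth has_derivative_ident])
  from has_derivative_compose[OF this DERIV_cos[THEN has_field_derivative_imp_has_derivative]]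
  have "(trig m d i has_derivative (\<lambda>v. - sin (2 * pi * of_int m * x $ i + d) * (2 * pi * of_int m * v $ i))) (at x)"
    by (simp add: trig_def[abs_def])
  from pd_eqI[OF this] show ?thesis by (simp add: dx_def axis_def)
qed

text \<open>As \<open>g\<close> is constant in direction \<open>i\<close>, the integrand is, up to
  the factor \<open>2 * pi * m\<close>, the derivative in that direction of the quarter-period shift
  times \<open>g\<close>.\<close>

lemma integral_trig:
  assumes "m \<noteq> 0" and g: "C1per g" "\<And>x. dx i g x = 0"
  shows "(\<integral>x. trig m d i x * g x \<partial>torus) = 0"
proof -
  define V where "V = trig m (d - pi / 2) i"
  have V: "C1per V" unfolding V_def by (intro testfun_C1per testfun_trig)
  have "dx i (\<lambda>x. V x * g x) x = (2 * pi * of_int m) * (trig m d i x * g x)" for x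
  proof -
    have "sin (2 * pi * of_int m * x $ i + (d - pi / 2)) = - cos (2 * pi * of_int m * x $ i + d)"
      by (simp add: sin_cos_eq algebra_simps)
    then show ?thesis using dx_mult[OF V g(1)] by (simp add: g(2)) (simp add: V_def dx_trig trig_def)
  qed
  then have "(\<integral>x. (2 * pi * of_int m) * (trig m d i x * g x) \<partial>torus) = 0"
    using torus_ibp[OF C1per_mult[OF V g(1)], of i] by simp
  then show ?thesis using assms(1) by simp
qed

text \<open>The Fejer kernel as the squared modulus of the exponential sum with frequencies below
  \<open>n\<close>, divided by \<open>n\<close>; nonnegativity is then visible.\<close>

definition fejer :: "nat \<Rightarrow> real \<Rightarrow> real" where
  "fejer n s = ((\<Sum>k<n. cos (2 * pi * real k * s))\<^sup>2 + (\<Sum>k<n. sin (2 * pi * real k * s))\<^sup>2) / real n"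

lemma fejer_nonneg: "fejer n s \<ge> 0" by (simp add: fejer_def)

lemma fejer_minus: "fejer n (- s) = fejer n s"
  by (simp add: fejer_def sum_negf)

definition cs :: "int \<Rightarrow> real \<Rightarrow> real" where "cs m s = cos (2 * pi * of_int m * s)"

lemma fejer_sum: "fejer n s = (\<Sum>j<n. \<Sum>k<n. cs (int j - int k) s) / real n"
proof -
  have "(\<Sum>k<n. cos (2 * pi * real k * s))\<^sup>2 + (\<Sum>k<n. sin (2 * pi * real k * s))\<^sup>2
     = (\<Sum>j<n. \<Sum>k<n. cos (2 * pi * real j * s) * cos (2 * pi * real k * s) + sin (2 * pi * real j * s) * sin (2 * pi * real k * s))"
    by (simp add: power2_eq_square sum_product sum.distrib)
  also have "\<dots> = (\<Sum>j<n. \<Sum>k<n. cs (int j - int k) s)"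
    by (intro sum.cong refl) (simp add: cos_diff[symmetric] cs_def algebra_simps)
  finally show ?thesis by (simp add: fejer_def)
qed

lemma cos_fejer_sum:
  "cos (2 * pi * s) * fejer n s = (\<Sum>j<n. \<Sum>k<n. (cs (int j - int k + 1) s + cs (int j - int k - 1) s) / 2) / real n"
proof -
  have "cos (2 * pi * s) * cs m s = (cs (m + 1) s + cs (m - 1) s) / 2" for m :: int
    using cos_times_cos[of "2 * pi * of_int m * s" "2 * pi * s"] by (simp add: cs_def algebra_simps)
  then show ?thesis by (simp only: fejer_sum times_divide_eq_right sum_distrib_left)
qed

lemma cs_shift: "cs m (x $ i - t) = trig m (- (2 * pi * of_int m * t)) i x"
  by (simp add: trig_def cs_def algebra_simps)

lemma integral_cs:
  assumes g: "C1per g" "\<And>x. dx i g x = 0"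
  shows "(\<integral>x. cs m (x $ i - t) * g x \<partial>torus) = (if m = 0 then (\<integral>x. g x \<partial>torus) else 0)"
proof (cases "m = 0")
  case False then show ?thesis unfolding cs_shift using integral_trig[OF _ g] by simp
qed (simp add: cs_def)

lemma integrable_cs:
  assumes g: "C1per g"
  shows "integrable torus (\<lambda>x. cs m (x $ i - t) * g x)"
  unfolding cs_shift
  by (rule integrable_torus_cont[OF C1per_cont[OF C1per_mult[OF testfun_C1per[OF testfun_trig] g]]])

lemma integral_fejer:
  assumes g: "C1per g" "\<And>x. dx i g x = 0" and n: "n > 0"
  shows "(\<integral>x. fejer n (x $ i - t) * g x \<partial>torus) = (\<integral>x. g x \<partial>torus)"
proof -
  have "(\<integral>x. fejer n (x $ i - t) * g x \<partial>torus)
      = (\<integral>x. (\<Sum>j<n. \<Sum>k<n. cs (int j - int k) (x $ i - t) * g x) / real n \<partial>torus)"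
    by (simp add: fejer_sum sum_distrib_right)
  also have "\<dots> = (\<Sum>j<n. \<Sum>k<n. \<integral>x. cs (int j - int k) (x $ i - t) * g x \<partial>torus) / real n"
    by (simp add: Bochner_Integration.integral_sum Bochner_Integration.integrable_sum integrable_cs[OF g(1)])
  also have "\<dots> = (\<Sum>j<n. \<Sum>k<n. (if j = k then (\<integral>x. g x \<partial>torus) else 0)) / real n"
    by (simp add: integral_cs[OF g])
  also have "\<dots> = (\<integral>x. g x \<partial>torus)" using n by (simp add: sum.delta)
  finally show ?thesis .
qed

text \<open>Integration keeps only frequency zero. There are \<open>n - 1\<close> pairs with
  \<open>k = j + 1\<close> and as many with \<open>k = j - 1\<close>, so the first Fourier
  coefficient of the kernel is \<open>(n - 1) / n\<close>. Its defect \<open>1 / n\<close> from one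
  measures how the kernel concentrates.\<close>

lemma integral_cos_fejer:
  assumes g: "C1per g" "\<And>x. dx i g x = 0" and n: "n > 0"
  shows "(\<integral>x. (1 - cos (2 * pi * (x $ i - t))) * (fejer n (x $ i - t) * g x) \<partial>torus) = (\<integral>x. g x \<partial>torus) / real n"
proof -
  let ?I = "\<integral>x. g x \<partial>torus"
  let ?c = "\<lambda>m x. cs m (x $ i - t) * g x"
  have "(\<integral>x. (cos (2 * pi * (x $ i - t)) * fejer n (x $ i - t)) * g x \<partial>torus)
     = (\<integral>x. (\<Sum>j<n. \<Sum>k<n. (?c (int j - int k + 1) x + ?c (int j - int k - 1) x) / 2) / real n \<partial>torus)"
    by (simp add: cos_fejer_sum sum_distrib_right distrib_right)
  also have "\<dots> = (\<Sum>j<n. \<Sum>k<n. ((\<integral>x. ?c (int j - int k + 1) x \<partial>torus) + (\<integral>x. ?c (int j - int k - 1) x \<partial>torus)) / 2) / real n"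
    by (simp add: Bochner_Integration.integral_sum Bochner_Integration.integrable_sum integrable_cs[OF g(1)])
  also have "\<dots> = (\<Sum>j<n. \<Sum>k<n. ((if int j - int k + 1 = 0 then ?I else 0) + (if int j - int k - 1 = 0 then ?I else 0)) / 2) / real n"
    by (simp add: integral_cs[OF g])
  also have "\<dots> = ?I * (real n - 1) / real n"
  proof -
    have a: "(\<Sum>j<n. \<Sum>k<n. (if int j - int k + 1 = 0 then ?I else 0)) = ?I * (real n - 1)"
    proof -
      have "(\<Sum>k<n. (if int j - int k + 1 = 0 then ?I else 0)) = (if Suc j < n then ?I else 0)" for j
      proof -
        have "(\<Sum>k<n. (if int j - int k + 1 = 0 then ?I else 0)) = (\<Sum>k<n. if k = Suc j then ?I else 0)"
          by (intro sum.cong) auto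
        then show ?thesis by (simp add: sum.delta)
      qed
      then have "(\<Sum>j<n. \<Sum>k<n. (if int j - int k + 1 = 0 then ?I else 0)) = (\<Sum>j<n. if Suc j < n then ?I else 0)" by simp
      also have "\<dots> = (\<Sum>j<n - 1. ?I)"
        by (rule sum.mono_neutral_cong_right) auto
      finally show ?thesis using n by (simp add: of_nat_diff mult.commute)
    qed
    have b: "(\<Sum>j<n. \<Sum>k<n. (if int j - int k - 1 = 0 then ?I else 0)) = ?I * (real n - 1)"
      unfolding a[symmetric] by (subst sum.swap) (intro sum.cong refl, auto)
    have "(\<Sum>j<n. \<Sum>k<n. ((if int j - int k + 1 = 0 then ?I else 0) + (if int j - int k - 1 = 0 then ?I else 0)) / 2)
       = ((\<Sum>j<n. \<Sum>k<n. (if int j - int k + 1 = 0 then ?I else 0)) + (\<Sum>j<n. \<Sum>k<n. (if int j - int k - 1 = 0 then ?I else 0))) / 2"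
      by (simp only: sum.distrib[symmetric] sum_divide_distrib)
    then show ?thesis unfolding a b by simp
  qed
  finally have c: "(\<integral>x. (cos (2 * pi * (x $ i - t)) * fejer n (x $ i - t)) * g x \<partial>torus) = ?I * (real n - 1) / real n" .
  have cf: "continuous_on UNIV (\<lambda>x. fejer n (x $ i - t))" "continuous_on UNIV (\<lambda>x. cos (2 * pi * (x $ i - t)))"
    unfolding fejer_def by (intro continuous_intros; use n in simp)+
  then have i: "integrable torus (\<lambda>x. fejer n (x $ i - t) * g x)" "integrable torus (\<lambda>x. (cos (2 * pi * (x $ i - t)) * fejer n (x $ i - t)) * g x)"
    by (intro integrable_torus_cont continuous_on_mult C1per_cont g(1) cf)+
  have "(\<integral>x. (1 - cos (2 * pi * (x $ i - t))) * (fejer n (x $ i - t) * g x) \<partial>torus)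
     = (\<integral>x. fejer n (x $ i - t) * g x - (cos (2 * pi * (x $ i - t)) * fejer n (x $ i - t)) * g x \<partial>torus)"
    by (simp add: algebra_simps)
  also have "\<dots> = ?I - ?I * (real n - 1) / real n" using i by (simp add: integral_fejer[OF g n] c)
  also have "\<dots> = ?I / real n" using n by (simp add: field_simps)
  finally show ?thesis .
qed

text \<open>Finite sums of products of test functions in the two variables. For such kernels the
  exchange of integrals and differentiation under the integral sign follow by induction from
  linearity.\<close>

inductive sep :: "(vec3 \<Rightarrow> vec3 \<Rightarrow> real) \<Rightarrow> bool" where
  base: "testfun a \<Longrightarrow> testfun b \<Longrightarrow> sep (\<lambda>x y. a x * b y)"
| add: "sep K \<Longrightarrow> sep L \<Longrightarrow> sep (\<lambda>x y. K x y + L x y)"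

lemma sep_base_mult: "sep L \<Longrightarrow> testfun a \<Longrightarrow> testfun b \<Longrightarrow> sep (\<lambda>x y. (a x * b y) * L x y)"
proof (induction rule: sep.induct)
  case (base c d)
  then have "sep (\<lambda>x y. (a x * c x) * (b y * d y))" by (intro sep.base testfun_mult)
  then show ?case by (simp add: mult.assoc mult.left_commute)
next
  case (add K L)
  then have "sep (\<lambda>x y. (a x * b y) * K x y + (a x * b y) * L x y)" by (intro sep.add)
  then show ?case by (simp add: distrib_left)
qed

lemma sep_mult: "sep K \<Longrightarrow> sep L \<Longrightarrow> sep (\<lambda>x y. K x y * L x y)"
proof (induction rule: sep.induct)
  case (base a b)
  then show ?case by (intro sep_base_mult)
next
  case (add K K')
  then have "sep (\<lambda>x y. K x y * L x y + K' x y * L x y)" by (intro sep.add)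
  then show ?case by (simp add: distrib_right)
qed

lemma sep_const: "sep (\<lambda>x y. c)"
  using sep.base[OF testfun_const[of c] testfun_const[of 1]] by simp

lemma sep_sum: "(\<And>i. i \<in> I \<Longrightarrow> sep (f i)) \<Longrightarrow> sep (\<lambda>x y. \<Sum>i\<in>I. f i x y)"
  by (induction I rule: infinite_finite_induct) (simp_all add: sep_const sep.add)

lemma sep_cs: "sep (\<lambda>x y. cs m (x $ i - y $ i))"
proof -
  have "trig m (- (pi / 2)) i x = sin (2 * pi * of_int m * x $ i)" for x
    by (simp add: trig_def cos_sin_eq)
  then have "cs m (x $ i - y $ i) = trig m 0 i x * trig m 0 i y + trig m (- (pi / 2)) i x * trig m (- (pi / 2)) i y" for x y
    using cos_diff[of "2 * pi * of_int m * x $ i" "2 * pi * of_int m * y $ i"]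
    by (simp add: cs_def trig_def algebra_simps)
  then show ?thesis by (simp only:) (intro sep.intros testfun_trig)
qed

lemma sep_fejer: "sep (\<lambda>x y. fejer n (x $ i - y $ i))"
proof -
  have "sep (\<lambda>x y. (\<Sum>j<n. \<Sum>k<n. cs (int j - int k) (x $ i - y $ i)) * (1 / real n))"
    by (intro sep_mult sep_sum sep_cs sep_const)
  then show ?thesis by (simp add: fejer_sum)
qed

definition kern :: "nat \<Rightarrow> vec3 \<Rightarrow> real" where
  "kern n z = fejer n (z $ 1) * (fejer n (z $ 2) * fejer n (z $ 3))"

lemma sep_kern: "sep (\<lambda>x y. kern n (x - y))"
  unfolding kern_def vector_minus_component by (intro sep_mult sep_fejer)

lemma kern_nonneg: "kern n z \<ge> 0" by (simp add: kern_def fejer_nonneg)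

lemma kern_commute: "kern n (x - y) = kern n (y - x)"
  using fejer_minus[of n "y $ i - x $ i" for i] by (simp add: kern_def)

lemma sep_testfun: "sep K \<Longrightarrow> testfun (\<lambda>x. K x y)" "sep K \<Longrightarrow> testfun (K x)"
proof (induction rule: sep.induct)
  case (base a b)
  { case 1 then show ?case using base by (intro testfun_mult testfun_const) }
  { case 2 then show ?case using base by (intro testfun_mult testfun_const) }
next
  case (add K L)
  { case 1 then show ?case using add by (intro testfun_add) }
  { case 2 then show ?case using testfun_add[OF add.IH(2) add.IH(4)] by simp }
qed

lemma testfun_mult_int: "testfun b \<Longrightarrow> integrable torus u \<Longrightarrow> integrable torus (\<lambda>y. u y * b y)"
  by (intro integrable_torus_mult_cont C1per_cont testfun_C1per)

lemma sep_int: "sep K \<Longrightarrow> integrable torus u \<Longrightarrow> integrable torus (\<lambda>y. u y * K x y)"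
  by (intro testfun_mult_int sep_testfun)

lemma sep_conv:
  assumes "sep K" and u: "integrable torus u"
  shows "testfun (\<lambda>x. \<integral>y. u y * K x y \<partial>torus) \<and>
     integrable torus (\<lambda>y. u y * dx \<alpha> (\<lambda>x. K x y) x) \<and>
     dx \<alpha> (\<lambda>x. \<integral>y. u y * K x y \<partial>torus) x = (\<integral>y. u y * dx \<alpha> (\<lambda>x. K x y) x \<partial>torus)"
  using assms(1)
proof (induction rule: sep.induct)
  case (base a b)
  have i: "integrable torus (\<lambda>y. u y * b y)" by (rule testfun_mult_int[OF base(2) u])
  have e: "(\<integral>y. u y * (a x * b y) \<partial>torus) = (\<integral>y. u y * b y \<partial>torus) * a x" for x
    by (simp add: mult.left_commute[of _ "a x"])
  have d: "dx \<alpha> (\<lambda>x. a x * b y) x = b y * dx \<alpha> a x" for y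
    using dx_cmult[OF testfun_C1per[OF base(1)], of \<alpha> "b y" x] by (simp add: mult.commute)
  show ?case unfolding e d using base i dx_cmult[OF testfun_C1per[OF base(1)]]
    by (auto simp: mult.assoc[symmetric] intro!: testfun_mult testfun_const)
next
  case (add K L)
  have C: "C1per (\<lambda>x. K x y)" "C1per (\<lambda>x. L x y)" for y
    using add sep_testfun(1) by (auto intro!: testfun_C1per)
  have D: "C1per (\<lambda>x. \<integral>y. u y * K x y \<partial>torus)" "C1per (\<lambda>x. \<integral>y. u y * L x y \<partial>torus)"
    using add by (auto intro!: testfun_C1per)
  have e: "(\<integral>y. u y * (K x y + L x y) \<partial>torus) = (\<integral>y. u y * K x y \<partial>torus) + (\<integral>y. u y * L x y \<partial>torus)" for x
    using sep_int[OF _ u] add by (simp add: distrib_left)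
  show ?case unfolding e dx_add[OF C] dx_add[OF D] using add
    by (simp add: distrib_left testfun_add)
qed

text \<open>Fubini's theorem for separated kernels: for a product, both sides equal the product of
  the same two integrals.\<close>

lemma sep_swap:
  assumes "sep K" and u: "integrable torus u" and a: "integrable torus a"
  shows "(\<integral>x. a x * (\<integral>y. u y * K x y \<partial>torus) \<partial>torus) = (\<integral>y. u y * (\<integral>x. a x * K x y \<partial>torus) \<partial>torus)"
    and "integrable torus (\<lambda>x. a x * (\<integral>y. u y * K x y \<partial>torus))"
proof -
  have t: "testfun (\<lambda>x. \<integral>y. u y * K x y \<partial>torus)" if "sep K" for K using sep_conv[OF that u] by blast
  have t2: "testfun (\<lambda>y. \<integral>x. a x * K x y \<partial>torus)" if "sep K" for K
    using that
  proof (induction rule: sep.induct)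
    case (base c b)
    have "(\<integral>x. a x * (c x * b y) \<partial>torus) = (\<integral>x. a x * c x \<partial>torus) * b y" for y
      by (simp only: mult.assoc[symmetric] integral_mult_left_zero)
    then show ?case using base by (simp only:) (intro testfun_mult testfun_const)
  next
    case (add K L)
    have "integrable torus (\<lambda>x. a x * K x y)" "integrable torus (\<lambda>x. a x * L x y)" for y
      using testfun_mult_int[OF sep_testfun(1) a] add.hyps by blast+
    then show ?case using add by (simp add: distrib_left testfun_add)
  qed
  show "integrable torus (\<lambda>x. a x * (\<integral>y. u y * K x y \<partial>torus))" using testfun_mult_int[OF t[OF assms(1)] a] .
  show "(\<integral>x. a x * (\<integral>y. u y * K x y \<partial>torus) \<partial>torus) = (\<integral>y. u y * (\<integral>x. a x * K x y \<partial>torus) \<partial>torus)"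
    using assms(1)
  proof (induction rule: sep.induct)
    case (base c b)
    have "(\<integral>x. a x * (\<integral>y. u y * (c x * b y) \<partial>torus) \<partial>torus) = (\<integral>x. (a x * c x) * (\<integral>y. u y * b y \<partial>torus) \<partial>torus)"
      by (intro Bochner_Integration.integral_cong refl) (simp only: mult.left_commute[of _ "c _"] integral_mult_right_zero mult.assoc)
    also have "\<dots> = (\<integral>y. (u y * b y) * (\<integral>x. a x * c x \<partial>torus) \<partial>torus)" by (simp add: mult.commute)
    also have "\<dots> = (\<integral>y. u y * (\<integral>x. a x * (c x * b y) \<partial>torus) \<partial>torus)"
      by (intro Bochner_Integration.integral_cong refl) (simp only: mult.assoc[symmetric] integral_mult_left_zero, simp)
    finally show ?case .
  next
    case (add K L)
    have i1: "integrable torus (\<lambda>y. u y * K x y)" "integrable torus (\<lambda>y. u y * L x y)" for x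
      using sep_int[OF _ u] add.hyps by blast+
    have i2: "integrable torus (\<lambda>x. a x * K x y)" "integrable torus (\<lambda>x. a x * L x y)" for y
      using testfun_mult_int[OF sep_testfun(1) a] add.hyps by blast+
    have i3: "integrable torus (\<lambda>x. a x * (\<integral>y. u y * K x y \<partial>torus))" "integrable torus (\<lambda>x. a x * (\<integral>y. u y * L x y \<partial>torus))"
      using testfun_mult_int[OF t a] add.hyps by blast+
    have i4: "integrable torus (\<lambda>y. u y * (\<integral>x. a x * K x y \<partial>torus))" "integrable torus (\<lambda>y. u y * (\<integral>x. a x * L x y \<partial>torus))"
      using testfun_mult_int[OF t2 u] add.hyps by blast+
    show ?case using i1 i2 i3 i4 add by (simp add: distrib_left)
  qed
qed

text \<open>One coordinate is integrated at a time, the other factors being constant in it. The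
  cosine is integrated with the kernel factor of its own coordinate, while the product of the other
  two factors has mean one.\<close>

lemma integral_kern: "n > 0 \<Longrightarrow> (\<integral>x. kern n (x - y) \<partial>torus) = 1"
  and integral_cos_kern: "n > 0 \<Longrightarrow> (\<integral>x. (1 - cos (2 * pi * (x $ i - y $ i))) * kern n (x - y) \<partial>torus) = 1 / real n"
proof -
  assume n: "n > 0"
  have cf: "continuous_on UNIV (fejer n)" unfolding fejer_def[abs_def] by (intro continuous_intros) (use n in auto)
  define f where "f k x = fejer n (x $ k - y $ k)" for k x
  have tf: "testfun (f k)" for k unfolding f_def by (rule sep_testfun(1)[OF sep_fejer])
  have df: "dx j (f k) x = 0" if "j \<noteq> k" for j k x
  proof -
    have "((\<lambda>s. f k (x + s *\<^sub>R axis j 1)) has_real_derivative dx j (f k) x) (at 0)"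
      using has_real_derivative_line[of "f k" x 0 "axis j 1"] C1D(1)[OF testfun_C1[OF tf]] by (simp add: dx_def)
    moreover have "(\<lambda>s. f k (x + s *\<^sub>R axis j 1)) = (\<lambda>s. f k x)"
      using that by (simp add: f_def axis_def)
    ultimately show ?thesis using DERIV_unique DERIV_const by metis
  qed
  have prod: "C1per (\<lambda>x. f j x * f k x)" for j k using tf by (intro C1per_mult testfun_C1per)
  have dprod: "dx i (\<lambda>x. f j x * f k x) x = 0" if "i \<noteq> j" "i \<noteq> k" for i j k x
    using that dx_mult[OF testfun_C1per[OF tf] testfun_C1per[OF tf], of i j k] by (simp add: df)
  have one: "(\<integral>x. f k x \<partial>torus) = 1" for k
    using integral_fejer[OF C1per_const[of 1] dx_const n, of k "y $ k"] by (simp add: f_def)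
  have two: "(\<integral>x. f j x * f k x \<partial>torus) = 1" if "j \<noteq> k" for j k
    using integral_fejer[OF testfun_C1per[OF tf[of k]] df[OF that] n, of "y $ j"] by (simp add: f_def[symmetric] one)
  have three: "(\<integral>x. f i x * (f j x * f k x) \<partial>torus) = 1" "(\<integral>x. (1 - cos (2 * pi * (x $ i - y $ i))) * (f i x * (f j x * f k x)) \<partial>torus) = 1 / real n"
    if "i \<noteq> j" "i \<noteq> k" "j \<noteq> k" for i j k
    using integral_fejer[OF prod[of j k] dprod[OF that(1,2)] n, of "y $ i"] 
       integral_cos_fejer[OF prod[of j k] dprod[OF that(1,2)] n, of "y $ i"] by (simp_all add: f_def[symmetric] two that)
  have K: "kern n (x - y) = f 1 x * (f 2 x * f 3 x)" for x by (simp add: kern_def f_def)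
  have K2: "f 1 x * (f 2 x * f 3 x) = f 2 x * (f 1 x * f 3 x)" "f 1 x * (f 2 x * f 3 x) = f 3 x * (f 1 x * f 2 x)" for x by simp_all
  show "(\<integral>x. kern n (x - y) \<partial>torus) = 1" unfolding K by (rule three) simp_all
  show "(\<integral>x. (1 - cos (2 * pi * (x $ i - y $ i))) * kern n (x - y) \<partial>torus) = 1 / real n"
    using exhaust_3[of i]
  proof (elim disjE)
    assume "i = 1" then show ?thesis using three(2)[of 1 2 3] by (simp add: K)
  next
    assume "i = 2" then show ?thesis using three(2)[of 2 1 3] by (simp add: K K2(1))
  next
    assume "i = 3" then show ?thesis using three(2)[of 3 1 2] by (simp add: K K2(2))
  qed
qed

text \<open>The Fejer mean of \<open>u\<close> in three variables, a trigonometric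
  polynomial.\<close>

definition approx :: "nat \<Rightarrow> (vec3 \<Rightarrow> real) \<Rightarrow> vec3 \<Rightarrow> real" where
  "approx n u x = (\<integral>y. u y * kern n (x - y) \<partial>torus)"

lemma testfun_approx: "integrable torus u \<Longrightarrow> testfun (approx n u)"
  unfolding approx_def using sep_conv[OF sep_kern] by blast

text \<open>The kernel depends on \<open>x - y\<close>, so the derivative can be moved to
  \<open>y\<close> at the price of a sign. In this form \<open>u\<close> is tested with the
  derivative of a test function, and weak identities for \<open>u\<close> apply.\<close>

lemma dx_approx_kernel:
  assumes u: "integrable torus u"
  shows "dx \<alpha> (approx n u) x = - (\<integral>y. u y * dx \<alpha> (\<lambda>y. kern n (x - y)) y \<partial>torus)"
proof -
  have C: "C1 (kern n)" using sep_testfun(1)[OF sep_kern, of n 0] by (simp add: testfun_C1)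
  have d1: "dx \<alpha> (\<lambda>x. kern n (x - y)) x = pd (kern n) (axis \<alpha> 1) (x - y)" for y
  proof -
    have "((\<lambda>x. x - y) has_derivative (\<lambda>v. v)) (at x)" by (auto intro!: derivative_eq_intros)
    from has_derivative_compose[OF this has_derivative_grad[OF C1D(1)[OF C]]]
    show ?thesis unfolding dx_def by (subst pd_eqI) (auto simp: pd_linear_comb[OF C1D(1)[OF C]])
  qed
  have d2: "dx \<alpha> (\<lambda>y. kern n (x - y)) y = - pd (kern n) (axis \<alpha> 1) (x - y)" for y
  proof -
    have "((\<lambda>y. x - y) has_derivative (\<lambda>v. - v)) (at y)" by (auto intro!: derivative_eq_intros)
    from has_derivative_compose[OF this has_derivative_grad[OF C1D(1)[OF C]]]
    show ?thesis unfolding dx_def by (subst pd_eqI) (auto simp: pd_linear_comb[OF C1D(1)[OF C]])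
  qed
  have "dx \<alpha> (approx n u) x = (\<integral>y. u y * dx \<alpha> (\<lambda>x. kern n (x - y)) x \<partial>torus)"
    unfolding approx_def using sep_conv[OF sep_kern u] by blast
  also have "\<dots> = - (\<integral>y. u y * dx \<alpha> (\<lambda>y. kern n (x - y)) y \<partial>torus)" by (simp add: d1 d2)
  finally show ?thesis .
qed

lemma dx_approx:
  assumes u: "integrable torus u"
    and m: "\<And>\<phi>. testfun \<phi> \<Longrightarrow> (\<integral>x. u x * dx \<alpha> \<phi> x \<partial>torus) = - (\<integral>x. m x * \<phi> x \<partial>torus)"
  shows "dx \<alpha> (approx n u) x = approx n m x"
  using m[OF sep_testfun(2)[OF sep_kern]] by (simp add: dx_approx_kernel[OF u] approx_def)

text \<open>Young's inequality is applied under the kernel, which is nonnegative with mass one in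
  either variable; hence the bound is independent of \<open>n\<close>. The small factor
  \<open>\<delta>\<close> goes to \<open>a\<close>, which is fixed in the limit argument, and
  \<open>C\<close> to \<open>u\<close>, which will be a small approximation error.\<close>

lemma integral_approx_le:
  assumes p: "1 < p" and \<delta>: "\<delta> > 0"
  obtains C where "C \<ge> 0" "\<And>a u n. Lr (p / (p - 1)) a \<Longrightarrow> Lr p u \<Longrightarrow> n > 0 \<Longrightarrow>
    \<bar>\<integral>x. a x * approx n u x \<partial>torus\<bar> \<le> \<delta> * (\<integral>x. \<bar>a x\<bar> powr (p / (p - 1)) \<partial>torus) + C * (\<integral>x. \<bar>u x\<bar> powr p \<partial>torus)"
     "\<And>a u. Lr (p / (p - 1)) a \<Longrightarrow> Lr p u \<Longrightarrow>
    \<bar>\<integral>x. a x * u x \<partial>torus\<bar> \<le> \<delta> * (\<integral>x. \<bar>a x\<bar> powr (p / (p - 1)) \<partial>torus) + C * (\<integral>x. \<bar>u x\<bar> powr p \<partial>torus)"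
proof -
  obtain C where C: "C \<ge> 0" "\<And>a u. 0 \<le> a \<Longrightarrow> 0 \<le> u \<Longrightarrow> a * u \<le> \<delta> * a powr (p / (p - 1)) + C * u powr p"
    using Young_scaled[OF p \<delta>] by blast
  have p': "1 < p / (p - 1)" using p by (simp add: field_simps)
  show ?thesis
  proof (rule that[OF C(1)])
    fix a u and n :: nat assume a: "Lr (p / (p - 1)) a" and u: "Lr p u" and n: "n > 0"
    have ia: "integrable torus a" "integrable torus (\<lambda>x. \<bar>a x\<bar> powr (p / (p - 1)))" using Lr_integrable[OF a] a p' by (auto simp: Lr_def)
    have iu: "integrable torus u" "integrable torus (\<lambda>x. \<bar>u x\<bar> powr p)" using Lr_integrable[OF u] u p by (auto simp: Lr_def)
    define A where "A x = \<bar>a x\<bar> powr (p / (p - 1))" for x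
    define B where "B x = \<bar>u x\<bar> powr p" for x
    have iAB: "integrable torus A" "integrable torus B" using ia iu by (auto simp: A_def[abs_def] B_def[abs_def])
    have k1: "(\<integral>y. kern n (x - y) \<partial>torus) = 1" for x
      using integral_kern[OF n, of x] by (simp add: kern_commute[of n x])
    have pt: "\<bar>a x * approx n u x\<bar> \<le> \<delta> * A x + C * approx n B x" for x
    proof -
      have sk: "integrable torus (\<lambda>y. w y * kern n (x - y))" if "integrable torus w" for w
        using sep_int[OF sep_kern that] .
      have "\<bar>a x * approx n u x\<bar> = \<bar>\<integral>y. a x * u y * kern n (x - y) \<partial>torus\<bar>"
        by (simp add: approx_def mult.assoc)
      also have "\<dots> \<le> (\<integral>y. \<bar>a x * u y * kern n (x - y)\<bar> \<partial>torus)" by (rule integral_abs_bound)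
      also have "\<dots> \<le> (\<integral>y. \<delta> * A x * kern n (x - y) + C * (B y * kern n (x - y)) \<partial>torus)"
      proof (rule integral_mono)
        show "integrable torus (\<lambda>y. \<bar>a x * u y * kern n (x - y)\<bar>)"
          using integrable_mult_right[OF sk[OF iu(1)], of "a x"] by (intro integrable_abs) (simp add: mult.assoc)
        show "integrable torus (\<lambda>y. \<delta> * A x * kern n (x - y) + C * (B y * kern n (x - y)))"
          using sk[OF integrable_torus_const[of 1]] sk[OF iAB(2)] by simp
        fix y
        have "\<bar>a x * u y * kern n (x - y)\<bar> = (\<bar>a x\<bar> * \<bar>u y\<bar>) * kern n (x - y)" using kern_nonneg[of n "x - y"] by (simp add: abs_mult)
        also have "\<dots> \<le> (\<delta> * A x + C * B y) * kern n (x - y)"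
          using C(2)[of "\<bar>a x\<bar>" "\<bar>u y\<bar>"] kern_nonneg[of n "x - y"] by (intro mult_right_mono) (auto simp: A_def B_def)
        finally show "\<bar>a x * u y * kern n (x - y)\<bar> \<le> \<delta> * A x * kern n (x - y) + C * (B y * kern n (x - y))"
          by (simp add: algebra_simps)
      qed
      also have "\<dots> = \<delta> * A x + C * approx n B x"
        using sk[OF integrable_torus_const[of 1]] sk[OF iAB(2)] by (simp add: k1 approx_def)
      finally show ?thesis .
    qed
    have iB: "integrable torus (approx n B)" "(\<integral>x. approx n B x \<partial>torus) = (\<integral>x. B x \<partial>torus)"
      using sep_swap[OF sep_kern iAB(2) integrable_torus_const[of 1], of n] integral_kern[OF n]
      by (simp_all add: approx_def[abs_def])
    have "\<bar>\<integral>x. a x * approx n u x \<partial>torus\<bar> \<le> (\<integral>x. \<bar>a x * approx n u x\<bar> \<partial>torus)" by (rule integral_abs_bound)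
    also have "\<dots> \<le> (\<integral>x. \<delta> * A x + C * approx n B x \<partial>torus)"
    proof (rule integral_mono)
      show "integrable torus (\<lambda>x. \<bar>a x * approx n u x\<bar>)"
        using sep_swap(2)[OF sep_kern iu(1) ia(1), of n] by (simp add: approx_def[abs_def] integrable_abs)
    qed (use iAB iB pt in auto)
    also have "\<dots> = \<delta> * (\<integral>x. A x \<partial>torus) + C * (\<integral>x. B x \<partial>torus)" using iAB iB by simp
    finally show "\<bar>\<integral>x. a x * approx n u x \<partial>torus\<bar> \<le> \<delta> * (\<integral>x. \<bar>a x\<bar> powr (p / (p - 1)) \<partial>torus) + C * (\<integral>x. \<bar>u x\<bar> powr p \<partial>torus)"
      by (simp add: A_def B_def)
  next
    fix a u assume a: "Lr (p / (p - 1)) a" and u: "Lr p u"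
    have "\<bar>\<integral>x. a x * u x \<partial>torus\<bar> \<le> (\<integral>x. \<bar>a x * u x\<bar> \<partial>torus)" by (rule integral_abs_bound)
    also have "\<dots> \<le> (\<integral>x. \<delta> * \<bar>a x\<bar> powr (p / (p - 1)) + C * \<bar>u x\<bar> powr p \<partial>torus)"
      using C(2)[of "\<bar>_\<bar>" "\<bar>_\<bar>"] a u by (intro integral_mono integrable_abs Lr_dual_integrable[OF p]) (auto simp: Lr_def abs_mult)
    also have "\<dots> = \<delta> * (\<integral>x. \<bar>a x\<bar> powr (p / (p - 1)) \<partial>torus) + C * (\<integral>x. \<bar>u x\<bar> powr p \<partial>torus)"
      using a u by (simp add: Lr_def)
    finally show "\<bar>\<integral>x. a x * u x \<partial>torus\<bar> \<le> \<delta> * (\<integral>x. \<bar>a x\<bar> powr (p / (p - 1)) \<partial>torus) + C * (\<integral>x. \<bar>u x\<bar> powr p \<partial>torus)" .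
  qed
qed

text \<open>Korovkin's idea: on the torus the modulus of continuity is controlled by \<open>1 - cos\<close>.\<close>

lemma cube_modulus:
  fixes c :: "vec3 \<Rightarrow> real"
  assumes c: "continuous_on UNIV c" and z: "\<And>x i. x \<in> cbox 0 One \<Longrightarrow> x $ i = 0 \<or> x $ i = 1 \<Longrightarrow> c x = 0" and e: "\<epsilon> > 0"
  obtains M where "M \<ge> 0" "\<And>x y. x \<in> cbox 0 One \<Longrightarrow> y \<in> cbox 0 One \<Longrightarrow>
     \<bar>c x - c y\<bar> \<le> \<epsilon> + M * (\<Sum>i\<in>UNIV. 1 - cos (2 * pi * (x $ i - y $ i)))"
proof -
  obtain B where B: "B \<ge> 0" "\<And>x. x \<in> cbox 0 One \<Longrightarrow> norm (c x) \<le> B" using cont_bdd_cube[OF c] by blast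
  define s where "s z = (\<Sum>i\<in>UNIV. 1 - cos (2 * pi * (fst z $ i - snd z $ i)))" for z :: "vec3 \<times> vec3"
  \<comment> \<open>The pairs on which \<open>c\<close> varies by at least
    \<open>\<epsilon>\<close>. On this compact set \<open>s\<close> is positive: \<open>s\<close>
    vanishes only for points that agree modulo integers, and such points are equal or differ by a
    full period in some coordinate, where \<open>c\<close> is zero at both.\<close>
  define Z where "Z = (cbox 0 One \<times> cbox 0 One) \<inter> {z. \<epsilon> \<le> \<bar>c (fst z) - c (snd z)\<bar>}"
  have s0: "s z \<ge> 0" for z unfolding s_def by (intro sum_nonneg) simp
  have "closed {z. \<epsilon> \<le> \<bar>c (fst z) - c (snd z)\<bar>}"
    by (intro closed_Collect_le continuous_intros continuous_on_compose2[OF c]) auto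
  then have Zc: "compact Z" unfolding Z_def by (intro compact_Int_closed compact_Times compact_cbox)
  have pos: "s z > 0" if "z \<in> Z" for z
  proof (rule ccontr)
    assume "\<not> s z > 0"
    then have "s z = 0" using s0[of z] by simp
    then have "\<forall>i\<in>UNIV. 1 - cos (2 * pi * (fst z $ i - snd z $ i)) = 0"
      unfolding s_def by (subst (asm) sum_nonneg_eq_0_iff) auto
    then have co: "\<exists>n::int. 2 * pi * (fst z $ i - snd z $ i) = of_int n * 2 * pi" for i
      using cos_one_2pi_int by auto
    then have int: "\<exists>n::int. fst z $ i - snd z $ i = of_int n" for i
    proof -
      obtain n :: int where "2 * pi * (fst z $ i - snd z $ i) = of_int n * 2 * pi" using co by blast
      then have "(2 * pi) * (fst z $ i - snd z $ i) = (2 * pi) * of_int n" by (simp only: mult.commute mult.left_commute)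
      then show ?thesis by simp
    qed
    have mem: "fst z \<in> cbox 0 One" "snd z \<in> cbox 0 One" and g: "\<epsilon> \<le> \<bar>c (fst z) - c (snd z)\<bar>" using that by (auto simp: Z_def)
    then have r: "0 \<le> fst z $ i" "fst z $ i \<le> 1" "0 \<le> snd z $ i" "snd z $ i \<le> 1" for i by (auto simp: mem_box_cart)
    show False
    proof (cases "fst z = snd z")
      case True then show False using g e by simp
    next
      case False
      then obtain i where i: "fst z $ i \<noteq> snd z $ i" by (auto simp: vec_eq_iff)
      obtain n :: int where n: "fst z $ i - snd z $ i = of_int n" using int by blast
      then have "\<bar>real_of_int n\<bar> \<le> 1" using r[of i] by linarith
      then have "n = -1 \<or> n = 0 \<or> n = 1" by linarith
      then have "(fst z $ i = 1 \<and> snd z $ i = 0) \<or> (fst z $ i = 0 \<and> snd z $ i = 1)"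
        using n i r[of i] by auto
      then have "c (fst z) = 0" "c (snd z) = 0" using z mem by blast+
      then show False using g e by simp
    qed
  qed
  show ?thesis
  proof (cases "Z = {}")
    case True
    show ?thesis
    proof (rule that[of 0])
      fix x y :: vec3 assume "x \<in> cbox 0 One" "y \<in> cbox 0 One"
      then have "(x, y) \<notin> Z \<and> x \<in> cbox 0 One \<and> y \<in> cbox 0 One" using True by simp
      then show "\<bar>c x - c y\<bar> \<le> \<epsilon> + 0 * (\<Sum>i\<in>UNIV. 1 - cos (2 * pi * (x $ i - y $ i)))" by (auto simp: Z_def)
    qed simp
  next
    case False
    have "continuous_on Z s" unfolding s_def by (intro continuous_intros)
    then obtain z0 where z0: "z0 \<in> Z" "\<And>z. z \<in> Z \<Longrightarrow> s z0 \<le> s z" using continuous_attains_inf[OF Zc False] by blast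
    have p0: "s z0 > 0" using pos z0 by blast
    show ?thesis
    \<comment> \<open>\<open>2 * B\<close> bounds every variation of \<open>c\<close>, and
      \<open>s z0\<close> is the minimum of \<open>s\<close> over the pairs in
      \<open>Z\<close>.\<close>
    proof (rule that[of "2 * B / s z0"])
      show "0 \<le> 2 * B / s z0" using B p0 by simp
      fix x y :: vec3 assume xy: "x \<in> cbox 0 One" "y \<in> cbox 0 One"
      show "\<bar>c x - c y\<bar> \<le> \<epsilon> + 2 * B / s z0 * (\<Sum>i\<in>UNIV. 1 - cos (2 * pi * (x $ i - y $ i)))"
      proof (cases "(x, y) \<in> Z")
        case True
        have "\<bar>c x - c y\<bar> \<le> 2 * B" using B(2)[OF xy(1)] B(2)[OF xy(2)] by simp
        also have "\<dots> = 2 * B / s z0 * s z0" using p0 by simp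
        also have "\<dots> \<le> 2 * B / s z0 * s (x, y)" using z0(2)[OF True] B p0 by (intro mult_left_mono) auto
        finally show ?thesis using e by (simp add: s_def)
      next
        case False
        then have "\<bar>c x - c y\<bar> \<le> \<epsilon>" using xy by (auto simp: Z_def)
        moreover have "2 * B / s z0 * s (x, y) \<ge> 0" using B p0 s0 by simp
        ultimately show ?thesis by (simp add: s_def)
      qed
    qed
  qed
qed

text \<open>Averages \<open>cube_modulus\<close> against the kernel. The three cosine defects have
  mean \<open>1 / n\<close> each, so the error is at most \<open>\<epsilon> / 2 + 3 * M / n\<close>.
  The zero boundary values make \<open>c\<close> continuous as a function on the torus.\<close>

lemma approx_continuous:
  fixes c :: "vec3 \<Rightarrow> real"
  assumes c: "continuous_on UNIV c" and z: "\<And>x i. x \<in> cbox 0 One \<Longrightarrow> x $ i = 0 \<or> x $ i = 1 \<Longrightarrow> c x = 0" and e: "\<epsilon> > 0"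
  shows "\<exists>N. \<forall>n\<ge>N. \<forall>x\<in>cbox 0 One. \<bar>approx n c x - c x\<bar> \<le> \<epsilon>"
proof -
  obtain M where M: "M \<ge> 0" "\<And>x y. x \<in> cbox 0 One \<Longrightarrow> y \<in> cbox 0 One \<Longrightarrow>
     \<bar>c x - c y\<bar> \<le> \<epsilon>/2 + M * (\<Sum>i\<in>UNIV. 1 - cos (2 * pi * (x $ i - y $ i)))"
    by (rule cube_modulus[OF c z half_gt_zero[OF e]]) (assumption | rule that | blast)+
  obtain N :: nat where N: "real N > 6 * M / \<epsilon>" using reals_Archimedean2 by blast
  show ?thesis
  proof (intro exI[of _ "Suc N"] allI impI ballI)
    fix n and x :: vec3 assume n: "n \<ge> Suc N" and x: "x \<in> cbox 0 One"
    then have n0: "n > 0" by simp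
    have kn: "testfun (\<lambda>y. kern n (x - y))" by (rule sep_testfun(2)[OF sep_kern])
    have ck: "continuous_on UNIV (\<lambda>y. kern n (x - y))" by (rule C1per_cont[OF testfun_C1per[OF kn]])
    have k1: "(\<integral>y. kern n (x - y) \<partial>torus) = 1"
      using integral_kern[OF n0, of x] by (simp add: kern_commute[of n x])
    have k2: "(\<integral>y. (1 - cos (2 * pi * (x $ i - y $ i))) * kern n (x - y) \<partial>torus) = 1 / real n" for i
    proof -
      have "cos (2 * pi * (x $ i - y $ i)) = cos (2 * pi * (y $ i - x $ i))" for y :: vec3
        using cos_minus[of "2 * pi * (y $ i - x $ i)"] by (simp add: algebra_simps)
      then show ?thesis using integral_cos_kern[OF n0, of i x] by (simp add: kern_commute[of n x])
    qed
    have i: "integrable torus (\<lambda>y. g y * kern n (x - y))" if "continuous_on UNIV g" for g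
      by (intro integrable_torus_cont continuous_on_mult that ck)
    have "approx n c x - c x = (\<integral>y. c y * kern n (x - y) - c x * kern n (x - y) \<partial>torus)"
      using i[OF c] i[OF continuous_on_const[of _ 1]] k1 by (simp add: approx_def)
    then have "\<bar>approx n c x - c x\<bar> \<le> (\<integral>y. \<bar>c y * kern n (x - y) - c x * kern n (x - y)\<bar> \<partial>torus)"
      using integral_abs_bound by metis
    also have "\<dots> \<le> (\<integral>y. \<epsilon>/2 * kern n (x - y) + M * (\<Sum>i\<in>UNIV. (1 - cos (2 * pi * (x $ i - y $ i))) * kern n (x - y)) \<partial>torus)"
    proof (rule integral_mono)
      show "integrable torus (\<lambda>y. \<bar>c y * kern n (x - y) - c x * kern n (x - y)\<bar>)"
        using i[OF c] i[OF continuous_on_const[of _ "c x"]] by (intro integrable_abs Bochner_Integration.integrable_diff)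
      show "integrable torus (\<lambda>y. \<epsilon>/2 * kern n (x - y) + M * (\<Sum>i\<in>UNIV. (1 - cos (2 * pi * (x $ i - y $ i))) * kern n (x - y)))"
        by (intro integrable_torus_cont continuous_intros ck)
      fix y assume "y \<in> space torus"
      then have "\<bar>c x - c y\<bar> \<le> \<epsilon>/2 + M * (\<Sum>i\<in>UNIV. 1 - cos (2 * pi * (x $ i - y $ i)))" using M(2) x by simp
      then have "\<bar>c x - c y\<bar> * kern n (x - y) \<le> (\<epsilon>/2 + M * (\<Sum>i\<in>UNIV. 1 - cos (2 * pi * (x $ i - y $ i)))) * kern n (x - y)"
        by (intro mult_right_mono kern_nonneg)
      moreover have "\<bar>c y * kern n (x - y) - c x * kern n (x - y)\<bar> = \<bar>c x - c y\<bar> * kern n (x - y)"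
        using kern_nonneg[of n "x - y"] by (simp add: left_diff_distrib[symmetric] abs_mult abs_minus_commute)
      ultimately show "\<bar>c y * kern n (x - y) - c x * kern n (x - y)\<bar> \<le> \<epsilon>/2 * kern n (x - y) + M * (\<Sum>i\<in>UNIV. (1 - cos (2 * pi * (x $ i - y $ i))) * kern n (x - y))"
        by (simp add: sum_distrib_right distrib_right mult.assoc)
    qed
    also have "\<dots> = \<epsilon>/2 * 1 + M * (\<Sum>i\<in>(UNIV::3 set). 1 / real n)"
    proof -
      have "integrable torus (\<lambda>y. (1 - cos (2 * pi * (x $ i - y $ i))) * kern n (x - y))" for i by (intro i continuous_intros)
      then show ?thesis using i[OF continuous_on_const[of _ 1]] by (simp add: k1 k2 Bochner_Integration.integral_sum)
    qed
    also have "\<dots> = \<epsilon>/2 + 3 * M / real n" by simp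
    also have "\<dots> \<le> \<epsilon>/2 + \<epsilon>/2"
    proof -
      have "6 * M / \<epsilon> < real n" using N n by linarith
      then have "3 * M / real n \<le> \<epsilon> / 2" using e n0 by (simp add: field_simps)
      then show ?thesis by simp
    qed
    finally show "\<bar>approx n c x - c x\<bar> \<le> \<epsilon>" by simp
  qed
qed

section \<open>Density in L^p and weak convergence of the Fejer means\<close>

lemma AE_torus_interior: "AE x in torus. x \<in> box 0 One"
proof -
  have "negligible (cbox 0 One - box 0 (One::vec3))" by (rule negligible_frontier_interval)
  then have "cbox 0 One - box 0 (One::vec3) \<in> null_sets lebesgue" by (simp add: negligible_iff_null_sets)
  then have "cbox 0 One - box 0 (One::vec3) \<in> null_sets (lebesgue_on (cbox 0 One))"
    by (subst null_sets_restrict_space) auto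
  then have "AE x in torus. x \<notin> cbox 0 One - box 0 One" unfolding torus_def by (rule AE_not_in)
  moreover have "AE x in torus. x \<in> cbox 0 One" by (intro AE_I2) simp
  ultimately show ?thesis by eventually_elim auto
qed

lemma negligible_AE_torus: "negligible N \<Longrightarrow> AE x in torus. x \<notin> N"
proof -
  assume "negligible N"
  then have "negligible (N \<inter> cbox 0 One)" by (rule negligible_Int[OF disjI1])
  then have "N \<inter> cbox 0 One \<in> null_sets (lebesgue_on (cbox 0 One))"
    by (subst null_sets_restrict_space) (auto simp: negligible_iff_null_sets)
  then have "AE x in torus. x \<notin> N \<inter> cbox 0 One" unfolding torus_def by (rule AE_not_in)
  moreover have "AE x in torus. x \<in> cbox 0 One" by (intro AE_I2) simp
  ultimately show ?thesis by eventually_elim auto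
qed

text \<open>Measurability supplies continuous functions that converge almost everywhere. Clamping
  them to \<open>[-M, M]\<close> makes them dominated, and the factor \<open>k n\<close>, zero on
  the boundary and eventually one at each interior point, enforces the boundary values.\<close>

lemma Lr_dense_bounded:
  fixes w :: "vec3 \<Rightarrow> real"
  assumes p: "0 < p" and w: "w \<in> borel_measurable torus" "\<And>x. \<bar>w x\<bar> \<le> M" and e: "\<epsilon> > 0"
  obtains c where "continuous_on UNIV c" "\<And>x i. x \<in> cbox 0 One \<Longrightarrow> x $ i = 0 \<or> x $ i = 1 \<Longrightarrow> c x = 0"
    "(\<integral>x. \<bar>w x - c x\<bar> powr p \<partial>torus) < \<epsilon>"
proof -
  have M: "M \<ge> 0" using w(2)[of 0] by linarith
  have "w measurable_on cbox 0 One"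
    using w(1) unfolding torus_def by (simp add: measurable_on_iff_borel_measurable)
  then obtain N g where N: "negligible N" and g: "\<And>n. continuous_on UNIV (g n)"
    and lim: "\<And>x. x \<notin> N \<Longrightarrow> (\<lambda>n. g n x) \<longlonglongrightarrow> (if x \<in> cbox 0 One then w x else 0)"
    unfolding measurable_on_def by metis
  define cl where "cl t = max (- M) (min M t)" for t
  define k where "k n x = min 1 (real n * (\<Prod>i\<in>UNIV. (1 - cos (2 * pi * x $ i))))" for n and x :: vec3
  define c where "c n x = cl (g n x) * k n x" for n x
  have cont: "continuous_on UNIV (c n)" for n
    unfolding c_def cl_def k_def by (intro continuous_intros g)
  have k01: "0 \<le> k n x" "k n x \<le> 1" for n x unfolding k_def by (auto intro!: mult_nonneg_nonneg prod_nonneg)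
  have clb: "\<bar>cl t\<bar> \<le> M" for t using M unfolding cl_def by auto
  have cb: "\<bar>c n x\<bar> \<le> M" for n x
    unfolding c_def abs_mult using clb k01[of n x] M by (metis abs_of_nonneg mult_left_le mult_right_mono order_trans)
  have zero: "c n x = 0" if "x $ i = 0 \<or> x $ i = 1" for n x i
  proof -
    have "1 - cos (2 * pi * x $ i) = 0" using that by auto
    then have P0: "(\<Prod>i\<in>UNIV. (1 - cos (2 * pi * x $ i))) = 0" by (intro prod_zero) auto
    show ?thesis unfolding c_def k_def P0 by simp
  qed
  have "(\<lambda>n. \<integral>x. \<bar>w x - c n x\<bar> powr p \<partial>torus) \<longlonglongrightarrow> (\<integral>x. 0 \<partial>torus)"
  proof (rule integral_dominated_convergence[where w="\<lambda>x. (2 * M) powr p"])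
    show "AE x in torus. (\<lambda>n. \<bar>w x - c n x\<bar> powr p) \<longlonglongrightarrow> 0"
      using AE_torus_interior negligible_AE_torus[OF N]
    proof eventually_elim
      case (elim x)
      then have xc: "x \<in> cbox 0 One" using box_subset_cbox by blast
      have "(\<lambda>n. cl (g n x)) \<longlonglongrightarrow> cl (w x)"
        unfolding cl_def using lim[of x] elim xc by (intro tendsto_intros) auto
      moreover have "cl (w x) = w x" using w(2)[of x] by (auto simp: cl_def)
      moreover have "(\<lambda>n. k n x) \<longlonglongrightarrow> 1"
      proof -
        have "1 - cos (2 * pi * x $ i) > 0" for i
        proof -
          have r: "0 < x $ i" "x $ i < 1" using elim by (auto simp: mem_box_cart)
          have "cos (2 * pi * x $ i) \<noteq> 1"
          proof
            assume "cos (2 * pi * x $ i) = 1"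
            then obtain n :: int where "2 * pi * x $ i = of_int n * 2 * pi" using cos_one_2pi_int by auto
            then have "(2 * pi) * x $ i = (2 * pi) * of_int n" by (simp only: mult.commute mult.left_commute)
            then have "x $ i = of_int n" by simp
            then show False using r by simp
          qed
          then show ?thesis using cos_le_one[of "2 * pi * x $ i"] by linarith
        qed
        then have P: "(\<Prod>i\<in>UNIV. (1 - cos (2 * pi * x $ i))) > 0" (is "?P > 0") by (intro prod_pos) auto
        obtain n0 :: nat where "real n0 > 1 / ?P" using reals_Archimedean2 by blast
        then have "\<forall>n\<ge>n0. k n x = 1"
        proof (intro allI impI)
          fix n assume "n0 \<le> n" "1 / ?P < real n0"
          then have "1 / ?P < real n" by linarith
          then have "1 \<le> real n * ?P" using P by (simp add: field_simps)
          then show "k n x = 1" by (simp add: k_def)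
        qed
        then show ?thesis by (intro tendsto_eventually eventually_sequentiallyI) blast
      qed
      ultimately have "(\<lambda>n. c n x) \<longlonglongrightarrow> w x * 1" unfolding c_def by (intro tendsto_mult) auto
      then have "(\<lambda>n. w x - c n x) \<longlonglongrightarrow> w x - w x * 1" by (intro tendsto_diff tendsto_const)
      then have "(\<lambda>n. \<bar>w x - c n x\<bar>) \<longlonglongrightarrow> 0" by (intro tendsto_rabs_zero) simp
      then show ?case using p by (intro tendsto_zero_powrI[where b=p]) auto
    qed
    show "AE x in torus. norm (\<bar>w x - c n x\<bar> powr p) \<le> (2 * M) powr p" for n
    proof (intro AE_I2)
      fix x
      have "\<bar>w x - c n x\<bar> \<le> 2 * M" using w(2)[of x] cb[of n x] by linarith
      then show "norm (\<bar>w x - c n x\<bar> powr p) \<le> (2 * M) powr p" using p by (simp add: powr_mono2)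
    qed
  qed (use w meas_torus_cont[OF cont] in auto)
  then have "(\<lambda>n. \<integral>x. \<bar>w x - c n x\<bar> powr p \<partial>torus) \<longlonglongrightarrow> 0" by simp
  from eventually_happens[OF order_tendstoD(2)[OF this e]]
  obtain n where "(\<integral>x. \<bar>w x - c n x\<bar> powr p \<partial>torus) < \<epsilon>" by auto
  then show ?thesis using that[of "c n"] cont zero by blast
qed

text \<open>Truncation reduces the claim to \<open>Lr_dense_bounded\<close>. The tolerance
  \<open>e'\<close> shares \<open>\<epsilon>\<close> between the two errors after the factor
  \<open>2 powr p\<close> of \<open>powr_add_le\<close>.\<close>

lemma Lr_dense:
  assumes p: "0 < p" and u: "Lr p u" and e: "\<epsilon> > 0"
  obtains c where "continuous_on UNIV c" "\<And>x i. x \<in> cbox 0 One \<Longrightarrow> x $ i = 0 \<or> x $ i = 1 \<Longrightarrow> c x = 0"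
    "(\<integral>x. \<bar>u x - c x\<bar> powr p \<partial>torus) < \<epsilon>"
proof -
  define w where "w M x = max (- real M) (min (real M) (u x))" for M x
  have mu: "u \<in> borel_measurable torus" using u by (rule Lr_meas)
  have mw: "w M \<in> borel_measurable torus" for M unfolding w_def using mu by measurable
  have bw: "\<bar>w M x\<bar> \<le> real M" for M x unfolding w_def by auto
  have dw: "\<bar>u x - w M x\<bar> \<le> \<bar>u x\<bar>" for M x unfolding w_def by (auto simp: max_def min_def)
  have "(\<lambda>M. \<integral>x. \<bar>u x - w M x\<bar> powr p \<partial>torus) \<longlonglongrightarrow> (\<integral>x. 0 \<partial>torus)"
  proof (rule integral_dominated_convergence[where w="\<lambda>x. \<bar>u x\<bar> powr p"])
    show "AE x in torus. (\<lambda>M. \<bar>u x - w M x\<bar> powr p) \<longlonglongrightarrow> 0"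
    proof (intro AE_I2)
      fix x
      obtain M0 :: nat where M0: "real M0 > \<bar>u x\<bar>" using reals_Archimedean2 by blast
      then have "\<forall>M\<ge>M0. \<bar>u x - w M x\<bar> powr p = 0" by (auto simp: w_def max_def min_def)
      then show "(\<lambda>M. \<bar>u x - w M x\<bar> powr p) \<longlonglongrightarrow> 0" by (intro tendsto_eventually eventually_sequentiallyI) blast
    qed
    show "AE x in torus. norm (\<bar>u x - w M x\<bar> powr p) \<le> \<bar>u x\<bar> powr p" for M
      using dw p by (intro AE_I2) (simp add: powr_mono2)
  qed (use u mu mw in \<open>auto simp: Lr_def\<close>)
  then have lim0: "(\<lambda>M. \<integral>x. \<bar>u x - w M x\<bar> powr p \<partial>torus) \<longlonglongrightarrow> 0" by simp
  define e' where "e' = \<epsilon> / (2 * 2 powr p)"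
  have e': "e' > 0" using e by (simp add: e'_def)
  from eventually_happens[OF order_tendstoD(2)[OF lim0 e']]
  obtain M where M: "(\<integral>x. \<bar>u x - w M x\<bar> powr p \<partial>torus) < e'" by auto
  obtain c where c: "continuous_on UNIV c" "\<And>x i. x \<in> cbox 0 One \<Longrightarrow> x $ i = 0 \<or> x $ i = 1 \<Longrightarrow> c x = 0"
    "(\<integral>x. \<bar>w M x - c x\<bar> powr p \<partial>torus) < e'"
    using Lr_dense_bounded[OF p mw bw e'] by blast
  have Lw: "Lr p (w M)" 
    by (rule Lr_dom[where g="\<lambda>_. real M powr p"]) (use mw bw p in \<open>auto intro!: powr_mono2\<close>)
  have Lc: "Lr p c" using c(1) p by (simp add: Lr_cont)
  have i1: "integrable torus (\<lambda>x. \<bar>u x - w M x\<bar> powr p)" "integrable torus (\<lambda>x. \<bar>w M x - c x\<bar> powr p)" "integrable torus (\<lambda>x. \<bar>u x - c x\<bar> powr p)"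
    using Lr_diff[OF u Lw] Lr_diff[OF Lw Lc] Lr_diff[OF u Lc] p by (auto simp: Lr_def)
  have "(\<integral>x. \<bar>u x - c x\<bar> powr p \<partial>torus) \<le> (\<integral>x. 2 powr p * (\<bar>u x - w M x\<bar> powr p + \<bar>w M x - c x\<bar> powr p) \<partial>torus)"
  proof (rule integral_mono)
    fix x
    have "\<bar>u x - c x\<bar> powr p \<le> (\<bar>u x - w M x\<bar> + \<bar>w M x - c x\<bar>) powr p" using p by (intro powr_mono2) auto
    also have "\<dots> \<le> 2 powr p * (\<bar>u x - w M x\<bar> powr p + \<bar>w M x - c x\<bar> powr p)" using p by (intro powr_add_le) auto
    finally show "\<bar>u x - c x\<bar> powr p \<le> 2 powr p * (\<bar>u x - w M x\<bar> powr p + \<bar>w M x - c x\<bar> powr p)" .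
  qed (use i1 in auto)
  also have "\<dots> = 2 powr p * ((\<integral>x. \<bar>u x - w M x\<bar> powr p \<partial>torus) + (\<integral>x. \<bar>w M x - c x\<bar> powr p \<partial>torus))"
    using i1 by simp
  also have "\<dots> < 2 powr p * (e' + e')" using M c(3) by (intro mult_strict_left_mono add_strict_mono) auto
  also have "\<dots> = \<epsilon>" by (simp add: e'_def)
  finally have fin: "(\<integral>x. \<bar>u x - c x\<bar> powr p \<partial>torus) < \<epsilon>" .
  show ?thesis by (rule that[OF c(1) _ fin]) (rule c(2))
qed

text \<open>\<open>u\<close> is split into a continuous \<open>c\<close> and a remainder small in
  L^p. The Fejer means of \<open>c\<close> converge uniformly, and those of the remainder are
  controlled by \<open>integral_approx_le\<close>.\<close>

theorem approx_weak:
  assumes p: "1 < p" and a: "Lr (p / (p - 1)) a" and u: "Lr p u"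
  shows "(\<lambda>n. \<integral>x. a x * approx n u x \<partial>torus) \<longlonglongrightarrow> (\<integral>x. a x * u x \<partial>torus)"
proof (rule LIMSEQ_I)
  fix \<epsilon> :: real assume e: "\<epsilon> > 0"
  have p': "1 < p / (p - 1)" using p by (simp add: field_simps)
  have ia: "integrable torus a" using Lr_integrable[OF a] p' by simp
  define A where "A = (\<integral>x. \<bar>a x\<bar> powr (p / (p - 1)) \<partial>torus)"
  have A: "A \<ge> 0" unfolding A_def by simp
  \<comment> \<open>The order of the choices matters: \<open>\<delta>\<close> is adapted to
    \<open>a\<close>, it determines \<open>C\<close>, then \<open>\<epsilon>'\<close> limits the
    remainder of \<open>u\<close> against \<open>C\<close>, and \<open>\<rho>\<close> limits the
    uniform error against the integral of the modulus of \<open>a\<close>. Each of the three errors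
    is then at most \<open>\<epsilon> / 4\<close>.\<close>
  define \<delta> where "\<delta> = \<epsilon> / (8 * (A + 1))"
  have d: "\<delta> > 0" using e A by (simp add: \<delta>_def)
  have dA: "\<delta> * A \<le> \<epsilon> / 8" using e A by (simp add: \<delta>_def field_simps)
  obtain C where C: "C \<ge> 0" "\<And>a u n. Lr (p / (p - 1)) a \<Longrightarrow> Lr p u \<Longrightarrow> n > 0 \<Longrightarrow>
    \<bar>\<integral>x. a x * approx n u x \<partial>torus\<bar> \<le> \<delta> * (\<integral>x. \<bar>a x\<bar> powr (p / (p - 1)) \<partial>torus) + C * (\<integral>x. \<bar>u x\<bar> powr p \<partial>torus)"
     "\<And>a u. Lr (p / (p - 1)) a \<Longrightarrow> Lr p u \<Longrightarrow>
    \<bar>\<integral>x. a x * u x \<partial>torus\<bar> \<le> \<delta> * (\<integral>x. \<bar>a x\<bar> powr (p / (p - 1)) \<partial>torus) + C * (\<integral>x. \<bar>u x\<bar> powr p \<partial>torus)"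
    using integral_approx_le[OF p d] by blast
  define \<epsilon>' where "\<epsilon>' = \<epsilon> / (8 * (C + 1))"
  have e': "\<epsilon>' > 0" using e C(1) by (simp add: \<epsilon>'_def)
  have Ce: "C * t \<le> \<epsilon> / 8" if "t < \<epsilon>'" "0 \<le> t" for t
  proof -
    have "C * t \<le> (C + 1) * \<epsilon>'" using that C(1) by (intro mult_mono) auto
    also have "\<dots> = \<epsilon> / 8" using C(1) by (simp add: \<epsilon>'_def field_simps)
    finally show ?thesis .
  qed
  obtain c where c: "continuous_on UNIV c" "\<And>x i. x \<in> cbox 0 One \<Longrightarrow> x $ i = 0 \<or> x $ i = 1 \<Longrightarrow> c x = 0"
    "(\<integral>x. \<bar>u x - c x\<bar> powr p \<partial>torus) < \<epsilon>'" using Lr_dense[OF _ u e'] p by auto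
  define I where "I = (\<integral>x. \<bar>a x\<bar> \<partial>torus)"
  have I: "I \<ge> 0" unfolding I_def by simp
  define \<rho> where "\<rho> = \<epsilon> / (4 * (I + 1))"
  have r: "\<rho> > 0" using e I by (simp add: \<rho>_def)
  obtain N where N: "\<And>n x. n \<ge> N \<Longrightarrow> x \<in> cbox 0 One \<Longrightarrow> \<bar>approx n c x - c x\<bar> \<le> \<rho>"
  proof -
    have "\<exists>N. \<forall>n\<ge>N. \<forall>x\<in>cbox 0 One. \<bar>approx n c x - c x\<bar> \<le> \<rho>"
      by (rule approx_continuous[OF c(1) _ r]) (rule c(2))
    then show ?thesis using that by blast
  qed
  have Lc: "Lr p c" using c(1) p by (simp add: Lr_cont)
  have Ld: "Lr p (\<lambda>x. u x - c x)" using Lr_diff[OF u Lc] p by simp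
  have iu: "integrable torus u" "integrable torus c" using Lr_integrable[OF u] integrable_torus_cont[OF c(1)] p by auto
  show "\<exists>no. \<forall>n\<ge>no. norm ((\<integral>x. a x * approx n u x \<partial>torus) - (\<integral>x. a x * u x \<partial>torus)) < \<epsilon>"
  proof (intro exI[of _ "Suc N"] allI impI)
    fix n assume n: "n \<ge> Suc N"
    have lin: "approx n (\<lambda>x. u x - c x) x = approx n u x - approx n c x" for x
      using sep_int[OF sep_kern iu(1)] sep_int[OF sep_kern iu(2)] by (simp add: approx_def left_diff_distrib)
    have t: "integrable torus (\<lambda>x. a x * approx n v x)" if "integrable torus v" for v
      by (rule testfun_mult_int[OF testfun_approx[OF that] ia])
    have ac: "integrable torus (\<lambda>x. a x * c x)" "integrable torus (\<lambda>x. a x * u x)"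
      using Lr_dual_integrable[OF p a] Lc u by auto
    have E1: "\<bar>\<integral>x. a x * approx n (\<lambda>x. u x - c x) x \<partial>torus\<bar> \<le> \<epsilon>/4"
      using C(2)[OF a Ld, of n] n dA Ce[OF c(3)] by (simp add: A_def)
    have E2: "\<bar>\<integral>x. a x * (u x - c x) \<partial>torus\<bar> \<le> \<epsilon>/4"
      using C(3)[OF a Ld] dA Ce[OF c(3)] by (simp add: A_def)
    have E3: "\<bar>\<integral>x. a x * (approx n c x - c x) \<partial>torus\<bar> \<le> \<epsilon>/4"
    proof -
      have "\<bar>\<integral>x. a x * (approx n c x - c x) \<partial>torus\<bar> \<le> (\<integral>x. \<bar>a x * (approx n c x - c x)\<bar> \<partial>torus)" by (rule integral_abs_bound)
      also have "\<dots> \<le> (\<integral>x. \<bar>a x\<bar> * \<rho> \<partial>torus)"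
      proof (rule integral_mono)
        show "integrable torus (\<lambda>x. \<bar>a x * (approx n c x - c x)\<bar>)"
          using t[OF iu(2)] ac by (intro integrable_abs) (simp add: right_diff_distrib)
        fix x assume "x \<in> space torus"
        then show "\<bar>a x * (approx n c x - c x)\<bar> \<le> \<bar>a x\<bar> * \<rho>" unfolding abs_mult using N n by (intro mult_left_mono) auto
      qed (use ia in simp)
      also have "\<dots> = I * \<rho>" by (simp add: I_def)
      also have "\<dots> \<le> (I + 1) * \<rho>" using r by (intro mult_right_mono) auto
      also have "\<dots> = \<epsilon>/4" using I by (simp add: \<rho>_def field_simps)
      finally show ?thesis .
    qed
    have "(\<integral>x. a x * approx n u x \<partial>torus) - (\<integral>x. a x * u x \<partial>torus)
       = (\<integral>x. a x * approx n (\<lambda>x. u x - c x) x \<partial>torus) + (\<integral>x. a x * (approx n c x - c x) \<partial>torus) - (\<integral>x. a x * (u x - c x) \<partial>torus)"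
      unfolding lin using t[OF iu(1)] t[OF iu(2)] ac by (simp add: right_diff_distrib)
    then show "norm ((\<integral>x. a x * approx n u x \<partial>torus) - (\<integral>x. a x * u x \<partial>torus)) < \<epsilon>"
      using E1 E2 E3 e by simp
  qed
qed

section \<open>Weak derivatives\<close>

definition weak_grad :: "real \<Rightarrow> (vec3 \<Rightarrow> real) \<Rightarrow> (3 \<Rightarrow> vec3 \<Rightarrow> real) \<Rightarrow> bool" where
  "weak_grad p u m \<longleftrightarrow> Lr p u \<and> (\<forall>\<alpha>. Lr p (m \<alpha>)) \<and>
     (\<forall>\<phi> \<alpha>. testfun \<phi> \<longrightarrow> (\<integral>x. u x * dx \<alpha> \<phi> x \<partial>torus) = - (\<integral>x. m \<alpha> x * \<phi> x \<partial>torus))"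

text \<open>The Fejer means of \<open>u\<close> are test functions whose derivatives are the Fejer
  means of \<open>m\<close>. The weak form holds for them and passes to the limit by
  \<open>approx_weak\<close>.\<close>

lemma weak_form_extends:
  assumes p: "1 < p" and a: "Lr (p / (p - 1)) a" and s: "\<And>\<alpha>. Lr (p / (p - 1)) (s \<alpha>)"
    and weak: "\<And>\<phi>. testfun \<phi> \<Longrightarrow> (\<integral>x. a x * \<phi> x \<partial>torus) = - (\<Sum>\<alpha>\<in>UNIV. \<integral>x. s \<alpha> x * dx \<alpha> \<phi> x \<partial>torus)"
    and u: "weak_grad p u m"
  shows "(\<integral>x. a x * u x \<partial>torus) = - (\<Sum>\<alpha>\<in>UNIV. \<integral>x. s \<alpha> x * m \<alpha> x \<partial>torus)"
proof -
  have L: "Lr p u" "\<And>\<alpha>. Lr p (m \<alpha>)" using u by (auto simp: weak_grad_def)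
  have iu: "integrable torus u" using Lr_integrable[OF L(1)] p by simp
  have "dx \<alpha> (approx n u) = approx n (m \<alpha>)" for n \<alpha>
    using dx_approx[OF iu, of \<alpha> "m \<alpha>"] u by (auto simp: weak_grad_def)
  then have "(\<integral>x. a x * approx n u x \<partial>torus) = - (\<Sum>\<alpha>\<in>UNIV. \<integral>x. s \<alpha> x * approx n (m \<alpha>) x \<partial>torus)" for n
    using weak[OF testfun_approx[OF iu, of n]] by simp
  moreover have "(\<lambda>n. \<integral>x. a x * approx n u x \<partial>torus) \<longlonglongrightarrow> (\<integral>x. a x * u x \<partial>torus)"
    by (rule approx_weak[OF p a L(1)])
  moreover have "(\<lambda>n. - (\<Sum>\<alpha>\<in>UNIV. \<integral>x. s \<alpha> x * approx n (m \<alpha>) x \<partial>torus)) \<longlonglongrightarrow> - (\<Sum>\<alpha>\<in>UNIV. \<integral>x. s \<alpha> x * m \<alpha> x \<partial>torus)"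
    by (intro tendsto_minus tendsto_sum approx_weak[OF p s L(2)])
  ultimately show ?thesis using LIMSEQ_unique by (simp only:)
qed

lemma weak_grad_C1per:
  assumes c: "C1per c" and p: "0 \<le> p"
  shows "weak_grad p c (\<lambda>\<alpha>. dx \<alpha> c)"
  unfolding weak_grad_def
proof (intro conjI allI impI)
  fix \<phi> \<alpha> assume "testfun \<phi>"
  then have f: "C1per \<phi>" by (rule testfun_C1per)
  have i: "integrable torus (\<lambda>x. c x * dx \<alpha> \<phi> x)" "integrable torus (\<lambda>x. dx \<alpha> c x * \<phi> x)"
    by (intro integrable_torus_cont continuous_on_mult C1per_cont C1per_dx_cont c f)+
  have "(\<integral>x. c x * dx \<alpha> \<phi> x + dx \<alpha> c x * \<phi> x \<partial>torus) = 0"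
    using torus_ibp[OF C1per_mult[OF c f], of \<alpha>] by (simp add: dx_mult[OF c f])
  then show "(\<integral>x. c x * dx \<alpha> \<phi> x \<partial>torus) = - (\<integral>x. dx \<alpha> c x * \<phi> x \<partial>torus)" using i by simp
qed (use p in \<open>auto intro!: Lr_cont C1per_cont C1per_dx_cont c\<close>)

lemma dual_le: "2 \<le> (p::real) \<Longrightarrow> p / (p - 1) \<le> p" "2 \<le> (p::real) \<Longrightarrow> p / (p - 1) \<le> 2" "2 \<le> p \<Longrightarrow> 0 \<le> p / (p - 1)"
  by (simp_all add: field_simps)

text \<open>As \<open>c\<close> is only C^1, its product with a test function is no test function.
  It is nevertheless an admissible argument of \<open>weak_form_extends\<close>, applied with
  \<open>u\<close> and \<open>m\<close> as the dual fields; p \<ge> 2 puts them into the dual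
  class.\<close>

lemma weak_grad_mult_C1per:
  assumes u: "weak_grad p u m" and c: "C1per c" and p: "2 \<le> p"
  shows "weak_grad p (\<lambda>x. u x * c x) (\<lambda>\<alpha> x. m \<alpha> x * c x + u x * dx \<alpha> c x)"
  unfolding weak_grad_def
proof (intro conjI allI impI)
  have L: "Lr p u" "\<And>\<alpha>. Lr p (m \<alpha>)" using u by (auto simp: weak_grad_def)
  show "Lr p (\<lambda>x. u x * c x)" using L p by (intro Lr_mult_cont C1per_cont c) auto
  show "Lr p (\<lambda>x. m \<alpha> x * c x + u x * dx \<alpha> c x)" for \<alpha>
    using L p by (intro Lr_add Lr_mult_cont C1per_cont C1per_dx_cont c) auto
  fix \<phi> \<alpha> assume "testfun \<phi>"
  then have f: "C1per \<phi>" by (rule testfun_C1per)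
  have L': "Lr (p / (p - 1)) u" "Lr (p / (p - 1)) (m \<alpha>)"
    using L Lr_mono dual_le[OF p] by blast+
  have iu: "integrable torus u" "integrable torus (m \<alpha>)" using Lr_integrable[OF L(1)] Lr_integrable[OF L(2)] p by simp_all
  have cf: "C1per (\<lambda>x. c x * \<phi> x)" by (rule C1per_mult[OF c f])
  \<comment> \<open>A single partial derivative is presented as a divergence with one nonzero flux,
    to fit the form of \<open>weak_form_extends\<close>.\<close>
  have "(\<integral>x. m \<alpha> x * (c x * \<phi> x) \<partial>torus)
      = - (\<Sum>\<beta>\<in>UNIV. \<integral>x. (if \<beta> = \<alpha> then u x else 0) * dx \<beta> (\<lambda>x. c x * \<phi> x) x \<partial>torus)"
  proof (rule weak_form_extends[of p])
    show "Lr (p / (p - 1)) (\<lambda>x. if \<beta> = \<alpha> then u x else 0)" for \<beta> using L' by (cases "\<beta> = \<alpha>") (auto simp: Lr_const)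
    show "weak_grad p (\<lambda>x. c x * \<phi> x) (\<lambda>\<beta>. dx \<beta> (\<lambda>x. c x * \<phi> x))" using cf p by (intro weak_grad_C1per) auto
    fix \<psi> assume "testfun \<psi>"
    then have "(\<integral>x. m \<alpha> x * \<psi> x \<partial>torus) = - (\<integral>x. u x * dx \<alpha> \<psi> x \<partial>torus)" using u by (auto simp: weak_grad_def)
    also have "(\<integral>x. u x * dx \<alpha> \<psi> x \<partial>torus) = (\<Sum>\<beta>\<in>UNIV. if \<beta> = \<alpha> then \<integral>x. u x * dx \<beta> \<psi> x \<partial>torus else 0)" by (simp add: sum.delta)
    also have "\<dots> = (\<Sum>\<beta>\<in>UNIV. \<integral>x. (if \<beta> = \<alpha> then u x else 0) * dx \<beta> \<psi> x \<partial>torus)" by (intro sum.cong) auto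
    finally show "(\<integral>x. m \<alpha> x * \<psi> x \<partial>torus) = - (\<Sum>\<beta>\<in>UNIV. \<integral>x. (if \<beta> = \<alpha> then u x else 0) * dx \<beta> \<psi> x \<partial>torus)" .
  qed (use p L' in auto)
  also have "(\<Sum>\<beta>\<in>UNIV. \<integral>x. (if \<beta> = \<alpha> then u x else 0) * dx \<beta> (\<lambda>x. c x * \<phi> x) x \<partial>torus)
     = (\<Sum>\<beta>\<in>UNIV. if \<beta> = \<alpha> then \<integral>x. u x * dx \<beta> (\<lambda>x. c x * \<phi> x) x \<partial>torus else 0)" by (intro sum.cong) auto
  also have "\<dots> = (\<integral>x. u x * dx \<alpha> (\<lambda>x. c x * \<phi> x) x \<partial>torus)" by (simp add: sum.delta)
  also have "\<dots> = (\<integral>x. u x * (c x * dx \<alpha> \<phi> x) + u x * (dx \<alpha> c x * \<phi> x) \<partial>torus)" by (simp add: dx_mult[OF c f] distrib_left)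
  finally have "(\<integral>x. m \<alpha> x * (c x * \<phi> x) \<partial>torus) = - (\<integral>x. u x * (c x * dx \<alpha> \<phi> x) + u x * (dx \<alpha> c x * \<phi> x) \<partial>torus)" .
  moreover have "integrable torus (\<lambda>x. u x * (c x * dx \<alpha> \<phi> x))" "integrable torus (\<lambda>x. u x * (dx \<alpha> c x * \<phi> x))" "integrable torus (\<lambda>x. m \<alpha> x * (c x * \<phi> x))"
    by (intro integrable_torus_mult_cont iu continuous_on_mult C1per_cont C1per_dx_cont c f)+
  ultimately show "(\<integral>x. (u x * c x) * dx \<alpha> \<phi> x \<partial>torus) = - (\<integral>x. (m \<alpha> x * c x + u x * dx \<alpha> c x) * \<phi> x \<partial>torus)"
    by (simp add: distrib_right mult.assoc)
qed

text \<open>Testing with the Fejer means of the sign of \<open>w\<close> gives, in the limit, the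
  integral of its modulus.\<close>

lemma fundamental_lemma:
  assumes w: "Lr 2 w" and z: "\<And>\<phi>. testfun \<phi> \<Longrightarrow> (\<integral>x. w x * \<phi> x \<partial>torus) = 0"
  shows "AE x in torus. w x = 0"
proof -
  have mw: "w \<in> borel_measurable torus" using w by (rule Lr_meas)
  have s: "Lr 2 (\<lambda>x. sgn (w x))"
    by (rule Lr_dom[where g="\<lambda>_. 1"]) (use mw in \<open>auto simp: abs_sgn_eq\<close>)
  have "(\<lambda>n. \<integral>x. w x * approx n (\<lambda>x. sgn (w x)) x \<partial>torus) \<longlonglongrightarrow> (\<integral>x. w x * sgn (w x) \<partial>torus)"
    using w s by (intro approx_weak[of 2]) auto
  moreover have "(\<integral>x. w x * approx n (\<lambda>x. sgn (w x)) x \<partial>torus) = 0" for n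
    using Lr_integrable[OF s] by (intro z testfun_approx) simp
  ultimately have "(\<integral>x. \<bar>w x\<bar> \<partial>torus) = 0"
    using LIMSEQ_unique[OF _ tendsto_const] by (simp add: abs_sgn mult.commute)
  moreover have "integrable torus (\<lambda>x. \<bar>w x\<bar>)" using Lr_integrable[OF w] by simp
  ultimately show ?thesis using integral_nonneg_eq_0_iff_AE[of torus "\<lambda>x. \<bar>w x\<bar>"] by simp
qed

text \<open>The points of the open cube at which a continuous \<open>w\<close> is nonzero form an
  open null set, hence none exist.\<close>

lemma fundamental_lemma_cont:
  assumes w: "continuous_on UNIV w" and z: "\<And>\<phi>. testfun \<phi> \<Longrightarrow> (\<integral>x. w x * \<phi> x \<partial>torus) = 0"
    and x: "x \<in> box 0 One"
  shows "w x = 0"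
proof -
  have "AE x in torus. w x = 0" by (rule fundamental_lemma[OF Lr_cont[OF w] z]) auto
  then have "AE x in torus. x \<notin> {x \<in> box 0 One. w x \<noteq> 0}" by eventually_elim auto
  moreover have o: "open {x \<in> box 0 One. w x \<noteq> 0}"
  proof -
    have "open (box 0 One \<inter> w -` (- {0}))"
      using w by (intro open_Int open_box continuous_open_vimage) (auto simp: continuous_on_eq_continuous_at)
    moreover have "box 0 One \<inter> w -` (- {0}) = {x \<in> box 0 One. w x \<noteq> 0}" by auto
    ultimately show ?thesis by simp
  qed
  moreover have sub: "{x \<in> box 0 One. w x \<noteq> 0} \<subseteq> cbox 0 One" using box_subset_cbox by blast
  ultimately have "{x \<in> box 0 One. w x \<noteq> 0} \<in> null_sets (lebesgue_on (cbox 0 One))"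
    using AE_iff_null_sets[of "{x \<in> box 0 One. w x \<noteq> 0}" torus] unfolding torus_def
    by (simp add: sets_restrict_space_iff lborelD)
  then have "negligible {x \<in> box 0 One. w x \<noteq> 0}"
    by (subst (asm) null_sets_restrict_space) (auto simp: negligible_iff_null_sets)
  then have "{x \<in> box 0 One. w x \<noteq> 0} = {}" using o open_not_negligible by blast
  then show ?thesis using x by blast
qed

section \<open>Null Lagrangians\<close>

lemma four_five: "(4::3) = 1" "(5::3) = 2"
  by simp_all

lemma index3: "(1::3) + 1 = 2" "(2::3) + 1 = 3" "(3::3) + 1 = 1" "(1::3) + 2 = 3" "(2::3) + 2 = 1" "(3::3) + 2 = 2"
  by simp_all

lemma distinct3: "(1::3) \<noteq> 2" "(1::3) \<noteq> 3" "(2::3) \<noteq> 3" "(2::3) \<noteq> 1" "(3::3) \<noteq> 1" "(3::3) \<noteq> 2"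
  by simp_all

text \<open>The derivative of the pairing of \<open>cof F\<close> with \<open>Z\<close> in the entry
  \<open>(i, \<alpha>)\<close>; each of the four terms comes from a cofactor that contains this
  entry.\<close>

definition dcof :: "mat3 \<Rightarrow> 3 \<Rightarrow> 3 \<Rightarrow> mat3 \<Rightarrow> real" where
  "dcof Z i \<alpha> F = Z $ (i + 2) $ (\<alpha> + 2) * F $ (i + 1) $ (\<alpha> + 1) + Z $ (i + 1) $ (\<alpha> + 1) * F $ (i + 2) $ (\<alpha> + 2)
     - Z $ (i + 2) $ (\<alpha> + 1) * F $ (i + 1) $ (\<alpha> + 2) - Z $ (i + 1) $ (\<alpha> + 2) * F $ (i + 2) $ (\<alpha> + 1)"

lemma dPhi_eq: "dPhi A i \<alpha> F = fst A $ i $ \<alpha> + dcof (fst (snd A)) i \<alpha> F + snd (snd A) * cof F $ i $ \<alpha>"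
proof -
  obtain B Z w where A: "A = (B, Z, w)" by (cases A) auto
  have nth: "((\<lambda>F. F $ i $ j) has_derivative (\<lambda>v. v $ i $ j)) (at F)" for i j :: 3 and F :: mat3
    by (intro bounded_linear.has_derivative[OF bounded_linear_vec_nth] has_derivative_ident)
  have ax: "axis i (axis \<alpha> (1::real)) $ k $ l = (if k = i \<and> l = \<alpha> then 1 else 0)" for i k :: 3 and \<alpha> l :: 3
    by (simp add: axis_def)
  have ax2: "axis \<alpha> (1::real) $ l = (if l = \<alpha> then 1 else 0)" for \<alpha> l :: 3
    by (simp add: axis_def)
  have f: "(\<lambda>F. Phi F \<bullet> A) = (\<lambda>F. (\<Sum>k\<in>UNIV. \<Sum>l\<in>UNIV. F $ k $ l * B $ k $ l)
      + (\<Sum>k\<in>UNIV. \<Sum>l\<in>UNIV. cof F $ k $ l * Z $ k $ l) + det F * w)"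
    by (simp add: A Phi_def inner_vec_def add.assoc fun_eq_iff)
  have "pd (\<lambda>F. Phi F \<bullet> A) (axis i (axis \<alpha> 1)) F = B $ i $ \<alpha> + dcof Z i \<alpha> F + w * cof F $ i $ \<alpha>"
    \<comment> \<open>The pairing is an explicit polynomial in nine entries; after differentiation
      the nine positions of \<open>(i, \<alpha>)\<close> are checked one by one.\<close>
    unfolding f sum_3 det_3 cof_def vec_lambda_beta index3
    apply (rule trans[OF pd_eqI])
     apply (rule derivative_eq_intros nth refl)+
    using exhaust_3[of i] exhaust_3[of \<alpha>]
    by (elim disjE) (simp_all add: ax ax2 dcof_def four_five index3 distinct3 algebra_simps)
  then show ?thesis by (simp add: dPhi_def A)
qed

lemma continuous_dPhi: "continuous_on S (dPhi A i \<alpha>)"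
  unfolding dPhi_eq[abs_def] dcof_def cof_def by (simp, intro continuous_intros)

lemma Lr_mult_half:
  assumes u: "Lr p u" and v: "Lr p v" and p: "0 \<le> p"
  shows "Lr (p / 2) (\<lambda>x. u x * v x)"
proof (rule Lr_dom[where g="\<lambda>x. \<bar>u x\<bar> powr p + \<bar>v x\<bar> powr p"])
  fix x
  have m: "max \<bar>u x\<bar> \<bar>v x\<bar> \<ge> 0" by simp
  have "\<bar>u x * v x\<bar> powr (p / 2) \<le> (max \<bar>u x\<bar> \<bar>v x\<bar> * max \<bar>u x\<bar> \<bar>v x\<bar>) powr (p / 2)"
    unfolding abs_mult using p by (intro powr_mono2 mult_mono) auto
  also have "\<dots> = max \<bar>u x\<bar> \<bar>v x\<bar> powr p" using m by (simp add: powr_mult powr_add[symmetric])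
  also have "\<dots> \<le> \<bar>u x\<bar> powr p + \<bar>v x\<bar> powr p" by (auto simp: max_def)
  finally show "\<bar>u x * v x\<bar> powr (p / 2) \<le> \<bar>u x\<bar> powr p + \<bar>v x\<bar> powr p" .
qed (use u v in \<open>auto simp: Lr_def\<close>)

text \<open>A cross product of curl-free fields has no divergence. The expression is linear in
  \<open>g\<close>, so it suffices to regularise \<open>g\<close>: its Fejer means are curl-free
  pointwise, and \<open>k\<close> can be tested with their products with
  \<open>\<phi>\<close>.\<close>

lemma cross_curl_free:
  fixes g k :: "3 \<Rightarrow> vec3 \<Rightarrow> real"
  assumes p: "2 \<le> p" and g: "\<And>\<alpha>. Lr p (g \<alpha>)" and k: "\<And>\<alpha>. Lr p (k \<alpha>)"
    and cg: "\<And>\<phi> \<alpha> \<beta>. testfun \<phi> \<Longrightarrow> (\<integral>x. g \<alpha> x * dx \<beta> \<phi> x \<partial>torus) = (\<integral>x. g \<beta> x * dx \<alpha> \<phi> x \<partial>torus)"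
    and ck: "\<And>\<phi> \<alpha> \<beta>. testfun \<phi> \<Longrightarrow> (\<integral>x. k \<alpha> x * dx \<beta> \<phi> x \<partial>torus) = (\<integral>x. k \<beta> x * dx \<alpha> \<phi> x \<partial>torus)"
    and \<phi>: "testfun \<phi>"
  shows "(\<Sum>\<alpha>\<in>UNIV. \<integral>x. (g (\<alpha> + 1) x * k (\<alpha> + 2) x - g (\<alpha> + 2) x * k (\<alpha> + 1) x) * dx \<alpha> \<phi> x \<partial>torus) = 0"
proof -
  have ig: "integrable torus (g \<alpha>)" "integrable torus (k \<alpha>)" for \<alpha>
    using Lr_integrable[OF g] Lr_integrable[OF k] p by simp_all
  have p': "0 \<le> p / (p - 1)" "1 < p" using p by simp_all
  define a where "a \<beta> \<gamma> x = k \<beta> x * dx \<gamma> \<phi> x" for \<beta> \<gamma> x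
  have cphi: "continuous_on UNIV (dx \<gamma> \<phi>)" for \<gamma> using \<phi> by (intro C1per_dx_cont testfun_C1per)
  have La: "Lr (p / (p - 1)) (a \<beta> \<gamma>)" for \<beta> \<gamma>
    unfolding a_def using Lr_mono[OF k] dual_le[OF p] p' by (intro Lr_mult_cont cphi) auto
  define T where "T u = (\<integral>x. a 3 1 x * u 2 x \<partial>torus) - (\<integral>x. a 2 1 x * u 3 x \<partial>torus)
     + ((\<integral>x. a 1 2 x * u 3 x \<partial>torus) - (\<integral>x. a 3 2 x * u 1 x \<partial>torus))
     + ((\<integral>x. a 2 3 x * u 1 x \<partial>torus) - (\<integral>x. a 1 3 x * u 2 x \<partial>torus))" for u :: "3 \<Rightarrow> vec3 \<Rightarrow> real"
  have id: "integrable torus (\<lambda>x. a \<beta> \<gamma> x * g \<delta> x)" for \<beta> \<gamma> \<delta> by (rule Lr_dual_integrable[OF p'(2) La g])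
  have "(\<integral>x. (g \<beta> x * k \<gamma> x - g \<gamma> x * k \<beta> x) * dx \<alpha> \<phi> x \<partial>torus) = (\<integral>x. a \<gamma> \<alpha> x * g \<beta> x \<partial>torus) - (\<integral>x. a \<beta> \<alpha> x * g \<gamma> x \<partial>torus)" for \<alpha> \<beta> \<gamma>
  proof -
    have "(\<integral>x. (g \<beta> x * k \<gamma> x - g \<gamma> x * k \<beta> x) * dx \<alpha> \<phi> x \<partial>torus) = (\<integral>x. a \<gamma> \<alpha> x * g \<beta> x - a \<beta> \<alpha> x * g \<gamma> x \<partial>torus)"
      by (intro Bochner_Integration.integral_cong refl) (simp add: a_def algebra_simps)
    then show ?thesis using id by simp
  qed
  then have T: "(\<Sum>\<alpha>\<in>UNIV. \<integral>x. (g (\<alpha> + 1) x * k (\<alpha> + 2) x - g (\<alpha> + 2) x * k (\<alpha> + 1) x) * dx \<alpha> \<phi> x \<partial>torus) = T g"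
    unfolding sum_3 index3 T_def by (simp only:)
  have lim: "(\<lambda>n. T (\<lambda>\<alpha>. approx n (g \<alpha>))) \<longlonglongrightarrow> T g"
    unfolding T_def by (intro tendsto_add tendsto_diff approx_weak[OF p'(2) La g])
  have "T (\<lambda>\<alpha>. approx n (g \<alpha>)) = 0" for n
  proof -
    define G where "G \<alpha> = approx n (g \<alpha>)" for \<alpha>
    have tG: "testfun (G \<alpha>)" for \<alpha> unfolding G_def by (intro testfun_approx ig)
    have curl: "dx \<beta> (G \<alpha>) x = dx \<alpha> (G \<beta>) x" for \<alpha> \<beta> x
      unfolding G_def dx_approx_kernel[OF ig(1)] using cg[OF sep_testfun(2)[OF sep_kern]] by simp
    have cG: "continuous_on UNIV (\<lambda>x. dx \<alpha> (\<lambda>x. G \<beta> x * \<phi> x) x)" for \<alpha> \<beta>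
      using C1per_dx_cont[OF testfun_C1per[OF testfun_mult[OF tG \<phi>]]] by simp
    define I where "I \<alpha> \<beta> \<gamma> = (\<integral>x. k \<alpha> x * dx \<beta> (\<lambda>x. G \<gamma> x * \<phi> x) x \<partial>torus)" for \<alpha> \<beta> \<gamma>
    have sw: "I \<alpha> \<beta> \<gamma> = I \<beta> \<alpha> \<gamma>" for \<alpha> \<beta> \<gamma> unfolding I_def by (rule ck[OF testfun_mult[OF tG \<phi>]])
    \<comment> \<open>Derivatives that fall on \<open>G\<close> cancel because \<open>G\<close> is
      curl-free. What remains is \<open>k\<close> tested with derivatives of
      \<open>G * \<phi>\<close>, and the symmetry \<open>sw\<close> cancels these terms in the
      cyclic sum.\<close>
    have pr: "(\<integral>x. a \<beta> \<gamma> x * G \<delta> x \<partial>torus) - (\<integral>x. a \<beta> \<delta> x * G \<gamma> x \<partial>torus) = I \<beta> \<gamma> \<delta> - I \<beta> \<delta> \<gamma>" for \<beta> \<gamma> \<delta>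
    proof -
      have i: "integrable torus (\<lambda>x. a \<beta> \<gamma> x * G \<delta> x)" for \<beta> \<gamma> \<delta>
        unfolding a_def by (intro integrable_torus_mult_cont ig cphi C1per_cont testfun_C1per tG)
      have i2: "integrable torus (\<lambda>x. k \<alpha> x * dx \<beta> (\<lambda>x. G \<gamma> x * \<phi> x) x)" for \<alpha> \<beta> \<gamma>
        by (intro integrable_torus_mult_cont ig cG)
      have "(\<integral>x. a \<beta> \<gamma> x * G \<delta> x - a \<beta> \<delta> x * G \<gamma> x \<partial>torus) = (\<integral>x. k \<beta> x * dx \<gamma> (\<lambda>x. G \<delta> x * \<phi> x) x - k \<beta> x * dx \<delta> (\<lambda>x. G \<gamma> x * \<phi> x) x \<partial>torus)"
        unfolding dx_mult[OF testfun_C1per[OF tG] testfun_C1per[OF \<phi>]] a_def curl[of \<gamma> \<delta>]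
        by (intro Bochner_Integration.integral_cong refl) (simp add: algebra_simps)
      then show ?thesis using i i2 by (simp add: I_def)
    qed
    have "T G = ((\<integral>x. a 3 1 x * G 2 x \<partial>torus) - (\<integral>x. a 3 2 x * G 1 x \<partial>torus))
       + ((\<integral>x. a 1 2 x * G 3 x \<partial>torus) - (\<integral>x. a 1 3 x * G 2 x \<partial>torus))
       + ((\<integral>x. a 2 3 x * G 1 x \<partial>torus) - (\<integral>x. a 2 1 x * G 3 x \<partial>torus))" unfolding T_def by simp
    also have "\<dots> = 0" unfolding pr using sw[of 3 1 2] sw[of 3 2 1] sw[of 1 2 3] by simp
    finally show ?thesis by (simp add: G_def[abs_def])
  qed
  then have "T g = 0" using lim LIMSEQ_unique[OF _ tendsto_const] by (simp add: LIMSEQ_const_iff)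
  then show ?thesis using T by simp
qed

lemma Lr_dPhi:
  assumes p: "4 \<le> p" and f: "\<And>i \<alpha>. Lr p (\<lambda>x. f x $ i $ \<alpha>)"
  shows "Lr (p / 2) (\<lambda>x. dPhi A i \<alpha> (f x))"
proof -
  have 1: "Lr (p / 2) (\<lambda>x. f x $ i $ \<alpha>)" for i \<alpha> using Lr_mono[OF f] p by simp
  have 2: "Lr (p / 2) (\<lambda>x. f x $ i $ \<alpha> * f x $ j $ \<beta>)" for i j \<alpha> \<beta> using p by (intro Lr_mult_half f) simp
  have 3: "0 \<le> p / 2" using p by simp
  show ?thesis
    unfolding dPhi_eq dcof_def cof_def vec_lambda_beta by (intro Lr_add Lr_diff Lr_cmult Lr_const 1 2 3)
qed

text \<open>\<open>\<partial>\<Phi>/\<partial>F\<close> has a constant part, a part linear in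
  \<open>f\<close> and the cofactors. The first integrates to zero. The coefficients of the second
  are antisymmetric in the column index and the derivative direction, whereas \<open>J\<close> is
  symmetric. The rows of the third are cross products of rows of \<open>f\<close>.\<close>

theorem null_lagrangian:
  assumes p: "4 \<le> p" and f: "\<And>i \<alpha>. Lr p (\<lambda>x. f x $ i $ \<alpha>)" and c: "weak_curl_free f" and \<phi>: "testfun \<phi>"
  shows "(\<Sum>\<alpha>\<in>UNIV. \<integral>x. dPhi A i \<alpha> (f x) * dx \<alpha> \<phi> x \<partial>torus) = 0"
proof -
  obtain B Z w where A: "A = (B, Z, w)" by (cases A) auto
  have cphi: "continuous_on UNIV (dx \<gamma> \<phi>)" for \<gamma> using \<phi> by (intro C1per_dx_cont testfun_C1per)
  have fi: "integrable torus (\<lambda>x. f x $ i $ \<alpha>)" for i \<alpha> using Lr_integrable[OF f] p by simp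
  have L2: "Lr (p / 2) (\<lambda>x. f x $ i $ \<alpha> * f x $ j $ \<beta>)" for i j \<alpha> \<beta> using p by (intro Lr_mult_half f) simp
  have ci: "integrable torus (\<lambda>x. cof (f x) $ i $ \<alpha>)" for i \<alpha>
    unfolding cof_def vec_lambda_beta using L2 p by (intro Bochner_Integration.integrable_diff Lr_integrable[OF L2]) simp_all
  define J where "J i \<alpha> \<beta> = (\<integral>x. f x $ i $ \<alpha> * dx \<beta> \<phi> x \<partial>torus)" for i \<alpha> \<beta>
  have J: "J i \<alpha> \<beta> = J i \<beta> \<alpha>" for i \<alpha> \<beta> using c \<phi> by (simp add: J_def weak_curl_free_def)
  have ifx: "integrable torus (\<lambda>x. f x $ i $ \<alpha> * dx \<beta> \<phi> x)" for i \<alpha> \<beta> by (intro integrable_torus_mult_cont fi cphi)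
  have icx: "integrable torus (\<lambda>x. cof (f x) $ i $ \<alpha> * dx \<beta> \<phi> x)" for i \<alpha> \<beta> by (intro integrable_torus_mult_cont ci cphi)
  have iphi: "integrable torus (dx \<beta> \<phi>)" for \<beta> by (rule integrable_torus_cont[OF cphi])
  have e: "(\<integral>x. dPhi A i \<alpha> (f x) * dx \<alpha> \<phi> x \<partial>torus) =
     (Z $ (i + 2) $ (\<alpha> + 2) * J (i + 1) (\<alpha> + 1) \<alpha> + Z $ (i + 1) $ (\<alpha> + 1) * J (i + 2) (\<alpha> + 2) \<alpha>
     - Z $ (i + 2) $ (\<alpha> + 1) * J (i + 1) (\<alpha> + 2) \<alpha> - Z $ (i + 1) $ (\<alpha> + 2) * J (i + 2) (\<alpha> + 1) \<alpha>)
     + w * (\<integral>x. cof (f x) $ i $ \<alpha> * dx \<alpha> \<phi> x \<partial>torus)" for \<alpha>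
  proof -
    have "(\<integral>x. dPhi A i \<alpha> (f x) * dx \<alpha> \<phi> x \<partial>torus) = (\<integral>x. B $ i $ \<alpha> * dx \<alpha> \<phi> x +
     (Z $ (i + 2) $ (\<alpha> + 2) * (f x $ (i + 1) $ (\<alpha> + 1) * dx \<alpha> \<phi> x) + Z $ (i + 1) $ (\<alpha> + 1) * (f x $ (i + 2) $ (\<alpha> + 2) * dx \<alpha> \<phi> x)
     - Z $ (i + 2) $ (\<alpha> + 1) * (f x $ (i + 1) $ (\<alpha> + 2) * dx \<alpha> \<phi> x) - Z $ (i + 1) $ (\<alpha> + 2) * (f x $ (i + 2) $ (\<alpha> + 1) * dx \<alpha> \<phi> x))
     + w * (cof (f x) $ i $ \<alpha> * dx \<alpha> \<phi> x) \<partial>torus)"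
      by (intro Bochner_Integration.integral_cong refl) (simp add: dPhi_eq dcof_def A algebra_simps)
    also have "\<dots> = B $ i $ \<alpha> * (\<integral>x. dx \<alpha> \<phi> x \<partial>torus) + 
     (Z $ (i + 2) $ (\<alpha> + 2) * J (i + 1) (\<alpha> + 1) \<alpha> + Z $ (i + 1) $ (\<alpha> + 1) * J (i + 2) (\<alpha> + 2) \<alpha>
     - Z $ (i + 2) $ (\<alpha> + 1) * J (i + 1) (\<alpha> + 2) \<alpha> - Z $ (i + 1) $ (\<alpha> + 2) * J (i + 2) (\<alpha> + 1) \<alpha>)
     + w * (\<integral>x. cof (f x) $ i $ \<alpha> * dx \<alpha> \<phi> x \<partial>torus)"
      using ifx icx iphi by (simp add: J_def)
    finally show ?thesis using torus_ibp[OF testfun_C1per[OF \<phi>]] by simp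
  qed
  have "(\<Sum>\<alpha>\<in>UNIV. \<integral>x. cof (f x) $ i $ \<alpha> * dx \<alpha> \<phi> x \<partial>torus) = 0"
    unfolding cof_def vec_lambda_beta
    by (rule cross_curl_free[where p=p]) (use p f c \<phi> in \<open>auto simp: weak_curl_free_def\<close>)
  then have "w * (\<integral>x. cof (f x) $ i $ 1 * dx 1 \<phi> x \<partial>torus) + w * (\<integral>x. cof (f x) $ i $ 2 * dx 2 \<phi> x \<partial>torus)
     + w * (\<integral>x. cof (f x) $ i $ 3 * dx 3 \<phi> x \<partial>torus) = 0"
    unfolding sum_3 by (simp add: distrib_left[symmetric])
  then show ?thesis
    unfolding e sum_3 index3 using J[of "i+1" 2 1] J[of "i+1" 3 1] J[of "i+1" 3 2] J[of "i+2" 2 1] J[of "i+2" 3 1] J[of "i+2" 3 2]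
    by simp
qed

text \<open>This is \<open>weak_form_extends\<close> with zero density: the entries of
  \<open>\<partial>\<Phi>/\<partial>F\<close> lie in L^(p/2), which is contained in the dual class
  for p \<ge> 4.\<close>

lemma null_lagrangian_weak_grad:
  assumes p: "4 \<le> p" and f: "\<And>i \<alpha>. Lr p (\<lambda>x. f x $ i $ \<alpha>)" and c: "weak_curl_free f" and u: "weak_grad p u m"
  shows "(\<Sum>\<alpha>\<in>UNIV. \<integral>x. dPhi A i \<alpha> (f x) * m \<alpha> x \<partial>torus) = 0"
proof -
  have L: "Lr (p / (p - 1)) (\<lambda>x. dPhi A i \<alpha> (f x))" for \<alpha>
    using Lr_mono[OF Lr_dPhi[OF p f]] p by (simp add: field_simps)
  have "(\<integral>x. 0 * u x \<partial>torus) = - (\<Sum>\<alpha>\<in>UNIV. \<integral>x. dPhi A i \<alpha> (f x) * m \<alpha> x \<partial>torus)"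
    by (rule weak_form_extends[OF _ Lr_const[of _ 0] L _ u]) (use null_lagrangian[OF p f c] p in auto)
  then show ?thesis by simp
qed

text \<open>The classical form of \<open>null_lagrangian\<close>, used for the smooth solution; the
  symmetry of \<open>D\<close> meets the same antisymmetric pattern.\<close>

lemma piola_pointwise:
  assumes F: "\<And>i \<alpha>. C1per (\<lambda>y. F y $ i $ \<alpha>)"
    and c: "\<And>i \<alpha> \<beta>. dx \<beta> (\<lambda>y. F y $ i $ \<alpha>) x = dx \<alpha> (\<lambda>y. F y $ i $ \<beta>) x"
  shows "(\<Sum>\<alpha>\<in>UNIV. dx \<alpha> (\<lambda>y. dPhi A i \<alpha> (F y)) x) = 0"
proof -
  obtain B Z w where A: "A = (B, Z, w)" by (cases A) auto
  have m: "C1per (\<lambda>y. k * F y $ i $ \<alpha>)" "C1per (\<lambda>y. k * (F y $ i $ \<alpha> * F y $ j $ \<beta>))" for k i \<alpha> j \<beta>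
    by (intro C1per_mult C1per_const F)+
  have e: "dPhi A i \<alpha> (F y) = B $ i $ \<alpha> + (Z $ (i + 2) $ (\<alpha> + 2) * F y $ (i + 1) $ (\<alpha> + 1) + Z $ (i + 1) $ (\<alpha> + 1) * F y $ (i + 2) $ (\<alpha> + 2)
     + (- Z $ (i + 2) $ (\<alpha> + 1)) * F y $ (i + 1) $ (\<alpha> + 2) + (- Z $ (i + 1) $ (\<alpha> + 2)) * F y $ (i + 2) $ (\<alpha> + 1))
     + (w * (F y $ (i + 1) $ (\<alpha> + 1) * F y $ (i + 2) $ (\<alpha> + 2)) + (- w) * (F y $ (i + 1) $ (\<alpha> + 2) * F y $ (i + 2) $ (\<alpha> + 1)))" for \<alpha> y
    by (simp add: dPhi_eq dcof_def cof_def A algebra_simps)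
  define D where "D i \<alpha> \<beta> = dx \<beta> (\<lambda>y. F y $ i $ \<alpha>) x" for i \<alpha> \<beta>
  have D: "D i \<alpha> \<beta> = D i \<beta> \<alpha>" for i \<alpha> \<beta> unfolding D_def by (rule c)
  have d1: "dx \<beta> (\<lambda>y. k * F y $ i $ \<alpha>) x = k * D i \<alpha> \<beta>" for k i \<alpha> \<beta> by (simp add: D_def dx_cmult[OF F])
  have d2: "dx \<gamma> (\<lambda>y. k * (F y $ i $ \<alpha> * F y $ j $ \<beta>)) x = k * (F x $ i $ \<alpha> * D j \<beta> \<gamma> + D i \<alpha> \<gamma> * F x $ j $ \<beta>)" for k i \<alpha> j \<beta> \<gamma>
    by (simp add: D_def dx_cmult[OF C1per_mult[OF F F]] dx_mult[OF F F])
  have d: "dx \<alpha> (\<lambda>y. dPhi A i \<alpha> (F y)) x = (Z $ (i + 2) $ (\<alpha> + 2) * D (i + 1) (\<alpha> + 1) \<alpha> + Z $ (i + 1) $ (\<alpha> + 1) * D (i + 2) (\<alpha> + 2) \<alpha>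
     + (- Z $ (i + 2) $ (\<alpha> + 1)) * D (i + 1) (\<alpha> + 2) \<alpha> + (- Z $ (i + 1) $ (\<alpha> + 2)) * D (i + 2) (\<alpha> + 1) \<alpha>)
     + (w * (F x $ (i + 1) $ (\<alpha> + 1) * D (i + 2) (\<alpha> + 2) \<alpha> + D (i + 1) (\<alpha> + 1) \<alpha> * F x $ (i + 2) $ (\<alpha> + 2))
       + (- w) * (F x $ (i + 1) $ (\<alpha> + 2) * D (i + 2) (\<alpha> + 1) \<alpha> + D (i + 1) (\<alpha> + 2) \<alpha> * F x $ (i + 2) $ (\<alpha> + 1)))" for \<alpha>
    unfolding e by (simp only: dx_add m C1per_add C1per_const dx_const d1 d2 add_0)
  show ?thesis unfolding sum_3 d index3
    using D[of "i+1" 2 1] D[of "i+1" 3 1] D[of "i+1" 3 2] D[of "i+2" 2 1] D[of "i+2" 3 1] D[of "i+2" 3 2]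
    by (simp add: algebra_simps)
qed

section \<open>Taylor estimates along segments\<close>

lemma taylor_segment_lower:
  fixes f :: "real \<Rightarrow> real"
  assumes f: "\<And>s. (f has_real_derivative f' s) (at s)" "\<And>s. (f' has_real_derivative f'' s) (at s)"
    and k: "\<And>s. a \<le> s \<Longrightarrow> s \<le> b \<Longrightarrow> k \<le> f'' s" and ab: "a \<le> b"
  shows "f' a + k * (b - a) \<le> f' b" "f a + (b - a) * f' a + k * (b - a)\<^sup>2 / 2 \<le> f b"
proof -
  have 1: "f' a + k * (c - a) \<le> f' c" if "a \<le> c" "c \<le> b" for c
  proof -
    have "(\<lambda>s. f' s - k * (s - a)) a \<le> (\<lambda>s. f' s - k * (s - a)) c"
    proof (rule DERIV_nonneg_imp_nondecreasing[OF that(1)])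
      fix s assume "a \<le> s" "s \<le> c"
      then show "\<exists>y. ((\<lambda>s. f' s - k * (s - a)) has_real_derivative y) (at s) \<and> 0 \<le> y"
        using k[of s] that by (intro exI[of _ "f'' s - k"]) (auto intro!: derivative_eq_intros f)
    qed
    then show ?thesis by simp
  qed
  show "f' a + k * (b - a) \<le> f' b" using 1 ab by simp
  have "(\<lambda>s. f s - (s - a) * f' a - k * (s - a)\<^sup>2 / 2) a \<le> (\<lambda>s. f s - (s - a) * f' a - k * (s - a)\<^sup>2 / 2) b"
  proof (rule DERIV_nonneg_imp_nondecreasing[OF ab])
    fix s assume "a \<le> s" "s \<le> b"
    then show "\<exists>y. ((\<lambda>s. f s - (s - a) * f' a - k * (s - a)\<^sup>2 / 2) has_real_derivative y) (at s) \<and> 0 \<le> y"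
      using 1[of s] by (intro exI[of _ "f' s - f' a - k * (s - a)"])
        (auto intro!: derivative_eq_intros f simp: field_simps)
  qed
  then show "f a + (b - a) * f' a + k * (b - a)\<^sup>2 / 2 \<le> f b" by simp
qed

text \<open>The Bregman distance of \<open>f\<close>.\<close>

definition rel :: "('a::euclidean_space \<Rightarrow> real) \<Rightarrow> 'a \<Rightarrow> 'a \<Rightarrow> real" where
  "rel f x y = f x - f y - pd f (x - y) y"

definition C2 :: "('a::euclidean_space \<Rightarrow> real) \<Rightarrow> bool" where
  "C2 f \<longleftrightarrow> C1 f \<and> (\<forall>a\<in>Basis. C1 (pd f a))"

lemma C2_C1: "C2 f \<Longrightarrow> C1 f" "C2 f \<Longrightarrow> a \<in> Basis \<Longrightarrow> C1 (pd f a)" by (auto simp: C2_def)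

lemma Ck_C2: "Ck_on (Suc (Suc k)) UNIV f \<Longrightarrow> C2 f"
  unfolding C2_def using Ck_C1[of "Suc k" f] Ck_C1[of k] Ck_Suc_UNIV[of "Suc k" f] by blast

lemma pd_expand: "f differentiable at y \<Longrightarrow> pd f z y = (\<Sum>a\<in>Basis. (z \<bullet> a) * pd f a y)"
  by (subst pd_linear_comb, assumption) (simp add: grad_def inner_sum_left, simp add: mult.commute inner_commute)

lemma pd_line_deriv:
  assumes "C2 f"
  shows "((\<lambda>s. f (y + s *\<^sub>R z)) has_real_derivative pd f z (y + s *\<^sub>R z)) (at s)"
    and "((\<lambda>s. pd f z (y + s *\<^sub>R z)) has_real_derivative hess_form f (y + s *\<^sub>R z) z) (at s)"
proof -
  have d: "f differentiable at x" for x using C1D(1)[OF C2_C1(1)[OF assms]] .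
  show "((\<lambda>s. f (y + s *\<^sub>R z)) has_real_derivative pd f z (y + s *\<^sub>R z)) (at s)"
    by (rule has_real_derivative_line[OF d])
  have e: "(\<lambda>s. pd f z (y + s *\<^sub>R z)) = (\<lambda>s. \<Sum>a\<in>Basis. (z \<bullet> a) * pd f a (y + s *\<^sub>R z))"
    by (rule ext) (rule pd_expand[OF d])
  have "((\<lambda>s. \<Sum>a\<in>Basis. (z \<bullet> a) * pd f a (y + s *\<^sub>R z)) has_real_derivative
     (\<Sum>a\<in>Basis. (z \<bullet> a) * pd (pd f a) z (y + s *\<^sub>R z))) (at s)"
    by (intro DERIV_sum DERIV_cmult has_real_derivative_line C1D(1)[OF C2_C1(2)[OF assms]])
  moreover have "(\<Sum>a\<in>Basis. (z \<bullet> a) * pd (pd f a) z (y + s *\<^sub>R z)) = hess_form f (y + s *\<^sub>R z) z"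
    unfolding hess_form_def
    by (intro sum.cong refl, subst pd_expand[OF C1D(1)[OF C2_C1(2)[OF assms]]]) (simp_all add: sum_distrib_left mult_ac)
  ultimately show "((\<lambda>s. pd f z (y + s *\<^sub>R z)) has_real_derivative hess_form f (y + s *\<^sub>R z) z) (at s)"
    unfolding e by simp
qed

text \<open>Along the segment the slope never decreases. Therefore the strong bound \<open>k\<close>
  is asked only on \<open>[a, b]\<close>, and the pieces before and after it contribute at least
  their linear parts.\<close>

lemma rel_lower:
  assumes f: "C2 f" and nn: "\<And>s. 0 \<le> s \<Longrightarrow> s \<le> 1 \<Longrightarrow> 0 \<le> hess_form f (y + s *\<^sub>R (x - y)) (x - y)"
    and k: "\<And>s. a \<le> s \<Longrightarrow> s \<le> b \<Longrightarrow> k \<le> hess_form f (y + s *\<^sub>R (x - y)) (x - y)"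
    and ab: "0 \<le> a" "a \<le> b" "b \<le> 1"
  shows "k * (b - a)\<^sup>2 / 2 \<le> rel f x y"
proof -
  let ?f = "\<lambda>s. f (y + s *\<^sub>R (x - y))" and ?f' = "\<lambda>s. pd f (x - y) (y + s *\<^sub>R (x - y))"
  note T = taylor_segment_lower[OF pd_line_deriv(1)[OF f, where y=y and z="x - y"] pd_line_deriv(2)[OF f, where y=y and z="x - y"]]
  have 0: "?f' 0 + 0 * (a - 0) \<le> ?f' a" "?f 0 + (a - 0) * ?f' 0 + 0 * (a - 0)\<^sup>2 / 2 \<le> ?f a"
    using T[of 0 a 0] nn ab by auto
  have 1: "?f' a + k * (b - a) \<le> ?f' b" "?f a + (b - a) * ?f' a + k * (b - a)\<^sup>2 / 2 \<le> ?f b"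
    using T[of a b k] k ab by auto
  have moment: "?f' a + 0 * (b - a) \<le> ?f' b" using T(1)[of a b 0] nn ab by auto
  have 2: "?f b + (1 - b) * ?f' b + 0 * (1 - b)\<^sup>2 / 2 \<le> ?f 1" using T(2)[of b 1 0] nn ab by auto
  have m: "(b - a) * ?f' 0 \<le> (b - a) * ?f' a" "(1 - b) * ?f' 0 \<le> (1 - b) * ?f' b"
    using 0(1) moment ab by (auto intro!: mult_left_mono)
  have "rel f x y = ?f 1 - ?f 0 - ?f' 0" by (simp add: rel_def)
  moreover have "a * ?f' 0 + (b - a) * ?f' 0 + (1 - b) * ?f' 0 = ?f' 0" by (simp add: algebra_simps)
  ultimately show ?thesis using 0(2) 1(2) 2 m by simp
qed

lemma rel_upper:
  assumes f: "C2 f"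
    and k: "\<And>s. 0 \<le> s \<Longrightarrow> s \<le> 1 \<Longrightarrow> hess_form f (y + s *\<^sub>R (x - y)) (x - y) \<le> k"
  shows "rel f x y \<le> k / 2"
proof -
  have "- f (y + 0 *\<^sub>R (x - y)) + (1 - 0) * - pd f (x - y) (y + 0 *\<^sub>R (x - y)) + (- k) * (1 - 0)\<^sup>2 / 2 \<le> - f (y + 1 *\<^sub>R (x - y))"
  proof (rule taylor_segment_lower(2)[OF DERIV_minus[OF pd_line_deriv(1)[OF f]] DERIV_minus[OF pd_line_deriv(2)[OF f]]])
    fix s :: real assume "0 \<le> s" "s \<le> 1"
    then show "- k \<le> - hess_form f (y + s *\<^sub>R (x - y)) (x - y)" using k[of s] by linarith
  qed simp
  then show ?thesis by (simp add: rel_def)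
qed

text \<open>
  For a convex function the upper bound on the quadratic form of the Hessian near a point already
  makes the gradient Lipschitz; no operator norm of the Hessian is needed.
\<close>

lemma grad_lipschitz_convex:
  assumes f: "C2 f" and nn: "\<And>x z. 0 \<le> hess_form f x z"
    and L: "\<And>u z. norm (u - x) \<le> 2 * norm (y - x) \<Longrightarrow> hess_form f u z \<le> L * (norm z)\<^sup>2"
  shows "norm (grad f y - grad f x) \<le> 2 * L * norm (y - x)"
proof (cases "grad f y = grad f x")
  case True
  have "0 \<le> L * norm (y - x)"
  proof (cases "y = x")
    case False
    have "0 \<le> hess_form f x (y - x)" by (rule nn)
    also have "\<dots> \<le> L * (norm (y - x))\<^sup>2" by (rule L) simp
    finally have "0 \<le> L" using False by (simp add: zero_le_mult_iff)
    then show ?thesis by simp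
  qed simp
  then show ?thesis using True by simp
next
  case False
  define r where "r = norm (y - x)"
  have r: "r > 0" using False by (auto simp: r_def)
  \<comment> \<open>From \<open>y\<close> one moves by \<open>r\<close> along the gradient
    difference and compares three Bregman distances: those of \<open>(y, x)\<close> and
    \<open>(z, y)\<close> are nonnegative, that of \<open>(z, x)\<close> is bounded above. The
    distance from \<open>z\<close> to \<open>x\<close> is at most \<open>2 * r\<close>, which is the
    radius in the hypothesis.\<close>
  define e where "e = (grad f y - grad f x) /\<^sub>R norm (grad f y - grad f x)"
  have e: "norm e = 1" "(grad f y - grad f x) \<bullet> e = norm (grad f y - grad f x)"
    using False by (auto simp: e_def power2_norm_eq_inner[symmetric] power2_eq_square)
  have d: "f differentiable at x" for x using C1D(1)[OF C2_C1(1)[OF f]] .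
  define z where "z = y + r *\<^sub>R e"
  have nz: "norm (z - x) \<le> 2 * r"
    using norm_triangle_ineq[of "y - x" "r *\<^sub>R e"] e r by (simp add: z_def r_def algebra_simps)
  have up: "rel f z x \<le> L * (norm (z - x))\<^sup>2 / 2"
  proof (rule rel_upper[OF f])
    fix s :: real assume s: "0 \<le> s" "s \<le> 1"
    have "norm (s *\<^sub>R (z - x)) \<le> norm (z - x)" using s by (simp add: mult_left_le_one_le)
    then show "hess_form f (x + s *\<^sub>R (z - x)) (z - x) \<le> L * (norm (z - x))\<^sup>2"
      using nz by (intro L) (simp add: r_def)
  qed
  have lo: "0 \<le> rel f y x" "0 \<le> rel f z y"
    using rel_lower[OF f nn, of 0 1 0 x y] rel_lower[OF f nn, of 0 1 0 y z] nn by auto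
  have L0: "0 \<le> L"
  proof -
    have "0 \<le> hess_form f x e" by (rule nn)
    also have "\<dots> \<le> L * (norm e)\<^sup>2" by (rule L) simp
    finally show ?thesis using e by simp
  qed
  have "r * norm (grad f y - grad f x) = grad f y \<bullet> (z - y) - grad f x \<bullet> (z - y)"
    unfolding e(2)[symmetric] by (simp add: z_def inner_diff_left right_diff_distrib)
  also have "\<dots> \<le> rel f z x"
    using lo unfolding rel_def pd_linear_comb[OF d] by (simp add: inner_diff_right)
  also have "\<dots> \<le> L * (2 * r)\<^sup>2 / 2" using up nz L0 r
    by (intro order_trans[OF up] divide_right_mono mult_left_mono power_mono) auto
  finally have "r * norm (grad f y - grad f x) \<le> r * (2 * L * r)" by (simp add: power2_eq_square mult_ac)
  then show ?thesis using r by (simp add: r_def)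
qed

lemma second_order_remainder:
  assumes f: "C2 f"
    and k: "\<And>s. 0 \<le> s \<Longrightarrow> s \<le> 1 \<Longrightarrow> \<bar>hess_form f (y + s *\<^sub>R (x - y)) (x - y)\<bar> \<le> k"
  shows "\<bar>rel f x y\<bar> \<le> k / 2"
proof -
  have "rel f x y \<le> k / 2" by (rule rel_upper[OF f]) (use k abs_le_D1 in blast)
  moreover have "f (y + 0 *\<^sub>R (x - y)) + (1 - 0) * pd f (x - y) (y + 0 *\<^sub>R (x - y)) + (- k) * (1 - 0)\<^sup>2 / 2 \<le> f (y + 1 *\<^sub>R (x - y))"
  proof (rule taylor_segment_lower(2)[OF pd_line_deriv(1)[OF f] pd_line_deriv(2)[OF f]])
    fix s :: real assume "0 \<le> s" "s \<le> 1"
    then show "- k \<le> hess_form f (y + s *\<^sub>R (x - y)) (x - y)" using k[of s] by linarith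
  qed simp
  ultimately have "rel f x y \<le> k / 2" "- (k / 2) \<le> rel f x y" by (simp_all add: rel_def)
  then show ?thesis by linarith
qed

lemma segment_norm_le_max: "0 \<le> s \<Longrightarrow> s \<le> 1 \<Longrightarrow> norm (y + s *\<^sub>R (x - y)) \<le> max (norm x) (norm (y::'a::real_normed_vector))"
proof -
  assume s: "0 \<le> s" "s \<le> 1"
  have "norm (y + s *\<^sub>R (x - y)) = norm ((1 - s) *\<^sub>R y + s *\<^sub>R x)" by (simp add: algebra_simps)
  also have "\<dots> \<le> (1 - s) * norm y + s * norm x" using norm_triangle_ineq[of "(1 - s) *\<^sub>R y" "s *\<^sub>R x"] s by simp
  also have "\<dots> \<le> (1 - s) * max (norm x) (norm y) + s * max (norm x) (norm y)" using s by (intro add_mono mult_left_mono) auto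
  also have "\<dots> = max (norm x) (norm y)" by (simp add: algebra_simps)
  finally show ?thesis .
qed

lemma segment_powr_le: "0 \<le> s \<Longrightarrow> s \<le> 1 \<Longrightarrow> 0 \<le> q \<Longrightarrow>
   norm (y + s *\<^sub>R (x - y)) powr q \<le> norm x powr q + norm (y::'a::real_normed_vector) powr q"
proof -
  assume s: "0 \<le> s" "s \<le> 1" "0 \<le> q"
  have "norm (y + s *\<^sub>R (x - y)) powr q \<le> max (norm x) (norm y) powr q"
    using s by (intro powr_mono2 segment_norm_le_max) auto
  also have "\<dots> \<le> norm x powr q + norm y powr q" by (auto simp: max_def)
  finally show ?thesis .
qed

text \<open>The quarter is taken next to the end point of larger norm. The whole segment is at most
  twice that norm long, so a quarter of it changes the norm by at most one half of it.\<close>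

lemma segment_norm_ge:
  obtains a b where "0 \<le> a" "b \<le> 1" "b = a + 1/4"
    "\<And>s. a \<le> s \<Longrightarrow> s \<le> b \<Longrightarrow> norm (y + s *\<^sub>R (x - y)) \<ge> max (norm x) (norm (y::'a::real_normed_vector)) / 2"
proof (cases "norm x \<le> norm y")
  case True
  have "norm (x - y) \<le> 2 * norm y" using norm_triangle_ineq4[of x y] True by simp
  show ?thesis
  proof (rule that[of 0 "1/4"])
    fix s :: real assume s: "0 \<le> s" "s \<le> 1/4"
    have "norm (s *\<^sub>R (x - y)) \<le> 1/4 * (2 * norm y)"
      using s \<open>norm (x - y) \<le> 2 * norm y\<close> by (simp only: norm_scaleR abs_of_nonneg) (intro mult_mono, auto)
    then show "max (norm x) (norm y) / 2 \<le> norm (y + s *\<^sub>R (x - y))"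
      using norm_diff_ineq[of y "s *\<^sub>R (x - y)"] True by simp
  qed auto
next
  case False
  have n: "norm (x - y) \<le> 2 * norm x" using norm_triangle_ineq4[of x y] False by simp
  show ?thesis
  proof (rule that[of "3/4" 1])
    fix s :: real assume s: "3/4 \<le> s" "s \<le> 1"
    have "norm ((s - 1) *\<^sub>R (x - y)) \<le> 1/4 * (2 * norm x)"
      using s n by (simp only: norm_scaleR) (intro mult_mono, auto)
    moreover have "y + s *\<^sub>R (x - y) = x + (s - 1) *\<^sub>R (x - y)" by (simp add: algebra_simps)
    ultimately show "max (norm x) (norm y) / 2 \<le> norm (y + s *\<^sub>R (x - y))"
      using norm_diff_ineq[of x "(s - 1) *\<^sub>R (x - y)"] False by simp
  qed auto
qed

section \<open>The energy density\<close>

text \<open>The existential constants of the hypotheses are fixed once, so that all later constants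
  can be built from them before any time step or iterate is chosen.\<close>

locale energy_density =
  fixes G :: "ext \<Rightarrow> real" and H :: "mat3 \<Rightarrow> real" and R :: "ext \<Rightarrow> real"
    and p \<kappa> \<kappa>' \<gamma> \<gamma>' c\<^sub>1 c\<^sub>4 c\<^sub>7 c\<^sub>8 :: real
  assumes p6: "6 \<le> p"
    and C3: "Ck_on 3 UNIV G" "Ck_on 3 UNIV H" "Ck_on 3 UNIV R"
    and G_split: "\<And>X. G X = H (fst X) + R X"
    and G_nonneg: "\<And>X. 0 \<le> G X"
    and kappa: "0 < \<kappa>" "\<And>F z. \<kappa> * norm F powr (p - 2) * (norm z)\<^sup>2 \<le> hess_form H F z"
    and kappa': "0 < \<kappa>'" "\<And>F z. hess_form H F z \<le> \<kappa>' * norm F powr (p - 2) * (norm z)\<^sup>2"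
    and gamma: "0 < \<gamma>" "\<And>X z. \<gamma> * (norm z)\<^sup>2 \<le> hess_form R X z"
    and gamma': "0 < \<gamma>'" "\<And>X z. hess_form R X z \<le> \<gamma>' * (norm z)\<^sup>2"
    and coercive: "0 < c\<^sub>1" "\<And>X. c\<^sub>1 * norm (fst X) powr p - c\<^sub>4 \<le> G X"
    and third_H: "0 < c\<^sub>7" "\<And>F a b c. a \<in> Basis \<Longrightarrow> b \<in> Basis \<Longrightarrow> c \<in> Basis \<Longrightarrow> \<bar>pd (pd (pd H a) b) c F\<bar> \<le> c\<^sub>7 * norm F powr (p - 3)"
    and third_R: "0 < c\<^sub>8" "\<And>X a b c. a \<in> Basis \<Longrightarrow> b \<in> Basis \<Longrightarrow> c \<in> Basis \<Longrightarrow> \<bar>pd (pd (pd R a) b) c X\<bar> \<le> c\<^sub>8"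
begin

abbreviation "q \<equiv> p - 2"

definition wt :: "mat3 \<Rightarrow> mat3 \<Rightarrow> real" where "wt F F' = norm F powr q + norm F' powr q"

lemma wt_nonneg: "0 \<le> wt F F'" by (simp add: wt_def)

lemma C2_all: "C2 G" "C2 H" "C2 R"
  using C3 Ck_C2[of 1] by (simp_all add: numeral_3_eq_3 numeral_2_eq_2)

lemma C2_pd: "a \<in> Basis \<Longrightarrow> C2 (pd G a)" "b \<in> Basis \<Longrightarrow> C2 (pd H b)" "a \<in> Basis \<Longrightarrow> C2 (pd R a)"
  using C3 Ck_C2[of 0 "pd G a"] Ck_C2[of 0 "pd H b"] Ck_C2[of 0 "pd R a"] Ck_Suc_UNIV[of 2 G] Ck_Suc_UNIV[of 2 H] Ck_Suc_UNIV[of 2 R]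
  by (simp_all add: numeral_3_eq_3 numeral_2_eq_2)

lemma diffs: "G differentiable at X" "H differentiable at F" "R differentiable at X"
  using C1D(1)[OF C2_C1(1)] C2_all by blast+

lemma pd_fst:
  fixes f :: "'a::euclidean_space \<Rightarrow> real" and X :: "'a \<times> 'b::euclidean_space"
  assumes "f differentiable at (fst X)"
  shows "(\<lambda>X. f (fst X)) differentiable at X" "pd (\<lambda>X. f (fst X)) z X = pd f (fst z) (fst X)"
proof -
  have "((\<lambda>X. f (fst X)) has_derivative (\<lambda>v. pd f (fst v) (fst X))) (at X)"
    using has_derivative_compose[OF has_derivative_fst[OF has_derivative_ident] assms[unfolded frechet_derivative_works]]
    by (simp add: pd_def)
  then show "(\<lambda>X. f (fst X)) differentiable at X" "pd (\<lambda>X. f (fst X)) z X = pd f (fst z) (fst X)"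
    by (auto simp: differentiable_def intro: pd_eqI)
qed

lemma pd_G: "pd G z X = pd H (fst z) (fst X) + pd R z X"
proof -
  have e: "G = (\<lambda>X. H (fst X) + R X)" using G_split by auto
  show ?thesis by (subst e, subst pd_add) (simp_all add: pd_fst diffs)
qed

lemma pd_H_0 [simp]: "pd H 0 F = 0" by (simp add: pd_linear_comb diffs)

lemma fst_Basis: "A \<in> (Basis :: ext set) \<Longrightarrow> fst A \<in> Basis \<or> fst A = 0"
  by (auto simp: Basis_prod_def)

lemma pd_pd_G:
  assumes "A \<in> Basis"
  shows "pd (pd G A) z X = pd (pd H (fst A)) (fst z) (fst X) + pd (pd R A) z X"
proof -
  have "pd H (fst A) differentiable at F" for F
    using fst_Basis[OF assms] C1D(1)[OF C2_C1(2)[OF C2_all(2)]]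
  proof
    have "pd H 0 = (\<lambda>_. 0)" by auto
    then show "fst A = 0 \<Longrightarrow> pd H (fst A) differentiable at F" by simp
  qed
  moreover have "pd R A differentiable at X" using C1D(1)[OF C2_C1(2)[OF C2_all(3) assms]] .
  moreover have "pd G A = (\<lambda>X. pd H (fst A) (fst X) + pd R A X)" by (rule ext) (rule pd_G)
  ultimately show ?thesis by (simp add: pd_add pd_fst)
qed

lemma rel_G: "rel G X Y = rel H (fst X) (fst Y) + rel R X Y"
  by (simp add: rel_def pd_G G_split)

lemma hess_H_nonneg: "0 \<le> hess_form H F z"
  by (rule order_trans[OF _ kappa(2)]) (use kappa(1) in simp)

text \<open>The constant collects \<open>(1/2) powr q\<close> from halving the norm,
  \<open>1/16\<close> from the squared length of the quarter, \<open>1/2\<close> from Taylor's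
  formula and \<open>1/2\<close> from \<open>wt F F' \<le> 2 * M powr q\<close>.\<close>

lemma rel_H_lower: "\<kappa> * (1/2) powr q / 64 * (wt F F' * (norm (F - F'))\<^sup>2) \<le> rel H F F'"
proof -
  obtain a b where ab: "0 \<le> a" "b \<le> 1" "b = a + 1/4"
    "\<And>s. a \<le> s \<Longrightarrow> s \<le> b \<Longrightarrow> norm (F' + s *\<^sub>R (F - F')) \<ge> max (norm F) (norm F') / 2"
    by (rule segment_norm_ge[where x=F and y=F']) auto
  define M where "M = max (norm F) (norm F')"
  have M: "M \<ge> 0" by (simp add: M_def le_max_iff_disj)
  have "\<kappa> * (M / 2) powr q * (norm (F - F'))\<^sup>2 * (b - a)\<^sup>2 / 2 \<le> rel H F F'"
  proof (rule rel_lower[OF C2_all(2) hess_H_nonneg])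
    fix s assume "a \<le> s" "s \<le> b"
    then have "(M / 2) powr q \<le> norm (F' + s *\<^sub>R (F - F')) powr q"
      using ab(4) M p6 by (intro powr_mono2) (auto simp: M_def)
    then have "\<kappa> * (M / 2) powr q * (norm (F - F'))\<^sup>2 \<le> \<kappa> * norm (F' + s *\<^sub>R (F - F')) powr q * (norm (F - F'))\<^sup>2"
      using kappa(1) by (intro mult_right_mono mult_left_mono) auto
    then show "\<kappa> * (M / 2) powr q * (norm (F - F'))\<^sup>2 \<le> hess_form H (F' + s *\<^sub>R (F - F')) (F - F')"
      using kappa(2) order_trans by blast
  qed (use ab in auto)
  moreover have "(M / 2) powr q = (1/2) powr q * M powr q" using M powr_mult[of "1/2" M q] by simp
  moreover have "wt F F' \<le> 2 * M powr q"
  proof -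
    have "norm F powr q \<le> M powr q" "norm F' powr q \<le> M powr q" using p6 by (auto intro!: powr_mono2 simp: M_def)
    then show ?thesis by (simp add: wt_def)
  qed
  moreover have "(b - a)\<^sup>2 = 1/16" using ab by (simp add: power2_eq_square)
  ultimately have 1: "\<kappa> * (1/2) powr q / 32 * (M powr q * (norm (F - F'))\<^sup>2) \<le> rel H F F'" by (simp add: mult_ac)
  have "\<kappa> * (1/2) powr q / 64 * (wt F F' * (norm (F - F'))\<^sup>2) \<le> \<kappa> * (1/2) powr q / 64 * (2 * M powr q * (norm (F - F'))\<^sup>2)"
    using \<open>wt F F' \<le> 2 * M powr q\<close> kappa(1) by (intro mult_left_mono mult_right_mono) auto
  then show ?thesis using 1 by (simp add: mult_ac)
qed

lemma rel_R_lower: "\<gamma> / 2 * (norm (X - Y))\<^sup>2 \<le> rel R X Y"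
  using rel_lower[OF C2_all(3), where a=0 and b=1 and k="\<gamma> * (norm (X - Y))\<^sup>2" and x=X and y=Y]
    order_trans[OF _ gamma(2)] gamma by auto

definition "c_low = min (\<gamma> / 2) (\<kappa> * (1/2) powr q / 64)"

lemma c_low_pos: "0 < c_low" using gamma(1) kappa(1) by (simp add: c_low_def)

lemma rel_G_lower: "c_low * ((norm (X - Y))\<^sup>2 + wt (fst X) (fst Y) * (norm (fst X - fst Y))\<^sup>2) \<le> rel G X Y"
proof -
  have "c_low * (norm (X - Y))\<^sup>2 \<le> \<gamma> / 2 * (norm (X - Y))\<^sup>2" by (intro mult_right_mono) (auto simp: c_low_def)
  moreover have "c_low * (wt (fst X) (fst Y) * (norm (fst X - fst Y))\<^sup>2) \<le> \<kappa> * (1/2) powr q / 64 * (wt (fst X) (fst Y) * (norm (fst X - fst Y))\<^sup>2)"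
    by (intro mult_right_mono) (auto simp: c_low_def wt_nonneg)
  ultimately show ?thesis using rel_H_lower[of "fst X" "fst Y"] rel_R_lower[of X Y] by (simp add: rel_G distrib_left)
qed

definition "c_up = max \<gamma>' \<kappa>'"

lemma c_up_pos: "0 < c_up" using gamma'(1) by (simp add: c_up_def)

lemma rel_G_upper: "rel G X Y \<le> c_up * ((norm (X - Y))\<^sup>2 + wt (fst X) (fst Y) * (norm (fst X - fst Y))\<^sup>2)"
proof -
  have "rel R X Y \<le> \<gamma>' * (norm (X - Y))\<^sup>2 / 2" by (rule rel_upper[OF C2_all(3) gamma'(2)])
  moreover have "rel H (fst X) (fst Y) \<le> \<kappa>' * wt (fst X) (fst Y) * (norm (fst X - fst Y))\<^sup>2 / 2"
  proof (rule rel_upper[OF C2_all(2)])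
    fix s :: real assume "0 \<le> s" "s \<le> 1"
    then have "\<kappa>' * norm (fst Y + s *\<^sub>R (fst X - fst Y)) powr q * (norm (fst X - fst Y))\<^sup>2 \<le> \<kappa>' * wt (fst X) (fst Y) * (norm (fst X - fst Y))\<^sup>2"
      unfolding wt_def using p6 kappa'(1) by (intro mult_right_mono mult_left_mono segment_powr_le) auto
    then show "hess_form H (fst Y + s *\<^sub>R (fst X - fst Y)) (fst X - fst Y) \<le> \<kappa>' * wt (fst X) (fst Y) * (norm (fst X - fst Y))\<^sup>2"
      using kappa'(2) order_trans by blast
  qed
  moreover have "\<gamma>' * (norm (X - Y))\<^sup>2 \<le> c_up * (norm (X - Y))\<^sup>2" by (intro mult_right_mono) (auto simp: c_up_def)
  moreover have "\<kappa>' * (wt (fst X) (fst Y) * (norm (fst X - fst Y))\<^sup>2) \<le> c_up * (wt (fst X) (fst Y) * (norm (fst X - fst Y))\<^sup>2)"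
    by (intro mult_right_mono) (auto simp: c_up_def wt_nonneg)
  moreover have "0 \<le> c_up * (norm (X - Y))\<^sup>2" "0 \<le> c_up * (wt (fst X) (fst Y) * (norm (fst X - fst Y))\<^sup>2)"
    using c_up_pos wt_nonneg by auto
  ultimately show ?thesis by (simp add: rel_G distrib_left mult.assoc)
qed

lemma rel_sum: "rel G X Y + rel G Y X = (grad G X - grad G Y) \<bullet> (X - Y)"
  by (simp add: rel_def pd_linear_comb diffs inner_diff_left inner_diff_right)

lemma wt_commute: "wt F F' = wt F' F" by (simp add: wt_def)

lemma grad_G_mono: "c_low * ((norm (X - Y))\<^sup>2 + wt (fst X) (fst Y) * (norm (fst X - fst Y))\<^sup>2) \<le> (grad G X - grad G Y) \<bullet> (X - Y)"
proof -
  have "0 \<le> c_low * ((norm (X - Y))\<^sup>2 + wt (fst X) (fst Y) * (norm (fst X - fst Y))\<^sup>2)"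
    using c_low_pos wt_nonneg by simp
  then show ?thesis
    using rel_G_lower[of X Y] rel_G_lower[of Y X] rel_sum[of X Y] by (simp add: wt_commute norm_minus_commute)
qed

lemma grad_R_lipschitz: "norm (grad R X - grad R Y) \<le> 2 * \<gamma>' * norm (X - Y)"
proof (rule grad_lipschitz_convex[OF C2_all(3)])
  show "0 \<le> hess_form R x z" for x z by (rule order_trans[OF _ gamma(2)]) (use gamma(1) in simp)
qed (rule gamma'(2))

lemma grad_H_lipschitz: "norm (grad H F - grad H F') \<le> 2 * (\<kappa>' * 5 powr q) * wt F F' * norm (F - F')"
proof -
  have "norm (grad H F - grad H F') \<le> 2 * (\<kappa>' * 5 powr q * wt F F') * norm (F - F')"
  proof (rule grad_lipschitz_convex[OF C2_all(2) hess_H_nonneg])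
    \<comment> \<open>\<open>norm u\<close> is at most \<open>norm F' + 2 * norm (F - F')\<close>,
      hence five times the larger norm; this is the origin of \<open>5 powr q\<close>.\<close>
    fix u z :: mat3 assume u: "norm (u - F') \<le> 2 * norm (F - F')"
    have "norm u \<le> norm F' + norm (u - F')" using norm_triangle_ineq[of F' "u - F'"] by simp
    also have "\<dots> \<le> 5 * max (norm F) (norm F')" using u norm_triangle_ineq4[of F F'] by (auto simp: max_def)
    finally have "norm u powr q \<le> (5 * max (norm F) (norm F')) powr q" using p6 by (intro powr_mono2) auto
    also have "\<dots> = 5 powr q * max (norm F) (norm F') powr q" by (simp add: powr_mult)
    also have "\<dots> \<le> 5 powr q * wt F F'" by (intro mult_left_mono) (auto simp: wt_def max_def)
    finally have "\<kappa>' * norm u powr q * (norm z)\<^sup>2 \<le> \<kappa>' * (5 powr q * wt F F') * (norm z)\<^sup>2"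
      using kappa'(1) by (intro mult_right_mono mult_left_mono) auto
    then show "hess_form H u z \<le> \<kappa>' * 5 powr q * wt F F' * (norm z)\<^sup>2"
      using kappa'(2)[of u z] by (simp add: mult.assoc)
  qed
  then show ?thesis by (simp add: mult_ac)
qed

definition "c_lip = 2 * \<gamma>' + 2 * (\<kappa>' * 5 powr q)"

lemma c_lip_pos: "0 < c_lip" using gamma'(1) kappa'(1) by (simp add: c_lip_def add_pos_pos)

lemma grad_G_inner: "grad G X \<bullet> z = grad H (fst X) \<bullet> fst z + grad R X \<bullet> z"
  using pd_G[of z X] by (simp add: pd_linear_comb diffs)

text \<open>Kept as a pairing with \<open>z\<close> because the superquadratic part acts on the
  \<open>F\<close> component of \<open>z\<close> alone; if that component is zero, a plain Lipschitz
  bound is left.\<close>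

lemma grad_G_lipschitz: "\<bar>(grad G X - grad G Y) \<bullet> z\<bar> \<le>
   c_lip * (norm (X - Y) * norm z + wt (fst X) (fst Y) * norm (fst X - fst Y) * norm (fst z))"
proof -
  have "\<bar>(grad G X - grad G Y) \<bullet> z\<bar> \<le> \<bar>(grad H (fst X) - grad H (fst Y)) \<bullet> fst z\<bar> + \<bar>(grad R X - grad R Y) \<bullet> z\<bar>"
    by (simp add: inner_diff_left grad_G_inner)
  also have "\<dots> \<le> norm (grad H (fst X) - grad H (fst Y)) * norm (fst z) + norm (grad R X - grad R Y) * norm z"
    by (intro add_mono Cauchy_Schwarz_ineq2)
  also have "\<dots> \<le> (2 * (\<kappa>' * 5 powr q) * wt (fst X) (fst Y) * norm (fst X - fst Y)) * norm (fst z) + (2 * \<gamma>' * norm (X - Y)) * norm z"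
    by (intro add_mono mult_right_mono grad_H_lipschitz grad_R_lipschitz norm_ge_zero)
  also have "\<dots> \<le> c_lip * (norm (X - Y) * norm z) + c_lip * (wt (fst X) (fst Y) * norm (fst X - fst Y) * norm (fst z))"
  proof -
    have "2 * (\<kappa>' * 5 powr q) * (wt (fst X) (fst Y) * norm (fst X - fst Y) * norm (fst z)) \<le> c_lip * (wt (fst X) (fst Y) * norm (fst X - fst Y) * norm (fst z))"
      using wt_nonneg gamma'(1) by (intro mult_right_mono) (auto simp: c_lip_def)
    moreover have "2 * \<gamma>' * (norm (X - Y) * norm z) \<le> c_lip * (norm (X - Y) * norm z)"
      using kappa'(1) by (intro mult_right_mono) (auto simp: c_lip_def)
    ultimately show ?thesis by (simp add: mult_ac)
  qed
  finally show ?thesis by (simp add: distrib_left)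
qed

lemma pd_G_lipschitz: "\<bar>pd G A X - pd G A Y\<bar> \<le>
   c_lip * (norm (X - Y) * norm A + wt (fst X) (fst Y) * norm (fst X - fst Y) * norm (fst A))"
  using grad_G_lipschitz[of X Y A] by (simp add: pd_linear_comb diffs inner_diff_left)

lemma hess_pd_bound:
  fixes f :: "'a::euclidean_space \<Rightarrow> real"
  assumes "\<And>b c. b \<in> Basis \<Longrightarrow> c \<in> Basis \<Longrightarrow> \<bar>pd (pd f b) c x\<bar> \<le> K"
  shows "\<bar>hess_form f x z\<bar> \<le> (real DIM('a))\<^sup>2 * K * (norm z)\<^sup>2"
proof -
  have "\<bar>hess_form f x z\<bar> \<le> (\<Sum>a\<in>Basis. \<bar>\<Sum>b\<in>Basis. (z \<bullet> a) * pd (pd f a) b x * (z \<bullet> b)\<bar>)"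
    unfolding hess_form_def by (rule sum_abs)
  also have "\<dots> \<le> (\<Sum>a\<in>(Basis::'a set). \<Sum>b\<in>(Basis::'a set). K * (norm z)\<^sup>2)"
  proof (intro sum_mono order_trans[OF sum_abs])
    fix a b :: 'a assume ab: "a \<in> Basis" "b \<in> Basis"
    have K: "0 \<le> K" using order_trans[OF abs_ge_zero assms[OF ab]] .
    have "\<bar>z \<bullet> a\<bar> * \<bar>pd (pd f a) b x\<bar> * \<bar>z \<bullet> b\<bar> \<le> norm z * K * norm z"
      using ab assms[OF ab] K by (intro mult_mono Basis_le_norm) auto
    then show "\<bar>(z \<bullet> a) * pd (pd f a) b x * (z \<bullet> b)\<bar> \<le> K * (norm z)\<^sup>2"
      by (simp add: abs_mult power2_eq_square mult_ac)
  qed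
  also have "\<dots> = (real DIM('a))\<^sup>2 * K * (norm z)\<^sup>2" by (simp add: power2_eq_square)
  finally show ?thesis .
qed

text \<open>The number 400 exceeds \<open>19^2 / 2\<close>, from Taylor's formula for
  \<open>R\<close> on \<open>ext\<close>, and \<open>9^2\<close>, from that for \<open>H\<close> on
  \<open>mat3\<close>.\<close>

definition "c_rem = 400 * (c\<^sub>7 + c\<^sub>8)"

lemma c_rem_pos: "0 < c_rem" using third_H(1) third_R(1) by (simp add: c_rem_def)

lemma DIMs: "DIM(mat3) = 9" "DIM(ext) = 19" by simp_all

text \<open>The second-order remainder of a first derivative is governed by third derivatives. Those
  of \<open>H\<close> grow like the power \<open>p - 3\<close>, which \<open>1 + wt\<close>
  dominates along the segment.\<close>

lemma pd_G_remainder: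
  assumes A: "A \<in> Basis"
  shows "\<bar>pd G A X - pd G A Y - (\<Sum>B\<in>Basis. pd (pd G A) B Y * ((X - Y) \<bullet> B))\<bar> \<le>
    c_rem * ((norm (X - Y))\<^sup>2 + (1 + wt (fst X) (fst Y)) * (norm (fst X - fst Y))\<^sup>2)"
proof -
  have dA: "pd G A differentiable at Y" using C1D(1)[OF C2_C1(2)[OF C2_all(1) A]] .
  have "pd G A X - pd G A Y - (\<Sum>B\<in>Basis. pd (pd G A) B Y * ((X - Y) \<bullet> B)) = rel (pd G A) X Y"
    unfolding rel_def by (subst pd_expand[OF dA]) (simp add: mult.commute)
  also have "\<dots> = rel (pd H (fst A)) (fst X) (fst Y) + rel (pd R A) X Y"
    by (simp add: rel_def pd_pd_G[OF A]) (simp add: pd_G)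
  finally have e: "pd G A X - pd G A Y - (\<Sum>B\<in>Basis. pd (pd G A) B Y * ((X - Y) \<bullet> B)) = rel (pd H (fst A)) (fst X) (fst Y) + rel (pd R A) X Y" .
  have 1: "\<bar>rel (pd R A) X Y\<bar> \<le> (real DIM(ext))\<^sup>2 * c\<^sub>8 * (norm (X - Y))\<^sup>2 / 2"
    by (rule second_order_remainder[OF C2_pd(3)[OF A]]) (intro hess_pd_bound third_R(2) A)
  have 2: "\<bar>rel (pd H (fst A)) (fst X) (fst Y)\<bar> \<le> (real DIM(mat3))\<^sup>2 * (c\<^sub>7 * (2 * (1 + wt (fst X) (fst Y)))) * (norm (fst X - fst Y))\<^sup>2 / 2"
  proof (cases "fst A = 0")
    case True
    have "pd H 0 = (\<lambda>_. 0)" by auto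
    moreover have "rel (\<lambda>_. 0) x y = 0" for x y :: mat3 using pd_eqI[OF has_derivative_const] by (simp add: rel_def)
    ultimately show ?thesis using True third_H(1) wt_nonneg by simp
  next
    case False
    then have fA: "fst A \<in> Basis" using fst_Basis[OF A] by simp
    show ?thesis
    proof (rule second_order_remainder[OF C2_pd(2)[OF fA]], rule hess_pd_bound)
      fix s :: real and b c :: mat3 assume s: "0 \<le> s" "s \<le> 1" and bc: "b \<in> Basis" "c \<in> Basis"
      have "norm (fst Y + s *\<^sub>R (fst X - fst Y)) powr (p - 3) \<le> norm (fst X) powr (p - 3) + norm (fst Y) powr (p - 3)"
        using s p6 by (intro segment_powr_le) auto
      also have "\<dots> \<le> (1 + norm (fst X) powr q) + (1 + norm (fst Y) powr q)"
        using p6 by (intro add_mono powr_le_1_plus) auto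
      also have "\<dots> \<le> 2 * (1 + wt (fst X) (fst Y))" by (simp add: wt_def)
      finally have "c\<^sub>7 * norm (fst Y + s *\<^sub>R (fst X - fst Y)) powr (p - 3) \<le> c\<^sub>7 * (2 * (1 + wt (fst X) (fst Y)))"
        using third_H(1) by (intro mult_left_mono) auto
      then show "\<bar>pd (pd (pd H (fst A)) b) c (fst Y + s *\<^sub>R (fst X - fst Y))\<bar> \<le> c\<^sub>7 * (2 * (1 + wt (fst X) (fst Y)))"
        using third_H(2)[OF fA bc] order_trans by blast
    qed
  qed
  have a: "(real DIM(ext))\<^sup>2 * c\<^sub>8 * (norm (X - Y))\<^sup>2 / 2 \<le> c_rem * (norm (X - Y))\<^sup>2"
  proof -
    have "361 * c\<^sub>8 / 2 * (norm (X - Y))\<^sup>2 \<le> c_rem * (norm (X - Y))\<^sup>2"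
      using third_H(1) third_R(1) by (intro mult_right_mono) (auto simp: c_rem_def)
    then show ?thesis by (simp add: DIMs)
  qed
  have b: "(real DIM(mat3))\<^sup>2 * (c\<^sub>7 * (2 * (1 + wt (fst X) (fst Y)))) * (norm (fst X - fst Y))\<^sup>2 / 2
      \<le> c_rem * ((1 + wt (fst X) (fst Y)) * (norm (fst X - fst Y))\<^sup>2)"
  proof -
    have "81 * c\<^sub>7 * ((1 + wt (fst X) (fst Y)) * (norm (fst X - fst Y))\<^sup>2) \<le> c_rem * ((1 + wt (fst X) (fst Y)) * (norm (fst X - fst Y))\<^sup>2)"
      using third_H(1) third_R(1) wt_nonneg[of "fst X" "fst Y"] by (intro mult_right_mono) (auto simp: c_rem_def)
    moreover have "(real DIM(mat3))\<^sup>2 * (c\<^sub>7 * (2 * (1 + wt (fst X) (fst Y)))) * (norm (fst X - fst Y))\<^sup>2 / 2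
      = 81 * c\<^sub>7 * ((1 + wt (fst X) (fst Y)) * (norm (fst X - fst Y))\<^sup>2)"
      unfolding DIMs by (simp add: algebra_simps)
    ultimately show ?thesis by (simp only:)
  qed
  show ?thesis unfolding e using 1 2 a b by (simp add: distrib_left)
qed

lemma grad_G_growth: 
  obtains C where "C > 0" "\<And>X z. \<bar>grad G X \<bullet> z\<bar> \<le> C * ((1 + norm X) * norm z + norm (fst X) powr (p - 1) * norm (fst z))"
proof (rule that[of "norm (grad G 0) + c_lip"])
  show "0 < norm (grad G 0) + c_lip" using c_lip_pos by (simp add: add_nonneg_pos)
  fix X z :: ext
  have pw: "norm (fst X) powr q * norm (fst X) = norm (fst X) powr (p - 1)"
    using powr_add[of "norm (fst X)" q 1] by (cases "fst X = 0") auto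
  have "\<bar>grad G X \<bullet> z\<bar> \<le> \<bar>grad G 0 \<bullet> z\<bar> + \<bar>(grad G X - grad G 0) \<bullet> z\<bar>" by (simp add: inner_diff_left)
  also have "\<dots> \<le> norm (grad G 0) * norm z + c_lip * (norm X * norm z + norm (fst X) powr (p - 1) * norm (fst z))"
    using grad_G_lipschitz[of X 0 z] p6 by (intro add_mono Cauchy_Schwarz_ineq2) (simp add: wt_def pw)
  also have "\<dots> \<le> (norm (grad G 0) + c_lip) * norm z + (norm (grad G 0) + c_lip) * (norm X * norm z + norm (fst X) powr (p - 1) * norm (fst z))"
    using c_lip_pos by (intro add_mono mult_right_mono) auto
  also have "\<dots> = (norm (grad G 0) + c_lip) * ((1 + norm X) * norm z + norm (fst X) powr (p - 1) * norm (fst z))"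
    by (simp add: algebra_simps)
  finally show "\<bar>grad G X \<bullet> z\<bar> \<le> (norm (grad G 0) + c_lip) * ((1 + norm X) * norm z + norm (fst X) powr (p - 1) * norm (fst z))" .
qed

end

section \<open>The smooth solution\<close>

lemma C1per_comp:
  fixes g :: "'a::euclidean_space \<Rightarrow> real" and u :: "vec3 \<Rightarrow> 'a"
  assumes g: "C1 g" and u: "\<And>b. b \<in> Basis \<Longrightarrow> C1per (\<lambda>y. u y \<bullet> b)"
  shows "C1per (\<lambda>y. g (u y))" "dx \<alpha> (\<lambda>y. g (u y)) x = (\<Sum>b\<in>Basis. pd g b (u x) * dx \<alpha> (\<lambda>y. u y \<bullet> b) x)"
proof -
  have du: "(u has_derivative (\<lambda>v. \<Sum>b\<in>Basis. pd (\<lambda>y. u y \<bullet> b) v x *\<^sub>R b)) (at x)" for x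
  proof -
    have "((\<lambda>y. \<Sum>b\<in>Basis. (u y \<bullet> b) *\<^sub>R b) has_derivative (\<lambda>v. \<Sum>b\<in>Basis. pd (\<lambda>y. u y \<bullet> b) v x *\<^sub>R b)) (at x)"
    proof (intro has_derivative_sum has_derivative_scaleR_left)
      fix b :: 'a assume "b \<in> Basis"
      then have "(\<lambda>y. u y \<bullet> b) differentiable at x" using u by (simp add: C1per_def C1D)
      then show "((\<lambda>y. u y \<bullet> b) has_derivative (\<lambda>v. pd (\<lambda>y. u y \<bullet> b) v x)) (at x)"
        unfolding frechet_derivative_works by (simp add: pd_def)
    qed
    then show ?thesis by (simp add: euclidean_representation)
  qed
  have d: "((\<lambda>y. g (u y)) has_derivative (\<lambda>v. \<Sum>b\<in>Basis. pd g b (u x) * pd (\<lambda>y. u y \<bullet> b) v x)) (at x)" for x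
  proof -
    have "((\<lambda>y. g (u y)) has_derivative (\<lambda>v. grad g (u x) \<bullet> (\<Sum>b\<in>Basis. pd (\<lambda>y. u y \<bullet> b) v x *\<^sub>R b))) (at x)"
      by (rule has_derivative_compose[OF du has_derivative_grad[OF C1D(1)[OF g]]])
    moreover have "(\<lambda>v. grad g (u x) \<bullet> (\<Sum>b\<in>Basis. pd (\<lambda>y. u y \<bullet> b) v x *\<^sub>R b)) = (\<lambda>v. \<Sum>b\<in>Basis. pd g b (u x) * pd (\<lambda>y. u y \<bullet> b) v x)"
      unfolding inner_sum_right inner_scaleR_right
      by (intro ext sum.cong refl, subst grad_inner_Basis) (auto simp: mult.commute)
    ultimately show ?thesis by simp
  qed
  have e: "pd (\<lambda>y. g (u y)) v = (\<lambda>x. \<Sum>b\<in>Basis. pd g b (u x) * pd (\<lambda>y. u y \<bullet> b) v x)" for v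
    by (rule ext) (rule pd_eqI[OF d])
  then show "dx \<alpha> (\<lambda>y. g (u y)) x = (\<Sum>b\<in>Basis. pd g b (u x) * dx \<alpha> (\<lambda>y. u y \<bullet> b) x)"
    by (simp add: dx_def)
  have cu: "continuous_on UNIV u"
    by (rule continuous_at_imp_continuous_on, intro ballI) (rule has_derivative_continuous[OF du])
  have "continuous_on UNIV (\<lambda>x. \<Sum>b\<in>Basis. pd g b (u x) * pd (\<lambda>y. u y \<bullet> b) v x)" if "v \<in> Basis" for v
  proof (intro continuous_on_sum continuous_on_mult)
    fix b :: 'a assume b: "b \<in> Basis"
    show "continuous_on UNIV (\<lambda>x. pd g b (u x))"
      using continuous_on_compose2[OF C1D(2)[OF g b] cu] by simp
    show "continuous_on UNIV (pd (\<lambda>y. u y \<bullet> b) v)" using u[OF b] that by (simp add: C1per_def C1D)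
  qed
  then have "C1 (\<lambda>y. g (u y))" unfolding C1_def e by (simp add: differentiableI[OF d])
  moreover have "u (x + axis i 1) = u x" for x i
  proof (rule euclidean_eqI)
    fix b :: 'a assume "b \<in> Basis"
    then show "u (x + axis i 1) \<bullet> b = u x \<bullet> b" using u by (simp add: C1per_def periodic_def)
  qed
  ultimately show "C1per (\<lambda>y. g (u y))" by (simp add: C1per_def periodic_def)
qed

lemma dx_sum_mult:
  assumes "finite I" "\<And>i. i \<in> I \<Longrightarrow> C1per (f i)" "\<And>i. i \<in> I \<Longrightarrow> C1per (g i)"
  shows "dx \<alpha> (\<lambda>y. \<Sum>i\<in>I. f i y * g i y) x = (\<Sum>i\<in>I. f i x * dx \<alpha> (g i) x + dx \<alpha> (f i) x * g i x)"
proof -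
  have "dx \<alpha> (\<lambda>y. \<Sum>i\<in>I. f i y * g i y) x = (\<Sum>i\<in>I. dx \<alpha> (\<lambda>y. f i y * g i y) x)"
    using assms(1) by (rule dx_sum) (rule C1per_mult[OF assms(2,3)])
  also have "\<dots> = (\<Sum>i\<in>I. f i x * dx \<alpha> (g i) x + dx \<alpha> (f i) x * g i x)"
    by (rule sum.cong[OF refl]) (rule dx_mult[OF assms(2,3)])
  finally show ?thesis .
qed

lemma Pair_0_Basis: "b \<in> Basis \<Longrightarrow> (b, 0) \<in> Basis"
  by (auto simp: Basis_prod_def)

locale smooth_sol = energy_density +
  fixes T :: real and U\<^sub>0 :: "vec3 \<Rightarrow> state" and U :: "real \<Rightarrow> vec3 \<Rightarrow> state"
  assumes T: "0 < T" and sol: "smooth_solution G T U\<^sub>0 U" and grad0: "is_gradient (\<lambda>x. dgrad (U\<^sub>0 x))"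
begin

definition "\<Omega> = {0..T} \<times> (UNIV :: vec3 set)"
definition "UU = (\<lambda>(t, x). U t x)"
text \<open>Derivatives of the solution jointly in time and space, taken within the closed strip and
  therefore one-sided in time at 0 and \<open>T\<close>.\<close>

definition "D b z = frechet_derivative UU (at z within \<Omega>) b"
definition "DD b b' z = frechet_derivative (D b) (at z within \<Omega>) b'"

lemma U_periodic: "t \<in> {0..T} \<Longrightarrow> U t (x + axis i 1) = U t x"
  using sol unfolding smooth_solution_def periodic_def by blast

lemma U_init: "U 0 = U\<^sub>0"
  using sol unfolding smooth_solution_def by blast

lemma sol_v: "t \<in> {0..T} \<Longrightarrow> ((\<lambda>s. vel (U s x) $ i) has_real_derivative (\<Sum>\<alpha>\<in>UNIV. dx \<alpha> (\<lambda>y. \<Sum>A\<in>Basis. pd G A (xi (U t y)) * dPhi A i \<alpha> (dgrad (U t y))) x)) (at t within {0..T})"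
  using sol unfolding smooth_solution_def by blast

lemma sol_x: "t \<in> {0..T} \<Longrightarrow> A \<in> Basis \<Longrightarrow> ((\<lambda>s. xi (U s x) \<bullet> A) has_real_derivative (\<Sum>\<alpha>\<in>UNIV. dx \<alpha> (\<lambda>y. \<Sum>i\<in>UNIV. dPhi A i \<alpha> (dgrad (U t y)) * vel (U t y) $ i) x)) (at t within {0..T})"
  using sol unfolding smooth_solution_def by blast

lemma UU_smooth: "Ck_on k \<Omega> UU"
  using sol by (simp add: smooth_solution_def smooth_on_def \<Omega>_def UU_def)

lemma UU_Ck: "Ck_on 0 \<Omega> UU" "UU differentiable_on \<Omega>" "b \<in> Basis \<Longrightarrow> Ck_on (Suc 0) \<Omega> (D b)"
  using UU_smooth[of 0] UU_smooth[of "Suc (Suc 0)"]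
  unfolding Ck_on.simps(2)[of "Suc 0"] D_def[abs_def] by blast+

lemma D_Ck: "b \<in> Basis \<Longrightarrow> D b differentiable_on \<Omega>" "b \<in> Basis \<Longrightarrow> b' \<in> Basis \<Longrightarrow> continuous_on \<Omega> (DD b b')"
  using UU_Ck(3)[of b] unfolding Ck_on.simps DD_def[abs_def] by blast+

lemma UU_deriv: "z \<in> \<Omega> \<Longrightarrow> (UU has_derivative (\<lambda>b. D b z)) (at z within \<Omega>)"
proof -
  assume "z \<in> \<Omega>"
  then have "UU differentiable (at z within \<Omega>)" using UU_Ck(2) by (simp add: differentiable_on_def)
  then have "(UU has_derivative frechet_derivative UU (at z within \<Omega>)) (at z within \<Omega>)"
    by (simp only: frechet_derivative_works)
  then show ?thesis by (simp add: D_def)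
qed

lemma D_deriv: "z \<in> \<Omega> \<Longrightarrow> b \<in> Basis \<Longrightarrow> (D b has_derivative (\<lambda>b'. DD b b' z)) (at z within \<Omega>)"
proof -
  assume "z \<in> \<Omega>" "b \<in> Basis"
  then have "D b differentiable (at z within \<Omega>)" using D_Ck(1) by (simp add: differentiable_on_def)
  then have "(D b has_derivative frechet_derivative (D b) (at z within \<Omega>)) (at z within \<Omega>)"
    by (simp only: frechet_derivative_works)
  then show ?thesis by (simp add: DD_def)
qed

lemma D_cont: "b \<in> Basis \<Longrightarrow> continuous_on \<Omega> (D b)"
  by (rule differentiable_imp_continuous_on[OF D_Ck(1)])

lemmas DD_cont = D_Ck(2)

lemma UU_cont: "continuous_on \<Omega> UU" using UU_smooth[of 0] by simp

abbreviation "tdir \<equiv> (1::real, 0::vec3)"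
abbreviation "xdir \<alpha> \<equiv> (0::real, axis \<alpha> 1 :: vec3)"

lemma dir_Basis: "tdir \<in> Basis" "xdir \<alpha> \<in> Basis" by (auto simp: Basis_prod_def)

lemma U_space_deriv:
  assumes t: "t \<in> {0..T}"
  shows "(U t has_derivative (\<lambda>v. D (0, v) (t, x))) (at x)"
proof -
  have "((\<lambda>x. (t, x)) has_derivative (\<lambda>v. (0, v))) (at x within UNIV)" by (auto intro!: derivative_eq_intros)
  moreover have "(UU has_derivative (\<lambda>b. D b (t, x))) (at (t, x) within (\<lambda>x. (t, x)) ` UNIV)"
    by (rule has_derivative_subset[OF UU_deriv]) (use t in \<open>auto simp: \<Omega>_def\<close>)
  ultimately have "((\<lambda>x. UU (t, x)) has_derivative (\<lambda>v. D (0, v) (t, x))) (at x within UNIV)"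
    by (rule has_derivative_in_compose)
  then show ?thesis by (simp add: UU_def)
qed

lemma D_lin: 
  assumes z: "z \<in> \<Omega>" shows "linear (\<lambda>b. D b z)"
  using has_derivative_bounded_linear[OF UU_deriv[OF z]] bounded_linear.linear by blast

lemma U_time_deriv:
  assumes t: "t \<in> {0..T}"
  shows "((\<lambda>s. U s x) has_vector_derivative D tdir (t, x)) (at t within {0..T})"
proof -
  have "((\<lambda>s. (s, x)) has_derivative (\<lambda>v. (v, 0))) (at t within {0..T})" by (auto intro!: derivative_eq_intros)
  moreover have "(UU has_derivative (\<lambda>b. D b (t, x))) (at (t, x) within (\<lambda>s. (s, x)) ` {0..T})"
    by (rule has_derivative_subset[OF UU_deriv]) (use t in \<open>auto simp: \<Omega>_def\<close>)
  ultimately have "((\<lambda>s. UU (s, x)) has_derivative (\<lambda>v. D (v, 0) (t, x))) (at t within {0..T})"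
    by (rule has_derivative_in_compose)
  moreover have "(\<lambda>v. D (v, 0) (t, x)) = (\<lambda>v. v *\<^sub>R D tdir (t, x))"
  proof
    fix v :: real
    have "D (v, 0) (t, x) = D (v *\<^sub>R tdir) (t, x)" by simp
    also have "\<dots> = v *\<^sub>R D tdir (t, x)" using t by (intro linear_cmul D_lin) (simp add: \<Omega>_def)
    finally show "D (v, 0) (t, x) = v *\<^sub>R D tdir (t, x)" .
  qed
  ultimately show ?thesis unfolding UU_def prod.case has_vector_derivative_def by (simp only:)
qed

lemma dx_U: "t \<in> {0..T} \<Longrightarrow> dx \<alpha> (\<lambda>y. U t y \<bullet> c) x = D (xdir \<alpha>) (t, x) \<bullet> c"
  unfolding dx_def using pd_eqI[OF has_derivative_inner_left[OF U_space_deriv]] by simp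

lemma C1per_U:
  assumes t: "t \<in> {0..T}"
  shows "C1per (\<lambda>y. U t y \<bullet> c)"
  unfolding C1per_def
proof
  have d: "((\<lambda>y. U t y \<bullet> c) has_derivative (\<lambda>v. D (0, v) (t, x) \<bullet> c)) (at x)" for x
    by (rule has_derivative_inner_left[OF U_space_deriv[OF t]])
  have e: "pd (\<lambda>y. U t y \<bullet> c) b = (\<lambda>x. D (0, b) (t, x) \<bullet> c)" for b
    by (rule ext) (rule pd_eqI[OF d])
  have "continuous_on UNIV (\<lambda>x. D (0, b) (t, x) \<bullet> c)" if "b \<in> Basis" for b
  proof -
    have "(0, b) \<in> Basis" using that by (auto simp: Basis_prod_def)
    moreover have "continuous_on UNIV (\<lambda>x::vec3. (t, x))" by (intro continuous_intros)
    moreover have "range (\<lambda>x::vec3. (t, x)) \<subseteq> \<Omega>" using t by (auto simp: \<Omega>_def)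
    ultimately show ?thesis
      by (intro continuous_on_inner continuous_on_const continuous_on_compose2[OF D_cont, of "(0, b)" UNIV "\<lambda>x. (t, x)"])
  qed
  then show "C1 (\<lambda>y. U t y \<bullet> c)" unfolding C1_def e by (simp add: differentiableI[OF d])
  show "periodic (\<lambda>y. U t y \<bullet> c)" using U_periodic[OF t] by (simp add: periodic_def)
qed

lemma component_inner:
  "vel s $ i = s \<bullet> (axis i 1, 0)" "dgrad s $ i $ \<alpha> = s \<bullet> (0, axis i (axis \<alpha> 1), 0)" "xi s \<bullet> A = s \<bullet> (0, A)"
  by (simp_all add: vel_def dgrad_def xi_def inner_prod_def inner_axis)

lemma C1per_comps:
  assumes t: "t \<in> {0..T}"
  shows "C1per (\<lambda>y. vel (U t y) $ i)" "C1per (\<lambda>y. dgrad (U t y) $ i $ \<alpha>)" "C1per (\<lambda>y. xi (U t y) \<bullet> A)"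
  unfolding component_inner by (rule C1per_U[OF t])+

lemma open_interior: "open ({0<..<T} \<times> (UNIV :: vec3 set))" by (intro open_Times) auto

lemma interior_at: 
  assumes "t \<in> {0<..<T}" shows "at (t, x) within \<Omega> = at (t, x)"
  by (rule at_within_open_subset[OF _ open_interior]) (use assms in \<open>auto simp: \<Omega>_def\<close>)

lemma line_deriv:
  fixes f :: "real \<times> vec3 \<Rightarrow> 'b::euclidean_space"
  assumes "(f has_derivative f') (at z)"
  shows "((\<lambda>s. f (z + s *\<^sub>R b) \<bullet> c) has_real_derivative f' b \<bullet> c) (at 0)"
proof -
  have "((\<lambda>s. z + s *\<^sub>R b) has_derivative (\<lambda>h. h *\<^sub>R b)) (at 0)" by (auto intro!: derivative_eq_intros)
  moreover have "(f has_derivative f') (at (z + 0 *\<^sub>R b))" using assms by simp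
  ultimately have "((\<lambda>s. f (z + s *\<^sub>R b)) has_derivative (\<lambda>h. f' (h *\<^sub>R b))) (at 0)"
    by (rule has_derivative_compose)
  then have "((\<lambda>s. f (z + s *\<^sub>R b) \<bullet> c) has_derivative (\<lambda>h. f' (h *\<^sub>R b) \<bullet> c)) (at 0)"
    by (rule has_derivative_inner_left)
  moreover have "f' (h *\<^sub>R b) \<bullet> c = (f' b \<bullet> c) * h" for h
    using linear_cmul[OF bounded_linear.linear[OF has_derivative_bounded_linear[OF assms]]] by simp
  ultimately show ?thesis by (simp add: has_field_derivative_def mult_commute_abs)
qed

lemma D_line: "t \<in> {0<..<T} \<Longrightarrow> ((\<lambda>s. UU ((t, x) + s *\<^sub>R b) \<bullet> c) has_real_derivative D b (t, x) \<bullet> c) (at 0)"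
  using UU_deriv[of "(t, x)"] by (intro line_deriv[where f'="\<lambda>b. D b (t, x)"]) (simp add: interior_at, simp add: \<Omega>_def)

lemma DD_line: "t \<in> {0<..<T} \<Longrightarrow> b \<in> Basis \<Longrightarrow> ((\<lambda>s. D b ((t, x) + s *\<^sub>R b') \<bullet> c) has_real_derivative DD b b' (t, x) \<bullet> c) (at 0)"
  using D_deriv[of "(t, x)" b] by (intro line_deriv[where f'="\<lambda>b'. DD b b' (t, x)"]) (simp add: interior_at, simp add: \<Omega>_def)

text \<open>Restricted to the open strip, where derivatives within \<open>\<Omega>\<close> are
  ordinary derivatives.\<close>

lemma DD_commute:
  assumes t: "t \<in> {0<..<T}" and b: "b \<in> Basis" "b' \<in> Basis"
  shows "DD b b' (t, x) \<bullet> c = DD b' b (t, x) \<bullet> c"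
proof -
  let ?S = "{0<..<T} \<times> (UNIV :: vec3 set)"
  have cont: "isCont (\<lambda>z. DD b b' z \<bullet> c) (t, x)" if "b \<in> Basis" "b' \<in> Basis" for b b'
  proof -
    have "continuous_on ?S (\<lambda>z. DD b b' z \<bullet> c)"
      by (intro continuous_on_inner continuous_on_const continuous_on_subset[OF DD_cont[OF that]]) (auto simp: \<Omega>_def)
    then show ?thesis using t open_interior by (simp add: continuous_on_eq_continuous_at)
  qed
  show ?thesis
    by (rule mixed_derivatives_commute[OF open_interior, where f="\<lambda>z. UU z \<bullet> c" and fa="\<lambda>z. D b z \<bullet> c" and fb="\<lambda>z. D b' z \<bullet> c"
         and a=b and b=b' and fab="\<lambda>z. DD b b' z \<bullet> c" and fba="\<lambda>z. DD b' b z \<bullet> c"])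
       (use t b cont in \<open>auto intro!: D_line DD_line\<close>)
qed

abbreviation "cF i \<alpha> \<equiv> ((0, axis i (axis \<alpha> 1), 0) :: state)"
abbreviation "cV i \<equiv> ((axis i 1, 0) :: state)"

lemma at_T: "t \<in> {0..T} \<Longrightarrow> at t within {0..T} \<noteq> bot"
  using T by (simp add: trivial_limit_within islimpt_Icc)

text \<open>Derivatives within \<open>[0, T]\<close> are unique, so the right-hand sides of the
  system can be read as components of \<open>D tdir\<close>.\<close>

lemma U_component_deriv:
  assumes "t \<in> {0..T}" and "((\<lambda>s. U s x \<bullet> c) has_real_derivative d) (at t within {0..T})"
  shows "D tdir (t, x) \<bullet> c = d"
proof -
  have "((\<lambda>s. U s x \<bullet> c) has_vector_derivative D tdir (t, x) \<bullet> c) (at t within {0..T})"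
    by (rule bounded_linear.has_vector_derivative[OF bounded_linear_inner_left U_time_deriv[OF assms(1)]])
  from vector_derivative_unique_within[OF at_T[OF assms(1)] this]
  show ?thesis using assms(2) unfolding has_real_derivative_iff_has_vector_derivative by blast
qed

lemma sol_xi: "t \<in> {0..T} \<Longrightarrow> A \<in> Basis \<Longrightarrow> D tdir (t, x) \<bullet> (0, A) =
    (\<Sum>\<alpha>\<in>UNIV. dx \<alpha> (\<lambda>y. \<Sum>i\<in>UNIV. dPhi A i \<alpha> (dgrad (U t y)) * vel (U t y) $ i) x)"
  by (rule U_component_deriv, assumption) (rule sol_x[where x=x, unfolded component_inner(3)[of "U _ x"]])

lemma sol_vel: "t \<in> {0..T} \<Longrightarrow> D tdir (t, x) \<bullet> cV i =
    (\<Sum>\<alpha>\<in>UNIV. dx \<alpha> (\<lambda>y. \<Sum>A\<in>Basis. pd G A (xi (U t y)) * dPhi A i \<alpha> (dgrad (U t y))) x)"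
  by (rule U_component_deriv, assumption) (rule sol_v[where x=x, unfolded component_inner(1)[of "U _ x"]])

lemma dPhi_F: "dPhi (axis k (axis \<beta> 1), 0, 0) i \<alpha> F = (if i = k \<and> \<alpha> = \<beta> then 1 else 0)"
proof -
  have "axis k (axis \<beta> (1::real)) $ i $ \<alpha> = (if i = k \<and> \<alpha> = \<beta> then 1 else 0)" by (simp add: axis_def)
  then have "fst (axis k (axis \<beta> 1), 0, 0) $ i $ \<alpha> = (if i = k \<and> \<alpha> = \<beta> then (1::real) else 0)" by simp
  moreover have "dcof 0 i \<alpha> F = 0" by (simp add: dcof_def)
  ultimately show ?thesis unfolding dPhi_eq by (simp only: fst_conv snd_conv mult_zero_left add_0_right)
qed

text \<open>In the \<open>F\<close> block \<open>\<partial>\<Phi>/\<partial>F\<close> is the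
  Kronecker delta. This part of the system is what propagates curl-freeness.\<close>

lemma F_evolution: "t \<in> {0..T} \<Longrightarrow> D tdir (t, x) \<bullet> cF i \<alpha> = D (xdir \<alpha>) (t, x) \<bullet> cV i"
proof -
  assume t: "t \<in> {0..T}"
  have "(axis i (axis \<alpha> 1), 0, 0) \<in> (Basis :: ext set)"
  proof -
    have "axis i (axis \<alpha> 1) \<in> (Basis :: mat3 set)" by (simp add: axis_in_Basis_iff)
    then have "(axis i (axis \<alpha> 1) :: mat3, 0 :: mat3 \<times> real) \<in> Basis"
      by (rule Pair_0_Basis)
    then show ?thesis by (simp add: zero_prod_def)
  qed
  from sol_xi[OF t this, of x]
  have "D tdir (t, x) \<bullet> cF i \<alpha> = (\<Sum>\<beta>\<in>UNIV. dx \<beta> (\<lambda>y. \<Sum>k\<in>UNIV. (if k = i \<and> \<beta> = \<alpha> then 1 else 0) * vel (U t y) $ k) x)"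
    by (simp add: dPhi_F zero_prod_def)
  also have "\<dots> = (\<Sum>\<beta>\<in>UNIV. if \<beta> = \<alpha> then dx \<beta> (\<lambda>y. vel (U t y) $ i) x else 0)"
  proof (intro sum.cong refl)
    fix \<beta>
    have "(\<lambda>y. \<Sum>k\<in>UNIV. (if k = i \<and> \<beta> = \<alpha> then 1 else 0) * vel (U t y) $ k) = (\<lambda>y. if \<beta> = \<alpha> then vel (U t y) $ i else 0)"
      by (auto simp: if_distrib[of "\<lambda>z. z * _"] cong: if_cong)
    then show "dx \<beta> (\<lambda>y. \<Sum>k\<in>UNIV. (if k = i \<and> \<beta> = \<alpha> then 1 else 0) * vel (U t y) $ k) x = (if \<beta> = \<alpha> then dx \<beta> (\<lambda>y. vel (U t y) $ i) x else 0)"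
      by (auto simp: dx_const)
  qed
  also have "\<dots> = D (xdir \<alpha>) (t, x) \<bullet> cV i" by (simp add: component_inner dx_U[OF t])
  finally show ?thesis .
qed

text \<open>The curl of the deformation gradient is constant in time, as its time derivative is a
  commutator of second space derivatives of the velocity. It vanishes initially because a gradient
  is weakly curl-free and the initial field is C^1. The faces of the cube are left out; they form a
  null set.\<close>

lemma curl_free:
  assumes t: "t \<in> {0..T}" and x: "x \<in> box 0 One"
  shows "dx \<beta> (\<lambda>y. dgrad (U t y) $ i $ \<alpha>) x = dx \<alpha> (\<lambda>y. dgrad (U t y) $ i $ \<beta>) x"
proof -
  define k where "k s = D (xdir \<beta>) (s, x) \<bullet> cF i \<alpha> - D (xdir \<alpha>) (s, x) \<bullet> cF i \<beta>" for s
  have 0: "k 0 = 0"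
  proof -
    define w where "w y = dx \<beta> (\<lambda>y. dgrad (U 0 y) $ i $ \<alpha>) y - dx \<alpha> (\<lambda>y. dgrad (U 0 y) $ i $ \<beta>) y" for y
    have t0: "(0::real) \<in> {0..T}" using T by simp
    note C = C1per_comps(2)[OF t0]
    have cw: "continuous_on UNIV w" unfolding w_def
      by (rule continuous_on_diff[OF C1per_dx_cont[OF C] C1per_dx_cont[OF C]])
    have "weak_curl_free (\<lambda>x. dgrad (U 0 x))"
    proof (rule gradient_weak_curl_free)
      show "is_gradient (\<lambda>x. dgrad (U 0 x))" using grad0 by (simp add: U_init)
      show "periodic (\<lambda>x. dgrad (U 0 x))" by (simp add: periodic_def U_periodic[OF t0])
    qed (rule integrable_torus_cont[OF C1per_cont[OF C]])
    then have cf: "(\<integral>x. dgrad (U 0 x) $ i $ \<alpha> * dx \<beta> \<phi> x \<partial>torus) = (\<integral>x. dgrad (U 0 x) $ i $ \<beta> * dx \<alpha> \<phi> x \<partial>torus)" if "testfun \<phi>" for \<phi>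
      using that by (simp add: weak_curl_free_def)
    have "w x = 0"
    proof (rule fundamental_lemma_cont[OF cw _ x])
      fix \<phi> assume f: "testfun \<phi>"
      have i: "integrable torus (\<lambda>x. dx \<beta> (\<lambda>y. dgrad (U 0 y) $ i $ \<alpha>) x * \<phi> x)" for \<alpha> \<beta>
        by (intro integrable_torus_cont continuous_on_mult C1per_dx_cont C C1per_cont testfun_C1per f)
      have g: "(\<integral>x. dgrad (U 0 x) $ i $ \<alpha> * dx \<beta> \<phi> x \<partial>torus) = - (\<integral>x. dx \<beta> (\<lambda>y. dgrad (U 0 y) $ i $ \<alpha>) x * \<phi> x \<partial>torus)" for \<alpha> \<beta>
        using weak_grad_C1per[OF C, of 2 i \<alpha>] f unfolding weak_grad_def by simp
      show "(\<integral>x. w x * \<phi> x \<partial>torus) = 0"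
        using cf[OF f] unfolding g using i by (simp add: w_def left_diff_distrib)
    qed
    then show ?thesis using t0 by (simp add: w_def k_def component_inner dx_U)
  qed
  have cont: "continuous_on {0..T} k" unfolding k_def
    by (intro continuous_on_diff continuous_on_inner continuous_on_const continuous_on_compose2[OF D_cont[OF dir_Basis(2)]])
       (auto simp: \<Omega>_def intro!: continuous_intros)
  have deriv: "(k has_real_derivative 0) (at s)" if s: "0 < s" "s < T" for s
  proof -
    have s': "s \<in> {0<..<T}" using s by simp
    have tl: "((\<lambda>r. D (xdir \<beta>) (r, x) \<bullet> c) has_real_derivative DD (xdir \<beta>) tdir (s, x) \<bullet> c) (at s)" for \<beta> c
    proof -
      have "((\<lambda>r. D (xdir \<beta>) ((s, x) + r *\<^sub>R tdir) \<bullet> c) has_real_derivative DD (xdir \<beta>) tdir (s, x) \<bullet> c) (at (s - s))"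
        using DD_line[OF s' dir_Basis(2)[of \<beta>], where x=x and b'=tdir and c=c] by simp
      from DERIV_chain2[OF this DERIV_diff[OF DERIV_ident DERIV_const]] show ?thesis by simp
    qed
    \<comment> \<open>\<open>F_evolution\<close> holds along the whole line in direction
      \<open>xdir \<beta>\<close> and may be differentiated there; this turns the time derivative of
      a derivative of \<open>F\<close> into a second space derivative of the velocity.\<close>
    have eq: "DD (xdir \<beta>) tdir (s, x) \<bullet> cF i \<alpha> = DD (xdir \<alpha>) (xdir \<beta>) (s, x) \<bullet> cV i" for \<alpha> \<beta>
    proof -
      have "((\<lambda>r. D tdir ((s, x) + r *\<^sub>R xdir \<beta>) \<bullet> cF i \<alpha>) has_real_derivative DD tdir (xdir \<beta>) (s, x) \<bullet> cF i \<alpha>) (at 0)"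
        by (rule DD_line[OF s' dir_Basis(1)])
      moreover have "(\<lambda>r. D tdir ((s, x) + r *\<^sub>R xdir \<beta>) \<bullet> cF i \<alpha>) = (\<lambda>r. D (xdir \<alpha>) ((s, x) + r *\<^sub>R xdir \<beta>) \<bullet> cV i)"
        using F_evolution[of s] s by auto
      ultimately have "DD tdir (xdir \<beta>) (s, x) \<bullet> cF i \<alpha> = DD (xdir \<alpha>) (xdir \<beta>) (s, x) \<bullet> cV i"
        using DERIV_unique DD_line[OF s' dir_Basis(2)[of \<alpha>], where x=x and b'="xdir \<beta>" and c="cV i"] by metis
      then show ?thesis using DD_commute[OF s' dir_Basis(2) dir_Basis(1)] by simp
    qed
    have "(k has_real_derivative (DD (xdir \<beta>) tdir (s, x) \<bullet> cF i \<alpha> - DD (xdir \<alpha>) tdir (s, x) \<bullet> cF i \<beta>)) (at s)"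
      unfolding k_def by (intro DERIV_diff tl)
    then show ?thesis unfolding eq using DD_commute[OF s' dir_Basis(2)[of \<alpha>] dir_Basis(2)[of \<beta>], where x=x] by simp
  qed
  have "k t = k 0" using t T by (intro DERIV_isconst2[OF T cont]) (auto intro: deriv)
  then show ?thesis using 0 t by (simp add: k_def component_inner dx_U)
qed

abbreviation "gb A t x \<equiv> pd G A (xi (U t x))"
abbreviation "Pb A i \<alpha> t x \<equiv> dPhi A i \<alpha> (dgrad (U t x))"

lemma C1per_gb: "t \<in> {0..T} \<Longrightarrow> A \<in> Basis \<Longrightarrow> C1per (\<lambda>y. gb A t y)"
  by (rule C1per_comp(1)[OF C2_C1(2)[OF C2_all(1)]]) (auto intro: C1per_comps(3))

lemma dPhi_C1per:
  assumes F: "\<And>i \<alpha>. C1per (\<lambda>y. F y $ i $ \<alpha>)"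
  shows "C1per (\<lambda>y. dPhi A i \<alpha> (F y))"
proof -
  have m: "C1per (\<lambda>y. k * F y $ i $ \<alpha>)" "C1per (\<lambda>y. k * (F y $ i $ \<alpha> * F y $ j $ \<beta>))" for k i \<alpha> j \<beta>
    by (intro C1per_mult C1per_const F)+
  have "dPhi A i \<alpha> (F y) = fst A $ i $ \<alpha> + (fst (snd A) $ (i + 2) $ (\<alpha> + 2) * F y $ (i + 1) $ (\<alpha> + 1) + fst (snd A) $ (i + 1) $ (\<alpha> + 1) * F y $ (i + 2) $ (\<alpha> + 2)
     + (- fst (snd A) $ (i + 2) $ (\<alpha> + 1)) * F y $ (i + 1) $ (\<alpha> + 2) + (- fst (snd A) $ (i + 1) $ (\<alpha> + 2)) * F y $ (i + 2) $ (\<alpha> + 1))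
     + (snd (snd A) * (F y $ (i + 1) $ (\<alpha> + 1) * F y $ (i + 2) $ (\<alpha> + 2)) + (- snd (snd A)) * (F y $ (i + 1) $ (\<alpha> + 2) * F y $ (i + 2) $ (\<alpha> + 1)))" for y
    by (simp add: dPhi_eq dcof_def cof_def algebra_simps)
  then show ?thesis by (simp only:) (intro C1per_add m C1per_const)
qed

lemma C1per_Pb: "t \<in> {0..T} \<Longrightarrow> C1per (\<lambda>y. Pb A i \<alpha> t y)"
  by (intro dPhi_C1per C1per_comps(2))

lemma piola_Pb: "t \<in> {0..T} \<Longrightarrow> x \<in> box 0 One \<Longrightarrow> (\<Sum>\<alpha>\<in>UNIV. dx \<alpha> (\<lambda>y. Pb A i \<alpha> t y) x) = 0"
  by (intro piola_pointwise C1per_comps(2) curl_free)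

text \<open>The conservation law in nonconservative form: the terms with a derivative on
  \<open>\<partial>\<Phi>/\<partial>F\<close> disappear by the Piola identity. The same happens in
  \<open>xi_evolution\<close>.\<close>

lemma vel_evolution:
  assumes t: "t \<in> {0..T}" and x: "x \<in> box 0 One"
  shows "D tdir (t, x) \<bullet> cV i = (\<Sum>\<alpha>\<in>UNIV. \<Sum>A\<in>Basis. dx \<alpha> (\<lambda>y. gb A t y) x * Pb A i \<alpha> t x)"
proof -
  have "D tdir (t, x) \<bullet> cV i = (\<Sum>\<alpha>\<in>UNIV. \<Sum>A\<in>Basis. gb A t x * dx \<alpha> (\<lambda>y. Pb A i \<alpha> t y) x + dx \<alpha> (\<lambda>y. gb A t y) x * Pb A i \<alpha> t x)"
    unfolding sol_vel[OF t]
    by (intro sum.cong refl dx_sum_mult finite_Basis C1per_gb[OF t] C1per_Pb[OF t])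
  also have "\<dots> = (\<Sum>A\<in>Basis. gb A t x * (\<Sum>\<alpha>\<in>UNIV. dx \<alpha> (\<lambda>y. Pb A i \<alpha> t y) x)) + (\<Sum>\<alpha>\<in>UNIV. \<Sum>A\<in>Basis. dx \<alpha> (\<lambda>y. gb A t y) x * Pb A i \<alpha> t x)"
    by (simp only: sum.distrib sum_distrib_left, subst sum.swap, rule refl)
  finally show ?thesis using piola_Pb[OF t x] by simp
qed

lemma xi_evolution:
  assumes t: "t \<in> {0..T}" and x: "x \<in> box 0 One" and A: "A \<in> Basis"
  shows "D tdir (t, x) \<bullet> (0, A) = (\<Sum>i\<in>UNIV. \<Sum>\<alpha>\<in>UNIV. Pb A i \<alpha> t x * dx \<alpha> (\<lambda>y. vel (U t y) $ i) x)"
proof -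
  have "D tdir (t, x) \<bullet> (0, A) = (\<Sum>\<alpha>\<in>UNIV. \<Sum>i\<in>UNIV. Pb A i \<alpha> t x * dx \<alpha> (\<lambda>y. vel (U t y) $ i) x + dx \<alpha> (\<lambda>y. Pb A i \<alpha> t y) x * vel (U t x) $ i)"
    unfolding sol_xi[OF t A]
    by (intro sum.cong refl dx_sum_mult finite C1per_comps(1)[OF t] C1per_Pb[OF t])
  also have "\<dots> = (\<Sum>i\<in>UNIV. \<Sum>\<alpha>\<in>UNIV. Pb A i \<alpha> t x * dx \<alpha> (\<lambda>y. vel (U t y) $ i) x) + (\<Sum>i\<in>UNIV. (\<Sum>\<alpha>\<in>UNIV. dx \<alpha> (\<lambda>y. Pb A i \<alpha> t y) x) * vel (U t x) $ i)"
    unfolding sum.distrib sum_distrib_right by (subst sum.swap, subst (2) sum.swap) (rule refl)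
  finally show ?thesis using piola_Pb[OF t x] by simp
qed

section \<open>Bounds for the smooth solution on the space-time cylinder\<close>

lemma compact_bound:
  fixes f :: "real \<times> vec3 \<Rightarrow> 'b::real_normed_vector"
  assumes "continuous_on \<Omega> f"
  obtains B where "B \<ge> 0" "\<And>t x. t \<in> {0..T} \<Longrightarrow> x \<in> cbox 0 One \<Longrightarrow> norm (f (t, x)) \<le> B"
proof -
  have "compact (f ` ({0..T} \<times> cbox 0 One))"
    by (intro compact_continuous_image compact_Times compact_cbox continuous_on_subset[OF assms]) (auto simp: \<Omega>_def)
  then obtain B where B: "\<forall>y\<in>f ` ({0..T} \<times> cbox 0 One). norm y \<le> B" using compact_imp_bounded bounded_iff by blast
  show ?thesis
  proof (rule that[of "max B 0"])
    fix t and x :: vec3 assume "t \<in> {0..T}" "x \<in> cbox 0 One"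
    then have "f (t, x) \<in> f ` ({0..T} \<times> cbox 0 One)" by (intro imageI SigmaI)
    then have "norm (f (t, x)) \<le> B" using B by blast
    then show "norm (f (t, x)) \<le> max B 0" by (rule max.coboundedI1)
  qed simp
qed

lemma finite_family_bound:
  fixes f :: "'i \<Rightarrow> real \<times> vec3 \<Rightarrow> 'b::real_normed_vector"
  assumes "finite I" "\<And>i. i \<in> I \<Longrightarrow> continuous_on \<Omega> (f i)"
  obtains B where "B \<ge> 0" "\<And>i t x. i \<in> I \<Longrightarrow> t \<in> {0..T} \<Longrightarrow> x \<in> cbox 0 One \<Longrightarrow> norm (f i (t, x)) \<le> B"
proof -
  have "continuous_on \<Omega> (\<lambda>z. \<Sum>i\<in>I. norm (f i z))" using assms(2) by (intro continuous_on_sum continuous_on_norm)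
  from compact_bound[OF this] obtain B where B: "B \<ge> 0" "\<And>t x. t \<in> {0..T} \<Longrightarrow> x \<in> cbox 0 One \<Longrightarrow> norm (\<Sum>i\<in>I. norm (f i (t, x))) \<le> B" by blast
  show ?thesis
  proof (rule that[OF B(1)])
    fix i t and x :: vec3 assume i: "i \<in> I" and tx: "t \<in> {0..T}" "x \<in> cbox 0 One"
    have "norm (f i (t, x)) \<le> (\<Sum>i\<in>I. norm (f i (t, x)))" by (rule member_le_sum[OF i _ assms(1)]) auto
    then show "norm (f i (t, x)) \<le> B" using B(2)[OF tx] by simp
  qed
qed

lemma dx_gb: "t \<in> {0..T} \<Longrightarrow> A \<in> Basis \<Longrightarrow>
   dx \<alpha> (\<lambda>y. gb A t y) x = (\<Sum>B\<in>Basis. pd (pd G A) B (xi (U t x)) * (D (xdir \<alpha>) (t, x) \<bullet> (0, B)))"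
proof -
  assume t: "t \<in> {0..T}" and A: "A \<in> Basis"
  have "dx \<alpha> (\<lambda>y. gb A t y) x = (\<Sum>B\<in>Basis. pd (pd G A) B (xi (U t x)) * dx \<alpha> (\<lambda>y. xi (U t y) \<bullet> B) x)"
    by (rule C1per_comp(2)[OF C2_C1(2)[OF C2_all(1) A]]) (rule C1per_comps(3)[OF t])
  then show ?thesis by (simp only: component_inner(3) dx_U[OF t])
qed

text \<open>All these fields are continuous on the strip, hence bounded over the compact cylinder.
  The last summand of the constant covers the chain rule for \<open>gb\<close>.\<close>

lemma solution_bounds:
  obtains B where "1 \<le> B"
    "\<And>t x. t \<in> {0..T} \<Longrightarrow> x \<in> cbox 0 One \<Longrightarrow> norm (U t x) \<le> B"
    "\<And>t x. t \<in> {0..T} \<Longrightarrow> x \<in> cbox 0 One \<Longrightarrow> norm (D tdir (t, x)) \<le> B"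
    "\<And>t x i \<alpha>. t \<in> {0..T} \<Longrightarrow> x \<in> cbox 0 One \<Longrightarrow> \<bar>dx \<alpha> (\<lambda>y. vel (U t y) $ i) x\<bar> \<le> B"
    "\<And>t x A \<alpha>. t \<in> {0..T} \<Longrightarrow> x \<in> cbox 0 One \<Longrightarrow> A \<in> Basis \<Longrightarrow> \<bar>dx \<alpha> (\<lambda>y. gb A t y) x\<bar> \<le> B"
    "\<And>t x A. t \<in> {0..T} \<Longrightarrow> x \<in> cbox 0 One \<Longrightarrow> A \<in> Basis \<Longrightarrow> \<bar>gb A t x\<bar> \<le> B"
    "\<And>t x A A'. t \<in> {0..T} \<Longrightarrow> x \<in> cbox 0 One \<Longrightarrow> A \<in> Basis \<Longrightarrow> A' \<in> Basis \<Longrightarrow> \<bar>pd (pd G A) A' (xi (U t x))\<bar> \<le> B"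
proof -
  have cxi: "continuous_on \<Omega> (\<lambda>z. xi (UU z))" unfolding xi_def by (intro continuous_intros UU_cont)
  have c2: "continuous_on \<Omega> (\<lambda>z. pd (pd G A) A' (xi (UU z)))" if "A \<in> Basis" "A' \<in> Basis" for A A'
    using continuous_on_compose2[OF C1D(2)[OF C2_C1(2)[OF C2_all(1) that(1)] that(2)] cxi] by auto
  have c1: "continuous_on \<Omega> (\<lambda>z. pd G A (xi (UU z)))" if "A \<in> Basis" for A
    using continuous_on_compose2[OF C1D(2)[OF C2_C1(1)[OF C2_all(1)] that] cxi] by auto
  obtain B1 where B1: "B1 \<ge> 0" "\<And>t x. t \<in> {0..T} \<Longrightarrow> x \<in> cbox 0 One \<Longrightarrow> norm (UU (t, x)) \<le> B1"
    by (rule compact_bound[OF UU_cont]) blast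
  obtain B2 where B2: "B2 \<ge> 0" "\<And>t x. t \<in> {0..T} \<Longrightarrow> x \<in> cbox 0 One \<Longrightarrow> norm (D tdir (t, x)) \<le> B2"
    by (rule compact_bound[OF D_cont[OF dir_Basis(1)]]) blast
  obtain B3 where B3: "B3 \<ge> 0" "\<And>i t x. i \<in> UNIV \<Longrightarrow> t \<in> {0..T} \<Longrightarrow> x \<in> cbox 0 One \<Longrightarrow> norm (D (xdir i) (t, x)) \<le> B3"
    by (rule finite_family_bound[of UNIV "\<lambda>i. D (xdir i)", OF _ D_cont[OF dir_Basis(2)]]) auto
  obtain B4 where B4: "B4 \<ge> 0" "\<And>i t x. i \<in> (Basis::ext set) \<Longrightarrow> t \<in> {0..T} \<Longrightarrow> x \<in> cbox 0 One \<Longrightarrow> norm (pd G i (xi (UU (t, x)))) \<le> B4"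
    by (rule finite_family_bound[of Basis "\<lambda>A z. pd G A (xi (UU z))", OF _ c1]) auto
  obtain B5 where B5: "B5 \<ge> 0" "\<And>i t x. i \<in> Basis \<times> (Basis::ext set) \<Longrightarrow> t \<in> {0..T} \<Longrightarrow> x \<in> cbox 0 One \<Longrightarrow> norm (pd (pd G (fst i)) (snd i) (xi (UU (t, x)))) \<le> B5"
    by (rule finite_family_bound[of "Basis \<times> Basis" "\<lambda>i z. pd (pd G (fst i)) (snd i) (xi (UU z))"]) (auto intro!: c2)
  have UUU: "UU (t, x) = U t x" for t x by (simp add: UU_def)
  have ds: "0 \<le> (\<Sum>B\<in>(Basis::ext set). B5 * B3)" using B5 B3 by (intro sum_nonneg) auto
  show ?thesis
  proof (rule that[of "1 + B1 + B2 + B3 + B4 + B5 + (\<Sum>B\<in>(Basis::ext set). B5 * B3)"])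
    fix t and x :: vec3 assume tx: "t \<in> {0..T}" "x \<in> cbox 0 One"
    show "norm (U t x) \<le> 1 + B1 + B2 + B3 + B4 + B5 + (\<Sum>B\<in>(Basis::ext set). B5 * B3)"
      using B1(2)[OF tx] B1(1) B2(1) B3(1) B4(1) B5(1) ds unfolding UUU by linarith
    show "norm (D tdir (t, x)) \<le> 1 + B1 + B2 + B3 + B4 + B5 + (\<Sum>B\<in>(Basis::ext set). B5 * B3)"
      using B2(2)[OF tx] B1(1) B2(1) B3(1) B4(1) B5(1) ds by linarith
    have D3: "\<bar>D (xdir \<alpha>) (t, x) \<bullet> c\<bar> \<le> B3" if "c \<in> Basis" for \<alpha> c
      using Basis_le_norm[OF that, of "D (xdir \<alpha>) (t, x)"] B3(2)[of \<alpha> t x] tx by simp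
    fix \<alpha>
    { fix i
      have "cV i \<in> Basis" by (auto simp: Basis_prod_def)
      then show "\<bar>dx \<alpha> (\<lambda>y. vel (U t y) $ i) x\<bar> \<le> 1 + B1 + B2 + B3 + B4 + B5 + (\<Sum>B\<in>(Basis::ext set). B5 * B3)"
        using D3[of "cV i" \<alpha>] B1(1) B2(1) B3(1) B4(1) B5(1) ds unfolding component_inner dx_U[OF tx(1)] by linarith }
    fix A :: ext assume A: "A \<in> Basis"
    show "\<bar>gb A t x\<bar> \<le> 1 + B1 + B2 + B3 + B4 + B5 + (\<Sum>B\<in>(Basis::ext set). B5 * B3)"
      using B4(2)[OF A tx] B1(1) B2(1) B3(1) B4(1) B5(1) ds unfolding UUU real_norm_def by linarith
    have b5: "\<bar>pd (pd G A) A' (xi (U t x))\<bar> \<le> B5" if "A' \<in> Basis" for A'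
      using B5(2)[of "(A, A')" t x] A that tx unfolding UUU by (simp del: One_nth)
    { fix A' :: ext assume "A' \<in> Basis"
      then show "\<bar>pd (pd G A) A' (xi (U t x))\<bar> \<le> 1 + B1 + B2 + B3 + B4 + B5 + (\<Sum>B\<in>(Basis::ext set). B5 * B3)"
        using b5[of A'] B1(1) B2(1) B3(1) B4(1) B5(1) ds by linarith }
    have "\<bar>dx \<alpha> (\<lambda>y. gb A t y) x\<bar> \<le> (\<Sum>B\<in>(Basis::ext set). \<bar>pd (pd G A) B (xi (U t x)) * (D (xdir \<alpha>) (t, x) \<bullet> (0, B))\<bar>)"
      unfolding dx_gb[OF tx(1) A] by (rule sum_abs)
    also have "\<dots> \<le> (\<Sum>B\<in>(Basis::ext set). B5 * B3)"
      unfolding abs_mult using b5 B5(1) by (intro sum_mono mult_mono D3) (auto simp: Basis_prod_def)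
    finally show "\<bar>dx \<alpha> (\<lambda>y. gb A t y) x\<bar> \<le> 1 + B1 + B2 + B3 + B4 + B5 + (\<Sum>B\<in>(Basis::ext set). B5 * B3)"
      using B1(1) B2(1) B3(1) B4(1) B5(1) by linarith
  qed (use B1 B2 B3 B4 B5 ds in linarith)
qed

end

section \<open>One time step\<close>

lemma weak_grad_add:
  assumes "weak_grad p u m" "weak_grad p v n" "1 \<le> p"
  shows "weak_grad p (\<lambda>x. u x + v x) (\<lambda>\<alpha> x. m \<alpha> x + n \<alpha> x)"
  unfolding weak_grad_def
proof (intro conjI allI impI)
  have L: "Lr p u" "Lr p v" "\<And>\<alpha>. Lr p (m \<alpha>)" "\<And>\<alpha>. Lr p (n \<alpha>)" using assms by (auto simp: weak_grad_def)
  show "Lr p (\<lambda>x. u x + v x)" "\<And>\<alpha>. Lr p (\<lambda>x. m \<alpha> x + n \<alpha> x)" using L assms(3) by (auto intro!: Lr_add)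
  fix \<phi> \<alpha> assume f: "testfun \<phi>"
  have c: "continuous_on UNIV \<phi>" "continuous_on UNIV (dx \<alpha> \<phi>)"
    using testfun_C1per[OF f] by (auto intro: C1per_cont C1per_dx_cont)
  have i: "integrable torus (\<lambda>x. w x * \<psi> x)" if "Lr p w" "continuous_on UNIV \<psi>" for w \<psi>
    by (rule integrable_torus_mult_cont[OF Lr_integrable[OF that(1) assms(3)] that(2)])
  have "(\<integral>x. u x * dx \<alpha> \<phi> x \<partial>torus) = - (\<integral>x. m \<alpha> x * \<phi> x \<partial>torus)" "(\<integral>x. v x * dx \<alpha> \<phi> x \<partial>torus) = - (\<integral>x. n \<alpha> x * \<phi> x \<partial>torus)"
    using assms f by (auto simp: weak_grad_def)
  then show "(\<integral>x. (u x + v x) * dx \<alpha> \<phi> x \<partial>torus) = - (\<integral>x. (m \<alpha> x + n \<alpha> x) * \<phi> x \<partial>torus)"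
    using i[OF L(1) c(2)] i[OF L(2) c(2)] i[OF L(3) c(1)] i[OF L(4) c(1)] by (simp add: distrib_right)
qed

lemma deriv_comp_time:
  fixes g :: "'a::euclidean_space \<Rightarrow> real"
  assumes "g differentiable at (y s)" "(y has_vector_derivative y') (at s within S)"
  shows "((\<lambda>s. g (y s)) has_real_derivative (\<Sum>b\<in>Basis. pd g b (y s) * (y' \<bullet> b))) (at s within S)"
proof -
  have "((\<lambda>s. g (y s)) has_derivative (\<lambda>r. grad g (y s) \<bullet> (r *\<^sub>R y'))) (at s within S)"
    by (rule has_derivative_compose[OF assms(2)[unfolded has_vector_derivative_def] has_derivative_grad[OF assms(1)]])
  moreover have "grad g (y s) \<bullet> y' = (\<Sum>b\<in>Basis. pd g b (y s) * (y' \<bullet> b))"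
    by (simp add: grad_def inner_sum_left) (simp add: inner_commute)
  ultimately show ?thesis by (simp add: has_field_derivative_def mult_commute_abs)
qed

lemma vec3_axis_sum: "(\<chi> \<alpha>. f \<alpha>) = (\<Sum>\<alpha>\<in>UNIV. f \<alpha> *\<^sub>R axis \<alpha> (1::real))"
  by (simp add: vec_eq_iff sum_component axis_def if_distrib[of "\<lambda>z. _ * z"] cong: if_cong)

lemma state_parts: "norm (vel s) \<le> norm s" "norm (xi s) \<le> norm s" "norm (dgrad s) \<le> norm s" "fst (xi s) = dgrad s" "norm (dgrad s) \<le> norm (xi s)"
proof -
  have a: "norm (fst z) \<le> norm z" for z :: "'x::real_normed_vector \<times> 'y::real_normed_vector"
    using norm_fst_le[of "fst z" "snd z"] by simp
  have b: "norm (snd z) \<le> norm z" for z :: "'x::real_normed_vector \<times> 'y::real_normed_vector"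
    using norm_snd_le[of "snd z" "fst z"] by simp
  show "norm (vel s) \<le> norm s" "norm (xi s) \<le> norm s" "fst (xi s) = dgrad s" "norm (dgrad s) \<le> norm (xi s)" using a b by (simp_all add: vel_def xi_def dgrad_def)
  show "norm (dgrad s) \<le> norm s" unfolding dgrad_def by (rule order_trans[OF a b])
qed

lemma state_diff: "vel (a - b) = vel a - vel b" "xi (a - b) = xi a - xi b" "dgrad (a - b) = dgrad a - dgrad b"
  by (simp_all add: vel_def xi_def dgrad_def)

text \<open>A single step from the old iterate \<open>A\<close> to the new iterate \<open>B\<close>.
  The balances are (P2), the velocity of \<open>B\<close> lies in L^p by (P4), and the weak curl
  condition on \<open>A\<close> will come from (P3).\<close>

locale time_step = smooth_sol +
  fixes h :: real and A B :: "vec3 \<Rightarrow> state"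
  assumes h: "0 < h" and inA: "in_space p A" and inB: "in_space p B" and vB: "Lp p (\<lambda>x. vel (B x))"
    and bal_vel: "\<And>i. distr_balance (\<lambda>x. (vel (B x) $ i - vel (A x) $ i) / h)
        (\<lambda>x. \<chi> \<alpha>. \<Sum>C\<in>Basis. pd G C (xi (B x)) * dPhi C i \<alpha> (dgrad (A x))) (\<lambda>x. 0)"
    and bal_xi: "\<And>C. C \<in> Basis \<Longrightarrow> distr_balance (\<lambda>x. (xi (B x) \<bullet> C - xi (A x) \<bullet> C) / h)
        (\<lambda>x. \<chi> \<alpha>. \<Sum>i\<in>UNIV. dPhi C i \<alpha> (dgrad (A x)) * vel (B x) $ i) (\<lambda>x. 0)"
    and curlA: "weak_curl_free (\<lambda>x. dgrad (A x))"
begin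

section \<open>Growth calculus for the fields of one step\<close>

lemma state_norm2: "(norm s)\<^sup>2 = (norm (vel s))\<^sup>2 + ((norm (dgrad s))\<^sup>2 + ((norm (fst (snd (xi s))))\<^sup>2 + (snd (snd (xi s)))\<^sup>2))"
  by (cases s) (simp add: vel_def dgrad_def xi_def norm_Pair)

lemma meas_state:
  assumes "in_space p Y" shows "Y \<in> borel_measurable torus"
proof -
  have m: "(\<lambda>x. vel (Y x)) \<in> borel_measurable torus" "(\<lambda>x. dgrad (Y x)) \<in> borel_measurable torus"
     "(\<lambda>x. fst (snd (xi (Y x)))) \<in> borel_measurable torus" "(\<lambda>x. snd (snd (xi (Y x)))) \<in> borel_measurable torus"
    using assms by (simp_all add: in_space_def Lp_def)
  have "(\<lambda>x. (vel (Y x), dgrad (Y x), fst (snd (xi (Y x))), snd (snd (xi (Y x))))) \<in> borel_measurable torus"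
    by (intro borel_measurable_Pair m)
  then show ?thesis by (simp add: vel_def dgrad_def xi_def)
qed

lemma integrable_norm2:
  assumes "in_space p Y" shows "integrable torus (\<lambda>x. (norm (Y x))\<^sup>2)"
proof -
  have i: "integrable torus (\<lambda>x. norm (vel (Y x)) powr 2)" "integrable torus (\<lambda>x. norm (dgrad (Y x)) powr p)"
     "integrable torus (\<lambda>x. norm (fst (snd (xi (Y x)))) powr 2)" "integrable torus (\<lambda>x. norm (snd (snd (xi (Y x)))) powr 2)"
    using assms by (simp_all add: in_space_def Lp_def)
  show ?thesis
  proof (rule integrable_dom)
    show "(\<lambda>x. (norm (Y x))\<^sup>2) \<in> borel_measurable torus" using meas_state[OF assms] by measurable
    show "integrable torus (\<lambda>x. norm (vel (Y x)) powr 2 + ((1 + norm (dgrad (Y x)) powr p) + (norm (fst (snd (xi (Y x)))) powr 2 + norm (snd (snd (xi (Y x)))) powr 2)))"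
      using i by simp
    fix x
    have "(norm (dgrad (Y x)))\<^sup>2 \<le> 1 + norm (dgrad (Y x)) powr p"
      using powr_le_1_plus[of "norm (dgrad (Y x))" 2 p] p6 by simp
    then show "norm ((norm (Y x))\<^sup>2) \<le> norm (vel (Y x)) powr 2 + ((1 + norm (dgrad (Y x)) powr p) + (norm (fst (snd (xi (Y x)))) powr 2 + norm (snd (snd (xi (Y x)))) powr 2))"
      by (simp add: state_norm2)
  qed
qed

text \<open>A sum of integrable quantities. The constant 1 makes the powers of
  \<open>majorant\<close> increase with the exponent.\<close>

definition "moment x = 1 + norm (dgrad (A x)) powr p + norm (dgrad (B x)) powr p + norm (vel (B x)) powr p + (norm (A x))\<^sup>2 + (norm (B x))\<^sup>2"

text \<open>All fields of the step are dominated by powers of one function in \<open>L\<^sup>p\<close>.\<close>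

definition "majorant x = moment x powr (1 / p)"

lemma moment_ge: "1 \<le> moment x" unfolding moment_def by simp

lemma majorant_ge: "1 \<le> majorant x" unfolding majorant_def using moment_ge[of x] p6 by (simp add: ge_one_powr_ge_zero)

lemma majorant_powr: "majorant x powr p = moment x" unfolding majorant_def using moment_ge[of x] p6 by (simp add: powr_powr)

lemma integrable_moment: "integrable torus moment"
proof -
  have "integrable torus (\<lambda>x. norm (dgrad (A x)) powr p)" "integrable torus (\<lambda>x. norm (dgrad (B x)) powr p)" "integrable torus (\<lambda>x. norm (vel (B x)) powr p)"
    using inA inB vB by (simp_all add: in_space_def Lp_def)
  then show ?thesis unfolding moment_def[abs_def] using integrable_norm2[OF inA] integrable_norm2[OF inB] by simp
qed

lemma integrable_majorant: "integrable torus (\<lambda>x. majorant x powr p)" using integrable_moment by (simp add: majorant_powr)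

lemma le_majorant: "0 \<le> y \<Longrightarrow> y powr p \<le> moment x \<Longrightarrow> y \<le> majorant x"
proof -
  assume y: "0 \<le> y" "y powr p \<le> moment x"
  have "y = (y powr p) powr (1 / p)" using y p6 by (simp add: powr_powr)
  also have "\<dots> \<le> majorant x" unfolding majorant_def using y p6 by (intro powr_mono2) auto
  finally show ?thesis .
qed

lemma majorant_bounds: "norm (dgrad (A x)) \<le> majorant x" "norm (dgrad (B x)) \<le> majorant x" "norm (vel (B x)) \<le> majorant x"
  "norm (A x) \<le> majorant x powr (p / 2)" "norm (B x) \<le> majorant x powr (p / 2)"
proof -
  show "norm (dgrad (A x)) \<le> majorant x" "norm (dgrad (B x)) \<le> majorant x" "norm (vel (B x)) \<le> majorant x"
    by (rule le_majorant; simp add: moment_def)+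
  have e: "majorant x powr (p / 2) = sqrt (moment x)"
    unfolding majorant_def using moment_ge[of x] p6 by (simp add: powr_powr powr_half_sqrt)
  show "norm (A x) \<le> majorant x powr (p / 2)" "norm (B x) \<le> majorant x powr (p / 2)"
    unfolding e by (rule real_le_rsqrt; simp add: moment_def)+
qed

lemma majorant_mono: "a \<le> b \<Longrightarrow> majorant x powr a \<le> majorant x powr b"
  by (rule powr_mono[OF _ majorant_ge])

text \<open>Time and relative position are treated as independent parameters; in a step beginning at
  \<open>t0\<close> only the pairs \<open>(s, (s - t0) / h)\<close> occur.\<close>

abbreviation "J \<equiv> {0..T} \<times> {0..(1::real)}"

text \<open>
  Growth classes for families indexed by the time and the position inside the time step;
  the constant is uniform over the family.
\<close>

definition bd :: "real \<Rightarrow> (real \<times> real \<Rightarrow> vec3 \<Rightarrow> real) \<Rightarrow> bool" where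
  "bd a f \<longleftrightarrow> (\<forall>j\<in>J. f j \<in> borel_measurable torus) \<and> (\<exists>C\<ge>0. \<forall>j\<in>J. \<forall>x\<in>cbox 0 One. \<bar>f j x\<bar> \<le> C * majorant x powr a)"

lemma bdI: "(\<And>j. j \<in> J \<Longrightarrow> f j \<in> borel_measurable torus) \<Longrightarrow> 0 \<le> C \<Longrightarrow>
    (\<And>j x. j \<in> J \<Longrightarrow> x \<in> cbox 0 One \<Longrightarrow> \<bar>f j x\<bar> \<le> C * majorant x powr a) \<Longrightarrow> bd a f"
  unfolding bd_def by blast

lemma bdE:
  assumes "bd a f" obtains C where "0 \<le> C" "\<And>j x. j \<in> J \<Longrightarrow> x \<in> cbox 0 One \<Longrightarrow> \<bar>f j x\<bar> \<le> C * majorant x powr a"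
  using assms unfolding bd_def by blast

lemma bd_meas: "bd a f \<Longrightarrow> j \<in> J \<Longrightarrow> f j \<in> borel_measurable torus" unfolding bd_def by blast

lemma bd_mono: assumes "bd a f" "a \<le> b" shows "bd b f"
proof -
  obtain C where C: "0 \<le> C" "\<And>j x. j \<in> J \<Longrightarrow> x \<in> cbox 0 One \<Longrightarrow> \<bar>f j x\<bar> \<le> C * majorant x powr a"
    by (rule bdE[OF assms(1)]) blast
  show ?thesis
  proof (rule bdI[OF bd_meas[OF assms(1)] C(1)])
    fix j and x :: vec3 assume "j \<in> J" "x \<in> cbox 0 One"
    then have "\<bar>f j x\<bar> \<le> C * majorant x powr a" by (rule C(2))
    also have "\<dots> \<le> C * majorant x powr b" by (rule mult_left_mono[OF majorant_mono[OF assms(2)] C(1)])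
    finally show "\<bar>f j x\<bar> \<le> C * majorant x powr b" .
  qed
qed

lemma bd_add: assumes "bd a f" "bd a g" shows "bd a (\<lambda>j x. f j x + g j x)"
proof -
  obtain C where C: "0 \<le> C" "\<And>j x. j \<in> J \<Longrightarrow> x \<in> cbox 0 One \<Longrightarrow> \<bar>f j x\<bar> \<le> C * majorant x powr a"
    by (rule bdE[OF assms(1)]) blast
  obtain C' where C': "0 \<le> C'" "\<And>j x. j \<in> J \<Longrightarrow> x \<in> cbox 0 One \<Longrightarrow> \<bar>g j x\<bar> \<le> C' * majorant x powr a"
    by (rule bdE[OF assms(2)]) blast
  show ?thesis
  proof (rule bdI[of _ "C + C'"])
    fix j and x :: vec3 assume x: "j \<in> J" "x \<in> cbox 0 One"
    show "\<bar>f j x + g j x\<bar> \<le> (C + C') * majorant x powr a"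
      using C(2)[OF x] C'(2)[OF x] unfolding distrib_right by linarith
  next
    show "(\<lambda>x. f j x + g j x) \<in> borel_measurable torus" if "j \<in> J" for j
      by (intro borel_measurable_add bd_meas[OF assms(1) that] bd_meas[OF assms(2) that])
  qed (use C(1) C'(1) in simp)
qed

lemma bd_mult: assumes "bd a f" "bd b g" shows "bd (a + b) (\<lambda>j x. f j x * g j x)"
proof -
  obtain C where C: "0 \<le> C" "\<And>j x. j \<in> J \<Longrightarrow> x \<in> cbox 0 One \<Longrightarrow> \<bar>f j x\<bar> \<le> C * majorant x powr a"
    by (rule bdE[OF assms(1)]) blast
  obtain C' where C': "0 \<le> C'" "\<And>j x. j \<in> J \<Longrightarrow> x \<in> cbox 0 One \<Longrightarrow> \<bar>g j x\<bar> \<le> C' * majorant x powr b"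
    by (rule bdE[OF assms(2)]) blast
  show ?thesis
  proof (rule bdI[of _ "C * C'"])
    fix j and x :: vec3 assume x: "j \<in> J" "x \<in> cbox 0 One"
    have "\<bar>f j x * g j x\<bar> \<le> (C * majorant x powr a) * (C' * majorant x powr b)"
      unfolding abs_mult by (intro mult_mono C(2)[OF x] C'(2)[OF x]) (use C(1) in auto)
    then show "\<bar>f j x * g j x\<bar> \<le> C * C' * majorant x powr (a + b)" by (simp add: powr_add mult_ac)
  next
    show "(\<lambda>x. f j x * g j x) \<in> borel_measurable torus" if "j \<in> J" for j
      by (intro borel_measurable_times bd_meas[OF assms(1) that] bd_meas[OF assms(2) that])
  qed (use C(1) C'(1) in simp)
qed

lemma slice_cont: "continuous_on \<Omega> f \<Longrightarrow> t \<in> {0..T} \<Longrightarrow> continuous_on UNIV (\<lambda>x. f (t, x))"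
proof -
  assume f: "continuous_on \<Omega> f" and t: "t \<in> {0..T}"
  have 1: "continuous_on UNIV (\<lambda>x::vec3. (t, x))" by (intro continuous_intros)
  have 2: "range (\<lambda>x::vec3. (t, x)) \<subseteq> \<Omega>" using t by (auto simp: \<Omega>_def)
  show ?thesis by (rule continuous_on_compose2[OF f 1 2])
qed

lemma bd_Om:
  fixes f :: "real \<times> vec3 \<Rightarrow> real"
  assumes f: "continuous_on \<Omega> f" shows "bd 0 (\<lambda>j x. f (fst j, x))"
proof -
  obtain C where C: "C \<ge> 0" "\<And>t x. t \<in> {0..T} \<Longrightarrow> x \<in> cbox 0 One \<Longrightarrow> norm (f (t, x)) \<le> C"
    by (rule compact_bound[OF f]) blast
  show ?thesis
  proof (rule bdI[of _ C])
    fix j and x :: vec3 assume "j \<in> J" "x \<in> cbox 0 One"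
    then have "\<bar>f (fst j, x)\<bar> \<le> C" using C(2)[of "fst j" x] by auto
    then show "\<bar>f (fst j, x)\<bar> \<le> C * majorant x powr 0" using majorant_ge[of x] by simp
  next
    show "(\<lambda>x. f (fst j, x)) \<in> borel_measurable torus" if "j \<in> J" for j
      using that by (intro meas_torus_cont slice_cont[OF f]) auto
  qed (rule C(1))
qed

lemma bd_cont: "continuous_on UNIV f \<Longrightarrow> bd 0 (\<lambda>j x. f x)"
proof -
  assume c: "continuous_on UNIV f"
  have "continuous_on \<Omega> (\<lambda>z. f (snd z))"
    by (rule continuous_on_compose2[OF c continuous_on_snd[OF continuous_on_id] subset_UNIV])
  from bd_Om[OF this] show ?thesis by simp
qed

lemma bd_const: "bd 0 (\<lambda>j x. c)" by (rule bd_cont) simp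

lemma bd_cmult: "bd a f \<Longrightarrow> bd a (\<lambda>j x. c * f j x)" using bd_mult[OF bd_const, of a f c] by simp
lemma bd_divide: "bd a f \<Longrightarrow> bd a (\<lambda>j x. f j x / c)" using bd_cmult[of a f "1 / c"] by simp
lemma bd_diff: "bd a f \<Longrightarrow> bd a g \<Longrightarrow> bd a (\<lambda>j x. f j x - g j x)"
  using bd_add[OF _ bd_cmult[of a g "-1"], of f] by simp
lemma bd_mult0: "bd 0 f \<Longrightarrow> bd a g \<Longrightarrow> bd a (\<lambda>j x. f j x * g j x)"
  using bd_mult[of 0 f a g] by simp
lemma bd_0: "bd 0 f \<Longrightarrow> 0 \<le> a \<Longrightarrow> bd a f" by (rule bd_mono)
lemma bd_sum: "(\<And>i. i \<in> I \<Longrightarrow> bd a (f i)) \<Longrightarrow> 0 \<le> a \<Longrightarrow> bd a (\<lambda>j x. \<Sum>i\<in>I. f i j x)"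
  by (induction I rule: infinite_finite_induct) (simp_all add: bd_0[OF bd_const] bd_add)

text \<open>Exponent \<open>p\<close> is the threshold, since \<open>majorant x powr p\<close> is
  \<open>moment x\<close>. Integrability of all products below thus becomes a count of
  exponents.\<close>

lemma bd_integrable: assumes "bd a f" "a \<le> p" "j \<in> J" shows "integrable torus (f j)"
proof -
  obtain C where C: "0 \<le> C" "\<And>j x. j \<in> J \<Longrightarrow> x \<in> cbox 0 One \<Longrightarrow> \<bar>f j x\<bar> \<le> C * majorant x powr p"
    by (rule bdE[OF bd_mono[OF assms(1,2)]]) blast
  show ?thesis
    by (rule integrable_dom[OF bd_meas[OF assms(1,3)], of "\<lambda>x. C * majorant x powr p"]) (use C assms(3) integrable_majorant in auto)
qed

lemma bd_Lr: assumes "bd a f" "0 \<le> r" "a * r \<le> p" "j \<in> J" shows "Lr r (f j)"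
proof -
  obtain C where C: "0 \<le> C" "\<And>j x. j \<in> J \<Longrightarrow> x \<in> cbox 0 One \<Longrightarrow> \<bar>f j x\<bar> \<le> C * majorant x powr a"
    by (rule bdE[OF assms(1)]) blast
  show ?thesis
  proof (rule Lr_dom[OF bd_meas[OF assms(1,4)]])
    show "integrable torus (\<lambda>x. C powr r * majorant x powr p)" using integrable_majorant by simp
    fix x :: vec3 assume x: "x \<in> cbox 0 One"
    have "\<bar>f j x\<bar> powr r \<le> (C * majorant x powr a) powr r" using C(2)[OF assms(4) x] assms(2) by (intro powr_mono2) auto
    also have "\<dots> = C powr r * majorant x powr (a * r)" using C(1) majorant_ge[of x] by (simp add: powr_mult powr_powr)
    also have "\<dots> \<le> C powr r * majorant x powr p" using majorant_mono[OF assms(3)] by (intro mult_left_mono) auto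
    finally show "\<bar>f j x\<bar> powr r \<le> C powr r * majorant x powr p" .
  qed
qed

text \<open>The two exponents record that the deformation gradient is in L^p and the full state in
  L^2. The iterates and every interpolate between them belong to this class.\<close>

definition adm :: "(real \<times> real \<Rightarrow> vec3 \<Rightarrow> state) \<Rightarrow> bool" where
  "adm Y \<longleftrightarrow> (\<forall>j\<in>J. Y j \<in> borel_measurable torus \<and> (\<forall>x. norm (dgrad (Y j x)) \<le> majorant x \<and> norm (Y j x) \<le> majorant x powr (p / 2)))"

lemma admD:
  assumes "adm Y" "j \<in> J"
  shows "Y j \<in> borel_measurable torus" "norm (dgrad (Y j x)) \<le> majorant x" "norm (Y j x) \<le> majorant x powr (p / 2)"
  using assms unfolding adm_def by blast+

lemma adm_A: "adm (\<lambda>j. A)" and adm_B: "adm (\<lambda>j. B)"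
  unfolding adm_def using meas_state[OF inA] meas_state[OF inB] majorant_bounds by blast+

definition LL :: "real \<Rightarrow> vec3 \<Rightarrow> state" where "LL l x = A x + l *\<^sub>R (B x - A x)"

lemma dgrad_LL: "dgrad (LL l x) = dgrad (A x) + l *\<^sub>R (dgrad (B x) - dgrad (A x))"
  and xi_LL: "xi (LL l x) = xi (A x) + l *\<^sub>R (xi (B x) - xi (A x))"
  and vel_LL: "vel (LL l x) = vel (A x) + l *\<^sub>R (vel (B x) - vel (A x))"
  by (simp_all add: LL_def dgrad_def xi_def vel_def)

lemma adm_LL: "adm (\<lambda>j. LL (snd j))"
  unfolding adm_def
proof (intro ballI conjI allI)
  fix j assume "j \<in> J"
  then have l: "0 \<le> snd j" "snd j \<le> 1" by auto
  show "LL (snd j) \<in> borel_measurable torus" unfolding LL_def[abs_def]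
    using meas_state[OF inA] meas_state[OF inB] by measurable
  fix x
  have "norm (dgrad (LL (snd j) x)) \<le> max (norm (dgrad (B x))) (norm (dgrad (A x)))"
    unfolding dgrad_LL by (rule segment_norm_le_max[OF l])
  also have "\<dots> \<le> majorant x" using majorant_bounds(1,2)[of x] by simp
  finally show "norm (dgrad (LL (snd j) x)) \<le> majorant x" .
  have "norm (LL (snd j) x) \<le> max (norm (B x)) (norm (A x))"
    unfolding LL_def by (rule segment_norm_le_max[OF l])
  also have "\<dots> \<le> majorant x powr (p / 2)" using majorant_bounds(4,5)[of x] by simp
  finally show "norm (LL (snd j) x) \<le> majorant x powr (p / 2)" .
qed

lemma adm_comp: 
  assumes Y: "adm Y" and c: "norm c \<le> 1"
  shows "bd (p / 2) (\<lambda>j x. Y j x \<bullet> c)"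
proof (rule bdI[of _ 1])
  show "(\<lambda>x. Y j x \<bullet> c) \<in> borel_measurable torus" if "j \<in> J" for j using admD(1)[OF Y that] by measurable
  fix j x assume j: "j \<in> J"
  have "\<bar>Y j x \<bullet> c\<bar> \<le> norm (Y j x) * norm c" by (rule Cauchy_Schwarz_ineq2)
  also have "\<dots> \<le> norm (Y j x) * 1" using c by (intro mult_left_mono) auto
  also have "\<dots> \<le> majorant x powr (p / 2)" using admD(3)[OF Y j] by simp
  finally show "\<bar>Y j x \<bullet> c\<bar> \<le> 1 * majorant x powr (p / 2)" by simp
qed simp

lemma unit_dirs: "norm (cV i) \<le> 1" "norm (cF i \<alpha>) \<le> 1" "C \<in> Basis \<Longrightarrow> norm ((0, C) :: state) \<le> 1"
  by (simp_all add: norm_Pair norm_Basis axis_in_Basis_iff)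

lemma adm_vel: "adm Y \<Longrightarrow> bd (p / 2) (\<lambda>j x. vel (Y j x) $ i)"
  and adm_xi: "adm Y \<Longrightarrow> C \<in> Basis \<Longrightarrow> bd (p / 2) (\<lambda>j x. xi (Y j x) \<bullet> C)"
  unfolding component_inner(1,3) by (rule adm_comp; use unit_dirs in simp)+

lemma adm_xi_F:
  assumes Y: "adm Y" and C: "C \<in> Basis" "snd C = 0"
  shows "bd 1 (\<lambda>j x. xi (Y j x) \<bullet> C)"
proof (rule bdI[of _ 1])
  show "(\<lambda>x. xi (Y j x) \<bullet> C) \<in> borel_measurable torus" if "j \<in> J" for j
    unfolding component_inner using admD(1)[OF Y that] by measurable
  fix j x assume j: "j \<in> J"
  have "xi (Y j x) \<bullet> C = dgrad (Y j x) \<bullet> fst C" unfolding inner_prod_def[of _ C] C(2) state_parts(4) inner_zero_right by simp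
  then have "\<bar>xi (Y j x) \<bullet> C\<bar> \<le> norm (dgrad (Y j x)) * norm (fst C)" using Cauchy_Schwarz_ineq2[of "dgrad (Y j x)" "fst C"] by simp
  also have "\<dots> \<le> norm (dgrad (Y j x)) * 1"
    using norm_fst_le[of "fst C" "snd C"] C(1) by (intro mult_left_mono) auto
  also have "\<dots> \<le> majorant x" using admD(2)[OF Y j] by simp
  finally show "\<bar>xi (Y j x) \<bullet> C\<bar> \<le> 1 * majorant x powr 1" using majorant_ge[of x] by simp
qed simp

lemma adm_F:
  assumes Y: "adm Y" shows "bd 1 (\<lambda>j x. dgrad (Y j x) $ i $ \<alpha>)"
proof (rule bdI[of _ 1])
  show "(\<lambda>x. dgrad (Y j x) $ i $ \<alpha>) \<in> borel_measurable torus" if "j \<in> J" for j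
    unfolding component_inner using admD(1)[OF Y that] by measurable
  fix j x assume j: "j \<in> J"
  have "\<bar>dgrad (Y j x) $ i $ \<alpha>\<bar> \<le> norm (dgrad (Y j x))"
    using component_le_norm_cart[of "dgrad (Y j x) $ i" \<alpha>] Finite_Cartesian_Product.norm_nth_le[of "dgrad (Y j x)" i] by linarith
  then show "\<bar>dgrad (Y j x) $ i $ \<alpha>\<bar> \<le> 1 * majorant x powr 1" using admD(2)[OF Y j, of x] majorant_ge[of x] by simp
qed simp

lemma bd_vB: "bd 1 (\<lambda>j x. vel (B x) $ i)"
proof (rule bdI[of _ 1])
  show "(\<lambda>x. vel (B x) $ i) \<in> borel_measurable torus" unfolding component_inner using meas_state[OF inB] by measurable
  fix j x
  show "\<bar>vel (B x) $ i\<bar> \<le> 1 * majorant x powr 1"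
    using component_le_norm_cart[of "vel (B x)" i] majorant_bounds(3)[of x] majorant_ge[of x] by simp
qed simp

text \<open>The derivative of \<open>G\<close> in an \<open>F\<close> direction grows like the power
  \<open>p - 1\<close> of the deformation gradient plus the norm of the state, whose exponent
  \<open>p / 2\<close> is at most \<open>p - 1\<close>. In the other directions only the norm of the
  state is left.\<close>

lemma adm_pd_G:
  assumes Y: "adm Y" and C: "C \<in> Basis"
  shows "bd (p - 1) (\<lambda>j x. pd G C (xi (Y j x)))" "fst C = 0 \<Longrightarrow> bd (p / 2) (\<lambda>j x. pd G C (xi (Y j x)))"
proof -
  have nC: "norm C = 1" "norm (fst C) \<le> 1" using C norm_fst_le[of "fst C" "snd C"] by auto
  have "continuous_on UNIV (\<lambda>s. pd G C (xi s))"
    unfolding xi_def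
    using continuous_on_compose2[OF C1D(2)[OF C2_C1(1)[OF C2_all(1)] C] continuous_on_snd[OF continuous_on_id] subset_UNIV] .
  then have m: "(\<lambda>x. pd G C (xi (Y j x))) \<in> borel_measurable torus" if "j \<in> J" for j
    by (rule borel_measurable_continuous_on[OF _ admD(1)[OF Y that]])
  obtain K where K: "K > 0" "\<And>X z. \<bar>grad G X \<bullet> z\<bar> \<le> K * ((1 + norm X) * norm z + norm (fst X) powr (p - 1) * norm (fst z))"
    by (rule grad_G_growth) blast
  have base: "\<bar>pd G C (xi (Y j x))\<bar> \<le> K * (2 * majorant x powr (p / 2) + majorant x powr (p - 1) * norm (fst C))" if j: "j \<in> J" for j x
  proof -
    have "\<bar>pd G C (xi (Y j x))\<bar> \<le> K * ((1 + norm (xi (Y j x))) * 1 + norm (dgrad (Y j x)) powr (p - 1) * norm (fst C))"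
      using K(2)[of "xi (Y j x)" C] by (simp add: pd_linear_comb diffs nC state_parts)
    also have "\<dots> \<le> K * (2 * majorant x powr (p / 2) + majorant x powr (p - 1) * norm (fst C))"
    proof -
      have "1 \<le> majorant x powr (p / 2)" using majorant_ge[of x] p6 by (simp add: ge_one_powr_ge_zero)
      moreover have "norm (xi (Y j x)) \<le> majorant x powr (p / 2)" by (rule order_trans[OF state_parts(2) admD(3)[OF Y j]])
      moreover have "norm (dgrad (Y j x)) powr (p - 1) \<le> majorant x powr (p - 1)" using admD(2)[OF Y j] p6 by (intro powr_mono2) auto
      ultimately show ?thesis using K(1) by (intro mult_left_mono add_mono mult_right_mono) auto
    qed
    finally show ?thesis .
  qed
  show "bd (p - 1) (\<lambda>j x. pd G C (xi (Y j x)))"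
  proof (rule bdI[of _ "K * 3"])
    fix j x assume j: "j \<in> J"
    have "majorant x powr (p / 2) \<le> majorant x powr (p - 1)" using p6 by (intro majorant_mono) simp
    moreover have "majorant x powr (p - 1) * norm (fst C) \<le> majorant x powr (p - 1) * 1" using nC by (intro mult_left_mono) auto
    ultimately have "K * (2 * majorant x powr (p / 2) + majorant x powr (p - 1) * norm (fst C)) \<le> K * (3 * majorant x powr (p - 1))"
      using K(1) by (intro mult_left_mono) auto
    then show "\<bar>pd G C (xi (Y j x))\<bar> \<le> K * 3 * majorant x powr (p - 1)" using base[OF j, of x] by simp
  qed (use K m in simp_all)
  show "bd (p / 2) (\<lambda>j x. pd G C (xi (Y j x)))" if z: "fst C = 0"
  proof (rule bdI[of _ "K * 2"])
    fix j x assume "j \<in> J"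
    from base[OF this, of x] show "\<bar>pd G C (xi (Y j x))\<bar> \<le> K * 2 * majorant x powr (p / 2)" using z by simp
  qed (use K m in simp_all)
qed

lemma bd_dPhi:
  assumes Y: "adm Y"
  shows "bd 2 (\<lambda>j x. dPhi C i \<alpha> (dgrad (Y j x)))" "snd C = 0 \<Longrightarrow> bd 0 (\<lambda>j x. dPhi C i \<alpha> (dgrad (Y j x)))"
proof -
  have 1: "bd 2 (\<lambda>j x. dgrad (Y j x) $ i $ \<alpha>)" for i \<alpha> by (rule bd_mono[OF adm_F[OF Y]]) simp
  have 2: "bd 2 (\<lambda>j x. dgrad (Y j x) $ i $ \<alpha> * dgrad (Y j x) $ k $ \<beta>)" for i k \<alpha> \<beta>
    using bd_mult[OF adm_F[OF Y] adm_F[OF Y]] by simp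
  have 3: "bd 2 (\<lambda>j x. c)" for c by (rule bd_mono[OF bd_const]) simp
  show "bd 2 (\<lambda>j x. dPhi C i \<alpha> (dgrad (Y j x)))"
    unfolding dPhi_eq dcof_def cof_def vec_lambda_beta by (intro bd_add bd_diff bd_cmult 1 2 3)
  show "bd 0 (\<lambda>j x. dPhi C i \<alpha> (dgrad (Y j x)))" if "snd C = 0"
  proof -
    have "dcof 0 i \<alpha> F = 0" for F by (simp add: dcof_def)
    then have "(\<lambda>j x. dPhi C i \<alpha> (dgrad (Y j x))) = (\<lambda>j x. fst C $ i $ \<alpha>)" unfolding dPhi_eq using that by simp
    then show ?thesis by (simp only: bd_const)
  qed
qed

lemma Basis_ext_cases: "C \<in> (Basis::ext set) \<Longrightarrow> fst C = 0 \<or> snd C = 0"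
  by (auto simp: Basis_prod_def)

text \<open>The growth of \<open>G\<close> and that of \<open>\<partial>\<Phi>/\<partial>F\<close>
  never add up in full. Outside the \<open>F\<close> block the exponents are \<open>p / 2\<close>
  and 2, and \<open>p / 2 + 2 \<le> p - 1\<close> means p \<ge> 6; inside it they are
  \<open>p - 1\<close> and 0. Exponent \<open>p - 1\<close> places the stress in the dual of
  L^p.\<close>

lemma bd_stress:
  assumes Y: "adm Y" "adm Y'" and C: "C \<in> Basis"
  shows "bd (p - 1) (\<lambda>j x. pd G C (xi (Y j x)) * dPhi C i \<alpha> (dgrad (Y' j x)))"
  using Basis_ext_cases[OF C]
proof
  assume "fst C = 0"
  from bd_mult[OF adm_pd_G(2)[OF Y(1) C this] bd_dPhi(1)[OF Y(2)]] show ?thesis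
    by (rule bd_mono) (use p6 in simp)
next
  assume "snd C = 0"
  from bd_mult[OF adm_pd_G(1)[OF Y(1) C] bd_dPhi(2)[OF Y(2) this]] show ?thesis by simp
qed

text \<open>The exponents are complementary in both cases: \<open>p / 2 + p / 2\<close> outside the
  \<open>F\<close> block and \<open>(p - 1) + 1\<close> inside it.\<close>

lemma bd_power:
  assumes Y: "adm Y" "adm Y'" "adm Y''" and C: "C \<in> Basis"
  shows "bd p (\<lambda>j x. pd G C (xi (Y j x)) * (xi (Y' j x) \<bullet> C - xi (Y'' j x) \<bullet> C))"
  using Basis_ext_cases[OF C]
proof
  assume "fst C = 0"
  from bd_mult[OF adm_pd_G(2)[OF Y(1) C this] bd_diff[OF adm_xi[OF Y(2) C] adm_xi[OF Y(3) C]]] show ?thesis by simp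
next
  assume z: "snd C = 0"
  from bd_mult[OF adm_pd_G(1)[OF Y(1) C] bd_diff[OF adm_xi_F[OF Y(2) C z] adm_xi_F[OF Y(3) C z]]] show ?thesis by simp
qed

end

text \<open>The finite-dimensional content of the relative entropy identity. Here \<open>f\<close>
  and \<open>df\<close> are the value and gradient of the test function, \<open>gL\<close>,
  \<open>gB\<close>, \<open>gb\<close> the derivatives of \<open>G\<close> at the interpolate, the
  new state and the smooth state, and the first three assumptions the evolution laws. On the right
  stand the momentum balance tested with \<open>(vB i - Vb i) * f\<close> and null Lagrangians
  tested with this times \<open>gb C\<close>.\<close>

lemma step_algebra:
  fixes dv V Vb vB Db :: "'i::finite \<Rightarrow> real" and M dVb :: "'i \<Rightarrow> 'a::finite \<Rightarrow> real" and I :: "'c set"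
    and dgb :: "'a \<Rightarrow> 'c \<Rightarrow> real" and P Pb :: "'i \<Rightarrow> 'a \<Rightarrow> 'c \<Rightarrow> real"
  assumes Db: "\<And>i. Db i = (\<Sum>\<alpha>\<in>UNIV. \<Sum>C\<in>I. dgb \<alpha> C * Pb i \<alpha> C)"
    and Xb: "\<And>C. C \<in> I \<Longrightarrow> Xb C = (\<Sum>i\<in>UNIV. \<Sum>\<alpha>\<in>UNIV. Pb i \<alpha> C * dVb i \<alpha>)"
    and de: "\<And>C. C \<in> I \<Longrightarrow> de C = (\<Sum>i\<in>UNIV. \<Sum>\<alpha>\<in>UNIV. P i \<alpha> C * M i \<alpha>)"
    and sym: "\<And>C E. C \<in> I \<Longrightarrow> E \<in> I \<Longrightarrow> Hs C E = Hs E C"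
  shows "((\<Sum>i\<in>UNIV. (V i - Vb i) * (dv i - Db i)) + (\<Sum>C\<in>I. (gL C - gb C) * de C)
        - (\<Sum>C\<in>I. (\<Sum>E\<in>I. Hs C E * Xb E) * r C)) * f
      + (\<Sum>\<alpha>\<in>UNIV. (\<Sum>i\<in>UNIV. \<Sum>C\<in>I. (vB i - Vb i) * (gB C - gb C) * P i \<alpha> C) * df \<alpha>)
      - ((\<Sum>i\<in>UNIV. \<Sum>\<alpha>\<in>UNIV. \<Sum>C\<in>I. dgb \<alpha> C * (P i \<alpha> C * (vB i - Vb i) - Pb i \<alpha> C * (V i - Vb i))
          + dVb i \<alpha> * ((gB C - gb C) * P i \<alpha> C - (\<Sum>E\<in>I. Hs C E * r E) * Pb i \<alpha> C))
        - ((\<Sum>i\<in>UNIV. (vB i - V i) * dv i) + (\<Sum>C\<in>I. (gB C - gL C) * de C))) * f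
    = (\<Sum>i\<in>UNIV. dv i * ((vB i - Vb i) * f)
        + (\<Sum>\<alpha>\<in>UNIV. (\<Sum>C\<in>I. gB C * P i \<alpha> C) * ((M i \<alpha> - dVb i \<alpha>) * f + (vB i - Vb i) * df \<alpha>)))
      - (\<Sum>i\<in>UNIV. \<Sum>C\<in>I. \<Sum>\<alpha>\<in>UNIV. P i \<alpha> C * ((M i \<alpha> - dVb i \<alpha>) * (gb C * f) + (vB i - Vb i) * (gb C * df \<alpha> + dgb \<alpha> C * f)))"
proof -
  \<comment> \<open>The terms are brought to triple sums over \<open>i\<close>,
    \<open>\<alpha>\<close> and \<open>C\<close>, after which the identity is checked summand by
    summand.\<close>
  define SS where "SS k = (\<Sum>i\<in>UNIV. \<Sum>\<alpha>\<in>UNIV. \<Sum>C\<in>I. k i \<alpha> C)" for k :: "'i \<Rightarrow> 'a \<Rightarrow> 'c \<Rightarrow> real"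
  define K where "K C = (\<Sum>E\<in>I. Hs C E * r E)" for C
  define k1 where "k1 i \<alpha> C = (V i - Vb i) * (dgb \<alpha> C * Pb i \<alpha> C)" for i \<alpha> C
  define k2 where "k2 i \<alpha> C = (gL C - gb C) * (P i \<alpha> C * M i \<alpha>)" for i \<alpha> C
  define k3 where "k3 i \<alpha> C = K C * (Pb i \<alpha> C * dVb i \<alpha>)" for i \<alpha> C
  define k4 where "k4 i \<alpha> C = (vB i - Vb i) * (gB C - gb C) * P i \<alpha> C * df \<alpha>" for i \<alpha> C
  define k5 where "k5 i \<alpha> C = dgb \<alpha> C * (P i \<alpha> C * (vB i - Vb i) - Pb i \<alpha> C * (V i - Vb i))
          + dVb i \<alpha> * ((gB C - gb C) * P i \<alpha> C - K C * Pb i \<alpha> C)" for i \<alpha> C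
  define k6 where "k6 i \<alpha> C = (gB C - gL C) * (P i \<alpha> C * M i \<alpha>)" for i \<alpha> C
  define k7 where "k7 i \<alpha> C = gB C * P i \<alpha> C * ((M i \<alpha> - dVb i \<alpha>) * f + (vB i - Vb i) * df \<alpha>)" for i \<alpha> C
  define k8 where "k8 i \<alpha> C = P i \<alpha> C * ((M i \<alpha> - dVb i \<alpha>) * (gb C * f) + (vB i - Vb i) * (gb C * df \<alpha> + dgb \<alpha> C * f))" for i \<alpha> C
  have comb: "(\<Sum>C\<in>I. z C * (\<Sum>i\<in>UNIV. \<Sum>\<alpha>\<in>UNIV. k i \<alpha> C)) = SS (\<lambda>i \<alpha> C. z C * k i \<alpha> C)" for z k
  proof -
    have "(\<Sum>C\<in>I. z C * (\<Sum>i\<in>UNIV. \<Sum>\<alpha>\<in>UNIV. k i \<alpha> C)) = (\<Sum>i\<in>UNIV. \<Sum>C\<in>I. \<Sum>\<alpha>\<in>UNIV. z C * k i \<alpha> C)"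
      by (simp only: sum_distrib_left) (rule sum.swap)
    also have "\<dots> = SS (\<lambda>i \<alpha> C. z C * k i \<alpha> C)" unfolding SS_def by (intro sum.cong refl, rule sum.swap)
    finally show ?thesis .
  qed
  have de': "(\<Sum>C\<in>I. z C * de C) = SS (\<lambda>i \<alpha> C. z C * (P i \<alpha> C * M i \<alpha>))" for z
    unfolding comb[symmetric] by (intro sum.cong refl) (simp add: de)
  have e1: "(\<Sum>i\<in>UNIV. (V i - Vb i) * (dv i - Db i)) = (\<Sum>i\<in>UNIV. (V i - Vb i) * dv i) - SS k1"
    unfolding SS_def k1_def Db right_diff_distrib[of _ "dv _"] sum_subtractf by (simp only: sum_distrib_left)
  \<comment> \<open>Symmetry of the Hessian moves it from the time derivative of the smooth state to
    the difference \<open>r\<close>.\<close>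
  have e3: "(\<Sum>C\<in>I. (\<Sum>E\<in>I. Hs C E * Xb E) * r C) = SS k3"
  proof -
    have "(\<Sum>C\<in>I. (\<Sum>E\<in>I. Hs C E * Xb E) * r C) = (\<Sum>C\<in>I. \<Sum>E\<in>I. Hs E C * r C * Xb E)"
      unfolding sum_distrib_right by (intro sum.cong refl) (simp add: sym)
    also have "\<dots> = (\<Sum>E\<in>I. \<Sum>C\<in>I. Hs E C * r C * Xb E)" by (rule sum.swap)
    also have "\<dots> = (\<Sum>E\<in>I. K E * (\<Sum>i\<in>UNIV. \<Sum>\<alpha>\<in>UNIV. Pb i \<alpha> E * dVb i \<alpha>))"
      unfolding K_def sum_distrib_right[symmetric] by (intro sum.cong refl) (simp add: Xb)
    finally show ?thesis unfolding comb k3_def[abs_def] .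
  qed
  have e4: "(\<Sum>\<alpha>\<in>UNIV. (\<Sum>i\<in>UNIV. \<Sum>C\<in>I. (vB i - Vb i) * (gB C - gb C) * P i \<alpha> C) * df \<alpha>) = SS k4"
    unfolding SS_def k4_def sum_distrib_right by (rule sum.swap)
  have e7: "(\<Sum>i\<in>UNIV. dv i * ((vB i - Vb i) * f)
        + (\<Sum>\<alpha>\<in>UNIV. (\<Sum>C\<in>I. gB C * P i \<alpha> C) * ((M i \<alpha> - dVb i \<alpha>) * f + (vB i - Vb i) * df \<alpha>))) = (\<Sum>i\<in>UNIV. dv i * ((vB i - Vb i) * f)) + SS k7"
    unfolding SS_def k7_def sum.distrib by (simp only: sum_distrib_right)
  have e8: "(\<Sum>i\<in>UNIV. \<Sum>C\<in>I. \<Sum>\<alpha>\<in>UNIV. P i \<alpha> C * ((M i \<alpha> - dVb i \<alpha>) * (gb C * f) + (vB i - Vb i) * (gb C * df \<alpha> + dgb \<alpha> C * f))) = SS k8"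
    unfolding SS_def k8_def by (intro sum.cong refl, rule sum.swap)
  have S: "(\<Sum>i\<in>UNIV. dv i * ((vB i - Vb i) * f)) = (\<Sum>i\<in>UNIV. (V i - Vb i) * dv i) * f + (\<Sum>i\<in>UNIV. (vB i - V i) * dv i) * f"
    unfolding sum_distrib_right sum.distrib[symmetric] by (intro sum.cong refl) (simp add: algebra_simps)
  have L: "SS k7 - SS k8 = (SS k2 - SS k1 - SS k3) * f + SS k4 - (SS k5 - SS k6) * f"
    unfolding SS_def sum_distrib_right sum.distrib[symmetric] sum_subtractf[symmetric]
    by (intro sum.cong refl) (simp add: k1_def k2_def k3_def k4_def k5_def k6_def k7_def k8_def algebra_simps)
  have k5': "(\<Sum>i\<in>UNIV. \<Sum>\<alpha>\<in>UNIV. \<Sum>C\<in>I. dgb \<alpha> C * (P i \<alpha> C * (vB i - Vb i) - Pb i \<alpha> C * (V i - Vb i))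
          + dVb i \<alpha> * ((gB C - gb C) * P i \<alpha> C - (\<Sum>E\<in>I. Hs C E * r E) * Pb i \<alpha> C)) = SS k5"
    unfolding SS_def k5_def K_def ..
  show ?thesis
    unfolding k5' e7 e8 e4 e3 e1 de' k2_def[symmetric, abs_def] k6_def[symmetric, abs_def]
    using L S by (simp add: algebra_simps)
qed

section \<open>The relative entropy identity in one step\<close>

context time_step
begin

lemma J0: "(0, 0) \<in> J" using T by simp

lemma bd_cong: "(\<And>j x. j \<in> J \<Longrightarrow> f j x = g j x) \<Longrightarrow> bd a g \<Longrightarrow> bd a f"
proof -
  assume e: "\<And>j x. j \<in> J \<Longrightarrow> f j x = g j x" and g: "bd a g"
  then have "\<And>j. j \<in> J \<Longrightarrow> f j = g j" by blast
  then show "bd a f" using g unfolding bd_def by simp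
qed

lemma bd_U: assumes "continuous_on UNIV g" shows "bd 0 (\<lambda>j x. g (U (fst j) x))"
proof -
  have "continuous_on \<Omega> (\<lambda>z. g (UU z))" by (rule continuous_on_compose2[OF assms UU_cont subset_UNIV])
  from bd_Om[OF this] show ?thesis by (simp add: UU_def)
qed

lemma cont_xi: "continuous_on UNIV f \<Longrightarrow> continuous_on UNIV (\<lambda>s. f (xi s))"
  unfolding xi_def using continuous_on_compose2[OF _ continuous_on_snd[OF continuous_on_id] subset_UNIV] .

lemma cont_dgrad: "continuous_on UNIV f \<Longrightarrow> continuous_on UNIV (\<lambda>s. f (dgrad s))"
  unfolding dgrad_def using continuous_on_compose2[OF _ continuous_on_fst[OF continuous_on_snd[OF continuous_on_id]] subset_UNIV] .

lemma bd_gb: "C \<in> Basis \<Longrightarrow> bd 0 (\<lambda>j x. gb C (fst j) x)"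
  by (rule bd_U, rule cont_xi, rule C1D(2)[OF C2_C1(1)[OF C2_all(1)]])

lemma bd_hess: "C \<in> Basis \<Longrightarrow> E \<in> Basis \<Longrightarrow> bd 0 (\<lambda>j x. pd (pd G C) E (xi (U (fst j) x)))"
  by (rule bd_U, rule cont_xi, rule C1D(2)[OF C2_C1(1)[OF C2_pd(1)]])

lemma bd_Pb: "bd 0 (\<lambda>j x. Pb C i \<alpha> (fst j) x)"
  by (rule bd_U, rule cont_dgrad, rule continuous_dPhi)

lemma bd_Ub: "bd 0 (\<lambda>j x. U (fst j) x \<bullet> c)"
  by (rule bd_U) (intro continuous_intros)

lemma bd_D: "b \<in> Basis \<Longrightarrow> bd 0 (\<lambda>j x. D b (fst j, x) \<bullet> c)"
  by (rule bd_Om) (intro continuous_intros D_cont)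

lemma bd_dVb: "bd 0 (\<lambda>j x. dx \<alpha> (\<lambda>y. vel (U (fst j) y) $ i) x)"
  unfolding component_inner by (rule bd_cong[OF dx_U bd_D[OF dir_Basis(2)]]) auto

lemma bd_dgb: "C \<in> Basis \<Longrightarrow> bd 0 (\<lambda>j x. dx \<alpha> (\<lambda>y. gb C (fst j) y) x)"
proof (rule bd_cong[OF dx_gb])
  assume "C \<in> Basis"
  then show "bd 0 (\<lambda>j x. \<Sum>B\<in>Basis. pd (pd G C) B (xi (U (fst j) x)) * (D (xdir \<alpha>) (fst j, x) \<bullet> (0, B)))"
    by (intro bd_sum bd_mult0 bd_hess bd_D dir_Basis) auto
qed auto

lemma bd_Vb: "bd 0 (\<lambda>j x. vel (U (fst j) x) $ i)" and bd_xib: "bd 0 (\<lambda>j x. xi (U (fst j) x) \<bullet> C)"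
  unfolding component_inner by (rule bd_Ub)+

text \<open>The pointwise time derivative of the relative entropy, at relative position \<open>l\<close> in the step.\<close>

definition entropy_rate :: "real \<times> real \<Rightarrow> vec3 \<Rightarrow> real" where
  "entropy_rate j x = (\<Sum>i\<in>UNIV. (vel (LL (snd j) x) $ i - vel (U (fst j) x) $ i) *
        ((vel (B x) $ i - vel (A x) $ i) / h - D tdir (fst j, x) \<bullet> cV i))
    + (\<Sum>C\<in>Basis. (pd G C (xi (LL (snd j) x)) - gb C (fst j) x) * ((xi (B x) \<bullet> C - xi (A x) \<bullet> C) / h))
    - (\<Sum>C\<in>Basis. (\<Sum>E\<in>Basis. pd (pd G C) E (xi (U (fst j) x)) * (D tdir (fst j, x) \<bullet> (0, E)))
        * (xi (LL (snd j) x) \<bullet> C - xi (U (fst j) x) \<bullet> C))"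

lemma p2: "0 \<le> p / 2" "p / 2 + p / 2 = p" "0 \<le> p" using p6 by simp_all

lemma bd_dv: "bd (p / 2) (\<lambda>j x. (vel (B x) $ i - vel (A x) $ i) / h)"
  by (intro bd_divide bd_diff adm_vel adm_A adm_B)

lemma bd_de: "C \<in> Basis \<Longrightarrow> bd (p / 2) (\<lambda>j x. (xi (B x) \<bullet> C - xi (A x) \<bullet> C) / h)"
  by (intro bd_divide bd_diff adm_xi adm_A adm_B)

lemma bd_half_mult: "bd (p / 2) f \<Longrightarrow> bd (p / 2) g \<Longrightarrow> bd p (\<lambda>j x. f j x * g j x)"
  using bd_mult[of "p / 2" f "p / 2" g] by simp

lemma bd_p: "bd (p / 2) f \<Longrightarrow> bd p f" by (erule bd_mono) (use p6 in simp)

lemma bd_entropy_rate: "bd p entropy_rate"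
proof -
  have 2: "bd p (\<lambda>j x. (pd G C (xi (LL (snd j) x)) - gb C (fst j) x) * ((xi (B x) \<bullet> C - xi (A x) \<bullet> C) / h))"
    if C: "C \<in> Basis" for C
  proof -
    have "bd p (\<lambda>j x. (pd G C (xi (LL (snd j) x)) * (xi (B x) \<bullet> C - xi (A x) \<bullet> C) - gb C (fst j) x * (xi (B x) \<bullet> C - xi (A x) \<bullet> C)) / h)"
      by (intro bd_divide bd_diff bd_power[OF adm_LL adm_B adm_A C] bd_p[OF bd_mult0[OF bd_gb[OF C] bd_diff[OF adm_xi[OF adm_B C] adm_xi[OF adm_A C]]]])
    then show ?thesis by (simp add: left_diff_distrib)
  qed
  show ?thesis unfolding entropy_rate_def[abs_def]
    by (intro bd_add bd_diff bd_sum 2 bd_half_mult bd_dv bd_p[OF bd_mult0] bd_0[OF bd_Vb] bd_0[OF bd_xib] bd_0[OF bd_D[OF dir_Basis(1)]]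
       adm_vel adm_xi adm_LL bd_mult0 bd_hess bd_D dir_Basis p2)
qed

text \<open>The intermediate values in Q and S telescope. What survives are the products of the
  scheme, with the lagged \<open>\<partial>\<Phi>/\<partial>F\<close> and the new state, and those
  linearised at the smooth solution.\<close>

lemma QS_eq: "Q_term G (LL l) (U t) x + S_term G B (LL l) (\<lambda>x. dgrad (A x)) (U t) x =
  (\<Sum>i\<in>UNIV. \<Sum>\<alpha>\<in>UNIV. \<Sum>C\<in>Basis.
     dx \<alpha> (\<lambda>y. gb C t y) x * (dPhi C i \<alpha> (dgrad (A x)) * (vel (B x) $ i - vel (U t x) $ i) - Pb C i \<alpha> t x * (vel (LL l x) $ i - vel (U t x) $ i))
     + dx \<alpha> (\<lambda>y. vel (U t y) $ i) x * ((pd G C (xi (B x)) - gb C t x) * dPhi C i \<alpha> (dgrad (A x))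
        - (\<Sum>E\<in>Basis. pd (pd G C) E (xi (U t x)) * (xi (LL l x) \<bullet> E - xi (U t x) \<bullet> E)) * Pb C i \<alpha> t x))"
  unfolding Q_term_def S_term_def Let_def sum.distrib[symmetric] inner_diff_left
  by (intro sum.cong refl) (simp add: algebra_simps)

lemma has_derivative_eta: "(eta G has_derivative (\<lambda>z. vel s \<bullet> vel z + grad G (xi s) \<bullet> xi z)) (at s)"
proof -
  have 1: "((\<lambda>s::state. 1/2 * (fst s \<bullet> fst s)) has_derivative (\<lambda>z. fst s \<bullet> fst z)) (at s)"
    by (auto intro!: derivative_eq_intros simp: inner_commute)
  have 2: "((\<lambda>s::state. G (snd s)) has_derivative (\<lambda>z. grad G (snd s) \<bullet> snd z)) (at s)"
    by (rule has_derivative_compose[OF has_derivative_snd[OF has_derivative_ident] has_derivative_grad[OF diffs(1)]])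
  show ?thesis using has_derivative_add[OF 1 2] by (simp add: eta_def[abs_def] vel_def xi_def power2_norm_eq_inner)
qed

lemma grad_eta: "grad (eta G) s = (vel s, grad G (xi s))"
  by (rule grad_eqI[OF has_derivative_eq_rhs[OF has_derivative_eta]]) (simp add: fun_eq_iff inner_prod_def vel_def xi_def)

lemma eta_r_eq: "eta_r G a b = 1/2 * (norm (vel a - vel b))\<^sup>2 + rel G (xi a) (xi b)"
proof -
  have "pd G (xi a - xi b) (xi b) = grad G (xi b) \<bullet> (xi a - xi b)" by (simp add: pd_linear_comb diffs)
  then show ?thesis
    unfolding eta_r_def grad_eta rel_def eta_def
    by (simp add: inner_prod_def vel_def xi_def power2_norm_eq_inner inner_diff_left inner_diff_right inner_commute field_simps)
qed

lemma vec3_inner: "(a::vec3) \<bullet> b = (\<Sum>i\<in>UNIV. a $ i * b $ i)" by (simp add: inner_vec_def)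

lemma grad_G_sum: "grad G X \<bullet> z = (\<Sum>C\<in>Basis. pd G C X * (z \<bullet> C))"
  by (simp add: grad_def inner_sum_left) (simp add: inner_commute)

lemma state_inner: "(a::state) \<bullet> b = vel a \<bullet> vel b + xi a \<bullet> xi b"
  by (cases a; cases b) (simp add: vel_def xi_def)

lemma D_eq: "D_term G b L \<delta> = (\<Sum>i\<in>UNIV. (vel b $ i - vel L $ i) * vel \<delta> $ i) + (\<Sum>C\<in>Basis. (pd G C (xi b) - pd G C (xi L)) * (xi \<delta> \<bullet> C))"
proof -
  have "D_term G b L \<delta> = (vel b - vel L) \<bullet> vel \<delta> + (grad G (xi b) - grad G (xi L)) \<bullet> xi \<delta>"
    unfolding D_term_def grad_eta state_inner by (simp add: vel_def xi_def)
  then show ?thesis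
    unfolding vec3_inner inner_diff_left grad_G_sum by (simp add: left_diff_distrib sum_subtractf)
qed

definition MM :: "3 \<Rightarrow> 3 \<Rightarrow> vec3 \<Rightarrow> real" where
  "MM i \<alpha> x = (dgrad (B x) $ i $ \<alpha> - dgrad (A x) $ i $ \<alpha>) / h"

lemma bd_MM: "bd 1 (\<lambda>j x. MM i \<alpha> x)"
  unfolding MM_def by (intro bd_divide bd_diff adm_F adm_A adm_B)

lemma weak_grad_vB: "weak_grad p (\<lambda>x. vel (B x) $ i) (MM i)"
  unfolding weak_grad_def
proof (intro conjI allI impI)
  show "Lr p (\<lambda>x. vel (B x) $ i)" by (rule bd_Lr[OF bd_vB _ _ J0]) (use p6 in auto)
  show "Lr p (MM i \<alpha>)" for \<alpha> using bd_Lr[OF bd_MM _ _ J0, of p i \<alpha>] p6 by simp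
  fix \<phi> and \<alpha> :: 3 assume f: "testfun \<phi>"
  define C where "C = (axis i (axis \<alpha> (1::real)), 0::mat3, 0::real)"
  have "(axis i (axis \<alpha> (1::real)), 0::mat3 \<times> real) \<in> Basis" by (rule Pair_0_Basis) (simp add: axis_in_Basis_iff)
  then have C: "C \<in> Basis" unfolding C_def by (simp only: zero_prod_def)
  have x: "xi s \<bullet> C = dgrad s $ i $ \<alpha>" for s by (simp add: C_def xi_def dgrad_def inner_prod_def inner_axis)
  have s: "(\<Sum>k\<in>UNIV. dPhi C k \<beta> F * v $ k) = (if \<beta> = \<alpha> then v $ i else 0)" for \<beta> F and v :: vec3
    unfolding C_def dPhi_F by (cases "\<beta> = \<alpha>") (simp_all add: if_distrib[of "\<lambda>z. z * _"] cong: if_cong)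
  from bal_xi[OF C, unfolded distr_balance_def] f
  have "(\<integral>x. MM i \<alpha> x * \<phi> x \<partial>torus) + (\<integral>x. vel (B x) $ i * dx \<alpha> \<phi> x \<partial>torus) = 0"
    by (simp add: x s MM_def if_distrib[of "\<lambda>z. z * _"] cong: if_cong)
  then show "(\<integral>x. vel (B x) $ i * dx \<alpha> \<phi> x \<partial>torus) = - (\<integral>x. MM i \<alpha> x * \<phi> x \<partial>torus)" by simp
qed

lemma bd_test: assumes "testfun \<phi>" shows "bd 0 (\<lambda>j x. \<phi> x)" "bd 0 (\<lambda>j x. dx \<alpha> \<phi> x)"
  using testfun_C1per[OF assms] by (auto intro: bd_cont C1per_cont C1per_dx_cont)

lemma bd_mult_test: "bd a f \<Longrightarrow> bd 0 g \<Longrightarrow> bd a (\<lambda>j x. f j x * g j x)" using bd_mult[of a f 0 g] by simp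

abbreviation "PA C i \<alpha> x \<equiv> dPhi C i \<alpha> (dgrad (A x))"

lemma LrA: "Lr p (\<lambda>x. dgrad (A x) $ i $ \<alpha>)"
  by (rule bd_Lr[OF adm_F[OF adm_A] _ _ J0]) (use p6 in auto)

lemma null_A: "weak_grad p u m \<Longrightarrow> (\<Sum>\<alpha>\<in>UNIV. \<integral>x. PA C i \<alpha> x * m \<alpha> x \<partial>torus) = 0"
  by (rule null_lagrangian_weak_grad[OF _ LrA curlA]) (use p6 in auto)

lemma bd_PM: "bd 3 (\<lambda>j x. PA C i \<alpha> x * MM i \<alpha> x)"
  using bd_mult[OF bd_dPhi(1)[OF adm_A] bd_MM] by simp

text \<open>
  The weak gradient of the new velocity is the difference quotient of the deformation gradient;
  since the columns of \<open>\<partial>\<Phi>/\<partial>F\<close> are divergence free, the balance of \<open>\<Xi>\<close> holds pointwise.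
\<close>

lemma AE_de:
  assumes C: "C \<in> Basis"
  shows "AE x in torus. (xi (B x) \<bullet> C - xi (A x) \<bullet> C) / h = (\<Sum>i\<in>UNIV. \<Sum>\<alpha>\<in>UNIV. PA C i \<alpha> x * MM i \<alpha> x)"
proof -
  define w where "w x = (xi (B x) \<bullet> C - xi (A x) \<bullet> C) / h - (\<Sum>i\<in>UNIV. \<Sum>\<alpha>\<in>UNIV. PA C i \<alpha> x * MM i \<alpha> x)" for x
  have b: "bd (p / 2) (\<lambda>j x. w x)" unfolding w_def
    by (intro bd_diff bd_de[OF C] bd_sum bd_mono[OF bd_PM]) (use p6 in auto)
  have "AE x in torus. w x = 0"
  proof (rule fundamental_lemma)
    show "Lr 2 w" by (rule bd_Lr[OF b _ _ J0]) simp_all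
    fix \<phi> assume f: "testfun \<phi>"
    note ft = bd_test[OF f]
    \<comment> \<open>\<open>X\<close> is the null Lagrangian at the old deformation gradient tested
      with the new velocity times \<open>\<phi>\<close>; \<open>Y\<close> is the flux term of the
      balance. The density plus \<open>Y\<close> integrates to zero by the balance, \<open>X\<close>
      by the null Lagrangian property, and \<open>w * \<phi>\<close> is the difference.\<close>
    define X where "X i \<alpha> x = PA C i \<alpha> x * (MM i \<alpha> x * \<phi> x + vel (B x) $ i * dx \<alpha> \<phi> x)" for i \<alpha> x
    define Y where "Y x = (\<Sum>\<alpha>\<in>UNIV. (\<chi> \<alpha>. \<Sum>i\<in>UNIV. PA C i \<alpha> x * vel (B x) $ i) $ \<alpha> * dx \<alpha> \<phi> x)" for x
    have iX: "integrable torus (X i \<alpha>)" for i \<alpha>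
    proof -
      have "bd (2 + 1) (\<lambda>j. X i \<alpha>)" unfolding X_def
        by (intro bd_mult bd_dPhi adm_A bd_add bd_mult_test bd_MM bd_vB ft)
      from bd_integrable[OF this _ J0] show ?thesis using p6 by simp
    qed
    have iY: "integrable torus Y"
    proof -
      have 1: "bd 3 (\<lambda>j x. PA C i \<alpha> x * vel (B x) $ i)" for i \<alpha>
        using bd_mult[OF bd_dPhi(1)[OF adm_A, of C i \<alpha>] bd_vB[of i]] by simp
      have "bd 3 (\<lambda>j. Y)" unfolding Y_def vec_lambda_beta by (intro bd_sum bd_mult_test[OF bd_sum[OF 1] ft(2)]) auto
      from bd_integrable[OF this _ J0] show ?thesis using p6 by simp
    qed
    have ie: "integrable torus (\<lambda>x. (xi (B x) \<bullet> C - xi (A x) \<bullet> C) / h * \<phi> x)"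
      by (rule bd_integrable[OF bd_mult_test[OF bd_de[OF C] ft(1)] _ J0]) (use p6 in simp)
    have "(\<Sum>\<alpha>\<in>UNIV. \<integral>x. X i \<alpha> x \<partial>torus) = 0" for i
      unfolding X_def by (rule null_A[OF weak_grad_mult_C1per[OF weak_grad_vB testfun_C1per[OF f]]]) (use p6 in simp)
    then have X0: "(\<Sum>i\<in>UNIV. \<Sum>\<alpha>\<in>UNIV. \<integral>x. X i \<alpha> x \<partial>torus) = 0" by simp
    have Y0: "(\<integral>x. (xi (B x) \<bullet> C - xi (A x) \<bullet> C) / h * \<phi> x \<partial>torus) + (\<integral>x. Y x \<partial>torus) = 0"
      using bal_xi[OF C] f unfolding distr_balance_def Y_def by simp
    have "w x * \<phi> x = ((xi (B x) \<bullet> C - xi (A x) \<bullet> C) / h * \<phi> x + Y x) - (\<Sum>i\<in>UNIV. \<Sum>\<alpha>\<in>UNIV. X i \<alpha> x)" for x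
    proof -
      have "Y x = (\<Sum>i\<in>UNIV. \<Sum>\<alpha>\<in>UNIV. PA C i \<alpha> x * vel (B x) $ i * dx \<alpha> \<phi> x)"
        unfolding Y_def vec_lambda_beta sum_distrib_right by (rule sum.swap)
      moreover have "(\<Sum>i\<in>UNIV. \<Sum>\<alpha>\<in>UNIV. X i \<alpha> x) = (\<Sum>i\<in>UNIV. \<Sum>\<alpha>\<in>UNIV. PA C i \<alpha> x * MM i \<alpha> x) * \<phi> x + (\<Sum>i\<in>UNIV. \<Sum>\<alpha>\<in>UNIV. PA C i \<alpha> x * vel (B x) $ i * dx \<alpha> \<phi> x)"
        unfolding X_def sum_distrib_right sum.distrib[symmetric] by (intro sum.cong refl) (simp add: algebra_simps)
      ultimately show ?thesis unfolding w_def by (simp add: algebra_simps)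
    qed
    then have "(\<integral>x. w x * \<phi> x \<partial>torus) = (\<integral>x. ((xi (B x) \<bullet> C - xi (A x) \<bullet> C) / h * \<phi> x + Y x) - (\<Sum>i\<in>UNIV. \<Sum>\<alpha>\<in>UNIV. X i \<alpha> x) \<partial>torus)" by simp
    also have "\<dots> = ((\<integral>x. (xi (B x) \<bullet> C - xi (A x) \<bullet> C) / h * \<phi> x \<partial>torus) + (\<integral>x. Y x \<partial>torus)) - (\<Sum>i\<in>UNIV. \<Sum>\<alpha>\<in>UNIV. \<integral>x. X i \<alpha> x \<partial>torus)"
      by (subst Bochner_Integration.integral_diff; (intro Bochner_Integration.integrable_add Bochner_Integration.integrable_sum iX iY ie)?)
        (subst Bochner_Integration.integral_add[OF ie iY], simp add: iX Bochner_Integration.integrable_sum)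
    finally show "(\<integral>x. w x * \<phi> x \<partial>torus) = 0" using X0 Y0 by simp
  qed
  then show ?thesis by (rule AE_mp) (simp add: w_def)
qed

abbreviation "rhs j x \<equiv> Q_term G (LL (snd j)) (U (fst j)) x - 1 / h * D_term G (B x) (LL (snd j) x) (B x - A x)
     + S_term G B (LL (snd j)) (\<lambda>x. dgrad (A x)) (U (fst j)) x"

lemma rhs_eq: "rhs j x = 
  (\<Sum>i\<in>UNIV. \<Sum>\<alpha>\<in>UNIV. \<Sum>C\<in>Basis.
     dx \<alpha> (\<lambda>y. gb C (fst j) y) x * (PA C i \<alpha> x * (vel (B x) $ i - vel (U (fst j) x) $ i) - Pb C i \<alpha> (fst j) x * (vel (LL (snd j) x) $ i - vel (U (fst j) x) $ i))
     + dx \<alpha> (\<lambda>y. vel (U (fst j) y) $ i) x * ((pd G C (xi (B x)) - gb C (fst j) x) * PA C i \<alpha> x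
        - (\<Sum>E\<in>Basis. pd (pd G C) E (xi (U (fst j) x)) * (xi (LL (snd j) x) \<bullet> E - xi (U (fst j) x) \<bullet> E)) * Pb C i \<alpha> (fst j) x))
   - ((\<Sum>i\<in>UNIV. (vel (B x) $ i - vel (LL (snd j) x) $ i) * ((vel (B x) $ i - vel (A x) $ i) / h))
      + (\<Sum>C\<in>Basis. (pd G C (xi (B x)) - pd G C (xi (LL (snd j) x))) * ((xi (B x) \<bullet> C - xi (A x) \<bullet> C) / h)))"
proof -
  have v: "vel (B x - A x) = vel (B x) - vel (A x)" "xi (B x - A x) = xi (B x) - xi (A x)" by (simp_all add: vel_def xi_def)
  have "1 / h * D_term G (B x) (LL (snd j) x) (B x - A x) =
     (\<Sum>i\<in>UNIV. (vel (B x) $ i - vel (LL (snd j) x) $ i) * ((vel (B x) $ i - vel (A x) $ i) / h))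
      + (\<Sum>C\<in>Basis. (pd G C (xi (B x)) - pd G C (xi (LL (snd j) x))) * ((xi (B x) \<bullet> C - xi (A x) \<bullet> C) / h))"
    unfolding D_eq v distrib_left sum_distrib_left inner_diff_left by (simp add: mult.assoc)
  then show ?thesis unfolding QS_eq[symmetric] by linarith
qed

lemma bd_stressA: "C \<in> Basis \<Longrightarrow> bd (p - 1) (\<lambda>j x. pd G C (xi (B x)) * PA C i \<alpha> x)"
  by (rule bd_stress[OF adm_B adm_A])

lemma bd_gbPA: "C \<in> Basis \<Longrightarrow> bd (p - 1) (\<lambda>j x. (pd G C (xi (B x)) - gb C (fst j) x) * PA C i \<alpha> x)"
  unfolding left_diff_distrib
  by (intro bd_diff bd_stressA bd_mono[OF bd_mult0[OF bd_gb bd_dPhi(1)[OF adm_A]]]) (use p6 in auto)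

lemma bd_wB: "bd 1 (\<lambda>j x. vel (B x) $ i - vel (U (fst j) x) $ i)"
  by (intro bd_diff bd_vB bd_0[OF bd_Vb]) simp

lemma bd_rhs: "bd p rhs"
proof -
  have 3: "bd p (\<lambda>j x. (pd G C (xi (B x)) - pd G C (xi (LL (snd j) x))) * ((xi (B x) \<bullet> C - xi (A x) \<bullet> C) / h))" if C: "C \<in> Basis" for C
  proof -
    have "bd p (\<lambda>j x. (pd G C (xi (B x)) * (xi (B x) \<bullet> C - xi (A x) \<bullet> C) - pd G C (xi (LL (snd j) x)) * (xi (B x) \<bullet> C - xi (A x) \<bullet> C)) / h)"
      by (intro bd_divide bd_diff bd_power C adm_A adm_B adm_LL)
    then show ?thesis by (simp add: left_diff_distrib)
  qed
  have 4: "bd p (\<lambda>j x. PA C i \<alpha> x * (vel (B x) $ i - vel (U (fst j) x) $ i))" for C i \<alpha>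
    by (rule bd_mono[OF bd_mult[OF bd_dPhi(1)[OF adm_A] bd_wB]]) (use p6 in simp)
  show ?thesis unfolding rhs_eq[abs_def]
    by (intro bd_add bd_diff bd_sum 3 4 bd_mult0[OF bd_dgb] bd_mult0[OF bd_dVb] bd_mult0[OF bd_Pb] bd_mono[OF bd_gbPA] 
       bd_mult_test[OF _ bd_Pb] bd_half_mult bd_dv adm_vel adm_xi adm_B adm_A adm_LL bd_p[OF bd_mult0] bd_hess p2
       bd_0[OF bd_Vb] bd_0[OF bd_xib] bd_p[OF bd_diff[OF adm_vel bd_0[OF bd_Vb]]] bd_p) (use p6 in simp_all)
qed

lemma q_rel_nth: "q_rel G B (\<lambda>x. dgrad (A x)) (U t) x $ \<alpha> = (\<Sum>i\<in>UNIV. \<Sum>C\<in>Basis.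
     (vel (B x) $ i - vel (U t x) $ i) * (pd G C (xi (B x)) - gb C t x) * PA C i \<alpha> x)"
  by (simp add: q_rel_def)

lemma bd_q: "bd p (\<lambda>j x. q_rel G B (\<lambda>x. dgrad (A x)) (U (fst j)) x $ \<alpha>)"
  unfolding q_rel_nth mult.assoc using bd_mult[OF bd_wB bd_gbPA] p6 by (intro bd_sum) auto

lemma weak_grad_wB:
  assumes t: "t \<in> {0..T}"
  shows "weak_grad p (\<lambda>x. vel (B x) $ i - vel (U t x) $ i) (\<lambda>\<alpha> x. MM i \<alpha> x - dx \<alpha> (\<lambda>y. vel (U t y) $ i) x)"
proof -
  have "C1per (\<lambda>x. -1 * vel (U t x) $ i)" by (rule C1per_mult[OF C1per_const C1per_comps(1)[OF t]])
  from weak_grad_add[OF weak_grad_vB weak_grad_C1per[OF this p2(3)]] dx_cmult[OF C1per_comps(1)[OF t, of i], of _ "-1"] p6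
  show ?thesis by simp
qed

text \<open>By \<open>step_algebra\<close> the defect between the two sides is almost everywhere the
  momentum balance tested with the relative velocity times \<open>\<phi>\<close>, minus null
  Lagrangians whose test functions contain the derivatives of \<open>G\<close> at the smooth
  solution. Both integrate to zero.\<close>

lemma step_identity:
  assumes j: "j \<in> J"
  shows "distr_balance (entropy_rate j) (q_rel G B (\<lambda>x. dgrad (A x)) (U (fst j))) (rhs j)"
proof -
  define t where "t = fst j"
  have t: "t \<in> {0..T}" using j by (auto simp: t_def)
  have i1: "integrable torus (entropy_rate j)" "integrable torus (rhs j)" using bd_integrable[OF bd_entropy_rate order_refl j] bd_integrable[OF bd_rhs order_refl j] .
  let ?q = "q_rel G B (\<lambda>x. dgrad (A x)) (U (fst j))"
  have iq: "integrable torus ?q"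
  proof -
    have "integrable torus (\<lambda>x. \<Sum>\<alpha>\<in>UNIV. ?q x $ \<alpha> *\<^sub>R axis \<alpha> (1::real))"
      using bd_integrable[OF bd_q order_refl j] by (intro Bochner_Integration.integrable_sum integrable_scaleR_left) simp
    then show ?thesis unfolding vec3_axis_sum[symmetric] vec_nth_inverse .
  qed
  have main: "(\<integral>x. entropy_rate j x * \<phi> x \<partial>torus) + (\<integral>x. (\<Sum>\<alpha>\<in>UNIV. ?q x $ \<alpha> * dx \<alpha> \<phi> x) \<partial>torus) = (\<integral>x. rhs j x * \<phi> x \<partial>torus)"
    if f: "testfun \<phi>" for \<phi>
  proof -
    note ft = bd_test[OF f]
    define vr where "vr i x = vel (B x) $ i - vel (U t x) $ i" for i x
    define mw where "mw i \<alpha> x = MM i \<alpha> x - dx \<alpha> (\<lambda>y. vel (U t y) $ i) x" for i \<alpha> x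
    define T1 where "T1 i x = (vel (B x) $ i - vel (A x) $ i) / h * (vr i x * \<phi> x)" for i x
    define \<sigma> where "\<sigma> i \<alpha> x = (\<Sum>C\<in>Basis. pd G C (xi (B x)) * PA C i \<alpha> x)" for i \<alpha> x
    define T2 where "T2 i \<alpha> x = \<sigma> i \<alpha> x * (mw i \<alpha> x * \<phi> x + vr i x * dx \<alpha> \<phi> x)" for i \<alpha> x
    define T3 where "T3 i C \<alpha> x = PA C i \<alpha> x * (mw i \<alpha> x * (gb C t x * \<phi> x) + vr i x * (gb C t x * dx \<alpha> \<phi> x + dx \<alpha> (\<lambda>y. gb C t y) x * \<phi> x))" for i C \<alpha> x
    have bvr: "bd 1 (\<lambda>j x. vel (B x) $ i - vel (U (fst j) x) $ i)" for i by (rule bd_wB)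
    have bmw: "bd 1 (\<lambda>j x. MM i \<alpha> x - dx \<alpha> (\<lambda>y. vel (U (fst j) y) $ i) x)" for i \<alpha> by (intro bd_diff bd_MM bd_0[OF bd_dVb]) simp
    have b\<sigma>: "bd (p - 1) (\<lambda>j. \<sigma> i \<alpha>)" for i \<alpha> unfolding \<sigma>_def by (intro bd_sum bd_stressA) (use p6 in auto)
    have I1: "integrable torus (T1 i)" for i
      unfolding T1_def[abs_def] vr_def t_def
      by (rule bd_integrable[OF bd_mult[OF bd_dv bd_mult_test[OF bvr ft(1)]] _ j]) (use p6 in simp)
    have I2: "integrable torus (T2 i \<alpha>)" for i \<alpha>
      unfolding T2_def[abs_def] vr_def mw_def t_def
      by (rule bd_integrable[OF bd_mult[OF b\<sigma> bd_add[OF bd_mult_test[OF bmw ft(1)] bd_mult_test[OF bvr ft(2)]]] _ j]) simp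
    have I3: "integrable torus (T3 i C \<alpha>)" if C: "C \<in> Basis" for i C \<alpha>
      unfolding T3_def[abs_def] vr_def mw_def t_def
      by (rule bd_integrable[OF bd_mult[OF bd_dPhi(1)[OF adm_A] bd_add[OF bd_mult_test[OF bmw bd_mult0[OF bd_gb[OF C] ft(1)]]
          bd_mult_test[OF bvr bd_add[OF bd_mult0[OF bd_gb[OF C] ft(2)] bd_mult0[OF bd_dgb[OF C] ft(1)]]]]] _ j]) (use p6 in simp)
    note wg = weak_grad_wB[OF t, folded mw_def vr_def]
    \<comment> \<open>The relative velocity times \<open>\<phi>\<close> is no test function, but it
      has a weak gradient in L^p, and the stress lies in the dual class.\<close>
    have E1: "(\<integral>x. T1 i x \<partial>torus) = - (\<Sum>\<alpha>\<in>UNIV. \<integral>x. T2 i \<alpha> x \<partial>torus)" for i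
      unfolding T1_def T2_def
    proof (rule weak_form_extends)
      show "1 < p" using p6 by simp
      show "Lr (p / (p - 1)) (\<lambda>x. (vel (B x) $ i - vel (A x) $ i) / h)"
        by (rule bd_Lr[OF bd_dv _ _ j]) (use p6 in \<open>simp_all add: field_simps\<close>)
      show "Lr (p / (p - 1)) (\<sigma> i \<alpha>)" for \<alpha> by (rule bd_Lr[OF b\<sigma> _ _ j]) (use p6 in \<open>simp_all add: field_simps\<close>)
      show "weak_grad p (\<lambda>x. vr i x * \<phi> x) (\<lambda>\<alpha> x. mw i \<alpha> x * \<phi> x + vr i x * dx \<alpha> \<phi> x)"
        by (rule weak_grad_mult_C1per[OF wg testfun_C1per[OF f]]) (use p6 in simp)
      fix \<psi> assume g: "testfun \<psi>"
      have "integrable torus (\<lambda>x. \<sigma> i \<alpha> x * dx \<alpha> \<psi> x)" for \<alpha>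
        by (rule bd_integrable[OF bd_mult_test[OF b\<sigma> bd_test(2)[OF g]] _ j]) simp
      then show "(\<integral>x. (vel (B x) $ i - vel (A x) $ i) / h * \<psi> x \<partial>torus) = - (\<Sum>\<alpha>\<in>UNIV. \<integral>x. \<sigma> i \<alpha> x * dx \<alpha> \<psi> x \<partial>torus)"
        using bal_vel[of i, unfolded distr_balance_def \<sigma>_def[symmetric] vec_lambda_beta, THEN conjunct2, THEN conjunct2, THEN conjunct2, rule_format, OF g]
        by (simp add: eq_neg_iff_add_eq_0)
    qed
    \<comment> \<open>The C^1 factor \<open>gb C t\<close> is moved into the test function, which
      leaves the bare null Lagrangian.\<close>
    have E3: "(\<Sum>\<alpha>\<in>UNIV. \<integral>x. T3 i C \<alpha> x \<partial>torus) = 0" if C: "C \<in> Basis" for i C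
    proof -
      have c: "C1per (\<lambda>x. gb C t x * \<phi> x)" by (rule C1per_mult[OF C1per_gb[OF t C] testfun_C1per[OF f]])
      show ?thesis
        using null_A[OF weak_grad_mult_C1per[OF wg c], of C i] p6 dx_mult[OF C1per_gb[OF t C] testfun_C1per[OF f]]
        unfolding T3_def by simp
    qed
    have AEd: "AE x in torus. \<forall>C\<in>Basis. (xi (B x) \<bullet> C - xi (A x) \<bullet> C) / h = (\<Sum>i\<in>UNIV. \<Sum>\<alpha>\<in>UNIV. PA C i \<alpha> x * MM i \<alpha> x)"
      by (rule AE_finite_allI) (use AE_de in auto)
    \<comment> \<open>The nonconservative equations of the smooth solution are available in the open
      cube, and the pointwise balance of \<open>\<Xi>\<close> almost everywhere.\<close>
    have pw: "AE x in torus. (entropy_rate j x * \<phi> x + (\<Sum>\<alpha>\<in>UNIV. ?q x $ \<alpha> * dx \<alpha> \<phi> x)) - rhs j x * \<phi> x =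
        (\<Sum>i\<in>UNIV. T1 i x + (\<Sum>\<alpha>\<in>UNIV. T2 i \<alpha> x)) - (\<Sum>i\<in>UNIV. \<Sum>C\<in>Basis. \<Sum>\<alpha>\<in>UNIV. T3 i C \<alpha> x)"
      using AE_torus_interior AEd
    proof eventually_elim
      case (elim x)
      show ?case
        unfolding entropy_rate_def q_rel_nth rhs_eq unfolding T1_def T2_def T3_def \<sigma>_def mw_def vr_def t_def[symmetric]
        by (rule step_algebra[OF vel_evolution[OF t elim(1)] xi_evolution[OF t elim(1)]])
          (use elim(2) pd_pd_commute[OF Ck_on_le[OF C3(1)]] in simp_all)
    qed
    have iL: "integrable torus (\<lambda>x. entropy_rate j x * \<phi> x)" "integrable torus (\<lambda>x. rhs j x * \<phi> x)"
      using bd_integrable[OF bd_mult_test[OF bd_entropy_rate ft(1)] order_refl j] bd_integrable[OF bd_mult_test[OF bd_rhs ft(1)] order_refl j] .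
    have iQ: "integrable torus (\<lambda>x. \<Sum>\<alpha>\<in>UNIV. ?q x $ \<alpha> * dx \<alpha> \<phi> x)"
      by (intro Bochner_Integration.integrable_sum bd_integrable[OF bd_mult_test[OF bd_q ft(2)] order_refl j])
    have "(\<integral>x. (entropy_rate j x * \<phi> x + (\<Sum>\<alpha>\<in>UNIV. ?q x $ \<alpha> * dx \<alpha> \<phi> x)) - rhs j x * \<phi> x \<partial>torus) =
        (\<integral>x. (\<Sum>i\<in>UNIV. T1 i x + (\<Sum>\<alpha>\<in>UNIV. T2 i \<alpha> x)) - (\<Sum>i\<in>UNIV. \<Sum>C\<in>Basis. \<Sum>\<alpha>\<in>UNIV. T3 i C \<alpha> x) \<partial>torus)"
    proof (rule integral_cong_AE[OF _ _ pw])
      show "(\<lambda>x. (entropy_rate j x * \<phi> x + (\<Sum>\<alpha>\<in>UNIV. ?q x $ \<alpha> * dx \<alpha> \<phi> x)) - rhs j x * \<phi> x) \<in> borel_measurable torus"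
        by (intro borel_measurable_integrable Bochner_Integration.integrable_diff Bochner_Integration.integrable_add iL iQ)
      show "(\<lambda>x. (\<Sum>i\<in>UNIV. T1 i x + (\<Sum>\<alpha>\<in>UNIV. T2 i \<alpha> x)) - (\<Sum>i\<in>UNIV. \<Sum>C\<in>Basis. \<Sum>\<alpha>\<in>UNIV. T3 i C \<alpha> x)) \<in> borel_measurable torus"
        by (intro borel_measurable_integrable Bochner_Integration.integrable_diff Bochner_Integration.integrable_add Bochner_Integration.integrable_sum I1 I2 I3)
    qed
    also have "\<dots> = (\<integral>x. (\<Sum>i\<in>UNIV. T1 i x + (\<Sum>\<alpha>\<in>UNIV. T2 i \<alpha> x)) \<partial>torus) - (\<integral>x. (\<Sum>i\<in>UNIV. \<Sum>C\<in>Basis. \<Sum>\<alpha>\<in>UNIV. T3 i C \<alpha> x) \<partial>torus)"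
      by (intro Bochner_Integration.integral_diff Bochner_Integration.integrable_add Bochner_Integration.integrable_sum I1 I2 I3)
    also have "(\<integral>x. (\<Sum>i\<in>UNIV. T1 i x + (\<Sum>\<alpha>\<in>UNIV. T2 i \<alpha> x)) \<partial>torus) = 0"
      by (simp add: I1 I2 Bochner_Integration.integrable_sum E1)
    also have "(\<integral>x. (\<Sum>i\<in>UNIV. \<Sum>C\<in>Basis. \<Sum>\<alpha>\<in>UNIV. T3 i C \<alpha> x) \<partial>torus) = 0"
      by (simp add: I3 Bochner_Integration.integrable_sum E3)
    finally show ?thesis using iL iQ by simp
  qed
  show ?thesis unfolding distr_balance_def using i1 iq main by blast
qed

end

section \<open>Pointwise estimates of Q and S\<close>

lemma matrix_entry_le: "\<bar>(Z::mat3) $ i $ \<alpha>\<bar> \<le> norm Z"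
  using component_le_norm_cart[of "Z $ i" \<alpha>] Finite_Cartesian_Product.norm_nth_le[of Z i] by linarith

lemma dPhi_lipschitz:
  assumes C: "norm C \<le> 1"
  shows "\<bar>dPhi C i \<alpha> F - dPhi C i \<alpha> F'\<bar> \<le> 4 * (1 + norm F + norm F') * norm (F - F')"
proof -
  define Z where "Z = fst (snd C)"
  have Z: "\<bar>Z $ k $ \<beta>\<bar> \<le> 1" for k \<beta>
    using matrix_entry_le[of Z k \<beta>] C norm_snd_le[of "snd C" "fst C"] norm_fst_le[of Z "snd (snd C)"] by (simp add: Z_def)
  have w: "\<bar>snd (snd C)\<bar> \<le> 1"
    using C norm_snd_le[of "snd C" "fst C"] norm_snd_le[of "snd (snd C)" Z] by (simp add: Z_def)
  have d: "\<bar>F $ k $ \<beta> - F' $ k $ \<beta>\<bar> \<le> norm (F - F')" for k \<beta> using matrix_entry_le[of "F - F'" k \<beta>] by simp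
  have t: "\<bar>Z $ k $ \<beta> * (F $ m $ \<nu> - F' $ m $ \<nu>)\<bar> \<le> norm (F - F')" for k \<beta> m \<nu>
    using mult_mono[OF Z d] by (simp add: abs_mult)
  have prod: "\<bar>a * b - a' * b'\<bar> \<le> (norm F + norm F') * norm (F - F')"
    if "\<bar>a\<bar> \<le> norm F" "\<bar>b'\<bar> \<le> norm F'" "\<bar>b - b'\<bar> \<le> norm (F - F')" "\<bar>a - a'\<bar> \<le> norm (F - F')" for a b a' b'
  proof -
    have "\<bar>a * b - a' * b'\<bar> = \<bar>a * (b - b') + (a - a') * b'\<bar>" by (simp add: algebra_simps)
    also have "\<dots> \<le> \<bar>a\<bar> * \<bar>b - b'\<bar> + \<bar>a - a'\<bar> * \<bar>b'\<bar>" by (simp add: abs_mult[symmetric])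
    also have "\<dots> \<le> norm F * norm (F - F') + norm (F - F') * norm F'" using that by (intro add_mono mult_mono) auto
    finally show ?thesis by (simp add: algebra_simps)
  qed
  have c: "\<bar>cof F $ i $ \<alpha> - cof F' $ i $ \<alpha>\<bar> \<le> 2 * ((norm F + norm F') * norm (F - F'))"
  proof -
    have 1: "\<bar>F $ (i + 1) $ (\<alpha> + 1) * F $ (i + 2) $ (\<alpha> + 2) - F' $ (i + 1) $ (\<alpha> + 1) * F' $ (i + 2) $ (\<alpha> + 2)\<bar> \<le> (norm F + norm F') * norm (F - F')"
      by (intro prod matrix_entry_le d)
    have 2: "\<bar>F $ (i + 1) $ (\<alpha> + 2) * F $ (i + 2) $ (\<alpha> + 1) - F' $ (i + 1) $ (\<alpha> + 2) * F' $ (i + 2) $ (\<alpha> + 1)\<bar> \<le> (norm F + norm F') * norm (F - F')"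
      by (intro prod matrix_entry_le d)
    show ?thesis unfolding cof_def vec_lambda_beta using 1 2 by linarith
  qed
  have cw: "\<bar>snd (snd C) * (cof F $ i $ \<alpha> - cof F' $ i $ \<alpha>)\<bar> \<le> 2 * ((norm F + norm F') * norm (F - F'))"
    using mult_mono[OF w c] by (simp add: abs_mult)
  have "dPhi C i \<alpha> F - dPhi C i \<alpha> F' =
      Z $ (i + 2) $ (\<alpha> + 2) * (F $ (i + 1) $ (\<alpha> + 1) - F' $ (i + 1) $ (\<alpha> + 1))
    + Z $ (i + 1) $ (\<alpha> + 1) * (F $ (i + 2) $ (\<alpha> + 2) - F' $ (i + 2) $ (\<alpha> + 2))
    - Z $ (i + 2) $ (\<alpha> + 1) * (F $ (i + 1) $ (\<alpha> + 2) - F' $ (i + 1) $ (\<alpha> + 2))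
    - Z $ (i + 1) $ (\<alpha> + 2) * (F $ (i + 2) $ (\<alpha> + 1) - F' $ (i + 2) $ (\<alpha> + 1))
    + snd (snd C) * (cof F $ i $ \<alpha> - cof F' $ i $ \<alpha>)"
    unfolding dPhi_eq dcof_def Z_def[symmetric] by (simp add: right_diff_distrib)
  then have "\<bar>dPhi C i \<alpha> F - dPhi C i \<alpha> F'\<bar> \<le> 4 * norm (F - F') + 2 * ((norm F + norm F') * norm (F - F'))"
    using t[of "i + 2" "\<alpha> + 2" "i + 1" "\<alpha> + 1"] t[of "i + 1" "\<alpha> + 1" "i + 2" "\<alpha> + 2"]
      t[of "i + 2" "\<alpha> + 1" "i + 1" "\<alpha> + 2"] t[of "i + 1" "\<alpha> + 2" "i + 2" "\<alpha> + 1"] cw by linarith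
  also have "\<dots> \<le> 4 * (1 + norm F + norm F') * norm (F - F')"
    by (simp add: algebra_simps)
  finally show ?thesis .
qed

lemma dPhi_F_const: "snd C = 0 \<Longrightarrow> dPhi C i \<alpha> F = dPhi C i \<alpha> F'"
  by (simp add: dPhi_eq dcof_def)

lemma dPhi_bound: "norm C \<le> 1 \<Longrightarrow> \<bar>dPhi C i \<alpha> F\<bar> \<le> 1 + 4 * (1 + norm F) * norm F"
proof -
  assume C: "norm C \<le> 1"
  have "dPhi C i \<alpha> 0 = fst C $ i $ \<alpha>" by (simp add: dPhi_eq dcof_def cof_def)
  then have "\<bar>dPhi C i \<alpha> 0\<bar> \<le> 1" using matrix_entry_le[of "fst C" i \<alpha>] C norm_fst_le[of "fst C" "snd C"] by simp
  then show ?thesis using dPhi_lipschitz[OF C, of i \<alpha> F 0] by simp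
qed

lemma mult_sum4: "\<bar>(a + b) * (c + d)\<bar> \<le> a\<^sup>2 + b\<^sup>2 + c\<^sup>2 + (d::real)\<^sup>2"
proof -
  have 1: "(a + b)\<^sup>2 \<le> 2 * (a\<^sup>2 + b\<^sup>2)" and 2: "(c + d)\<^sup>2 \<le> 2 * (c\<^sup>2 + d\<^sup>2)"
    using sum_squares_bound[of a b] sum_squares_bound[of c d] by (simp_all add: power2_sum)
  have "2 * \<bar>(a + b) * (c + d)\<bar> \<le> (a + b)\<^sup>2 + (c + d)\<^sup>2"
    using sum_squares_bound[of "\<bar>a + b\<bar>" "\<bar>c + d\<bar>"] by (simp add: abs_mult)
  from order_trans[OF this add_mono[OF 1 2]] show ?thesis by simp
qed

lemma sq_sum3: "(x + y + z)\<^sup>2 \<le> 3 * (x\<^sup>2 + y\<^sup>2 + (z::real)\<^sup>2)"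
  using sum_squares_bound[of x y] sum_squares_bound[of x z] sum_squares_bound[of y z]
  by (simp add: power2_eq_square algebra_simps)

context energy_density
begin

definition err_density :: "state \<Rightarrow> state \<Rightarrow> real" where
  "err_density a b = (1 + norm (dgrad a) powr (p - 2) + norm (dgrad b) powr (p - 2)) * (norm (dgrad a - dgrad b))\<^sup>2 + (norm (a - b))\<^sup>2"

text \<open>
  The part of the increment that is controlled by the numerical dissipation, up to the cubic
  degeneration at the end of the time step.
\<close>

definition increment :: "state \<Rightarrow> state \<Rightarrow> real" where
  "increment a b = (norm (b - a))\<^sup>2 + ((norm (dgrad b))\<^sup>2 + (norm (dgrad b - dgrad a))\<^sup>2) * (norm (dgrad b - dgrad a))\<^sup>2"

lemma err_density_nonneg: "0 \<le> err_density a b" by (simp add: err_density_def)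
lemma increment_nonneg: "0 \<le> increment a b" by (simp add: increment_def)

lemma err_density_ge: "(norm (a - b))\<^sup>2 \<le> err_density a b" "(1 + wt (dgrad a) (dgrad b)) * (norm (dgrad a - dgrad b))\<^sup>2 + (norm (a - b))\<^sup>2 = err_density a b"
  by (simp_all add: err_density_def wt_def add.assoc)

lemma increment_ge: "(norm (b - a))\<^sup>2 \<le> increment a b" by (simp add: increment_def)

lemma sq_le_powr: "0 \<le> (y::real) \<Longrightarrow> y\<^sup>2 \<le> 1 + y powr q"
  using powr_le_1_plus[of y 2 q] p6 by simp

lemma vel_sq_le: "(vel a $ i - vel b $ i)\<^sup>2 \<le> (norm (a - b))\<^sup>2"
  using component_le_norm_cart[of "vel (a - b)" i] state_parts(1)[of "a - b"] by (simp add: state_diff abs_le_square_iff[symmetric])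

lemma pd_G_lipschitz_R:
  assumes "C \<in> Basis" "fst C = 0" shows "\<bar>pd G C (xi a) - pd G C (xi b)\<bar> \<le> c_lip * norm (a - b)"
proof -
  have "\<bar>pd G C (xi a) - pd G C (xi b)\<bar> \<le> c_lip * norm (xi a - xi b)" using pd_G_lipschitz[of C "xi a" "xi b"] assms by simp
  also have "\<dots> \<le> c_lip * norm (a - b)" using state_parts(2)[of "a - b"] c_lip_pos by (simp add: state_diff)
  finally show ?thesis .
qed

text \<open>The squared Lipschitz constant is quadratic in the deformation gradients and so below
  the power \<open>q\<close>. In \<open>144 = 16 * 9\<close> the 9 comes from replacing squares by
  that power.\<close>

lemma dPhi_diff_err_density: assumes "norm C \<le> 1" shows "(dPhi C i \<alpha> (dgrad a) - dPhi C i \<alpha> (dgrad b))\<^sup>2 \<le> 144 * err_density a b"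
proof -
  let ?F = "norm (dgrad a)" and ?F' = "norm (dgrad b)" and ?d = "norm (dgrad a - dgrad b)"
  have "(dPhi C i \<alpha> (dgrad a) - dPhi C i \<alpha> (dgrad b))\<^sup>2 \<le> (4 * (1 + ?F + ?F') * ?d)\<^sup>2"
    using dPhi_lipschitz[OF assms, of i \<alpha> "dgrad a" "dgrad b"] by (intro power2_le_iff_abs_le[THEN iffD2]) auto
  also have "\<dots> = 16 * (1 + ?F + ?F')\<^sup>2 * ?d\<^sup>2" by (simp only: power_mult_distrib) simp
  also have "\<dots> \<le> 16 * (9 * (1 + ?F powr q + ?F' powr q)) * ?d\<^sup>2"
  proof -
    have lin: "3 * (1\<^sup>2 + X + Y) \<le> 9 * (1 + x + y)" if "X \<le> 1 + x" "Y \<le> 1 + y" "0 \<le> x" "0 \<le> y" for X Y x y :: real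
      using that by simp
    have "3 * (1\<^sup>2 + ?F\<^sup>2 + ?F'\<^sup>2) \<le> 9 * (1 + ?F powr q + ?F' powr q)"
      by (rule lin[OF sq_le_powr[OF norm_ge_zero] sq_le_powr[OF norm_ge_zero] powr_ge_zero powr_ge_zero])
    from order_trans[OF sq_sum3 this] show ?thesis by (intro mult_right_mono mult_left_mono) auto
  qed
  also have "\<dots> \<le> 144 * err_density a b" by (simp add: err_density_def algebra_simps)
  finally show ?thesis .
qed

text \<open>Both arguments are measured by \<open>b\<close> and \<open>b - a\<close> instead of
  \<open>a\<close>, because the dissipation has weights at the new state and the interpolate. Here
  \<open>192 = 16 * 12\<close>.\<close>

lemma dPhi_diff_increment:
  assumes C: "norm C \<le> 1" and l: "0 \<le> l" "l \<le> 1"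
  shows "(dPhi C i \<alpha> (dgrad a) - dPhi C i \<alpha> (dgrad (a + l *\<^sub>R (b - a))))\<^sup>2 \<le> 192 * increment a b"
proof -
  let ?F = "dgrad a" and ?F' = "dgrad (a + l *\<^sub>R (b - a))" and ?B = "norm (dgrad b)" and ?d = "norm (dgrad b - dgrad a)"
  have e: "?F' = ?F + l *\<^sub>R (dgrad b - ?F)" by (simp add: dgrad_def)
  have n1: "norm ?F \<le> ?B + ?d" using norm_triangle_sub[of ?F "dgrad b"] by (simp add: norm_minus_commute)
  have n2: "norm ?F' \<le> ?B + ?d" unfolding e by (rule order_trans[OF segment_norm_le_max[OF l]]) (use n1 in simp)
  have n3: "norm (?F - ?F') \<le> ?d" unfolding e using l mult_right_mono[of l 1 ?d] by simp
  have "\<bar>dPhi C i \<alpha> ?F - dPhi C i \<alpha> ?F'\<bar> \<le> 4 * (1 + norm ?F + norm ?F') * norm (?F - ?F')" by (rule dPhi_lipschitz[OF C])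
  also have "\<dots> \<le> 4 * (1 + 2 * ?B + 2 * ?d) * ?d" using n1 n2 n3 by (intro mult_mono) auto
  finally have "(dPhi C i \<alpha> ?F - dPhi C i \<alpha> ?F')\<^sup>2 \<le> (4 * (1 + 2 * ?B + 2 * ?d) * ?d)\<^sup>2"
    by (intro power2_le_iff_abs_le[THEN iffD2]) auto
  also have "\<dots> = 16 * (1 + 2 * ?B + 2 * ?d)\<^sup>2 * ?d\<^sup>2" by (simp only: power_mult_distrib) simp
  also have "\<dots> \<le> 16 * (12 * (1 + (?B\<^sup>2 + ?d\<^sup>2))) * ?d\<^sup>2"
    by (intro mult_right_mono mult_left_mono order_trans[OF sq_sum3]) auto
  also have "\<dots> = 192 * (?d\<^sup>2 + (?B\<^sup>2 + ?d\<^sup>2) * ?d\<^sup>2)" by (simp add: algebra_simps)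
  also have "\<dots> \<le> 192 * increment a b"
    using state_parts(3)[of "b - a"] unfolding increment_def by (simp add: state_diff)
  finally show ?thesis .
qed

text \<open>\<open>eta_r'\<close> is the relative entropy in the form of \<open>eta_r_eq\<close>.
  The halved lower constant pays for the difference of deformation gradients, which
  \<open>err_density\<close> counts once more besides the difference of the full states.\<close>

lemma c_low_c_up:
  "min (1/2) c_low / 2 * err_density a b \<le> eta_r' a b" "eta_r' a b \<le> (1/2 + c_up) * err_density a b"
  if "eta_r' = (\<lambda>a b. 1/2 * (norm (vel a - vel b))\<^sup>2 + rel G (xi a) (xi b))"
proof -
  let ?V = "(norm (vel a - vel b))\<^sup>2" and ?X = "(norm (xi a - xi b))\<^sup>2" and ?F = "(norm (dgrad a - dgrad b))\<^sup>2"
  define m where "m = min (1/2) c_low"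
  have m: "0 < m" "m \<le> 1/2" "m \<le> c_low" using c_low_pos by (auto simp: m_def)
  have s: "(norm (a - b))\<^sup>2 = ?V + ?X" by (cases a; cases b) (simp add: vel_def xi_def norm_Pair)
  have F: "?F \<le> ?X" using power_mono[OF state_parts(5)[of "a - b"] norm_ge_zero, of 2] by (simp add: state_diff)
  have w: "0 \<le> wt (dgrad a) (dgrad b) * ?F" using wt_nonneg by simp
  have "m * ?X \<le> c_low * ?X" "m * (wt (dgrad a) (dgrad b) * ?F) \<le> c_low * (wt (dgrad a) (dgrad b) * ?F)" "m * ?V \<le> 1/2 * ?V"
    using m w by (intro mult_right_mono; simp)+
  moreover have "m * ?F \<le> m * ?X" using F m by simp
  moreover have "0 \<le> m * ?V" "0 \<le> m * (wt (dgrad a) (dgrad b) * ?F)" using m w by simp_all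
  moreover have "m / 2 * err_density a b = m * ?F / 2 + m * (wt (dgrad a) (dgrad b) * ?F) / 2 + m * ?V / 2 + m * ?X / 2"
    unfolding err_density_ge(2)[symmetric] s by (simp add: algebra_simps)
  ultimately have "m / 2 * err_density a b \<le> 1/2 * ?V + c_low * ?X + c_low * (wt (dgrad a) (dgrad b) * ?F)" by linarith
  then show "min (1/2) c_low / 2 * err_density a b \<le> eta_r' a b"
    using rel_G_lower[of "xi a" "xi b"] unfolding that m_def by (simp add: state_parts(4) algebra_simps)
  have u: "0 \<le> c_up * ?V" "0 \<le> c_up * ?F" using c_up_pos by simp_all
  have "(1/2 + c_up) * ((1 + wt (dgrad a) (dgrad b)) * ?F + (?V + ?X)) = (?F / 2 + wt (dgrad a) (dgrad b) * ?F / 2 + ?X / 2) + c_up * ?F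
      + c_up * ?V + 1/2 * ?V + (c_up * ?X + c_up * (wt (dgrad a) (dgrad b) * ?F))"
    by (simp add: algebra_simps)
  moreover have "rel G (xi a) (xi b) \<le> c_up * ?X + c_up * (wt (dgrad a) (dgrad b) * ?F)"
    using rel_G_upper[of "xi a" "xi b"] by (simp add: state_parts(4) distrib_left)
  moreover have "0 \<le> ?F / 2 + wt (dgrad a) (dgrad b) * ?F / 2 + ?X / 2" using w by simp
  ultimately show "eta_r' a b \<le> (1/2 + c_up) * err_density a b"
    unfolding that err_density_ge(2)[symmetric] s using u by linarith
qed

end

context smooth_sol
begin

text \<open>The sum of Q and S in the form of \<open>QS_eq\<close>, as a function of the values at
  one point: \<open>a\<close> is the old state, \<open>b\<close> the new one, \<open>L\<close> the
  interpolate.\<close>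

definition qs :: "real \<Rightarrow> vec3 \<Rightarrow> state \<Rightarrow> state \<Rightarrow> state \<Rightarrow> real" where
  "qs t x a b L = (\<Sum>i\<in>UNIV. \<Sum>\<alpha>\<in>UNIV. \<Sum>C\<in>Basis.
     dx \<alpha> (\<lambda>y. gb C t y) x * (dPhi C i \<alpha> (dgrad a) * (vel b $ i - vel (U t x) $ i) - Pb C i \<alpha> t x * (vel L $ i - vel (U t x) $ i))
     + dx \<alpha> (\<lambda>y. vel (U t y) $ i) x * ((pd G C (xi b) - gb C t x) * dPhi C i \<alpha> (dgrad a)
        - (\<Sum>E\<in>Basis. pd (pd G C) E (xi (U t x)) * (xi L \<bullet> E - xi (U t x) \<bullet> E)) * Pb C i \<alpha> t x))"

text \<open>A bound, up to a constant, for the difference of the derivatives of \<open>G\<close> at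
  \<open>b\<close> and \<open>L\<close>; the factor \<open>1 - l\<close> comes from
  \<open>b - L = (1 - l) *\<^sub>R (b - a)\<close>.\<close>

definition lin :: "real \<Rightarrow> state \<Rightarrow> state \<Rightarrow> state \<Rightarrow> real" where
  "lin l a b L = (1 - l) * (norm (b - a) + wt (dgrad b) (dgrad L) * norm (dgrad b - dgrad a))"

text \<open>Every difference is split at the interpolate \<open>L\<close> into a part controlled by
  the error and a part controlled by the increment. Products of two differences are then bounded by
  squares, and the linear term \<open>lin\<close> arises only from differences multiplied by the
  bounded coefficient \<open>Pu\<close>.\<close>

lemma qs_estimate:
  obtains K where "0 < K"
    "\<And>t x a b l. t \<in> {0..T} \<Longrightarrow> x \<in> cbox 0 One \<Longrightarrow> 0 \<le> l \<Longrightarrow> l \<le> 1 \<Longrightarrow>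
      qs t x a b (a + l *\<^sub>R (b - a)) \<le> K * (err_density (a + l *\<^sub>R (b - a)) (U t x) + increment a b + lin l a b (a + l *\<^sub>R (b - a)))"
proof -
  obtain B where B: "1 \<le> B" and bU: "\<And>t x. t \<in> {0..T} \<Longrightarrow> x \<in> cbox 0 One \<Longrightarrow> norm (U t x) \<le> B"
    and bV: "\<And>t x i \<alpha>. t \<in> {0..T} \<Longrightarrow> x \<in> cbox 0 One \<Longrightarrow> \<bar>dx \<alpha> (\<lambda>y. vel (U t y) $ i) x\<bar> \<le> B"
    and bg: "\<And>t x A \<alpha>. t \<in> {0..T} \<Longrightarrow> x \<in> cbox 0 One \<Longrightarrow> A \<in> Basis \<Longrightarrow> \<bar>dx \<alpha> (\<lambda>y. gb A t y) x\<bar> \<le> B"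
    by (rule solution_bounds) blast
  define Bp where "Bp = 1 + 4 * (1 + B) * B"
  have Bp: "1 \<le> Bp" using B by (simp add: Bp_def)
  define K1 where "K1 = 193 + Bp"
  define K2 where "K2 = c_lip\<^sup>2 + 192 + Bp * c_lip + Bp * c_rem"
  have K12: "0 < K1" "0 < K2" using Bp c_lip_pos c_rem_pos by (auto simp: K1_def K2_def intro!: add_pos_nonneg)
  show ?thesis
  \<comment> \<open>\<open>171 = 3 * 3 * 19\<close> is the number of summands.\<close>
  proof (rule that[of "171 * (B * (K1 + K2))"])
    show "0 < 171 * (B * (K1 + K2))" using B K12 by simp
    fix t :: real and x :: vec3 and a b :: state and l :: real
    assume t: "t \<in> {0..T}" and x: "x \<in> cbox 0 One" and l: "0 \<le> l" "l \<le> 1"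
    define L where "L = a + l *\<^sub>R (b - a)"
    let ?u = "U t x"
    define N where "N = err_density L ?u + increment a b + lin l a b L"
    have eL: "b - L = (1 - l) *\<^sub>R (b - a)" unfolding L_def by (simp add: algebra_simps)
    have nL: "norm (b - L) = (1 - l) * norm (b - a)" "norm (dgrad b - dgrad L) = (1 - l) * norm (dgrad b - dgrad a)"
    proof -
      show "norm (b - L) = (1 - l) * norm (b - a)" unfolding eL using l by simp
      have "dgrad b - dgrad L = (1 - l) *\<^sub>R (dgrad b - dgrad a)" unfolding L_def dgrad_def by (simp add: algebra_simps)
      then show "norm (dgrad b - dgrad L) = (1 - l) * norm (dgrad b - dgrad a)" using l by simp
    qed
    have nle: "norm (b - L) \<le> norm (b - a)" unfolding nL using l mult_right_mono[of "1 - l" 1 "norm (b - a)"] by simp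
    have nXX: "(norm (b - L))\<^sup>2 \<le> increment a b" using power_mono[OF nle norm_ge_zero, of 2] increment_ge[of b a] by linarith
    have lin0: "0 \<le> lin l a b L" "(1 - l) * norm (b - a) \<le> lin l a b L"
      unfolding lin_def using l wt_nonneg by (auto simp: distrib_left)
    have ln: "norm (b - L) + wt (dgrad b) (dgrad L) * norm (dgrad b - dgrad L) = lin l a b L"
      unfolding nL lin_def by (simp add: algebra_simps)
    have N0: "0 \<le> err_density L ?u" "0 \<le> increment a b" by (rule err_density_nonneg increment_nonneg)+
    have N_ge: "increment a b + err_density L ?u \<le> N" "lin l a b L \<le> N" using lin0(1) N0 unfolding N_def by linarith+
    have tm: "dx \<alpha> (\<lambda>y. gb C t y) x * (dPhi C i \<alpha> (dgrad a) * (vel b $ i - vel ?u $ i) - Pb C i \<alpha> t x * (vel L $ i - vel ?u $ i))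
     + dx \<alpha> (\<lambda>y. vel (U t y) $ i) x * ((pd G C (xi b) - gb C t x) * dPhi C i \<alpha> (dgrad a)
        - (\<Sum>E\<in>Basis. pd (pd G C) E (xi ?u) * (xi L \<bullet> E - xi ?u \<bullet> E)) * Pb C i \<alpha> t x) \<le> B * (K1 + K2) * N"
      if C: "C \<in> Basis" for i \<alpha> C
    proof -
      have C1: "norm C \<le> 1" "norm C = 1" "norm (fst C) \<le> 1" using C norm_fst_le[of "fst C" "snd C"] by auto
      define Pf P Pu where "Pf = dPhi C i \<alpha> (dgrad a)" and "P = dPhi C i \<alpha> (dgrad L)" and "Pu = Pb C i \<alpha> t x"
      define v V Vb where "v = vel b $ i" and "V = vel L $ i" and "Vb = vel ?u $ i"
      define gc g gu where "gc = pd G C (xi b)" and "g = pd G C (xi L)" and "gu = gb C t x"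
      define k where "k = (\<Sum>E\<in>Basis. pd (pd G C) E (xi ?u) * (xi L \<bullet> E - xi ?u \<bullet> E))"
      have p1: "(Pf - P)\<^sup>2 \<le> 192 * increment a b" "(P - Pu)\<^sup>2 \<le> 144 * err_density L ?u"
        unfolding Pf_def P_def Pu_def L_def by (rule dPhi_diff_increment[OF C1(1) l] dPhi_diff_err_density[OF C1(1)])+
      have v1: "(v - V)\<^sup>2 \<le> increment a b" "(V - Vb)\<^sup>2 \<le> err_density L ?u"
        unfolding v_def V_def Vb_def using vel_sq_le[of b i L] nXX vel_sq_le[of L i ?u] err_density_ge(1)[of L ?u] by linarith+
      have v2: "\<bar>v - V\<bar> \<le> lin l a b L"
        using component_le_norm_cart[of "vel (b - L)" i] state_parts(1)[of "b - L"] lin0(2) nL(1)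
        unfolding v_def V_def state_diff vector_minus_component by linarith
      have bPu: "\<bar>Pu\<bar> \<le> Bp"
      proof -
        have "norm (dgrad ?u) \<le> B" by (rule order_trans[OF state_parts(3) bU[OF t x]])
        then have "4 * (1 + norm (dgrad ?u)) * norm (dgrad ?u) \<le> 4 * (1 + B) * B" using B by (intro mult_mono) auto
        then show ?thesis using dPhi_bound[OF C1(1), of i \<alpha> "dgrad ?u"] unfolding Pu_def Bp_def by linarith
      qed
      \<comment> \<open>The first product consists of two differences and is quadratic; only the
        last term, with the bounded \<open>Pu\<close>, is linear in the increment.\<close>
      have a1: "\<bar>Pf * (v - Vb) - Pu * (V - Vb)\<bar> \<le> K1 * N"
      proof -
        have "Pf * (v - Vb) - Pu * (V - Vb) = ((Pf - P) + (P - Pu)) * ((v - V) + (V - Vb)) + Pu * (v - V)" by (simp add: algebra_simps)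
        also have "\<bar>\<dots>\<bar> \<le> ((Pf - P)\<^sup>2 + (P - Pu)\<^sup>2 + (v - V)\<^sup>2 + (V - Vb)\<^sup>2) + Bp * lin l a b L"
          using mult_mono[OF bPu v2] Bp by (intro order_trans[OF abs_triangle_ineq] add_mono mult_sum4) (simp_all add: abs_mult)
        also have "\<dots> \<le> 193 * N + Bp * N"
        proof (rule add_mono)
          show "(Pf - P)\<^sup>2 + (P - Pu)\<^sup>2 + (v - V)\<^sup>2 + (V - Vb)\<^sup>2 \<le> 193 * N"
            using p1 v1 N0 lin0(1) unfolding N_def distrib_left by linarith
          show "Bp * lin l a b L \<le> Bp * N" using Bp N0 unfolding N_def by (intro mult_left_mono) auto
        qed
        finally show ?thesis by (simp add: K1_def distrib_right)
      qed
      have gcg: "\<bar>gc - g\<bar> \<le> c_lip * lin l a b L"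
      proof -
        have "\<bar>gc - g\<bar> \<le> c_lip * (norm (xi b - xi L) * norm C + wt (dgrad b) (dgrad L) * norm (dgrad b - dgrad L) * norm (fst C))"
          unfolding gc_def g_def using pd_G_lipschitz[of C "xi b" "xi L"] by (simp add: state_parts(4))
        also have "\<dots> \<le> c_lip * (norm (b - L) * 1 + wt (dgrad b) (dgrad L) * norm (dgrad b - dgrad L) * 1)"
          using state_parts(2)[of "b - L"] C1 c_lip_pos wt_nonneg
          by (intro mult_left_mono add_mono mult_mono) (auto simp: state_diff)
        finally show ?thesis using ln by simp
      qed
      \<comment> \<open>The two kinds of index are separated: in the \<open>F\<close> block
        \<open>Pf - Pu\<close> vanishes, and elsewhere the derivative of \<open>G\<close> is
        Lipschitz, so that \<open>mult_sum4\<close> yields squares without weights.\<close>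
      have cross: "\<bar>(gc - gu) * (Pf - Pu)\<bar> \<le> (c_lip\<^sup>2 + 192) * N"
      proof -
        have "fst C = 0 \<or> snd C = 0" using C by (auto simp: Basis_prod_def)
        then show ?thesis
        proof
          assume "snd C = 0"
          then have "Pf - Pu = 0" unfolding Pf_def Pu_def using dPhi_F_const by simp
          then show ?thesis using N0 lin0(1) by (simp add: N_def)
        next
          assume z: "fst C = 0"
          have "(gc - g)\<^sup>2 \<le> (c_lip * norm (b - L))\<^sup>2" "(g - gu)\<^sup>2 \<le> (c_lip * norm (L - ?u))\<^sup>2"
            unfolding gc_def g_def gu_def using pd_G_lipschitz_R[OF C z, of b L] pd_G_lipschitz_R[OF C z, of L ?u] c_lip_pos
            by (auto intro!: power2_le_iff_abs_le[THEN iffD2])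
          moreover have "c_lip\<^sup>2 * (norm (b - L))\<^sup>2 \<le> c_lip\<^sup>2 * increment a b" "c_lip\<^sup>2 * (norm (L - ?u))\<^sup>2 \<le> c_lip\<^sup>2 * err_density L ?u"
            using nXX err_density_ge(1) by (intro mult_left_mono; simp)+
          ultimately have g2: "(gc - g)\<^sup>2 \<le> c_lip\<^sup>2 * increment a b" "(g - gu)\<^sup>2 \<le> c_lip\<^sup>2 * err_density L ?u"
            by (simp_all add: power_mult_distrib)
          have "(gc - gu) * (Pf - Pu) = ((gc - g) + (g - gu)) * ((Pf - P) + (P - Pu))" by simp
          also have "\<bar>\<dots>\<bar> \<le> (gc - g)\<^sup>2 + (g - gu)\<^sup>2 + (Pf - P)\<^sup>2 + (P - Pu)\<^sup>2" by (rule mult_sum4)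
          also have "\<dots> \<le> c_lip\<^sup>2 * (increment a b + err_density L ?u) + 192 * (increment a b + err_density L ?u)"
            using g2 p1 N0 unfolding distrib_left by linarith
          also have "\<dots> \<le> c_lip\<^sup>2 * N + 192 * N"
            using N_ge(1) by (intro add_mono mult_left_mono) auto
          finally show ?thesis by (simp add: distrib_right)
        qed
      qed
      have rem: "\<bar>g - gu - k\<bar> \<le> c_rem * N"
      proof -
        have "\<bar>g - gu - k\<bar> \<le> c_rem * ((norm (xi L - xi ?u))\<^sup>2 + (1 + wt (dgrad L) (dgrad ?u)) * (norm (dgrad L - dgrad ?u))\<^sup>2)"
          unfolding g_def gu_def k_def inner_diff_left[symmetric] using pd_G_remainder[OF C, of "xi L" "xi ?u"] by (simp add: state_parts(4))
        also have "\<dots> \<le> c_rem * err_density L ?u"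
          using state_parts(2)[of "L - ?u"] c_rem_pos unfolding err_density_ge(2)[symmetric] by (simp add: state_diff)
        also have "\<dots> \<le> c_rem * N" using c_rem_pos N0 lin0(1) unfolding N_def by (intro mult_left_mono) auto
        finally show ?thesis .
      qed
      have a2: "\<bar>(gc - gu) * Pf - k * Pu\<bar> \<le> K2 * N"
      proof -
        have "(gc - gu) * Pf - k * Pu = (gc - gu) * (Pf - Pu) + Pu * (gc - g) + Pu * (g - gu - k)" by (simp add: algebra_simps)
        also have "\<bar>\<dots>\<bar> \<le> (c_lip\<^sup>2 + 192) * N + Bp * (c_lip * lin l a b L) + Bp * (c_rem * N)"
        proof -
          have "\<bar>Pu * (gc - g)\<bar> \<le> Bp * (c_lip * lin l a b L)" "\<bar>Pu * (g - gu - k)\<bar> \<le> Bp * (c_rem * N)"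
            unfolding abs_mult using bPu gcg rem Bp by (intro mult_mono; simp)+
          then show ?thesis using cross by (intro order_trans[OF abs_triangle_ineq] add_mono)
        qed
        also have "\<dots> \<le> (c_lip\<^sup>2 + 192) * N + Bp * (c_lip * N) + Bp * (c_rem * N)"
          using Bp c_lip_pos c_rem_pos N_ge(2) by (intro add_mono mult_left_mono) auto
        finally show ?thesis by (simp add: K2_def algebra_simps)
      qed
      have "dx \<alpha> (\<lambda>y. gb C t y) x * (Pf * (v - Vb) - Pu * (V - Vb)) \<le> B * (K1 * N)"
        "dx \<alpha> (\<lambda>y. vel (U t y) $ i) x * ((gc - gu) * Pf - k * Pu) \<le> B * (K2 * N)"
        using mult_mono[OF bg[OF t x C] a1] mult_mono[OF bV[OF t x] a2] B by (auto simp: abs_mult[symmetric] intro: order_trans[OF abs_ge_self])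
      then show ?thesis
        unfolding Pf_def[symmetric] Pu_def[symmetric] v_def[symmetric] V_def[symmetric] Vb_def[symmetric] gc_def[symmetric] gu_def[symmetric] k_def[symmetric]
        by (simp add: algebra_simps)
    qed
    have "qs t x a b L \<le> of_nat (card (UNIV :: 3 set)) * (of_nat (card (UNIV :: 3 set)) * (of_nat (card (Basis :: ext set)) * (B * (K1 + K2) * N)))"
      unfolding qs_def by (intro sum_bounded_above tm)
    then show "qs t x a b (a + l *\<^sub>R (b - a)) \<le> 171 * (B * (K1 + K2)) * (err_density (a + l *\<^sub>R (b - a)) (U t x) + increment a b + lin l a b (a + l *\<^sub>R (b - a)))"
      unfolding L_def[symmetric] N_def[symmetric] by (simp add: mult.assoc)
  qed
qed

text \<open>Selected once for the energy and the smooth solution, before any step or iterate is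
  considered; this is what makes the constants of the error estimate uniform in the time
  step.\<close>

definition K_qs :: real where
  "K_qs = (SOME K. 0 < K \<and> (\<forall>t\<in>{0..T}. \<forall>x\<in>cbox 0 One. \<forall>a b. \<forall>l\<in>{0..1}.
      qs t x a b (a + l *\<^sub>R (b - a)) \<le> K * (err_density (a + l *\<^sub>R (b - a)) (U t x) + increment a b + lin l a b (a + l *\<^sub>R (b - a)))))"

lemma K_qs: "0 < K_qs"
  "t \<in> {0..T} \<Longrightarrow> x \<in> cbox 0 One \<Longrightarrow> 0 \<le> l \<Longrightarrow> l \<le> 1 \<Longrightarrow>
      qs t x a b (a + l *\<^sub>R (b - a)) \<le> K_qs * (err_density (a + l *\<^sub>R (b - a)) (U t x) + increment a b + lin l a b (a + l *\<^sub>R (b - a)))"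
proof -
  obtain K where K: "0 < K" "\<And>t x a b l. t \<in> {0..T} \<Longrightarrow> x \<in> cbox 0 One \<Longrightarrow> 0 \<le> l \<Longrightarrow> l \<le> 1 \<Longrightarrow>
      qs t x a b (a + l *\<^sub>R (b - a)) \<le> K * (err_density (a + l *\<^sub>R (b - a)) (U t x) + increment a b + lin l a b (a + l *\<^sub>R (b - a)))"
    by (rule qs_estimate) blast
  have "0 < K_qs \<and> (\<forall>t\<in>{0..T}. \<forall>x\<in>cbox 0 One. \<forall>a b. \<forall>l\<in>{0..1}.
      qs t x a b (a + l *\<^sub>R (b - a)) \<le> K_qs * (err_density (a + l *\<^sub>R (b - a)) (U t x) + increment a b + lin l a b (a + l *\<^sub>R (b - a))))"
    unfolding K_qs_def by (rule someI[of _ K]) (use K in auto)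
  note * = this
  show "0 < K_qs" using * by (rule conjunct1)
  assume "t \<in> {0..T}" "x \<in> cbox 0 One" "0 \<le> l" "l \<le> 1"
  then show "qs t x a b (a + l *\<^sub>R (b - a)) \<le> K_qs * (err_density (a + l *\<^sub>R (b - a)) (U t x) + increment a b + lin l a b (a + l *\<^sub>R (b - a)))"
    by (intro conjunct2[OF *, rule_format]) simp_all
qed

definition "c_dis = min 1 c_low"

lemma c_dis: "0 < c_dis" "c_dis \<le> 1" "c_dis \<le> c_low" using c_low_pos by (auto simp: c_dis_def)

definition "c_\<mu> = min (1/2) c_low / 2"

lemma c_\<mu>_pos: "0 < c_\<mu>" using c_low_pos by (simp add: c_\<mu>_def)

end

text \<open>Completes the square, with \<open>h\<close> placed so that the quadratic term has the
  size of the dissipation divided by \<open>h\<close> and the remainder is O(h).\<close>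

lemma Young_quadratic:
  assumes "0 < c" "0 < h" shows "K * y \<le> c / (2 * h) * y\<^sup>2 + K\<^sup>2 * h / (2 * (c::real))"
proof -
  have "0 \<le> c / (2 * h) * (y - K * h / c)\<^sup>2" using assms by simp
  also have "\<dots> = c / (2 * h) * y\<^sup>2 + K\<^sup>2 * h / (2 * c) - K * y"
    using assms by (simp add: power2_eq_square field_simps)
  finally show ?thesis by simp
qed

section \<open>Dissipation against increments\<close>

context time_step
begin

text \<open>The gradient difference is paired with \<open>b - a\<close>, while monotonicity speaks
  of \<open>b - L\<close>, which is \<open>1 - l\<close> times as long. Dividing once leaves one
  factor \<open>1 - l\<close>; for \<open>l = 1\<close> both sides are zero.\<close>

lemma D_lower:
  assumes l: "0 \<le> l" "l \<le> 1" and L: "L = a + l *\<^sub>R (b - a)"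
  shows "c_dis * ((1 - l) * ((norm (b - a))\<^sup>2 + wt (dgrad b) (dgrad L) * (norm (dgrad b - dgrad a))\<^sup>2)) \<le> D_term G b L (b - a)"
proof (cases "l = 1")
  case True
  then show ?thesis by (simp add: L D_term_def)
next
  case False
  then have l1: "0 < 1 - l" using l by simp
  let ?d = "norm (dgrad b - dgrad a)" and ?w = "wt (dgrad b) (dgrad L)"
  define g where "g = (grad G (xi b) - grad G (xi L)) \<bullet> (xi b - xi a)"
  have e: "vel b - vel L = (1 - l) *\<^sub>R (vel b - vel a)" "xi b - xi L = (1 - l) *\<^sub>R (xi b - xi a)" "dgrad b - dgrad L = (1 - l) *\<^sub>R (dgrad b - dgrad a)"
    unfolding L by (simp_all add: vel_def xi_def dgrad_def algebra_simps)
  have n: "norm (xi b - xi L) = (1 - l) * norm (xi b - xi a)" "norm (dgrad b - dgrad L) = (1 - l) * ?d"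
    unfolding e using l1 by simp_all
  have D: "D_term G b L (b - a) = (1 - l) * (norm (vel b - vel a))\<^sup>2 + g"
    unfolding D_term_def grad_eta state_inner g_def state_diff[symmetric] power2_norm_eq_inner
    using e(1) by (simp add: vel_def xi_def)
  have "c_low * ((norm (xi b - xi L))\<^sup>2 + ?w * (norm (dgrad b - dgrad L))\<^sup>2) \<le> (grad G (xi b) - grad G (xi L)) \<bullet> (xi b - xi L)"
    using grad_G_mono[of "xi b" "xi L"] by (simp add: state_parts(4))
  also have "\<dots> = (1 - l) * g" unfolding e g_def by simp
  finally have "(1 - l) * ((1 - l) * (c_low * ((norm (xi b - xi a))\<^sup>2 + ?w * ?d\<^sup>2))) \<le> (1 - l) * g"
    unfolding n by (simp add: power2_eq_square algebra_simps)
  then have "(1 - l) * (c_low * ((norm (xi b - xi a))\<^sup>2 + ?w * ?d\<^sup>2)) \<le> g" using l1 by simp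
  moreover have "(1 - l) * (c_dis * ((norm (xi b - xi a))\<^sup>2 + ?w * ?d\<^sup>2)) \<le> (1 - l) * (c_low * ((norm (xi b - xi a))\<^sup>2 + ?w * ?d\<^sup>2))"
    using l1 c_dis wt_nonneg by (intro mult_left_mono mult_right_mono) auto
  moreover have "(1 - l) * (c_dis * (norm (vel b - vel a))\<^sup>2) \<le> (1 - l) * (1 * (norm (vel b - vel a))\<^sup>2)"
    using l1 c_dis by (intro mult_left_mono mult_right_mono) auto
  moreover have "(norm (b - a))\<^sup>2 = (norm (vel b - vel a))\<^sup>2 + (norm (xi b - xi a))\<^sup>2"
    by (cases a; cases b) (simp add: vel_def xi_def norm_Pair)
  ultimately show ?thesis unfolding D by (simp add: algebra_simps)
qed

text \<open>\<open>(1 - l) * norm (dgrad b - dgrad a)\<close> is the distance from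
  \<open>dgrad b\<close> to \<open>dgrad L\<close>, hence at most the sum of their norms. Two
  factors \<open>1 - l\<close> therefore let the weight absorb the quartic part of
  \<open>increment\<close>. At \<open>l = 1\<close> the weight sees only \<open>dgrad b\<close> and
  no such bound holds.\<close>

lemma increment_le_dissipation:
  assumes l: "0 \<le> l" "l \<le> 1" and L: "L = a + l *\<^sub>R (b - a)"
  shows "(1 - l)\<^sup>2 * increment a b \<le> 6 * ((norm (b - a))\<^sup>2 + wt (dgrad b) (dgrad L) * (norm (dgrad b - dgrad a))\<^sup>2)"
proof -
  let ?d = "norm (dgrad b - dgrad a)" and ?w = "wt (dgrad b) (dgrad L)" and ?b = "norm (dgrad b)" and ?L = "norm (dgrad L)"
  have "dgrad b - dgrad L = (1 - l) *\<^sub>R (dgrad b - dgrad a)" unfolding L by (simp add: dgrad_def algebra_simps)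
  then have "(1 - l) * ?d = norm (dgrad b - dgrad L)" using l by simp
  also have "\<dots> \<le> ?b + ?L" by (rule norm_triangle_ineq4)
  finally have "((1 - l) * ?d)\<^sup>2 \<le> (?b + ?L)\<^sup>2" using l by (intro power_mono) auto
  then have 1: "(1 - l)\<^sup>2 * ?d\<^sup>2 \<le> 2 * ?b\<^sup>2 + 2 * ?L\<^sup>2"
    using sum_squares_bound[of ?b ?L] by (simp add: power_mult_distrib power2_sum)
  have m: "(1 - l)\<^sup>2 \<le> 1" using l by (simp add: power_le_one)
  have 2: "(1 - l)\<^sup>2 * ?b\<^sup>2 \<le> ?b\<^sup>2" "(1 - l)\<^sup>2 * (norm (b - a))\<^sup>2 \<le> (norm (b - a))\<^sup>2"
    using mult_right_mono[OF m, of "?b\<^sup>2"] mult_right_mono[OF m, of "(norm (b - a))\<^sup>2"] by simp_all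
  have 3: "(1 - l)\<^sup>2 * (?b\<^sup>2 + ?d\<^sup>2) \<le> 5 * (1 + ?w)"
    using 1 2 sq_le_powr[OF norm_ge_zero, of "dgrad b"] sq_le_powr[OF norm_ge_zero, of "dgrad L"]
      powr_ge_zero[of ?b q] powr_ge_zero[of ?L q] unfolding wt_def distrib_left by linarith
  have 4: "?d\<^sup>2 \<le> (norm (b - a))\<^sup>2" using power_mono[OF state_parts(3)[of "b - a"] norm_ge_zero, of 2] by (simp add: state_diff)
  have "(1 - l)\<^sup>2 * increment a b = (1 - l)\<^sup>2 * (norm (b - a))\<^sup>2 + ((1 - l)\<^sup>2 * (?b\<^sup>2 + ?d\<^sup>2)) * ?d\<^sup>2"
    unfolding increment_def by (simp add: algebra_simps)
  also have "\<dots> \<le> (norm (b - a))\<^sup>2 + (5 * (1 + ?w)) * ?d\<^sup>2"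
    by (intro add_mono 2 mult_right_mono 3) simp
  also have "\<dots> = (norm (b - a))\<^sup>2 + 5 * ?d\<^sup>2 + 5 * (?w * ?d\<^sup>2)" by (simp add: algebra_simps)
  also have "\<dots> \<le> 6 * ((norm (b - a))\<^sup>2 + ?w * ?d\<^sup>2)"
    using 4 mult_nonneg_nonneg[OF wt_nonneg[of "dgrad b" "dgrad L"] zero_le_power2[of ?d]] unfolding distrib_left by linarith
  finally show ?thesis .
qed

lemma rhs_qs: "rhs j x = qs (fst j) x (A x) (B x) (LL (snd j) x) - 1 / h * D_term G (B x) (LL (snd j) x) (B x - A x)"
  unfolding qs_def QS_eq[symmetric] by simp

text \<open>The dissipation is split in half. One half absorbs the linear term by Young's
  inequality, with a remainder of order \<open>h\<close>; the other half, through
  \<open>increment_le_dissipation\<close> with its factor 6, becomes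
  \<open>c_dis / (12 * h) * (1 - l) ^ 3\<close> times the increment.\<close>

lemma rhs_bound:
  assumes j: "j \<in> J" and x: "x \<in> cbox 0 One"
  shows "rhs j x \<le> K_qs * err_density (LL (snd j) x) (U (fst j) x) + (K_qs - c_dis / (12 * h) * (1 - snd j) ^ 3) * increment (A x) (B x)
     + K_qs\<^sup>2 * h / (2 * c_dis) * (1 + wt (dgrad (B x)) (dgrad (LL (snd j) x)))"
proof -
  define l a b L where "l = snd j" and "a = A x" and "b = B x" and "L = LL l x"
  have l: "0 \<le> l" "l \<le> 1" "fst j \<in> {0..T}" using j by (auto simp: l_def)
  have L: "L = a + l *\<^sub>R (b - a)" by (simp add: L_def LL_def a_def b_def)
  define n d w where "n = norm (b - a)" and "d = norm (dgrad b - dgrad a)" and "w = wt (dgrad b) (dgrad L)"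
  define Y m M where "Y = n\<^sup>2 + w * d\<^sup>2" and "m = 1 - l" and "M = K_qs\<^sup>2 * h / (2 * c_dis)"
  have w: "0 \<le> w" by (simp add: w_def wt_nonneg)
  have m: "0 \<le> m" "m \<le> 1" using l by (simp_all add: m_def)
  have M: "0 \<le> M" using h c_dis K_qs(1) by (simp add: M_def)
  have Q: "qs (fst j) x a b L \<le> K_qs * (err_density L (U (fst j) x) + increment a b + m * (n + w * d))"
    using K_qs(2)[OF l(3) x l(1,2), of a b] unfolding L[symmetric] lin_def m_def n_def d_def w_def .
  have Dl: "c_dis * (m * Y) \<le> D_term G b L (b - a)"
    unfolding m_def Y_def n_def d_def w_def by (rule D_lower[OF l(1,2) L])
  have Xl: "m\<^sup>2 * increment a b \<le> 6 * Y"
    unfolding m_def Y_def n_def d_def w_def by (rule increment_le_dissipation[OF l(1,2) L])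
  have y1: "K_qs * n \<le> c_dis / (2 * h) * n\<^sup>2 + M" and y2: "K_qs * d \<le> c_dis / (2 * h) * d\<^sup>2 + M"
    unfolding M_def by (rule Young_quadratic[OF c_dis(1) h])+
  \<comment> \<open>Multiplying by the weight gives the quadratic term the weight of the
    dissipation; the remainder then carries \<open>w\<close>, which is integrable.\<close>
  have "w * (K_qs * d) \<le> w * (c_dis / (2 * h) * d\<^sup>2 + M)" by (rule mult_left_mono[OF y2 w])
  then have "K_qs * (n + w * d) \<le> c_dis / (2 * h) * Y + M * (1 + w)"
    using y1 unfolding Y_def by (simp add: algebra_simps)
  then have "m * (K_qs * (n + w * d)) \<le> m * (c_dis / (2 * h) * Y + M * (1 + w))" using m by (intro mult_left_mono)
  also have "\<dots> \<le> c_dis / (2 * h) * (m * Y) + M * (1 + w)"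
    using mult_right_mono[OF m(2), of "M * (1 + w)"] M w by (simp add: algebra_simps)
  finally have 1: "m * (K_qs * (n + w * d)) \<le> c_dis / (2 * h) * (m * Y) + M * (1 + w)" .
  have 2: "c_dis / (12 * h) * m ^ 3 * increment a b \<le> c_dis / (2 * h) * (m * Y)"
  proof -
    have "c_dis / (12 * h) * m * (m\<^sup>2 * increment a b) \<le> c_dis / (12 * h) * m * (6 * Y)"
      using h c_dis m by (intro mult_left_mono[OF Xl]) simp
    then show ?thesis by (simp add: power2_eq_square power3_eq_cube algebra_simps)
  qed
  have 3: "1 / h * (c_dis * (m * Y)) \<le> 1 / h * D_term G b L (b - a)" using h by (intro mult_left_mono[OF Dl]) simp
  have 4: "1 / h * (c_dis * (m * Y)) = c_dis / (2 * h) * (m * Y) + c_dis / (2 * h) * (m * Y)" using h by (simp add: field_simps)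
  have 5: "K_qs * (err_density L (U (fst j) x) + increment a b + m * (n + w * d)) = K_qs * err_density L (U (fst j) x) + K_qs * increment a b + m * (K_qs * (n + w * d))"
    by (simp add: algebra_simps)
  have 6: "rhs j x = qs (fst j) x a b L - 1 / h * D_term G b L (b - a)" unfolding rhs_qs a_def b_def L_def l_def ..
  have "rhs j x \<le> K_qs * err_density L (U (fst j) x) + (K_qs * increment a b - c_dis / (12 * h) * m ^ 3 * increment a b) + M * (1 + w)"
    using Q 1 2 3 unfolding 4 5 6 by linarith
  then show ?thesis unfolding a_def b_def L_def l_def w_def M_def m_def by (simp add: left_diff_distrib)
qed

lemma meas_comp: "adm Y \<Longrightarrow> j \<in> J \<Longrightarrow> continuous_on UNIV f \<Longrightarrow> (\<lambda>x. f (Y j x)) \<in> borel_measurable torus"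
  by (rule borel_measurable_continuous_on[OF _ admD(1)])

lemma cont_id_dgrad: "continuous_on UNIV dgrad" unfolding dgrad_def[abs_def] by (intro continuous_intros)

lemma meas_Ut: "t \<in> {0..T} \<Longrightarrow> U t \<in> borel_measurable torus"
  using meas_torus_cont[OF slice_cont[OF UU_cont]] by (simp add: UU_def)

text \<open>The exponents add up exactly: \<open>q + 2 = p\<close> in the weighted term and twice
  \<open>p / 2\<close> in the other.\<close>

lemma bd_err_density: "bd p (\<lambda>j x. err_density (LL (snd j) x) (U (fst j) x))"
proof -
  obtain B0 where B0: "1 \<le> B0" and bU: "\<And>t x. t \<in> {0..T} \<Longrightarrow> x \<in> cbox 0 One \<Longrightarrow> norm (U t x) \<le> B0"
    by (rule solution_bounds) blast
  show ?thesis
  proof (rule bdI)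
    show "0 \<le> (3 + B0 powr q) * (1 + B0)\<^sup>2 + (1 + B0)\<^sup>2" by simp
    fix j and x :: vec3 assume j: "j \<in> J" and x: "x \<in> cbox 0 One"
    let ?L = "LL (snd j) x" and ?u = "U (fst j) x" and ?k = "majorant x"
    have nU1: "norm ?u \<le> B0" using bU[of "fst j" x] j x by auto
    note nU = nU1 order_trans[OF state_parts(3) nU1]
    have k: "1 \<le> ?k" "1 \<le> ?k powr (p / 2)" "1 \<le> ?k powr q" using majorant_ge[of x] p6 by (simp_all add: ge_one_powr_ge_zero)
    have Bk: "B0 \<le> B0 * ?k" "B0 \<le> B0 * ?k powr (p / 2)" "B0 powr q \<le> B0 powr q * ?k powr q" using mult_left_mono[OF k(1), of B0] mult_left_mono[OF k(2), of B0] mult_left_mono[OF k(3), of "B0 powr q"] B0 by auto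
    have F: "norm (dgrad ?L - dgrad ?u) \<le> (1 + B0) * ?k"
      using norm_triangle_ineq4[of "dgrad ?L" "dgrad ?u"] admD(2)[OF adm_LL j, of x] nU Bk unfolding distrib_right by linarith
    have S: "norm (?L - ?u) \<le> (1 + B0) * ?k powr (p / 2)"
      using norm_triangle_ineq4[of ?L ?u] admD(3)[OF adm_LL j, of x] nU Bk unfolding distrib_right by linarith
    have W: "1 + norm (dgrad ?L) powr (p - 2) + norm (dgrad ?u) powr (p - 2) \<le> (3 + B0 powr q) * ?k powr q"
    proof -
      have "norm (dgrad ?L) powr q \<le> ?k powr q" using admD(2)[OF adm_LL j, of x] p6 by (intro powr_mono2) auto
      moreover have "norm (dgrad ?u) powr q \<le> B0 powr q" using nU p6 by (intro powr_mono2) auto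
      ultimately show ?thesis using Bk(3) k(3) unfolding distrib_right by linarith
    qed
    have k2: "?k powr 2 = ?k\<^sup>2" using k(1) by (simp add: powr_numeral)
    have kp: "?k powr q * ?k\<^sup>2 = ?k powr p" "(?k powr (p / 2))\<^sup>2 = ?k powr p"
      unfolding k2[symmetric] power2_eq_square[of "?k powr _"] powr_add[symmetric] by simp_all
    have "err_density ?L ?u \<le> ((3 + B0 powr q) * ?k powr q) * ((1 + B0) * ?k)\<^sup>2 + ((1 + B0) * ?k powr (p / 2))\<^sup>2"
      unfolding err_density_def by (intro add_mono mult_mono W power_mono F S) auto
    also have "\<dots> = (3 + B0 powr q) * (1 + B0)\<^sup>2 * (?k powr q * ?k\<^sup>2) + (1 + B0)\<^sup>2 * (?k powr (p / 2))\<^sup>2"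
      by (simp add: power_mult_distrib)
    finally show "\<bar>err_density ?L ?u\<bar> \<le> ((3 + B0 powr q) * (1 + B0)\<^sup>2 + (1 + B0)\<^sup>2) * ?k powr p"
      unfolding kp using err_density_nonneg[of ?L ?u] by (simp add: distrib_right)
  next
    fix j assume j: "j \<in> J"
    then have t: "fst j \<in> {0..T}" by auto
    have 1: "(\<lambda>x. dgrad (LL (snd j) x)) \<in> borel_measurable torus" using meas_comp[OF adm_LL j cont_id_dgrad] .
    have 2: "(\<lambda>x. dgrad (U (fst j) x)) \<in> borel_measurable torus" by (rule borel_measurable_continuous_on[OF cont_id_dgrad meas_Ut[OF t]])
    have 3: "(\<lambda>x. LL (snd j) x) \<in> borel_measurable torus" using admD(1)[OF adm_LL j] .
    show "(\<lambda>x. err_density (LL (snd j) x) (U (fst j) x)) \<in> borel_measurable torus"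
      unfolding err_density_def using 1 2 3 meas_Ut[OF t] by measurable
  qed
qed

lemma bd_norm_diff:
  assumes Y: "adm Y" "adm Y'"
  shows "bd 1 (\<lambda>j x. norm (dgrad (Y j x) - dgrad (Y' j x)))" "bd (p / 2) (\<lambda>j x. norm (Y j x - Y' j x))" "bd 1 (\<lambda>j x. norm (dgrad (Y j x)))"
proof -
  have m: "(\<lambda>x. dgrad (Y j x)) \<in> borel_measurable torus" "(\<lambda>x. dgrad (Y' j x)) \<in> borel_measurable torus" if "j \<in> J" for j
    using meas_comp[OF Y(1) that cont_id_dgrad] meas_comp[OF Y(2) that cont_id_dgrad] .
  have k: "majorant x powr 1 = majorant x" for x using majorant_ge[of x] by simp
  show "bd 1 (\<lambda>j x. norm (dgrad (Y j x) - dgrad (Y' j x)))"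
  proof (rule bdI[of _ 2])
    fix j and x :: vec3 assume j: "j \<in> J"
    show "\<bar>norm (dgrad (Y j x) - dgrad (Y' j x))\<bar> \<le> 2 * majorant x powr 1"
      using norm_triangle_ineq4[of "dgrad (Y j x)" "dgrad (Y' j x)"] admD(2)[OF Y(1) j, of x] admD(2)[OF Y(2) j, of x] unfolding k abs_norm_cancel by linarith
  next
    show "(\<lambda>x. norm (dgrad (Y j x) - dgrad (Y' j x))) \<in> borel_measurable torus" if "j \<in> J" for j using m[OF that] by measurable
  qed simp
  show "bd (p / 2) (\<lambda>j x. norm (Y j x - Y' j x))"
  proof (rule bdI[of _ 2])
    fix j and x :: vec3 assume j: "j \<in> J"
    show "\<bar>norm (Y j x - Y' j x)\<bar> \<le> 2 * majorant x powr (p / 2)"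
      using norm_triangle_ineq4[of "Y j x" "Y' j x"] admD(3)[OF Y(1) j, of x] admD(3)[OF Y(2) j, of x] unfolding abs_norm_cancel by linarith
  next
    show "(\<lambda>x. norm (Y j x - Y' j x)) \<in> borel_measurable torus" if "j \<in> J" for j using admD(1)[OF Y(1) that] admD(1)[OF Y(2) that] by measurable
  qed simp
  show "bd 1 (\<lambda>j x. norm (dgrad (Y j x)))"
  proof (rule bdI[of _ 1])
    show "\<bar>norm (dgrad (Y j x))\<bar> \<le> 1 * majorant x powr 1" if "j \<in> J" for j x using admD(2)[OF Y(1) that, of x] k by simp
    show "(\<lambda>x. norm (dgrad (Y j x))) \<in> borel_measurable torus" if "j \<in> J" for j using m[OF that] by measurable
  qed simp
qed

lemma bd_increment: "bd p (\<lambda>j x. increment (A x) (B x))"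
proof -
  note n = bd_norm_diff[OF adm_B adm_A]
  have "bd p (\<lambda>j x. norm (B x - A x) * norm (B x - A x))" by (rule bd_half_mult[OF n(2) n(2)])
  moreover have "bd p (\<lambda>j x. (norm (dgrad (B x)) * norm (dgrad (B x)) + norm (dgrad (B x) - dgrad (A x)) * norm (dgrad (B x) - dgrad (A x))) * (norm (dgrad (B x) - dgrad (A x)) * norm (dgrad (B x) - dgrad (A x))))"
    by (rule bd_mono[OF bd_mult[OF bd_add[OF bd_mult[OF n(3) n(3)] bd_mult[OF n(1) n(1)]] bd_mult[OF n(1) n(1)]]]) (use p6 in simp)
  ultimately show ?thesis unfolding increment_def power2_eq_square by (rule bd_add)
qed

lemma bd_wt: "bd p (\<lambda>j x. wt (dgrad (B x)) (dgrad (LL (snd j) x)))"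
proof (rule bd_mono[OF bdI[of _ 2 q]])
  fix j and x :: vec3 assume j: "j \<in> J"
  have "norm (dgrad (LL (snd j) x)) powr q \<le> majorant x powr q" "norm (dgrad (B x)) powr q \<le> majorant x powr q"
    using admD(2)[OF adm_LL j, of x] admD(2)[OF adm_B j, of x] p6 by (auto intro!: powr_mono2)
  then show "\<bar>wt (dgrad (B x)) (dgrad (LL (snd j) x))\<bar> \<le> 2 * majorant x powr q" by (simp add: wt_def)
next
  show "(\<lambda>x. wt (dgrad (B x)) (dgrad (LL (snd j) x))) \<in> borel_measurable torus" if j: "j \<in> J" for j
    unfolding wt_def using meas_comp[OF adm_LL j cont_id_dgrad] meas_comp[OF adm_B j cont_id_dgrad] by measurable
qed simp_all

section \<open>The integrated relative entropy over one step\<close>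

abbreviation "er j x \<equiv> eta_r G (LL (snd j) x) (U (fst j) x)"

lemma eta_r_bounds: "c_\<mu> * err_density a b \<le> eta_r G a b" "eta_r G a b \<le> (1/2 + c_up) * err_density a b"
  using c_low_c_up[of "eta_r G" a b] unfolding c_\<mu>_def by (simp_all add: fun_eq_iff eta_r_eq)

lemma eta_r_sum: "eta_r G a b = 1/2 * (\<Sum>i\<in>UNIV. (vel a $ i - vel b $ i)\<^sup>2)
    + (G (xi a) - G (xi b) - (\<Sum>C\<in>Basis. pd G C (xi b) * (xi a \<bullet> C - xi b \<bullet> C)))"
proof -
  have "pd G (xi a - xi b) (xi b) = (\<Sum>C\<in>Basis. pd G C (xi b) * (xi a \<bullet> C - xi b \<bullet> C))"
    by (rule trans[OF pd_linear_comb[OF diffs(1)]]) (simp only: grad_G_sum inner_diff_left)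
  then show ?thesis unfolding eta_r_eq rel_def power2_norm_eq_inner vec3_inner by (simp add: power2_eq_square)
qed

text \<open>Convexity places the relative entropy between zero and a multiple of the error density,
  so it inherits the growth of the latter.\<close>

lemma bd_er: "bd p er"
proof -
  obtain C where C: "0 \<le> C" "\<And>j x. j \<in> J \<Longrightarrow> x \<in> cbox 0 One \<Longrightarrow> \<bar>err_density (LL (snd j) x) (U (fst j) x)\<bar> \<le> C * majorant x powr p"
    by (rule bdE[OF bd_err_density]) blast
  show ?thesis
  proof (rule bdI[of _ "(1/2 + c_up) * C"])
    fix j and x :: vec3 assume j: "j \<in> J" "x \<in> cbox 0 One"
    have "0 \<le> c_\<mu> * err_density (LL (snd j) x) (U (fst j) x)" using c_\<mu>_pos err_density_nonneg by simp
    then have "\<bar>er j x\<bar> = er j x" using eta_r_bounds(1)[of "LL (snd j) x" "U (fst j) x"] by simp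
    also have "\<dots> \<le> (1/2 + c_up) * err_density (LL (snd j) x) (U (fst j) x)" by (rule eta_r_bounds)
    also have "\<dots> \<le> (1/2 + c_up) * (C * majorant x powr p)"
      using C(2)[OF j] c_up_pos by (intro mult_left_mono) auto
    finally show "\<bar>er j x\<bar> \<le> (1/2 + c_up) * C * majorant x powr p" by simp
  next
    fix j assume j: "j \<in> J"
    then have t: "fst j \<in> {0..T}" by auto
    have cG: "continuous_on UNIV (\<lambda>s. G (xi s))" by (rule cont_xi[OF C1_cont[OF C2_C1(1)[OF C2_all(1)]]])
    have 1: "(\<lambda>x. G (xi (LL (snd j) x))) \<in> borel_measurable torus" by (rule meas_comp[OF adm_LL j cG])
    have 2: "(\<lambda>x. G (xi (U (fst j) x))) \<in> borel_measurable torus" by (rule borel_measurable_continuous_on[OF cG meas_Ut[OF t]])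
    show "er j \<in> borel_measurable torus" unfolding eta_r_sum
      by (intro borel_measurable_add borel_measurable_times borel_measurable_const borel_measurable_sum borel_measurable_diff borel_measurable_power 1 2
        bd_meas[OF adm_vel[OF adm_LL] j] bd_meas[OF bd_Vb j] bd_meas[OF bd_gb j] bd_meas[OF adm_xi[OF adm_LL] j] bd_meas[OF bd_xib j])
  qed (use C(1) c_up_pos in simp)
qed

text \<open>\<open>t0\<close> is the start of the step. The derivative is taken within
  \<open>[0, T]\<close>, where the smooth solution is given.\<close>

lemma er_deriv:
  assumes t: "t \<in> {0..T}"
  shows "((\<lambda>s. eta_r G (LL ((s - t0) / h) x) (U s x)) has_real_derivative entropy_rate (t, (t - t0) / h) x) (at t within {0..T})"
proof -
  let ?L = "\<lambda>s. LL ((s - t0) / h) x" and ?S = "{0..T}"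
  have l: "((\<lambda>s. (s - t0) / h) has_real_derivative 1 / h) (at t within ?S)"
    using h by (auto intro!: derivative_eq_intros)
  have U': "((\<lambda>s. U s x \<bullet> c) has_real_derivative D tdir (t, x) \<bullet> c) (at t within ?S)" for c
    using bounded_linear.has_vector_derivative[OF bounded_linear_inner_left[of c] U_time_deriv[OF t, of x]]
    by (simp add: has_real_derivative_iff_has_vector_derivative)
  have L': "((\<lambda>s. ?L s \<bullet> c) has_real_derivative (B x \<bullet> c - A x \<bullet> c) / h) (at t within ?S)" for c
  proof -
    have "((\<lambda>s. A x \<bullet> c + (s - t0) / h * (B x \<bullet> c - A x \<bullet> c)) has_real_derivative (B x \<bullet> c - A x \<bullet> c) / h) (at t within ?S)"
      using h by (auto intro!: derivative_eq_intros)
    then show ?thesis by (simp add: LL_def inner_add_left inner_diff_left)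
  qed
  have v: "((\<lambda>s. vel (?L s) $ i - vel (U s x) $ i) has_real_derivative (vel (B x) $ i - vel (A x) $ i) / h - D tdir (t, x) \<bullet> cV i) (at t within ?S)" for i
    unfolding component_inner by (rule DERIV_diff[OF L' U'])
  have z: "((\<lambda>s. xi (?L s) \<bullet> C - xi (U s x) \<bullet> C) has_real_derivative (xi (B x) \<bullet> C - xi (A x) \<bullet> C) / h - D tdir (t, x) \<bullet> (0, C)) (at t within ?S)" for C
    unfolding component_inner by (rule DERIV_diff[OF L' U'])
  have xU: "((\<lambda>s. xi (U s x)) has_vector_derivative xi (D tdir (t, x))) (at t within ?S)"
    unfolding xi_def by (rule bounded_linear.has_vector_derivative[OF bounded_linear_snd U_time_deriv[OF t]])
  have xL: "((\<lambda>s. xi (?L s)) has_vector_derivative (1 / h) *\<^sub>R (xi (B x) - xi (A x))) (at t within ?S)"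
  proof -
    have "((\<lambda>s. xi (A x) + ((s - t0) / h) *\<^sub>R (xi (B x) - xi (A x))) has_vector_derivative (0 + (1 / h) *\<^sub>R (xi (B x) - xi (A x)))) (at t within ?S)"
      by (intro has_vector_derivative_add has_vector_derivative_const has_vector_derivative_scaleR[OF l has_vector_derivative_const, simplified])
    then show ?thesis by (simp add: xi_LL)
  qed
  have xic: "xi s \<bullet> C = s \<bullet> (0, C)" for s C by (rule component_inner(3))
  have GL: "((\<lambda>s. G (xi (?L s))) has_real_derivative (\<Sum>C\<in>Basis. pd G C (xi (?L t)) * ((xi (B x) \<bullet> C - xi (A x) \<bullet> C) / h))) (at t within ?S)"
    using deriv_comp_time[OF diffs(1) xL] by (simp add: inner_diff_left)
  have GU: "((\<lambda>s. G (xi (U s x))) has_real_derivative (\<Sum>C\<in>Basis. gb C t x * (D tdir (t, x) \<bullet> (0, C)))) (at t within ?S)"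
    using deriv_comp_time[OF diffs(1) xU] by (simp add: xic)
  have gU: "((\<lambda>s. gb C s x) has_real_derivative (\<Sum>E\<in>Basis. pd (pd G C) E (xi (U t x)) * (D tdir (t, x) \<bullet> (0, E)))) (at t within ?S)"
    if C: "C \<in> Basis" for C
    using deriv_comp_time[OF C1D(1)[OF C2_C1(1)[OF C2_pd(1)[OF C]]] xU] by (simp add: xic)
  have s1: "((\<lambda>s. 1/2 * (\<Sum>i\<in>UNIV. (vel (?L s) $ i - vel (U s x) $ i)\<^sup>2)) has_real_derivative
      1/2 * (\<Sum>i\<in>UNIV. 2 * (vel (?L t) $ i - vel (U t x) $ i) * ((vel (B x) $ i - vel (A x) $ i) / h - D tdir (t, x) \<bullet> cV i))) (at t within ?S)"
  proof (intro DERIV_cmult DERIV_sum)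
    fix i :: 3
    show "((\<lambda>s. (vel (?L s) $ i - vel (U s x) $ i)\<^sup>2) has_real_derivative
      2 * (vel (?L t) $ i - vel (U t x) $ i) * ((vel (B x) $ i - vel (A x) $ i) / h - D tdir (t, x) \<bullet> cV i)) (at t within ?S)"
      by (rule DERIV_cong[OF DERIV_power[OF v]]) simp
  qed
  have s2: "((\<lambda>s. \<Sum>C\<in>Basis. gb C s x * (xi (?L s) \<bullet> C - xi (U s x) \<bullet> C)) has_real_derivative
      (\<Sum>C\<in>Basis. (\<Sum>E\<in>Basis. pd (pd G C) E (xi (U t x)) * (D tdir (t, x) \<bullet> (0, E))) * (xi (?L t) \<bullet> C - xi (U t x) \<bullet> C)
        + gb C t x * ((xi (B x) \<bullet> C - xi (A x) \<bullet> C) / h - D tdir (t, x) \<bullet> (0, C)))) (at t within ?S)"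
  proof (rule DERIV_sum)
    fix C :: ext assume C: "C \<in> Basis"
    show "((\<lambda>s. gb C s x * (xi (?L s) \<bullet> C - xi (U s x) \<bullet> C)) has_real_derivative
      (\<Sum>E\<in>Basis. pd (pd G C) E (xi (U t x)) * (D tdir (t, x) \<bullet> (0, E))) * (xi (?L t) \<bullet> C - xi (U t x) \<bullet> C)
        + gb C t x * ((xi (B x) \<bullet> C - xi (A x) \<bullet> C) / h - D tdir (t, x) \<bullet> (0, C))) (at t within ?S)"
      by (rule DERIV_cong[OF DERIV_mult[OF gU[OF C] z]]) simp
  qed
  have fin: "1/2 * (\<Sum>i\<in>UNIV. 2 * (vel (?L t) $ i - vel (U t x) $ i) * ((vel (B x) $ i - vel (A x) $ i) / h - D tdir (t, x) \<bullet> cV i))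
     + ((\<Sum>C\<in>Basis. pd G C (xi (?L t)) * ((xi (B x) \<bullet> C - xi (A x) \<bullet> C) / h)) - (\<Sum>C\<in>Basis. gb C t x * (D tdir (t, x) \<bullet> (0, C)))
      - (\<Sum>C\<in>Basis. (\<Sum>E\<in>Basis. pd (pd G C) E (xi (U t x)) * (D tdir (t, x) \<bullet> (0, E))) * (xi (?L t) \<bullet> C - xi (U t x) \<bullet> C)
        + gb C t x * ((xi (B x) \<bullet> C - xi (A x) \<bullet> C) / h - D tdir (t, x) \<bullet> (0, C)))) = entropy_rate (t, (t - t0) / h) x"
    unfolding entropy_rate_def fst_conv snd_conv sum.distrib right_diff_distrib[of "gb _ _ _"] left_diff_distrib[of _ "gb _ _ _"] sum_subtractf mult.assoc sum_distrib_left[symmetric]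
    by simp
  show ?thesis
    unfolding eta_r_sum by (rule DERIV_cong[OF DERIV_add[OF s1 DERIV_diff[OF DERIV_diff[OF GL GU] s2]] fin])
qed

definition phi :: "real \<Rightarrow> real \<Rightarrow> real" where
  "phi t0 s = (\<integral>x. er (s, (s - t0) / h) x \<partial>torus)"

text \<open>The constant test function removes the flux.\<close>

lemma integral_entropy_rate: "j \<in> J \<Longrightarrow> (\<integral>x. entropy_rate j x \<partial>torus) = (\<integral>x. rhs j x \<partial>torus)"
  using step_identity[unfolded distr_balance_def, THEN conjunct2, THEN conjunct2, THEN conjunct2, rule_format, OF _ testfun_const[of 1]]
  by (simp add: dx_const)

lemma step_J: "0 \<le> t0 \<Longrightarrow> t1 \<le> T \<Longrightarrow> t1 \<le> t0 + h \<Longrightarrow> r \<in> {t0..t1} \<Longrightarrow> (r, (r - t0) / h) \<in> J"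
  using h by (auto simp: field_simps)

text \<open>Differentiation under the integral: the rate is dominated over the whole step by a
  multiple of \<open>majorant x powr p\<close>, and by the mean value inequality so are the
  difference quotients. The derivative within \<open>[t0, t1]\<close> includes both ends.\<close>

lemma phi_deriv:
  assumes t: "0 \<le> t0" "t1 \<le> T" "t1 \<le> t0 + h" and s: "s \<in> {t0..t1}"
  shows "(phi t0 has_real_derivative (\<integral>x. entropy_rate (s, (s - t0) / h) x \<partial>torus)) (at s within {t0..t1})"
proof -
  define F where "F r x = er (r, (r - t0) / h) x" for r x
  note j = step_J[OF t]
  obtain C where C: "0 \<le> C" "\<And>j x. j \<in> J \<Longrightarrow> x \<in> cbox 0 One \<Longrightarrow> \<bar>entropy_rate j x\<bar> \<le> C * majorant x powr p"
    by (rule bdE[OF bd_entropy_rate]) blast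
  have der: "((\<lambda>r. F r x) has_real_derivative entropy_rate (r, (r - t0) / h) x) (at r within {t0..t1})" if r: "r \<in> {t0..t1}" for r x
  proof -
    have "r \<in> {0..T}" using r t by auto
    from er_deriv[OF this, of t0 x] show ?thesis
      unfolding F_def fst_conv snd_conv by (rule DERIV_subset) (use t in auto)
  qed
  have lip: "\<bar>F r x - F s x\<bar> \<le> C * majorant x powr p * \<bar>r - s\<bar>" if r: "r \<in> {t0..t1}" and x: "x \<in> cbox 0 One" for r x
    using field_differentiable_bound[OF convex_real_interval(5)[of t0 t1] der[of _ x], of "C * majorant x powr p" r s] C(2)[OF j x] r s
    by simp
  have iF: "integrable torus (F r)" if "r \<in> {t0..t1}" for r
    unfolding F_def[abs_def] using bd_integrable[OF bd_er order_refl j[OF that]] by simp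
  show ?thesis unfolding has_field_derivative_iff tendsto_at_iff_sequentially comp_def
  proof (intro allI impI)
    fix X :: "nat \<Rightarrow> real" assume X: "\<forall>i. X i \<in> {t0..t1} - {s}" "X \<longlonglongrightarrow> s"
    have Xi: "X i \<in> {t0..t1}" "X i \<noteq> s" for i using X(1) by auto
    have e: "(phi t0 (X i) - phi t0 s) / (X i - s) = (\<integral>x. (F (X i) x - F s x) / (X i - s) \<partial>torus)" for i
      using iF[OF Xi(1)] iF[OF s] unfolding phi_def F_def[symmetric] by simp
    show "(\<lambda>i. (phi t0 (X i) - phi t0 s) / (X i - s)) \<longlonglongrightarrow> (\<integral>x. entropy_rate (s, (s - t0) / h) x \<partial>torus)"
      unfolding e
    proof (rule integral_dominated_convergence[where w = "\<lambda>x. C * majorant x powr p"])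
      show "entropy_rate (s, (s - t0) / h) \<in> borel_measurable torus" by (rule bd_meas[OF bd_entropy_rate j[OF s]])
      show "(\<lambda>x. (F (X i) x - F s x) / (X i - s)) \<in> borel_measurable torus" for i
        by (intro borel_measurable_divide borel_measurable_diff borel_measurable_integrable iF Xi s borel_measurable_const)
      show "integrable torus (\<lambda>x. C * majorant x powr p)" using integrable_majorant by simp
      show "AE x in torus. (\<lambda>i. (F (X i) x - F s x) / (X i - s)) \<longlonglongrightarrow> entropy_rate (s, (s - t0) / h) x"
      proof (rule AE_I2)
        fix x
        show "(\<lambda>i. (F (X i) x - F s x) / (X i - s)) \<longlonglongrightarrow> entropy_rate (s, (s - t0) / h) x"
          using der[OF s, of x] X unfolding has_field_derivative_iff tendsto_at_iff_sequentially comp_def by blast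
      qed
      show "AE x in torus. norm ((F (X i) x - F s x) / (X i - s)) \<le> C * majorant x powr p" for i
      proof (rule AE_I2)
        fix x assume "x \<in> space torus"
        then have "\<bar>F (X i) x - F s x\<bar> \<le> C * majorant x powr p * \<bar>X i - s\<bar>" using lip[OF Xi(1)] by simp
        then show "norm ((F (X i) x - F s x) / (X i - s)) \<le> C * majorant x powr p"
          using Xi(2)[of i] by (simp add: divide_le_eq)
      qed
    qed
  qed
qed

text \<open>
  The correction \<open>b\<close> turns the dissipation, which degenerates cubically at the end of the step, into
  a bound that is uniform in the step; it vanishes at both ends, so the steps can be chained.
\<close>

lemma step_gronwall:
  assumes t: "0 \<le> t0" "t0 \<le> t1" "t1 \<le> T" "t1 \<le> t0 + h"
    and W: "\<And>l. 0 \<le> l \<Longrightarrow> l \<le> 1 \<Longrightarrow> (\<integral>x. wt (dgrad (B x)) (dgrad (LL l x)) \<partial>torus) \<le> W"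
    and hs: "h * (48 * K_qs) \<le> c_dis"
    and a: "a = K_qs / c_\<mu>" and M: "M = K_qs\<^sup>2 / (2 * c_dis) * (1 + W)"
  shows "exp (- (a * t1)) * phi t0 t1 - M * h * t1 \<le> exp (- (a * t0)) * phi t0 t0 - M * h * t0"
proof (cases "t0 = t1")
  case False
  then have lt: "t0 < t1" using t by simp
  have a0: "0 < a" using K_qs(1) c_\<mu>_pos by (simp add: a)
  have "0 \<le> (\<integral>x. wt (dgrad (B x)) (dgrad (LL 0 x)) \<partial>torus)" by (rule Bochner_Integration.integral_nonneg) (simp add: wt_nonneg)
  then have W0: "0 \<le> W" using W[of 0] by simp
  have M0: "0 \<le> M" using W0 c_dis K_qs(1) by (simp add: M)
  define Xb where "Xb = (\<integral>x. increment (A x) (B x) \<partial>torus)"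
  have Xb: "0 \<le> Xb" unfolding Xb_def by (rule Bochner_Integration.integral_nonneg) (rule increment_nonneg)
  \<comment> \<open>Its derivative in \<open>l\<close> is
    \<open>c_dis / 48 * (4 * (1 - l) ^ 3 - 1)\<close>. Divided by \<open>h\<close>, this exchanges
    the coefficient \<open>c_dis / (12 * h) * (1 - l) ^ 3\<close> of the increment for its mean
    \<open>c_dis / (48 * h)\<close> over the step.\<close>
  define b where "b l = c_dis / 48 * (1 - (1 - l) ^ 4 - l)" for l
  have b0: "0 \<le> b l" if "0 \<le> l" "l \<le> 1" for l
  proof -
    have "(1 - l) * (1 - l) ^ 3 \<le> (1 - l) * 1" using that by (intro mult_left_mono power_le_one) auto
    then have "0 \<le> 1 - (1 - l) ^ 4 - l" by (simp add: eval_nat_numeral)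
    then show ?thesis unfolding b_def using c_dis by (intro mult_nonneg_nonneg) auto
  qed
  define Dp where "Dp s = (\<integral>x. entropy_rate (s, (s - t0) / h) x \<partial>torus)" for s
  define ps where "ps s = phi t0 s + Xb * b ((s - t0) / h)" for s
  define ps' where "ps' s = Dp s + Xb * (c_dis / 48 * (4 * (1 - (s - t0) / h) ^ 3 - 1) / h)" for s
  define ch where "ch s = exp (- (a * s)) * ps s - M * h * s" for s
  have ps: "(ps has_real_derivative ps' s) (at s within {t0..t1})" if s: "s \<in> {t0..t1}" for s
  proof -
    have "((\<lambda>s. Xb * b ((s - t0) / h)) has_real_derivative Xb * (c_dis / 48 * (4 * (1 - (s - t0) / h) ^ 3 - 1) / h)) (at s within {t0..t1})"
    proof -
      have 1: "((\<lambda>s. (s - t0) / h) has_real_derivative 1 / h) (at s within {t0..t1})"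
        using h by (auto intro!: derivative_eq_intros)
      have 2: "(b has_real_derivative c_dis / 48 * (4 * (1 - l) ^ 3 - 1)) (at l)" for l
        unfolding b_def[abs_def] by (auto intro!: derivative_eq_intros)
      from DERIV_cmult[OF DERIV_chain'[OF 1 2], of Xb] show ?thesis by simp
    qed
    from DERIV_add[OF phi_deriv[OF t(1,3,4) s] this] show ?thesis unfolding ps_def[abs_def] ps'_def Dp_def .
  qed
  have ch: "(ch has_real_derivative exp (- (a * s)) * (ps' s - a * ps s) - M * h) (at s within {t0..t1})" if s: "s \<in> {t0..t1}" for s
    unfolding ch_def[abs_def] by (rule derivative_eq_intros ps[OF s] refl)+ (simp add: algebra_simps)
  have neg: "exp (- (a * s)) * (ps' s - a * ps s) - M * h \<le> 0" if s: "s \<in> {t0..t1}" for s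
  proof -
    define l where "l = (s - t0) / h"
    define j where "j = (s, l)"
    have j: "j \<in> J" using step_J[OF t(1,3,4) s] by (simp add: j_def l_def)
    then have l: "0 \<le> l" "l \<le> 1" by (auto simp: j_def)
    define E where "E = (\<integral>x. err_density (LL l x) (U s x) \<partial>torus)"
    define w where "w = (\<integral>x. wt (dgrad (B x)) (dgrad (LL l x)) \<partial>torus)"
    define P where "P = c_dis / (12 * h) * (1 - l) ^ 3 * Xb"
    have iE: "integrable torus (\<lambda>x. err_density (LL l x) (U s x))" using bd_integrable[OF bd_err_density order_refl j] by (simp add: j_def)
    have iX: "integrable torus (\<lambda>x. increment (A x) (B x))" using bd_integrable[OF bd_increment order_refl j] by simp
    have iw: "integrable torus (\<lambda>x. wt (dgrad (B x)) (dgrad (LL l x)))" using bd_integrable[OF bd_wt order_refl j] by (simp add: j_def)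
    have "Dp s = (\<integral>x. rhs j x \<partial>torus)" unfolding Dp_def l_def[symmetric] j_def[symmetric] by (rule integral_entropy_rate[OF j])
    also have "\<dots> \<le> (\<integral>x. K_qs * err_density (LL l x) (U s x) + (K_qs - c_dis / (12 * h) * (1 - l) ^ 3) * increment (A x) (B x)
       + K_qs\<^sup>2 * h / (2 * c_dis) * (1 + wt (dgrad (B x)) (dgrad (LL l x))) \<partial>torus)"
    proof (rule integral_mono)
      show "integrable torus (rhs j)" by (rule bd_integrable[OF bd_rhs order_refl j])
      show "integrable torus (\<lambda>x. K_qs * err_density (LL l x) (U s x) + (K_qs - c_dis / (12 * h) * (1 - l) ^ 3) * increment (A x) (B x)
       + K_qs\<^sup>2 * h / (2 * c_dis) * (1 + wt (dgrad (B x)) (dgrad (LL l x))))"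
        by (intro Bochner_Integration.integrable_add integrable_mult_right iE iX iw integrable_torus_const)
      fix x assume "x \<in> space torus"
      then show "rhs j x \<le> K_qs * err_density (LL l x) (U s x) + (K_qs - c_dis / (12 * h) * (1 - l) ^ 3) * increment (A x) (B x)
       + K_qs\<^sup>2 * h / (2 * c_dis) * (1 + wt (dgrad (B x)) (dgrad (LL l x)))"
        using rhs_bound[OF j, of x] by (simp add: j_def)
    qed
    also have "\<dots> = K_qs * E + (K_qs - c_dis / (12 * h) * (1 - l) ^ 3) * Xb + K_qs\<^sup>2 * h / (2 * c_dis) * (1 + w)"
      using iE iX iw by (simp add: E_def Xb_def w_def)
    finally have D: "Dp s \<le> K_qs * E + (K_qs * Xb - P) + K_qs\<^sup>2 * h / (2 * c_dis) * (1 + w)"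
      unfolding P_def by (simp add: left_diff_distrib)
    have "c_\<mu> * E \<le> phi t0 s"
    proof -
      have "(\<integral>x. c_\<mu> * err_density (LL l x) (U s x) \<partial>torus) \<le> (\<integral>x. eta_r G (LL l x) (U s x) \<partial>torus)"
        by (rule integral_mono[OF _ _ eta_r_bounds(1)]) (use iE bd_integrable[OF bd_er order_refl j] in \<open>simp_all add: j_def\<close>)
      then show ?thesis unfolding E_def phi_def l_def by simp
    qed
    then have 1: "K_qs * E \<le> a * phi t0 s"
      using K_qs(1) c_\<mu>_pos unfolding a by (simp add: field_simps)
    \<comment> \<open>The restriction on the time step enters here: the averaged coefficient has to
      beat \<open>K_qs\<close>.\<close>
    have 2: "K_qs * Xb \<le> c_dis / (48 * h) * Xb" using hs h Xb by (intro mult_right_mono) (simp_all add: field_simps)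
    have "K_qs\<^sup>2 * h / (2 * c_dis) * (1 + w) \<le> K_qs\<^sup>2 * h / (2 * c_dis) * (1 + W)"
      using W[OF l] h c_dis by (intro mult_left_mono) (auto simp: w_def)
    then have 3: "K_qs\<^sup>2 * h / (2 * c_dis) * (1 + w) \<le> M * h" by (simp add: M mult_ac)
    have 4: "Xb * (c_dis / 48 * (4 * (1 - l) ^ 3 - 1) / h) = P - c_dis / (48 * h) * Xb"
      unfolding P_def using h by (simp add: field_simps)
    have 5: "a * phi t0 s \<le> a * ps s" unfolding ps_def l_def[symmetric] using a0 Xb b0[OF l] by simp
    have "ps' s - a * ps s \<le> M * h" using D 1 2 3 5 unfolding ps'_def l_def[symmetric] 4 by linarith
    then have "exp (- (a * s)) * (ps' s - a * ps s) \<le> exp (- (a * s)) * (M * h)" by simp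
    also have "\<dots> \<le> 1 * (M * h)" using a0 s t M0 h by (intro mult_right_mono) auto
    finally show ?thesis by simp
  qed
  have "\<exists>s\<in>{t0<..<t1}. ch t1 - ch t0 = (exp (- (a * s)) * (ps' s - a * ps s) - M * h) * (t1 - t0)"
    by (rule mvt_simple[OF lt, where f' = "\<lambda>s y. (exp (- (a * s)) * (ps' s - a * ps s) - M * h) * y"])
      (rule has_field_derivative_imp_has_derivative[OF ch], simp)
  then obtain s where s: "s \<in> {t0<..<t1}" "ch t1 - ch t0 = (exp (- (a * s)) * (ps' s - a * ps s) - M * h) * (t1 - t0)" by blast
  have "ch t1 - ch t0 \<le> 0" unfolding s(2) using neg[of s] s(1) lt by (intro mult_nonpos_nonneg) auto
  moreover have "ch t0 = exp (- (a * t0)) * phi t0 t0 - M * h * t0" by (simp add: ch_def ps_def b_def)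
  moreover have "exp (- (a * t1)) * phi t0 t1 - M * h * t1 \<le> ch t1"
  proof -
    have "0 \<le> b ((t1 - t0) / h)" using b0 t lt h by (simp add: field_simps)
    then show ?thesis unfolding ch_def ps_def using Xb by simp
  qed
  ultimately show ?thesis by simp
qed simp

text \<open>Solves the definition of the relative entropy for the energy of the interpolate; every
  other term has exponent at most \<open>p\<close>.\<close>

lemma bd_G: "bd p (\<lambda>j x. G (xi (LL (snd j) x)))"
proof (rule bd_cong)
  fix j x
  show "G (xi (LL (snd j) x)) = (er j x - 1/2 * (\<Sum>i\<in>UNIV. (vel (LL (snd j) x) $ i - vel (U (fst j) x) $ i) * (vel (LL (snd j) x) $ i - vel (U (fst j) x) $ i)))
     + (G (xi (U (fst j) x)) + (\<Sum>C\<in>Basis. gb C (fst j) x * (xi (LL (snd j) x) \<bullet> C - xi (U (fst j) x) \<bullet> C)))"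
    unfolding eta_r_sum by (simp add: power2_eq_square)
next
  have v: "bd (p / 2) (\<lambda>j x. vel (LL (snd j) x) $ i - vel (U (fst j) x) $ i)" for i
    by (intro bd_diff adm_vel adm_LL bd_0[OF bd_Vb] p2)
  show "bd p (\<lambda>j x. (er j x - 1/2 * (\<Sum>i\<in>UNIV. (vel (LL (snd j) x) $ i - vel (U (fst j) x) $ i) * (vel (LL (snd j) x) $ i - vel (U (fst j) x) $ i)))
     + (G (xi (U (fst j) x)) + (\<Sum>C\<in>Basis. gb C (fst j) x * (xi (LL (snd j) x) \<bullet> C - xi (U (fst j) x) \<bullet> C))))"
    by (intro bd_add bd_diff[OF bd_er] bd_cmult bd_sum bd_half_mult v p2 bd_0[OF bd_U[OF cont_xi[OF C1_cont[OF C2_C1(1)[OF C2_all(1)]]]]]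
       bd_p[OF bd_mult0[OF bd_gb bd_diff[OF adm_xi[OF adm_LL] bd_0[OF bd_xib]]]])
qed

lemma LL_0_1: "LL 0 x = A x" "LL 1 x = B x" by (simp_all add: LL_def)

lemma integrable_G_A: "integrable torus (\<lambda>x. G (xi (A x)))" and integrable_G_B: "integrable torus (\<lambda>x. G (xi (B x)))"
  using bd_integrable[OF bd_G order_refl, of "(0, 0)"] bd_integrable[OF bd_G order_refl, of "(0, 1)"] T by (simp_all add: LL_0_1)

lemma wt_integral_le:
  assumes A: "(\<integral>x. norm (dgrad (A x)) powr p \<partial>torus) \<le> P" and B: "(\<integral>x. norm (dgrad (B x)) powr p \<partial>torus) \<le> P"
    and l: "0 \<le> l" "l \<le> 1"
  shows "(\<integral>x. wt (dgrad (B x)) (dgrad (LL l x)) \<partial>torus) \<le> 3 + 3 * P"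
proof -
  have j: "(0, l) \<in> J" using T l by simp
  have i: "integrable torus (\<lambda>x. norm (dgrad (A x)) powr p)" "integrable torus (\<lambda>x. norm (dgrad (B x)) powr p)"
    using inA inB by (simp_all add: in_space_def Lp_def)
  have "(\<integral>x. wt (dgrad (B x)) (dgrad (LL l x)) \<partial>torus) \<le> (\<integral>x. 3 + 2 * norm (dgrad (B x)) powr p + norm (dgrad (A x)) powr p \<partial>torus)"
  proof (rule integral_mono)
    show "integrable torus (\<lambda>x. wt (dgrad (B x)) (dgrad (LL l x)))" using bd_integrable[OF bd_wt order_refl j] by simp
    show "integrable torus (\<lambda>x. 3 + 2 * norm (dgrad (B x)) powr p + norm (dgrad (A x)) powr p)" using i by simp
    fix x
    have "norm (dgrad (LL l x)) powr q \<le> norm (dgrad (B x)) powr q + norm (dgrad (A x)) powr q"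
      unfolding dgrad_LL by (rule segment_powr_le) (use l p6 in auto)
    moreover have "norm F powr q \<le> 1 + norm F powr p" for F :: mat3 by (rule powr_le_1_plus) (use p6 in auto)
    note this[of "dgrad (A x)"] this[of "dgrad (B x)"]
    ultimately show "wt (dgrad (B x)) (dgrad (LL l x)) \<le> 3 + 2 * norm (dgrad (B x)) powr p + norm (dgrad (A x)) powr p"
      unfolding wt_def by linarith
  qed
  also have "\<dots> = 3 + 2 * (\<integral>x. norm (dgrad (B x)) powr p \<partial>torus) + (\<integral>x. norm (dgrad (A x)) powr p \<partial>torus)"
    using i by simp
  finally show ?thesis using A B by linarith
qed

end

section \<open>The scheme\<close>

locale scheme = smooth_sol +
  fixes E\<^sub>0 h :: real and Th :: "nat \<Rightarrow> vec3 \<Rightarrow> state"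
  assumes h: "0 < h" and it: "iterates G p E\<^sub>0 h Th" and grad_Th: "is_gradient (\<lambda>x. dgrad (Th 0 x))"
begin

lemma gradient_Th: "is_gradient (\<lambda>x. dgrad (Th j x))"
proof (cases j)
  case (Suc k)
  have "P3 Th" using it unfolding iterates_def by blast
  then have "\<forall>j\<ge>1. is_gradient (\<lambda>x. dgrad (Th j x))" unfolding P3_def by (rule mp) (rule grad_Th)
  then show ?thesis using Suc by simp
qed (simp add: grad_Th)

lemma in_space_Th: "in_space p (Th j)"
  using it unfolding iterates_def by blast

lemma curl_Th: "weak_curl_free (\<lambda>x. dgrad (Th j x))"
proof (rule gradient_weak_curl_free[OF gradient_Th])
  have L: "Lp p (\<lambda>x. dgrad (Th j x))" using in_space_Th[of j] by (simp add: in_space_def)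
  then show "periodic (\<lambda>x. dgrad (Th j x))" by (simp add: Lp_def)
  fix i \<alpha>
  have m: "(\<lambda>x. dgrad (Th j x)) \<in> borel_measurable torus" and i: "integrable torus (\<lambda>x. norm (dgrad (Th j x)) powr p)"
    using L by (simp_all add: Lp_def)
  have "Lr p (\<lambda>x. dgrad (Th j x) $ i $ \<alpha>)"
  proof (rule Lr_dom[OF _ i])
    have "continuous_on UNIV (\<lambda>F::mat3. F $ i $ \<alpha>)" by (intro continuous_intros)
    then show "(\<lambda>x. dgrad (Th j x) $ i $ \<alpha>) \<in> borel_measurable torus" by (rule borel_measurable_continuous_on[OF _ m])
    show "\<bar>dgrad (Th j x) $ i $ \<alpha>\<bar> powr p \<le> norm (dgrad (Th j x)) powr p" for x
      using matrix_entry_le p6 by (intro powr_mono2) auto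
  qed
  then show "integrable torus (\<lambda>x. dgrad (Th j x) $ i $ \<alpha>)" by (rule Lr_integrable) (use p6 in simp)
qed

text \<open>(P2) at index \<open>Suc j\<close> supplies the balances, (P4) the integrability of the
  new velocity, and \<open>curl_Th\<close>, through (P3), the curl condition.\<close>

lemma step: "time_step G H R p \<kappa> \<kappa>' \<gamma> \<gamma>' c\<^sub>1 c\<^sub>4 c\<^sub>7 c\<^sub>8 T U\<^sub>0 U h (Th j) (Th (Suc j))"
proof (rule time_step.intro[OF smooth_sol_axioms], rule time_step_axioms.intro)
  have P2: "P2 G h Th" using it unfolding iterates_def by blast
  have P2j: "(\<forall>i. distr_balance
        (\<lambda>x. (vel (Th (Suc j) x) $ i - vel (Th j x) $ i) / h)
        (\<lambda>x. \<chi> \<alpha>. \<Sum>A\<in>Basis. pd G A (xi (Th (Suc j) x)) * dPhi A i \<alpha> (dgrad (Th j x)))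
        (\<lambda>x. 0)) \<and>
     (\<forall>A\<in>Basis. distr_balance
        (\<lambda>x. (xi (Th (Suc j) x) \<bullet> A - xi (Th j x) \<bullet> A) / h)
        (\<lambda>x. \<chi> \<alpha>. \<Sum>i\<in>UNIV. dPhi A i \<alpha> (dgrad (Th j x)) * vel (Th (Suc j) x) $ i)
        (\<lambda>x. 0))"
    using P2[unfolded P2_def, rule_format, of "Suc j", unfolded diff_Suc_1] by simp
  show "distr_balance (\<lambda>x. (vel (Th (Suc j) x) $ i - vel (Th j x) $ i) / h)
        (\<lambda>x. \<chi> \<alpha>. \<Sum>C\<in>Basis. pd G C (xi (Th (Suc j) x)) * dPhi C i \<alpha> (dgrad (Th j x))) (\<lambda>x. 0)" for i
    using P2j by (elim conjE allE)
  show "distr_balance (\<lambda>x. (xi (Th (Suc j) x) \<bullet> C - xi (Th j x) \<bullet> C) / h)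
        (\<lambda>x. \<chi> \<alpha>. \<Sum>i\<in>UNIV. dPhi C i \<alpha> (dgrad (Th j x)) * vel (Th (Suc j) x) $ i) (\<lambda>x. 0)" if "C \<in> Basis" for C
    using P2j that by (elim conjE) (rule bspec)
  have "P4 p Th" using it unfolding iterates_def by blast
  then have "W1p p (\<lambda>x. vel (Th (Suc j) x))" unfolding P4_def by (elim allE[of _ "Suc j"]) simp
  then show "Lp p (\<lambda>x. vel (Th (Suc j) x))" unfolding W1p_def by (rule conjunct1)
qed (rule h in_space_Th curl_Th)+

text \<open>Steps are counted from zero here: step \<open>j\<close> starts at time
  \<open>j * h\<close>, leads from \<open>Th j\<close> to \<open>Th (Suc j)\<close>, and belongs to
  \<open>chi h (Suc j)\<close>.\<close>

definition step_interp :: "nat \<Rightarrow> real \<Rightarrow> vec3 \<Rightarrow> state" where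
  "step_interp j l x = Th j x + l *\<^sub>R (Th (Suc j) x - Th j x)"

definition step_entropy :: "nat \<Rightarrow> real \<Rightarrow> real" where
  "step_entropy j s = (\<integral>x. eta_r G (step_interp j ((s - real j * h) / h) x) (U s x) \<partial>torus)"

lemma chi_eq:
  assumes t: "real j * h \<le> t" "t < (real j + 1) * h" and k: "k \<ge> 1"
  shows "chi h k t = (if k = Suc j then 1 else 0)"
proof -
  consider "k = Suc j" | "k \<le> j" | "j + 2 \<le> k" by linarith
  then show ?thesis
  proof cases
    case 1
    then show ?thesis using t by (simp add: chi_def add.commute)
  next
    case 2
    then have "real k * h \<le> real j * h" using h by simp
    then show ?thesis using t 2 by (simp add: chi_def)
  next
    case 3
    then have "(real j + 1) * h \<le> (real k - 1) * h" using h by (intro mult_right_mono) auto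
    then show ?thesis using t 3 by (simp add: chi_def)
  qed
qed

lemma infsum_chi:
  fixes f :: "nat \<Rightarrow> 'b::real_normed_vector"
  assumes t: "real j * h \<le> t" "t < (real j + 1) * h"
  shows "(\<Sum>\<^sub>\<infinity>k\<in>{1..}. chi h k t *\<^sub>R f k) = f (Suc j)"
proof -
  have "(\<Sum>\<^sub>\<infinity>k\<in>{1..}. chi h k t *\<^sub>R f k) = infsum f {Suc j}"
    by (rule infsum_cong_neutral) (auto simp: chi_eq[OF t])
  then show ?thesis by simp
qed

lemma interp_eq:
  assumes t: "real j * h \<le> t" "t < (real j + 1) * h"
  shows "lin_interp h Th t = step_interp j ((t - real j * h) / h)" "const_interp h Th t = Th (Suc j)"
    "lag_interp h (\<lambda>j x. dgrad (Th j x)) t = (\<lambda>x. dgrad (Th j x))"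
  unfolding fun_eq_iff lin_interp_def const_interp_def lag_interp_def infsum_chi[OF t] step_interp_def by (auto simp: mult.commute)

lemma floor_step:
  assumes "0 \<le> t" obtains j where "real j * h \<le> t" "t < (real j + 1) * h"
proof
  have e: "real (nat \<lfloor>t / h\<rfloor>) = of_int \<lfloor>t / h\<rfloor>" using assms h by simp
  have "real (nat \<lfloor>t / h\<rfloor>) \<le> t / h" "t / h < real (nat \<lfloor>t / h\<rfloor>) + 1" unfolding e by linarith+
  then show "real (nat \<lfloor>t / h\<rfloor>) * h \<le> t" "t < (real (nat \<lfloor>t / h\<rfloor>) + 1) * h" using h by (simp_all add: field_simps)
qed

lemma l_range: "real j * h \<le> t \<Longrightarrow> t \<le> (real j + 1) * h \<Longrightarrow> 0 \<le> (t - real j * h) / h \<and> (t - real j * h) / h \<le> 1"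
  using h by (simp add: field_simps)

text \<open>Strictly inside a step the global interpolate coincides with that of the step on an open
  interval, so their time derivatives agree.\<close>

lemma identity:
  assumes t: "t \<in> {0<..<T}" "real j * h < t" "t < (real j + 1) * h"
  shows "rel_entropy_identity G h Th U t"
proof -
  interpret S: time_step G H R p \<kappa> \<kappa>' \<gamma> \<gamma>' c\<^sub>1 c\<^sub>4 c\<^sub>7 c\<^sub>8 T U\<^sub>0 U h "Th j" "Th (Suc j)" by (rule step)
  have LL: "S.LL = step_interp j" by (simp add: fun_eq_iff S.LL_def step_interp_def)
  define l where "l = (t - real j * h) / h"
  have t': "real j * h \<le> t" "t \<in> {0..T}" using t by auto
  have J: "(t, l) \<in> {0..T} \<times> {0..1}" using t' l_range[of j t] t by (auto simp: l_def)
  have der: "((\<lambda>s. eta_r G (lin_interp h Th s x) (U s x)) has_real_derivative S.entropy_rate (t, l) x) (at t)" for x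
  proof (rule has_field_derivative_transform_within_open)
    have "at t within {0..T} = at t" by (rule at_within_Icc_at) (use t in auto)
    then show "((\<lambda>s. eta_r G (step_interp j ((s - real j * h) / h) x) (U s x)) has_real_derivative S.entropy_rate (t, l) x) (at t)"
      using S.er_deriv[OF t'(2), of "real j * h" x] unfolding LL l_def by simp
    show "open {real j * h<..<(real j + 1) * h}" by simp
    show "t \<in> {real j * h<..<(real j + 1) * h}" using t by simp
    fix s assume "s \<in> {real j * h<..<(real j + 1) * h}"
    then have "lin_interp h Th s = step_interp j ((s - real j * h) / h)" by (intro interp_eq) auto
    then show "eta_r G (step_interp j ((s - real j * h) / h) x) (U s x) = eta_r G (lin_interp h Th s x) (U s x)" by simp
  qed
  note I = interp_eq[OF t'(1) t(3), folded l_def]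
  have dif: "AE x in torus. (\<lambda>s. eta_r G (lin_interp h Th s x) (U s x)) differentiable at t"
    by (rule AE_I2) (use der in \<open>auto simp: real_differentiable_def\<close>)
  have "(\<lambda>x. deriv (\<lambda>s. eta_r G (lin_interp h Th s x) (U s x)) t) = S.entropy_rate (t, l)"
    using DERIV_imp_deriv[OF der] by (simp add: fun_eq_iff)
  moreover have "(\<Sum>\<^sub>\<infinity>k\<in>{1..}. chi h k t * D_term G (Th (Suc j) x) (step_interp j l x) (Th k x - Th (k - 1) x))
      = D_term G (Th (Suc j) x) (step_interp j l x) (Th (Suc j) x - Th j x)" for x
    using infsum_chi[OF t'(1) t(3), of "\<lambda>k. D_term G (Th (Suc j) x) (step_interp j l x) (Th k x - Th (k - 1) x)"] by simp
  moreover note S.step_identity[OF J, unfolded fst_conv snd_conv LL]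
  ultimately show ?thesis
    using dif unfolding rel_entropy_identity_def Let_def I by simp
qed

lemma AE_identity: "AE t in lebesgue_on {0..T}. rel_entropy_identity G h Th U t"
proof -
  \<comment> \<open>Besides the grid points the two ends of \<open>[0, T]\<close> are removed: the
    identity contains a two-sided time derivative, and the solution is given on
    \<open>[0, T]\<close> alone.\<close>
  define N where "N = insert 0 (insert T (range (\<lambda>j. real j * h)))"
  have "countable N" unfolding N_def by simp
  then have "N \<in> null_sets lebesgue" by (intro null_sets_completionI countable_imp_null_set_lborel)
  then have "AE t in lebesgue. t \<notin> N" by (rule AE_not_in)
  then have "AE t in lebesgue. t \<in> {0..T} \<longrightarrow> rel_entropy_identity G h Th U t"
  proof eventually_elim
    case (elim t)
    show ?case
    proof
      assume t: "t \<in> {0..T}"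
      obtain j where j: "real j * h \<le> t" "t < (real j + 1) * h" using floor_step[of t] t by auto
      have n: "t \<noteq> 0" "t \<noteq> T" "t \<noteq> real j * h" using elim unfolding N_def by blast+
      show "rel_entropy_identity G h Th U t" by (rule identity[of t j]) (use t n j in auto)
    qed
  qed
  then show ?thesis by (subst AE_restrict_space_iff) auto
qed

abbreviation "Phi_t t \<equiv> \<integral>x. eta_r G (lin_interp h Th t x) (U t x) \<partial>torus"

lemma err_nonneg: "0 \<le> err p Y V"
  unfolding err_def by (rule Bochner_Integration.integral_nonneg) simp

lemma entropy_bounds:
  assumes t: "t \<in> {0..T}"
  shows "c_\<mu> * err p (lin_interp h Th t) (U t) \<le> Phi_t t" "Phi_t t \<le> (1/2 + c_up) * err p (lin_interp h Th t) (U t)"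
proof -
  obtain j where j: "real j * h \<le> t" "t < (real j + 1) * h" using floor_step[of t] t by auto
  interpret S: time_step G H R p \<kappa> \<kappa>' \<gamma> \<gamma>' c\<^sub>1 c\<^sub>4 c\<^sub>7 c\<^sub>8 T U\<^sub>0 U h "Th j" "Th (Suc j)" by (rule step)
  have LL: "S.LL = step_interp j" by (simp add: fun_eq_iff S.LL_def step_interp_def)
  define l where "l = (t - real j * h) / h"
  have J: "(t, l) \<in> {0..T} \<times> {0..1}" using t l_range[of j t] j by (auto simp: l_def)
  note I = interp_eq(1)[OF j, folded l_def]
  have e: "err p (step_interp j l) (U t) = (\<integral>x. err_density (step_interp j l x) (U t x) \<partial>torus)" by (simp add: err_def err_density_def)
  have i: "integrable torus (\<lambda>x. err_density (step_interp j l x) (U t x))" "integrable torus (\<lambda>x. eta_r G (step_interp j l x) (U t x))"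
    using S.bd_integrable[OF S.bd_err_density order_refl J] S.bd_integrable[OF S.bd_er order_refl J] by (simp_all add: LL)
  have "(\<integral>x. c_\<mu> * err_density (step_interp j l x) (U t x) \<partial>torus) \<le> (\<integral>x. eta_r G (step_interp j l x) (U t x) \<partial>torus)"
    by (rule integral_mono) (use i S.eta_r_bounds(1) in auto)
  then show "c_\<mu> * err p (lin_interp h Th t) (U t) \<le> Phi_t t" unfolding I e by simp
  have "(\<integral>x. eta_r G (step_interp j l x) (U t x) \<partial>torus) \<le> (\<integral>x. (1/2 + c_up) * err_density (step_interp j l x) (U t x) \<partial>torus)"
    by (rule integral_mono) (use i S.eta_r_bounds(2) in auto)
  then show "Phi_t t \<le> (1/2 + c_up) * err p (lin_interp h Th t) (U t)" unfolding I e by simp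
qed

text \<open>(P5) bounds the energy along the iterates, and coercivity turns this into an L^p bound
  that depends neither on \<open>j\<close> nor on \<open>h\<close>. It makes the O(h) remainder of
  \<open>rhs_bound\<close> uniform.\<close>

lemma deformation_bound: "(\<integral>x. norm (dgrad (Th j x)) powr p \<partial>torus) \<le> (E\<^sub>0 + c\<^sub>4) / c\<^sub>1"
proof -
  interpret S: time_step G H R p \<kappa> \<kappa>' \<gamma> \<gamma>' c\<^sub>1 c\<^sub>4 c\<^sub>7 c\<^sub>8 T U\<^sub>0 U h "Th j" "Th (Suc j)" by (rule step)
  define e where "e j = (\<integral>x. (norm (vel (Th j x)))\<^sup>2 \<partial>torus) + (\<integral>x. G (xi (Th j x)) \<partial>torus)" for j
  define d where "d j = (\<integral>x. (norm (Th (Suc j) x - Th j x))\<^sup>2 \<partial>torus)" for j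
  have "P5 G E\<^sub>0 Th" using it unfolding iterates_def by blast
  then have P: "bdd_above (range e)" "summable d" "(SUP j. e j) + (\<Sum>j. d j) \<le> E\<^sub>0"
    unfolding P5_def Let_def e_def[symmetric] d_def[symmetric] by auto
  have "e j \<le> (SUP j. e j)" by (rule cSUP_upper[OF UNIV_I P(1)])
  moreover have "0 \<le> (\<Sum>j. d j)" by (rule suminf_nonneg[OF P(2)]) (simp add: d_def Bochner_Integration.integral_nonneg)
  moreover have "0 \<le> (\<integral>x. (norm (vel (Th j x)))\<^sup>2 \<partial>torus)" by (rule Bochner_Integration.integral_nonneg) simp
  ultimately have 1: "(\<integral>x. G (xi (Th j x)) \<partial>torus) \<le> E\<^sub>0" using P(3) unfolding e_def by linarith
  have i: "integrable torus (\<lambda>x. norm (dgrad (Th j x)) powr p)" using in_space_Th[of j] by (simp add: in_space_def Lp_def)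
  have "(\<integral>x. c\<^sub>1 * norm (dgrad (Th j x)) powr p - c\<^sub>4 \<partial>torus) \<le> (\<integral>x. G (xi (Th j x)) \<partial>torus)"
    by (rule integral_mono) (use i S.integrable_G_A coercive(2)[of "xi (Th j _)"] in \<open>auto simp: state_parts(4)\<close>)
  then have "c\<^sub>1 * (\<integral>x. norm (dgrad (Th j x)) powr p \<partial>torus) - c\<^sub>4 \<le> E\<^sub>0" using i 1 by simp
  then show ?thesis using coercive(1) by (simp add: field_simps)
qed

text \<open>\<open>exp (- (a * t)) * Phi_t t - M * h * t\<close> does not increase from the start of
  a step to any later time in it, and the end of each step is the start of the next.\<close>

lemma Phi_growth:
  assumes hs: "h * (48 * K_qs) \<le> c_dis" and a: "a = K_qs / c_\<mu>" 
    and M: "M = K_qs\<^sup>2 / (2 * c_dis) * (1 + (3 + 3 * ((E\<^sub>0 + c\<^sub>4) / c\<^sub>1)))" and t: "t \<in> {0..T}"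
  shows "Phi_t t \<le> exp (a * T) * (Phi_t 0 + M * h * T)" "0 \<le> M"
proof -
  have P0: "0 \<le> (E\<^sub>0 + c\<^sub>4) / c\<^sub>1"
    by (rule order_trans[OF Bochner_Integration.integral_nonneg deformation_bound[of 0]]) simp
  have "0 \<le> 1 + (3 + 3 * ((E\<^sub>0 + c\<^sub>4) / c\<^sub>1))" using P0 by linarith
  then show M0: "0 \<le> M" unfolding M by (rule mult_nonneg_nonneg[rotated]) (use c_dis in simp)
  have a0: "0 < a" using K_qs(1) c_\<mu>_pos by (simp add: a)
  have local: "exp (- (a * s)) * step_entropy j s - M * h * s \<le> exp (- (a * (real j * h))) * step_entropy j (real j * h) - M * h * (real j * h)"
    if s: "real j * h \<le> s" "s \<le> (real j + 1) * h" "s \<le> T" for j s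
  proof -
    interpret S: time_step G H R p \<kappa> \<kappa>' \<gamma> \<gamma>' c\<^sub>1 c\<^sub>4 c\<^sub>7 c\<^sub>8 T U\<^sub>0 U h "Th j" "Th (Suc j)" by (rule step)
    have LL: "S.LL = step_interp j" by (simp add: fun_eq_iff S.LL_def step_interp_def)
    have ph: "S.phi (real j * h) s = step_entropy j s" for s unfolding S.phi_def step_entropy_def LL by simp
    have 1: "0 \<le> real j * h" "s \<le> real j * h + h" using h s by (simp_all add: distrib_right)
    show ?thesis
      using S.step_gronwall[OF 1(1) s(1,3) 1(2) S.wt_integral_le[OF deformation_bound deformation_bound] hs a M]
      unfolding ph by simp
  qed
  have start: "exp (- (a * (real j * h))) * step_entropy j (real j * h) - M * h * (real j * h) \<le> step_entropy 0 0" if "real j * h \<le> T" for j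
    using that
  proof (induction j)
    case (Suc j)
    have le: "real j * h \<le> real (Suc j) * h" using h by simp
    \<comment> \<open>The last position of step \<open>j\<close> and the first of step
      \<open>Suc j\<close> are the same state, which links the half-open steps.\<close>
    have "step_entropy (Suc j) (real (Suc j) * h) = step_entropy j (real (Suc j) * h)"
    proof -
      have "(real (Suc j) * h - real j * h) / h = 1" using h by (simp add: field_simps)
      then show ?thesis unfolding step_entropy_def by (simp add: step_interp_def)
    qed
    moreover have "real (Suc j) * h \<le> (real j + 1) * h" by (simp add: add.commute)
    note local[OF le this Suc.prems]
    moreover have "real j * h \<le> T" using le Suc.prems by linarith
    note Suc.IH[OF this]
    ultimately show ?case by simp
  qed simp
  have eq: "Phi_t s = step_entropy j s" if "real j * h \<le> s" "s < (real j + 1) * h" for j s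
    unfolding interp_eq(1)[OF that] step_entropy_def ..
  have z: "Phi_t 0 = step_entropy 0 0" using eq[of 0 0] h by simp
  have pos0: "0 \<le> Phi_t 0" using order_trans[OF _ entropy_bounds(1)[of 0]] T c_\<mu>_pos err_nonneg[of "lin_interp h Th 0" "U 0"] by simp
  obtain j where j: "real j * h \<le> t" "t < (real j + 1) * h" using floor_step[of t] t by auto
  have "exp (- (a * t)) * Phi_t t - M * h * t \<le> Phi_t 0"
    using local[of j t] start[of j] j t unfolding eq[OF j] z by simp
  then have "exp (a * t) * (exp (- (a * t)) * Phi_t t) \<le> exp (a * t) * (Phi_t 0 + M * h * t)" by (intro mult_left_mono) auto
  then have "Phi_t t \<le> exp (a * t) * (Phi_t 0 + M * h * t)" by (simp add: mult.assoc[symmetric] exp_add[symmetric])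
  also have "\<dots> \<le> exp (a * T) * (Phi_t 0 + M * h * T)"
    using a0 t M0 h pos0 by (intro mult_mono add_mono mult_left_mono) auto
  finally show "Phi_t t \<le> exp (a * T) * (Phi_t 0 + M * h * T)" .
qed

text \<open>The relative entropy is exchanged for the error at both times: the lower bound divides
  by \<open>c_\<mu>\<close> at time \<open>t\<close>, and the upper bound contributes
  \<open>1/2 + c_up\<close> at time 0.\<close>

lemma err_growth:
  assumes hs: "h * (48 * K_qs) \<le> c_dis" and a: "a = K_qs / c_\<mu>" 
    and M: "M = K_qs\<^sup>2 / (2 * c_dis) * (1 + (3 + 3 * ((E\<^sub>0 + c\<^sub>4) / c\<^sub>1)))" and t: "t \<in> {0..T}"
  shows "err p (lin_interp h Th t) (U t) \<le> exp (a * T) / c_\<mu> * (1/2 + c_up + M * T) * (err p (lin_interp h Th 0) (U 0) + h)"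
proof -
  let ?e = "err p (lin_interp h Th 0) (U 0)"
  have M0: "0 \<le> M" by (rule Phi_growth(2)[OF hs a M t])
  have "c_\<mu> * err p (lin_interp h Th t) (U t) \<le> exp (a * T) * (Phi_t 0 + M * h * T)"
    by (rule order_trans[OF entropy_bounds(1)[OF t] Phi_growth(1)[OF hs a M t]])
  also have "\<dots> \<le> exp (a * T) * ((1/2 + c_up) * ?e + M * h * T)"
    using entropy_bounds(2)[of 0] T by (intro mult_left_mono add_right_mono) auto
  also have "\<dots> \<le> exp (a * T) * ((1/2 + c_up + M * T) * (?e + h))"
  proof (rule mult_left_mono)
    have "0 \<le> (1/2 + c_up) * h" "0 \<le> M * T * ?e" using c_up_pos h M0 T err_nonneg by simp_all
    then show "(1/2 + c_up) * ?e + M * h * T \<le> (1/2 + c_up + M * T) * (?e + h)" by (simp add: algebra_simps)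
  qed simp
  finally show ?thesis using c_\<mu>_pos by (simp add: field_simps)
qed

end

lemma energy_hyps_density:
  assumes "energy_hyps G H R p"
  obtains \<kappa> \<kappa>' \<gamma> \<gamma>' c\<^sub>1 c\<^sub>4 c\<^sub>7 c\<^sub>8 where "energy_density G H R p \<kappa> \<kappa>' \<gamma> \<gamma>' c\<^sub>1 c\<^sub>4 c\<^sub>7 c\<^sub>8"
proof -
  have E: "H1 G H R p" "H2 G p" "H5 H R p" using assms by (auto simp: energy_hyps_def)
  note h1 = E(1)[unfolded H1_def]
  note h2 = h1[THEN conjunct2] note h3 = h2[THEN conjunct2] note h4 = h3[THEN conjunct2] note h5 = h4[THEN conjunct2] note h6 = h5[THEN conjunct2]
  note h9 = h6[THEN conjunct2, THEN conjunct2, THEN conjunct2] note h10 = h9[THEN conjunct2]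
  obtain \<kappa> \<kappa>' where k: "0 < \<kappa>" "0 < \<kappa>'" "\<forall>F z. \<kappa> * norm F powr (p - 2) * (norm z)\<^sup>2 \<le> hess_form H F z \<and>
        hess_form H F z \<le> \<kappa>' * norm F powr (p - 2) * (norm z)\<^sup>2"
    using h10[THEN conjunct1] by blast
  obtain \<gamma> \<gamma>' where g: "0 < \<gamma>" "0 < \<gamma>'" "\<forall>X z. \<gamma> * (norm z)\<^sup>2 \<le> hess_form R X z \<and> hess_form R X z \<le> \<gamma>' * (norm z)\<^sup>2"
    using h10[THEN conjunct2] by blast
  obtain c\<^sub>1 c\<^sub>2 c\<^sub>3 c\<^sub>4 where c: "0 < c\<^sub>1" "0 < c\<^sub>2" "0 < c\<^sub>3"
    "\<forall>F Z w. c\<^sub>1 * norm F powr p + c\<^sub>2 * (norm Z)\<^sup>2 + c\<^sub>3 * \<bar>w\<bar>\<^sup>2 - c\<^sub>4 \<le> G (F, Z, w)"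
    using E(2) unfolding H2_def by blast
  obtain c\<^sub>7 c\<^sub>8 where c7: "0 < c\<^sub>7" "\<forall>F. \<forall>a\<in>Basis. \<forall>b\<in>Basis. \<forall>c\<in>Basis. \<bar>pd (pd (pd H a) b) c F\<bar> \<le> c\<^sub>7 * norm F powr (p - 3)"
    and c8: "0 < c\<^sub>8" "\<forall>X. \<forall>A\<in>Basis. \<forall>B\<in>Basis. \<forall>D\<in>Basis. \<bar>pd (pd (pd R A) B) D X\<bar> \<le> c\<^sub>8"
    using E(3) unfolding H5_def by blast
  note split = h9[THEN conjunct1] and nn = h3[THEN conjunct1]
  have "energy_density G H R p \<kappa> \<kappa>' \<gamma> \<gamma>' c\<^sub>1 c\<^sub>4 c\<^sub>7 c\<^sub>8"
  proof
    show "6 \<le> p" "Ck_on 3 UNIV G" "Ck_on 3 UNIV H" "Ck_on 3 UNIV R" by (rule h1[THEN conjunct1] h2[THEN conjunct1] h4[THEN conjunct1] h6[THEN conjunct1])+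
    show "G X = H (fst X) + R X" for X using split by (cases X) simp
    show "0 \<le> G X" for X using nn by (rule spec)
    show "c\<^sub>1 * norm (fst X) powr p - c\<^sub>4 \<le> G X" for X
    proof -
      have "c\<^sub>1 * norm (fst X) powr p + c\<^sub>2 * (norm (fst (snd X)))\<^sup>2 + c\<^sub>3 * \<bar>snd (snd X)\<bar>\<^sup>2 - c\<^sub>4 \<le> G X"
        using c(4)[rule_format, of "fst X" "fst (snd X)" "snd (snd X)"] by simp
      moreover have "0 \<le> c\<^sub>2 * (norm (fst (snd X)))\<^sup>2" "0 \<le> c\<^sub>3 * \<bar>snd (snd X)\<bar>\<^sup>2" using c by simp_all
      ultimately show ?thesis by linarith
    qed
  qed (use k g c c7 c8 in blast)+
  then show ?thesis by (rule that)
qed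

theorem mainTheorem1:
  fixes W :: "mat3 \<Rightarrow> real" and G :: "ext \<Rightarrow> real" and H :: "mat3 \<Rightarrow> real" and R :: "ext \<Rightarrow> real"
    and p T E\<^sub>0 :: real
    and U\<^sub>0 :: "vec3 \<Rightarrow> state" and U :: "real \<Rightarrow> vec3 \<Rightarrow> state"
  assumes "polyconvex_energy W G"
    and "energy_hyps G H R p"
    and "T > 0" and "E\<^sub>0 > 0"
    and "smooth_solution G T U\<^sub>0 U"
    and "is_gradient (\<lambda>x. dgrad (U\<^sub>0 x))"
  shows "\<exists>\<mu>>0. \<exists>\<mu>'>0. \<exists>\<epsilon>>0. \<exists>C>0. \<forall>\<Theta> :: real \<Rightarrow> nat \<Rightarrow> vec3 \<Rightarrow> state.
    (\<forall>h>0. iterates G p E\<^sub>0 h (\<Theta> h) \<and> is_gradient (\<lambda>x. dgrad (\<Theta> h 0 x))) \<longrightarrow>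
    (let \<E> = (\<lambda>h t. err p (lin_interp h (\<Theta> h) t) (U t)) in
      (\<forall>h>0. (AE t in lebesgue_on {0..T}. rel_entropy_identity G h (\<Theta> h) U t)) \<and>
      (\<forall>h>0. \<forall>t\<in>{0..T}.
         \<mu> * \<E> h t \<le> (\<integral>x. eta_r G (lin_interp h (\<Theta> h) t x) (U t x) \<partial>torus) \<and>
         (\<integral>x. eta_r G (lin_interp h (\<Theta> h) t x) (U t x) \<partial>torus) \<le> \<mu>' * \<E> h t) \<and>
      (\<forall>h. 0 < h \<longrightarrow> h < \<epsilon> \<longrightarrow> (\<forall>\<tau>\<in>{0..T}. \<E> h \<tau> \<le> C * (\<E> h 0 + h))) \<and>
      (((\<lambda>h. \<E> h 0) \<longlongrightarrow> 0) (at_right 0) \<longrightarrow>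
         ((\<lambda>h. SUP t\<in>{0..T}. \<E> h t) \<longlongrightarrow> 0) (at_right 0)))"
proof -
  obtain \<kappa> \<kappa>' \<gamma> \<gamma>' c\<^sub>1 c\<^sub>4 c\<^sub>7 c\<^sub>8 where ed: "energy_density G H R p \<kappa> \<kappa>' \<gamma> \<gamma>' c\<^sub>1 c\<^sub>4 c\<^sub>7 c\<^sub>8"
    by (rule energy_hyps_density[OF assms(2)])
  interpret S: smooth_sol G H R p \<kappa> \<kappa>' \<gamma> \<gamma>' c\<^sub>1 c\<^sub>4 c\<^sub>7 c\<^sub>8 T U\<^sub>0 U
    by (intro smooth_sol.intro ed smooth_sol_axioms.intro assms)
  define a where "a = S.K_qs / S.c_\<mu>"
  define M where "M = S.K_qs\<^sup>2 / (2 * S.c_dis) * (1 + (3 + 3 * ((E\<^sub>0 + c\<^sub>4) / c\<^sub>1)))"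
  \<comment> \<open>\<open>C\<close> is chosen before any iterates are given, and the sign of
    \<open>M\<close> is known only once iterates exist, from \<open>Phi_growth\<close>; the modulus
    makes \<open>C\<close> positive in every case.\<close>
  define C where "C = exp (a * T) / S.c_\<mu> * (1/2 + S.c_up + \<bar>M\<bar> * T)"
  \<comment> \<open>Below this time step the hypothesis \<open>h * (48 * K_qs) \<le> c_dis\<close>
    of \<open>step_gronwall\<close> holds.\<close>
  define \<epsilon> where "\<epsilon> = S.c_dis / (48 * S.K_qs)"
  have pos: "0 < S.c_\<mu>" "0 < 1/2 + S.c_up" "0 < \<epsilon>" "0 < C"
    using S.c_\<mu>_pos S.c_up_pos S.c_dis S.K_qs(1) S.T by (auto simp: \<epsilon>_def C_def intro!: mult_pos_pos add_pos_nonneg divide_pos_pos)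
  have main: "let \<E> = (\<lambda>h t. err p (lin_interp h (\<Theta> h) t) (U t)) in
      (\<forall>h>0. (AE t in lebesgue_on {0..T}. rel_entropy_identity G h (\<Theta> h) U t)) \<and>
      (\<forall>h>0. \<forall>t\<in>{0..T}.
         S.c_\<mu> * \<E> h t \<le> (\<integral>x. eta_r G (lin_interp h (\<Theta> h) t x) (U t x) \<partial>torus) \<and>
         (\<integral>x. eta_r G (lin_interp h (\<Theta> h) t x) (U t x) \<partial>torus) \<le> (1/2 + S.c_up) * \<E> h t) \<and>
      (\<forall>h. 0 < h \<longrightarrow> h < \<epsilon> \<longrightarrow> (\<forall>\<tau>\<in>{0..T}. \<E> h \<tau> \<le> C * (\<E> h 0 + h))) \<and>
      (((\<lambda>h. \<E> h 0) \<longlongrightarrow> 0) (at_right 0) \<longrightarrow>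
         ((\<lambda>h. SUP t\<in>{0..T}. \<E> h t) \<longlongrightarrow> 0) (at_right 0))"
    if \<Theta>: "\<forall>h>0. iterates G p E\<^sub>0 h (\<Theta> h) \<and> is_gradient (\<lambda>x. dgrad (\<Theta> h 0 x))"
    for \<Theta> :: "real \<Rightarrow> nat \<Rightarrow> vec3 \<Rightarrow> state"
  proof -
    define e where "e h t = err p (lin_interp h (\<Theta> h) t) (U t)" for h t
    have sc: "scheme G H R p \<kappa> \<kappa>' \<gamma> \<gamma>' c\<^sub>1 c\<^sub>4 c\<^sub>7 c\<^sub>8 T U\<^sub>0 U E\<^sub>0 h (\<Theta> h)" if "0 < h" for h
      by (intro scheme.intro S.smooth_sol_axioms scheme_axioms.intro) (use \<Theta> that in auto)
    have growth: "e h \<tau> \<le> C * (e h 0 + h)" if h: "0 < h" "h < \<epsilon>" and \<tau>: "\<tau> \<in> {0..T}" for h \<tau>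
    proof -
      have hs: "h * (48 * S.K_qs) \<le> S.c_dis" using h S.K_qs(1) by (simp add: \<epsilon>_def field_simps)
      have M0: "0 \<le> M" by (rule scheme.Phi_growth(2)[OF sc[OF h(1)] hs a_def M_def \<tau>])
      show ?thesis
        using scheme.err_growth[OF sc[OF h(1)] hs a_def M_def \<tau>] M0 by (simp add: C_def e_def)
    qed
    have nonneg: "0 \<le> e h t" if "0 < h" for h t
      unfolding e_def by (rule scheme.err_nonneg[OF sc[OF that]])
    have sup: "((\<lambda>h. SUP t\<in>{0..T}. e h t) \<longlongrightarrow> 0) (at_right 0)" if lim: "((\<lambda>h. e h 0) \<longlongrightarrow> 0) (at_right 0)"
    proof (rule tendsto_sandwich)
      have ev: "eventually (\<lambda>h. 0 < h \<and> h < \<epsilon>) (at_right 0)" using eventually_at_right_real[OF pos(3)] by simp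
      have ne: "{0..T} \<noteq> {}" using S.T by simp
      show "eventually (\<lambda>h. (SUP t\<in>{0..T}. e h t) \<le> C * (e h 0 + h)) (at_right 0)"
        using ev by eventually_elim (intro cSUP_least ne growth; simp)
      show "eventually (\<lambda>h. 0 \<le> (SUP t\<in>{0..T}. e h t)) (at_right 0)"
        using ev
      proof eventually_elim
        case (elim h)
        \<comment> \<open>The growth estimate also shows that the supremum is over a bounded set; on
          the reals it would otherwise carry no information.\<close>
        have "bdd_above (e h ` {0..T})" by (rule bdd_aboveI2[of _ _ "C * (e h 0 + h)"]) (use growth elim in auto)
        then have "e h 0 \<le> (SUP t\<in>{0..T}. e h t)" by (intro cSUP_upper) (use S.T in auto)
        then show ?case using nonneg[of h 0] elim by linarith
      qed
      have "((\<lambda>h. h) \<longlongrightarrow> (0::real)) (at_right 0)" by (rule tendsto_ident_at)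
      from tendsto_mult_left[OF tendsto_add[OF lim this], of C] show "((\<lambda>h. C * (e h 0 + h)) \<longlongrightarrow> 0) (at_right 0)" by simp
    qed simp
    show ?thesis
      unfolding Let_def e_def[symmetric]
      using scheme.AE_identity[OF sc] scheme.entropy_bounds[OF sc, folded e_def] growth sup by blast
  qed
  show ?thesis
    using pos main by blast
qed

end
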